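(* Every free arrangement of three smooth conics $Q_1, Q_2, Q_3$ in $\mathbb{P}^2_{\mathbb{C}}$ admitting only ADE singularities and $J_{2,0}$ singularities is projectively equivalent to one of the following $6$ arrangements: (i) $Q_1: X^2 - YZ = 0$, $\;Q_2: X^2 - 2XY - YZ = 0$, $\;Q_3: X^2 + 2XZ - YZ = 0$; (ii) $Q_1: X^2 - YZ = 0$, $\;Q_2: 3X^2 + Y^2 + 3XY - 3YZ = 0$, $\;Q_3: X^2 + 27Z^2 + 9XZ - YZ = 0$; (iii) $Q_1: X^2 - YZ = 0$, $\;Q_2: X^2 + i\sqrt{3}Z^2 - YZ = 0$, $\;Q_3: 8X^2 - 3(i\sqrt{3}+1)Y^2 + 8i\sqrt{3}XY - 8YZ = 0$; (iv) $Q_1: X^2 - YZ = 0$, $\;Q_2: X^2 - 2Z^2 - YZ = 0$, $\;Q_3: 2X^2 - Y^2 - 2YZ = 0$; (v) $Q_1: X^2 - YZ = 0$, $\;Q_2: X^2 + 18(i\sqrt{3}+3)Y^2 - 18XY - YZ = 0$, $\;Q_3: 12X^2 + (i\sqrt{3}+3)XZ - 12YZ = 0$; (vi) $Q_1: X^2 - YZ = 0$, $\;Q_2: X^2 - 3Z^2 - YZ = 0$, $\;Q_3: 2X^2 + 3XY - 2YZ = 0$.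
   Context: An arrangement of three smooth conics is a set of three distinct smooth conics in $\mathbb{P}^2_{\mathbb{C}}$, identified with the reduced curve $C: f=0$ of degree $d=6$, where $f\in S=\mathbb{C}[X,Y,Z]$ is the product of the three defining quadratic forms. Two arrangements are projectively equivalent if some element of $\mathrm{PGL}_3(\mathbb{C})$ maps one set of conics onto the other. Freeness: let $J_f$ be the ideal generated by the partial derivatives of $f$ and $M(f)=S/J_f$. The curve $C$ is free if the minimal graded free resolution of $M(f)$ has the form $0\to S(1-d-d_1)\oplus S(1-d-d_2)\to S^3(1-d)\to S\to M(f)\to 0$ (then $d_1+d_2=d-1$); equivalently, the $S$-module of triples $(a,b,c)\in S^3$ with $a f_X+b f_Y+c f_Z=0$ is free. Singularities (up to local analytic equivalence of curve germs): $A_k$ ($k\ge1$) is $x^2+y^{k+1}=0$; $D_k$ ($k\ge4$) is $y^2x+x^{k-1}=0$; ADE singularities are the $A_k$, $D_k$ and $E_6,E_7,E_8$; $J_{2,0}$ is $x^3+bx^2y^2+y^6=0$ with $4b^3+27\neq0$. In an arrangement of three smooth conics the possible ADE singularities are: $A_1$, $A_3$, $A_5$, $A_7$ (exactly two of the conics pass through the point, with local intersection multiplicity $1,2,3,4$ respectively); $D_4$ (the three conics pass through the point and meet pairwise transversally there); $D_6$, $D_8$, $D_{10}$ (two conics meet at the point with local intersection multiplicity $2,3,4$ respectively, and the third conic passes through the point transversally to both). A $J_{2,0}$ singularity is a point through which all three conics pass, each pair having local intersection multiplicity $2$ there. *)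

theory Defs
  imports "HOL-Analysis.Analysis" "HOL-Computational_Algebra.Computational_Algebra"
begin

section \<open>The polynomial ring in three variables\<close>

text \<open>
  The ring \<open>S = \<complex>[X,Y,Z]\<close> is the iterated polynomial ring \<open>\<complex>[X][Y][Z]\<close>; the outermost
  variable is \<open>Z\<close>. So the coefficient of \<open>X\<^sup>i Y\<^sup>j Z\<^sup>k\<close> in \<open>F\<close> is
  \<open>coeff (coeff (coeff F k) j) i\<close>.
\<close>

type_synonym S = "complex poly poly poly"

definition X :: S where "X = [:[:[:0, 1:]:]:]"
definition Y :: S where "Y = [:[:0, 1:]:]"
definition Z :: S where "Z = [:0, 1:]"

definition const :: "complex \<Rightarrow> S" where
  "const c = [:[:[:c:]:]:]"

definition eval :: "S \<Rightarrow> complex ^ 3 \<Rightarrow> complex" where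
  "eval F v = poly (poly (poly F [:[:v $ 3:]:]) [:v $ 2:]) (v $ 1)"

definition dX :: "S \<Rightarrow> S" where "dX = map_poly (map_poly pderiv)"
definition dY :: "S \<Rightarrow> S" where "dY = map_poly pderiv"
definition dZ :: "S \<Rightarrow> S" where "dZ = pderiv"

text \<open>As usual, the zero polynomial is homogeneous of every degree.\<close>

definition homogeneous :: "nat \<Rightarrow> S \<Rightarrow> bool" where
  "homogeneous n F \<longleftrightarrow>
     (\<forall>i j k. coeff (coeff (coeff F k) j) i \<noteq> 0 \<longrightarrow> i + j + k = n)"


section \<open>Plane curves\<close>

text \<open>
  A point of the projective plane is given by its nonzero vectors of homogeneous coordinates,
  and a subset of the plane by the set of all nonzero vectors representing its points.
\<close>

definition curve :: "S \<Rightarrow> (complex ^ 3) set" where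
  "curve F = {v. v \<noteq> 0 \<and> eval F v = 0}"

definition singular_points :: "S \<Rightarrow> (complex ^ 3) set" where
  "singular_points F =
     {v \<in> curve F. eval (dX F) v = 0 \<and> eval (dY F) v = 0 \<and> eval (dZ F) v = 0}"

definition smooth_conic :: "S \<Rightarrow> bool" where
  "smooth_conic Q \<longleftrightarrow> homogeneous 2 Q \<and> singular_points Q = {}"

text \<open>
  Arrangements are given by sets of defining forms, but compared through the conics themselves,
  so scaling a form is immaterial. An element of \<open>PGL\<^sub>3\<close> is given by an invertible matrix.
\<close>

definition projectively_equivalent :: "S set \<Rightarrow> S set \<Rightarrow> bool" where
  "projectively_equivalent A B \<longleftrightarrow>
     (\<exists>T :: complex ^ 3 ^ 3. invertible T \<and> (\<lambda>C. (*v) T ` C) ` (curve ` A) = curve ` B)"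


section \<open>Free curves\<close>

definition syzygies :: "S \<Rightarrow> (S \<times> S \<times> S) set" where
  "syzygies f = {(a, b, c). a * dX f + b * dY f + c * dZ f = 0}"

fun smult3 :: "S \<Rightarrow> S \<times> S \<times> S \<Rightarrow> S \<times> S \<times> S" where
  "smult3 p (a, b, c) = (p * a, p * b, p * c)"

fun homogeneous3 :: "nat \<Rightarrow> S \<times> S \<times> S \<Rightarrow> bool" where
  "homogeneous3 n (a, b, c) \<longleftrightarrow> homogeneous n a \<and> homogeneous n b \<and> homogeneous n c"

text \<open>
  A graded resolution
  \<open>0 \<rightarrow> S(1-d-d\<^sub>1) \<oplus> S(1-d-d\<^sub>2) \<rightarrow> S\<^sup>3(1-d) \<rightarrow> S \<rightarrow> M(f) \<rightarrow> 0\<close>, with the gradient of \<open>f\<close>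
  as the map from \<open>S\<^sup>3(1-d)\<close> to \<open>S\<close>, is a pair of homogeneous triples \<open>r\<^sub>1\<close>, \<open>r\<^sub>2\<close> of degrees
  \<open>d\<^sub>1\<close>, \<open>d\<^sub>2\<close> (the images of the two generators) such that \<open>(p, q) \<mapsto> p r\<^sub>1 + q r\<^sub>2\<close> is injective
  with image the kernel of the gradient map; exactness at \<open>S\<close> holds by definition of \<open>M(f)\<close>.
  Equivalently, \<open>r\<^sub>1\<close>, \<open>r\<^sub>2\<close> is a homogeneous basis of the module of syzygies. The resolution is
  minimal unless \<open>d\<^sub>1 = 0\<close> or \<open>d\<^sub>2 = 0\<close>, that is, unless the partial derivatives of \<open>f\<close> are
  linearly dependent over \<open>\<complex>\<close>; this case is not excluded, in accordance with the
  characterization by freeness of the module of syzygies.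
\<close>

definition free_curve :: "S \<Rightarrow> bool" where
  "free_curve f \<longleftrightarrow>
     (\<exists>d1 d2 r1 r2. homogeneous3 d1 r1 \<and> homogeneous3 d2 r2 \<and>
        bij_betw (\<lambda>(p, q). smult3 p r1 + smult3 q r2) UNIV (syzygies f))"


section \<open>Singularities up to local analytic equivalence\<close>

text \<open>Holomorphy in two variables: complex Frechet differentiability at every point.\<close>

definition holomorphic2_on :: "(complex \<times> complex \<Rightarrow> complex) \<Rightarrow> (complex \<times> complex) set \<Rightarrow> bool"
  where
  "holomorphic2_on g U \<longleftrightarrow>
     (\<forall>z\<in>U. \<exists>a b. (g has_derivative (\<lambda>(h, k). a * h + b * k)) (at z))"

definition biholomorphism ::
  "(complex \<times> complex) set \<Rightarrow> (complex \<times> complex) set \<Rightarrow>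
   (complex \<times> complex \<Rightarrow> complex \<times> complex) \<Rightarrow> (complex \<times> complex \<Rightarrow> complex \<times> complex) \<Rightarrow> bool" where
  "biholomorphism U V \<phi> \<psi> \<longleftrightarrow>
     open U \<and> open V \<and> homeomorphism U V \<phi> \<psi> \<and>
     holomorphic2_on (fst \<circ> \<phi>) U \<and> holomorphic2_on (snd \<circ> \<phi>) U \<and>
     holomorphic2_on (fst \<circ> \<psi>) V \<and> holomorphic2_on (snd \<circ> \<psi>) V"

text \<open>
  Analytic equivalence of the curve germs \<open>g = 0\<close> and \<open>h = 0\<close> at the origin: a local change of
  coordinates takes the ideal of the one to the ideal of the other.
\<close>

definition germ_equivalent ::
  "(complex \<times> complex \<Rightarrow> complex) \<Rightarrow> (complex \<times> complex \<Rightarrow> complex) \<Rightarrow> bool" where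
  "germ_equivalent g h \<longleftrightarrow>
     (\<exists>U V \<phi> \<psi> u. biholomorphism U V \<phi> \<psi> \<and> (0, 0) \<in> U \<and> \<phi> (0, 0) = (0, 0) \<and>
        holomorphic2_on u U \<and> (\<forall>z\<in>U. u z \<noteq> 0) \<and> (\<forall>z\<in>U. g (\<phi> z) = u z * h z))"

text \<open>
  For linearly independent \<open>v\<close>, \<open>a\<close>, \<open>b\<close>, the map sending \<open>(s, t)\<close> to the point represented by
  \<open>v + s a + t b\<close> is an affine chart of the projective plane centred at the point represented
  by \<open>v\<close>. The germ does not depend on the choices of \<open>v\<close>, \<open>a\<close>, \<open>b\<close> up to equivalence.
\<close>

definition has_singularity_type ::
  "S \<Rightarrow> complex ^ 3 \<Rightarrow> (complex \<times> complex \<Rightarrow> complex) \<Rightarrow> bool" where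
  "has_singularity_type f v h \<longleftrightarrow>
     (\<exists>a b. invertible (vector [v, a, b] :: complex ^ 3 ^ 3) \<and>
        germ_equivalent (\<lambda>(s, t). eval f (v + s *s a + t *s b)) h)"

definition sing_A :: "nat \<Rightarrow> complex \<times> complex \<Rightarrow> complex" where
  "sing_A k = (\<lambda>(x, y). x ^ 2 + y ^ (k + 1))"
definition sing_D :: "nat \<Rightarrow> complex \<times> complex \<Rightarrow> complex" where
  "sing_D k = (\<lambda>(x, y). y ^ 2 * x + x ^ (k - 1))"
definition sing_E6 :: "complex \<times> complex \<Rightarrow> complex" where
  "sing_E6 = (\<lambda>(x, y). x ^ 3 + y ^ 4)"
definition sing_E7 :: "complex \<times> complex \<Rightarrow> complex" where
  "sing_E7 = (\<lambda>(x, y). x ^ 3 + x * y ^ 3)"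
definition sing_E8 :: "complex \<times> complex \<Rightarrow> complex" where
  "sing_E8 = (\<lambda>(x, y). x ^ 3 + y ^ 5)"
definition sing_J20 :: "complex \<Rightarrow> complex \<times> complex \<Rightarrow> complex" where
  "sing_J20 b = (\<lambda>(x, y). x ^ 3 + b * x ^ 2 * y ^ 2 + y ^ 6)"

definition is_ADE :: "S \<Rightarrow> complex ^ 3 \<Rightarrow> bool" where
  "is_ADE f v \<longleftrightarrow>
     (\<exists>k\<ge>1. has_singularity_type f v (sing_A k)) \<or>
     (\<exists>k\<ge>4. has_singularity_type f v (sing_D k)) \<or>
     has_singularity_type f v sing_E6 \<or>
     has_singularity_type f v sing_E7 \<or>
     has_singularity_type f v sing_E8"

definition is_J20 :: "S \<Rightarrow> complex ^ 3 \<Rightarrow> bool" where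
  "is_J20 f v \<longleftrightarrow> (\<exists>b. 4 * b ^ 3 + 27 \<noteq> 0 \<and> has_singularity_type f v (sing_J20 b))"

end

theory Submission
  imports Defs "HOL-Complex_Analysis.Cauchy_Integral_Formula"
begin

text \<open>
  A homogeneous basis of the module of syzygies of \<open>f = q\<^sub>1 q\<^sub>2 q\<^sub>3\<close> consists of two vector fields tangent
  to all three conics, whose determinant with the Euler field vanishes only on the curve. Comparing
  orders of vanishing along a generic line, its degrees sum to 5; degree 0 is impossible, and a
  linear field tangent to three conics forces either a degenerate determinant or a point
  where the singularity is not allowed. So the degrees are 2 and 3.

  Restricted to a conic, parametrized as a rational curve, the quadratic field becomes a nonzero
  polynomial of degree at most 4 which vanishes at all intersection points. Hence a conic carries
  at most four of them, and if it carries four then the other two conics meet in one point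
  only. A pair of conics meeting in two points can moreover not be bitangent. At a point where two
  conics have contact of order at least 3 and the third conic is tangent to them, the expansion of
  \<open>f\<close> along curves is incompatible with every ADE and \<open>J\<^sub>2\<^sub>,\<^sub>0\<close> germ. The few remaining patterns of
  intersection points lead to explicit equations, whose solutions are the six arrangements.
\<close>

text \<open>Everything runs on polynomial functions on \<open>complex ^ 3\<close> rather than on
  elements of \<open>S\<close>: a change of coordinates or the restriction to a parametrized conic
  is then composition, and contact orders of two conics are root multiplicities of one polynomial in
  the parameter. Freeness is exploited through a determinant: an exclusion typically ends with a
  point off the curve at which a field becomes radial or dependent on the other one. The singularity
  hypothesis allows arbitrary analytic changes of coordinates; it is tested only by limits along the
  arcs \<open>(x * w1, x * w2)\<close> and \<open>(c * x ^ 2, x)\<close>, that is, by leading parts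
  for weights (1, 1) and (2, 1), where the forbidden contact leaves a double root that the
  admissible germs do not have. The square root of -3 in (iii) and (v) comes from a quadratic
  equation for the last parameter; its two conjugate solutions are the same arrangement with two
  conics exchanged, so one entry for each suffices.\<close>

no_notation fps_nth (infixl "$" 75)

section \<open>Coordinates, determinants and invertible matrices in three dimensions\<close>

abbreviation vec3 :: "complex \<Rightarrow> complex \<Rightarrow> complex \<Rightarrow> complex ^ 3" where
  "vec3 x y z \<equiv> vector [x, y, z]"

lemma vec3_eq_iff: "v = w \<longleftrightarrow> v $ 1 = w $ 1 \<and> v $ 2 = w $ 2 \<and> v $ 3 = w $ 3"
  for v w :: "complex ^ 3"
  by (auto simp: vec_eq_iff forall_3)

lemma matrix_vector_mult_3:
  "((T :: complex ^ 3 ^ 3) *v v) $ i = T $ i $ 1 * v $ 1 + T $ i $ 2 * v $ 2 + T $ i $ 3 * v $ 3"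
  by (simp add: matrix_vector_mult_def sum_3)

definition det3 :: "complex ^ 3 \<Rightarrow> complex ^ 3 \<Rightarrow> complex ^ 3 \<Rightarrow> complex" where
  "det3 u v w = u $ 1 * (v $ 2 * w $ 3 - v $ 3 * w $ 2) - u $ 2 * (v $ 1 * w $ 3 - v $ 3 * w $ 1)
     + u $ 3 * (v $ 1 * w $ 2 - v $ 2 * w $ 1)"

definition columns3 :: "complex ^ 3 \<Rightarrow> complex ^ 3 \<Rightarrow> complex ^ 3 \<Rightarrow> complex ^ 3 ^ 3" where
  "columns3 u v w = (\<chi> i. vec3 (u $ i) (v $ i) (w $ i))"

lemma columns3_mult: "columns3 u v w *v x = x $ 1 *s u + x $ 2 *s v + x $ 3 *s w"
  by (simp add: vec3_eq_iff matrix_vector_mult_3 columns3_def)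

lemma det_columns3: "det (columns3 u v w) = det3 u v w"
  by (simp add: det_3 columns3_def det3_def algebra_simps)

lemma invertible_columns3: "invertible (columns3 u v w) \<longleftrightarrow> det3 u v w \<noteq> 0"
  by (simp add: invertible_det_nz det_columns3)

lemma det3_mult: "det3 (T *v u) (T *v v) (T *v w) = det T * det3 u v w"
  by (simp add: det3_def matrix_vector_mult_3 det_3 algebra_simps)

lemma det3_eq_0_imp:
  assumes "det3 u v w = 0"
  shows "\<exists>a b c. (a, b, c) \<noteq> (0, 0, 0) \<and> a *s u + b *s v + c *s w = 0"
proof -
  have "\<not> invertible (columns3 u v w)"
    using assms by (simp add: invertible_columns3)
  then obtain x where x: "x \<noteq> 0" "columns3 u v w *v x = 0"
    using matrix_left_invertible_ker invertible_left_inverse by blast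
  then have "(x $ 1, x $ 2, x $ 3) \<noteq> (0, 0, 0)"
    by (auto simp: vec3_eq_iff)
  then show ?thesis
    using x(2) unfolding columns3_mult by blast
qed

lemma invertible_mult_eq_0: "invertible T \<Longrightarrow> T *v v = 0 \<longleftrightarrow> v = 0" for T :: "complex ^ 3 ^ 3"
  by (metis invertible_def matrix_vector_mul_assoc matrix_vector_mul_lid matrix_vector_mult_0_right)

lemma invertible_inj: "invertible T \<Longrightarrow> T *v v = T *v w \<longleftrightarrow> v = w" for T :: "complex ^ 3 ^ 3"
  by (metis invertible_def matrix_vector_mul_assoc matrix_vector_mul_lid)

lemma invertible_obtain_inverse:
  assumes "invertible (T :: complex ^ 3 ^ 3)"
  obtains T' where "invertible T'" "\<And>v. T *v (T' *v v) = v" "\<And>v. T' *v (T *v v) = v"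
proof -
  obtain T' where T': "T ** T' = mat 1" "T' ** T = mat 1"
    using assms by (auto simp: invertible_def)
  show thesis
  proof
    show "invertible T'" using T' by (auto simp: invertible_def)
    show "T *v (T' *v v) = v" "T' *v (T *v v) = v" for v
      using T' by (simp_all add: matrix_vector_mul_assoc)
  qed
qed


section \<open>Forms\<close>

text \<open>Homogeneous polynomial functions of degree \<open>n\<close>, given by a splitting into
  coordinates times forms of one degree less. The splitting is not unique, but it lets closure under
  sums, products and substitutions follow by induction without any bookkeeping of
  coefficients.\<close>

primrec form :: "nat \<Rightarrow> (complex ^ 3 \<Rightarrow> complex) \<Rightarrow> bool" where
  "form 0 F \<longleftrightarrow> (\<exists>c. \<forall>v. F v = c)"
| "form (Suc n) F \<longleftrightarrow> (\<exists>A B C. form n A \<and> form n B \<and> form n C \<and>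
     (\<forall>v. F v = v $ 1 * A v + v $ 2 * B v + v $ 3 * C v))"

lemma form_add: "form n F \<Longrightarrow> form n G \<Longrightarrow> form n (\<lambda>v. F v + G v)"
proof (induction n arbitrary: F G)
  case (Suc n)
  obtain A B C where 1: "form n A" "form n B" "form n C"
    "\<forall>v. F v = v $ 1 * A v + v $ 2 * B v + v $ 3 * C v"
    using Suc.prems(1) by auto
  obtain A' B' C' where 2: "form n A'" "form n B'" "form n C'"
    "\<forall>v. G v = v $ 1 * A' v + v $ 2 * B' v + v $ 3 * C' v"
    using Suc.prems(2) by auto
  have "form n (\<lambda>v. A v + A' v)" "form n (\<lambda>v. B v + B' v)" "form n (\<lambda>v. C v + C' v)"
    using Suc.IH 1 2 by auto
  then show ?case
    using 1(4) 2(4)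
    unfolding form.simps
    by (intro exI[of _ "\<lambda>v. A v + A' v"] exI[of _ "\<lambda>v. B v + B' v"] exI[of _ "\<lambda>v. C v + C' v"])
       (auto simp: algebra_simps)
qed auto

lemma form_cmult: "form n F \<Longrightarrow> form n (\<lambda>v. c * F v)"
proof (induction n arbitrary: F)
  case (Suc n)
  obtain A B C where 1: "form n A" "form n B" "form n C"
    "\<forall>v. F v = v $ 1 * A v + v $ 2 * B v + v $ 3 * C v"
    using Suc.prems(1) by auto
  then show ?case
    using Suc.IH[OF 1(1)] Suc.IH[OF 1(2)] Suc.IH[OF 1(3)]
    unfolding form.simps
    by (intro exI[of _ "\<lambda>v. c * A v"] exI[of _ "\<lambda>v. c * B v"] exI[of _ "\<lambda>v. c * C v"])
       (auto simp: algebra_simps)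
qed auto

lemma form_0: "form n (\<lambda>v. 0)"
proof (induction n)
  case (Suc n)
  then show ?case
    unfolding form.simps
    by (intro exI[of _ "\<lambda>v. 0"]) auto
qed auto

lemma form_diff: "form n F \<Longrightarrow> form n G \<Longrightarrow> form n (\<lambda>v. F v - G v)"
  using form_add[of n F "\<lambda>v. (-1) * G v"] form_cmult[of n G "-1"] by simp

lemma form_sum: "(\<And>i. i \<in> I \<Longrightarrow> form n (F i)) \<Longrightarrow> form n (\<lambda>v. \<Sum>i\<in>I. F i v)"
  by (induction I rule: infinite_finite_induct) (auto intro: form_0 form_add)

lemma form_const: "form 0 (\<lambda>v. c)"
  by auto

lemma form_coord_mult: "form n F \<Longrightarrow> form (Suc n) (\<lambda>v. v $ i * F v)"
proof -
  assume F: "form n F"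
  have "i = 1 \<or> i = 2 \<or> i = 3" by (rule exhaust_3)
  then show ?thesis
    unfolding form.simps using F form_0[of n]
    apply (elim disjE)
    subgoal by (rule exI[of _ F], rule exI[of _ "\<lambda>v. 0"], rule exI[of _ "\<lambda>v. 0"]) simp
    subgoal by (rule exI[of _ "\<lambda>v. 0"], rule exI[of _ F], rule exI[of _ "\<lambda>v. 0"]) simp
    subgoal by (rule exI[of _ "\<lambda>v. 0"], rule exI[of _ "\<lambda>v. 0"], rule exI[of _ F]) simp
    done
qed

lemma form_coord: "form 1 (\<lambda>v. v $ i)"
  using form_coord_mult[OF form_const[of 1], of i] by simp

lemma form_mult: "form m F \<Longrightarrow> form n G \<Longrightarrow> form (m + n) (\<lambda>v. F v * G v)"
proof (induction m arbitrary: F)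
  case 0
  then obtain c where "F = (\<lambda>v. c)" by auto
  then show ?case using form_cmult[OF 0(2), of c] by simp
next
  case (Suc m)
  obtain A B C where 1: "form m A" "form m B" "form m C"
    "\<forall>v. F v = v $ 1 * A v + v $ 2 * B v + v $ 3 * C v"
    using Suc.prems(1) by auto
  show ?case
    using Suc.IH[OF 1(1) Suc.prems(2)] Suc.IH[OF 1(2) Suc.prems(2)] Suc.IH[OF 1(3) Suc.prems(2)] 1(4)
    unfolding form.simps add_Suc
    by (intro exI[of _ "\<lambda>v. A v * G v"] exI[of _ "\<lambda>v. B v * G v"] exI[of _ "\<lambda>v. C v * G v"])
       (auto simp: algebra_simps)
qed

lemma form_power: "form 1 F \<Longrightarrow> form n (\<lambda>v. F v ^ n)"
proof (induction n)
  case (Suc n)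
  then show ?case using form_mult[of 1 F n "\<lambda>v. F v ^ n"] by simp
qed auto

lemma form_homogeneous: "form n F \<Longrightarrow> F (c *s v) = c ^ n * F v"
proof (induction n arbitrary: F)
  case (Suc n)
  obtain A B C where 1: "form n A" "form n B" "form n C"
    "\<forall>v. F v = v $ 1 * A v + v $ 2 * B v + v $ 3 * C v"
    using Suc.prems(1) by auto
  then show ?case
    using Suc.IH[OF 1(1)] Suc.IH[OF 1(2)] Suc.IH[OF 1(3)]
    by (simp add: algebra_simps)
qed auto

lemma form_subst: "form n F \<Longrightarrow> form n (\<lambda>v. F (T *v v))"
proof (induction n arbitrary: F)
  case (Suc n)
  obtain A B C where 1: "form n A" "form n B" "form n C"
    "\<forall>v. F v = v $ 1 * A v + v $ 2 * B v + v $ 3 * C v"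
    using Suc.prems(1) by auto
  have *: "form (Suc n) (\<lambda>v. (T *v v) $ i * G (T *v v))" if "form n (\<lambda>v. G (T *v v))" for i G
  proof -
    have "form 1 (\<lambda>v. (T *v v) $ i)"
      unfolding matrix_vector_mult_3 by (intro form_add form_cmult form_coord)
    from form_mult[OF this that] show ?thesis by simp
  qed
  have "form (Suc n) (\<lambda>v. (T *v v) $ 1 * A (T *v v) + (T *v v) $ 2 * B (T *v v)
     + (T *v v) $ 3 * C (T *v v))"
    by (intro form_add * Suc.IH 1)
  then show ?case using 1(4) by (auto simp del: form.simps)
qed auto

lemma form1E:
  assumes "form 1 F"
  obtains a b c where "\<And>v. F v = a * v $ 1 + b * v $ 2 + c * v $ 3"
proof -
  obtain A B C where 1: "form 0 A" "form 0 B" "form 0 C"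
    "\<forall>v. F v = v $ 1 * A v + v $ 2 * B v + v $ 3 * C v"
    using assms unfolding One_nat_def form.simps(2) by blast
  then obtain a b c where "\<forall>v. A v = a" "\<forall>v. B v = b" "\<forall>v. C v = c" by auto
  then show thesis using 1(4) that[of a b c] by (simp add: mult.commute)
qed

lemma form1I: "form 1 (\<lambda>v. a * v $ 1 + b * v $ 2 + c * v $ 3)"
  by (intro form_add form_cmult form_coord)

lemma form2E:
  assumes "form 2 F"
  obtains a b c d e f where "\<And>v. F v = a * v $ 1 ^ 2 + b * v $ 2 ^ 2 + c * v $ 3 ^ 2
     + d * v $ 1 * v $ 2 + e * v $ 1 * v $ 3 + f * v $ 2 * v $ 3"
proof -
  obtain A B C where 1: "form 1 A" "form 1 B" "form 1 C"
    "\<forall>v. F v = v $ 1 * A v + v $ 2 * B v + v $ 3 * C v"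
    using assms unfolding numeral_2_eq_2 form.simps(2)[of "Suc 0"] One_nat_def by blast
  obtain a1 a2 a3 where a: "\<And>v. A v = a1 * v $ 1 + a2 * v $ 2 + a3 * v $ 3" using form1E[OF 1(1)] by blast
  obtain b1 b2 b3 where b: "\<And>v. B v = b1 * v $ 1 + b2 * v $ 2 + b3 * v $ 3" using form1E[OF 1(2)] by blast
  obtain c1 c2 c3 where c: "\<And>v. C v = c1 * v $ 1 + c2 * v $ 2 + c3 * v $ 3" using form1E[OF 1(3)] by blast
  show thesis
    by (rule that[of a1 b2 c3 "a2 + b1" "a3 + c1" "b3 + c2"])
       (simp add: 1(4) a b c power2_eq_square algebra_simps)
qed

lemma form_monom2: "form 2 (\<lambda>v. v $ i * v $ j)"
  using form_mult[OF form_coord[of i] form_coord[of j]] unfolding one_add_one .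

lemma form2I: "form 2 (\<lambda>v. a * v $ 1 ^ 2 + b * v $ 2 ^ 2 + c * v $ 3 ^ 2
     + d * v $ 1 * v $ 2 + e * v $ 1 * v $ 3 + f * v $ 2 * v $ 3)"
  unfolding power2_eq_square mult.assoc
  by (intro form_add form_cmult form_monom2)

lemma form3E:
  assumes "form 3 F"
  obtains a b c d e f g h i j where "\<And>v. F v = a * v $ 1 ^ 3 + b * v $ 2 ^ 3 + c * v $ 3 ^ 3
     + d * v $ 1 ^ 2 * v $ 2 + e * v $ 1 ^ 2 * v $ 3 + f * v $ 2 ^ 2 * v $ 1 + g * v $ 2 ^ 2 * v $ 3
     + h * v $ 3 ^ 2 * v $ 1 + i * v $ 3 ^ 2 * v $ 2 + j * v $ 1 * v $ 2 * v $ 3"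
proof -
  obtain A B C where 1: "form 2 A" "form 2 B" "form 2 C"
    "\<forall>v. F v = v $ 1 * A v + v $ 2 * B v + v $ 3 * C v"
    using assms unfolding numeral_3_eq_3 form.simps(2)[of "Suc (Suc 0)"] numeral_2_eq_2 by blast
  obtain a1 a2 a3 a4 a5 a6 where a: "\<And>v. A v = a1 * v $ 1 ^ 2 + a2 * v $ 2 ^ 2 + a3 * v $ 3 ^ 2
     + a4 * v $ 1 * v $ 2 + a5 * v $ 1 * v $ 3 + a6 * v $ 2 * v $ 3" using form2E[OF 1(1)] by blast
  obtain b1 b2 b3 b4 b5 b6 where b: "\<And>v. B v = b1 * v $ 1 ^ 2 + b2 * v $ 2 ^ 2 + b3 * v $ 3 ^ 2
     + b4 * v $ 1 * v $ 2 + b5 * v $ 1 * v $ 3 + b6 * v $ 2 * v $ 3" using form2E[OF 1(2)] by blast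
  obtain c1 c2 c3 c4 c5 c6 where c: "\<And>v. C v = c1 * v $ 1 ^ 2 + c2 * v $ 2 ^ 2 + c3 * v $ 3 ^ 2
     + c4 * v $ 1 * v $ 2 + c5 * v $ 1 * v $ 3 + c6 * v $ 2 * v $ 3" using form2E[OF 1(3)] by blast
  show thesis
    by (rule that[of a1 b2 c3 "a4 + b1" "a5 + c1" "a2 + b4" "b6 + c2" "a3 + c5" "b3 + c6" "a6 + b5 + c4"])
       (simp add: 1(4) a b c power2_eq_square power3_eq_cube algebra_simps)
qed

lemma form4E:
  assumes "form 4 F"
  obtains a1 a2 a3 a4 a5 a6 a7 a8 a9 a10 a11 a12 a13 a14 a15
  where "\<And>v. F v = a1 * v $ 1 ^ 4 + a2 * v $ 1 ^ 3 * v $ 2 + a3 * v $ 1 ^ 3 * v $ 3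
    + a4 * v $ 1 ^ 2 * v $ 2 ^ 2 + a5 * v $ 1 ^ 2 * v $ 2 * v $ 3 + a6 * v $ 1 ^ 2 * v $ 3 ^ 2
    + a7 * v $ 1 * v $ 2 ^ 3 + a8 * v $ 1 * v $ 2 ^ 2 * v $ 3 + a9 * v $ 1 * v $ 2 * v $ 3 ^ 2
    + a10 * v $ 1 * v $ 3 ^ 3 + a11 * v $ 2 ^ 4 + a12 * v $ 2 ^ 3 * v $ 3
    + a13 * v $ 2 ^ 2 * v $ 3 ^ 2 + a14 * v $ 2 * v $ 3 ^ 3 + a15 * v $ 3 ^ 4"
proof -
  have 4: "(4 :: nat) = Suc 3" by simp
  obtain A B C where 1: "form 3 A" "form 3 B" "form 3 C"
    "\<forall>v. F v = v $ 1 * A v + v $ 2 * B v + v $ 3 * C v"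
    using assms unfolding 4 form.simps(2)[of 3] by blast
  obtain a b c d e f g h i j where a: "\<And>v. A v = a * v $ 1 ^ 3 + b * v $ 2 ^ 3 + c * v $ 3 ^ 3
     + d * v $ 1 ^ 2 * v $ 2 + e * v $ 1 ^ 2 * v $ 3 + f * v $ 2 ^ 2 * v $ 1 + g * v $ 2 ^ 2 * v $ 3
     + h * v $ 3 ^ 2 * v $ 1 + i * v $ 3 ^ 2 * v $ 2 + j * v $ 1 * v $ 2 * v $ 3"
    using form3E[OF 1(1)] by blast
  obtain a' b' c' d' e' f' g' h' i' j' where b: "\<And>v. B v = a' * v $ 1 ^ 3 + b' * v $ 2 ^ 3 + c' * v $ 3 ^ 3
     + d' * v $ 1 ^ 2 * v $ 2 + e' * v $ 1 ^ 2 * v $ 3 + f' * v $ 2 ^ 2 * v $ 1 + g' * v $ 2 ^ 2 * v $ 3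
     + h' * v $ 3 ^ 2 * v $ 1 + i' * v $ 3 ^ 2 * v $ 2 + j' * v $ 1 * v $ 2 * v $ 3"
    using form3E[OF 1(2)] by blast
  obtain a'' b'' c'' d'' e'' f'' g'' h'' i'' j'' where c: "\<And>v. C v = a'' * v $ 1 ^ 3 + b'' * v $ 2 ^ 3 + c'' * v $ 3 ^ 3
     + d'' * v $ 1 ^ 2 * v $ 2 + e'' * v $ 1 ^ 2 * v $ 3 + f'' * v $ 2 ^ 2 * v $ 1 + g'' * v $ 2 ^ 2 * v $ 3
     + h'' * v $ 3 ^ 2 * v $ 1 + i'' * v $ 3 ^ 2 * v $ 2 + j'' * v $ 1 * v $ 2 * v $ 3"
    using form3E[OF 1(3)] by blast
  show thesis
    by (rule that[of a "d + a'" "e + a''" "f + d'" "j + e' + d''" "h + e''" "b + f'" "g + j' + f''"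
         "i + h' + j''" "c + h''" b' "g' + b''" "i' + g''" "c' + i''" c''])
       (simp add: 1(4) a b c power2_eq_square power3_eq_cube power4_eq_xxxx algebra_simps)
qed


section \<open>Quadratic forms\<close>

definition polar :: "(complex ^ 3 \<Rightarrow> complex) \<Rightarrow> complex ^ 3 \<Rightarrow> complex ^ 3 \<Rightarrow> complex" where
  "polar q u v = q (u + v) - q u - q v"

text \<open>\<open>polar q v\<close> is the differential of \<open>q\<close> at \<open>v\<close>,
  and \<open>polar q v v = 2 * q v\<close>, so a nonzero vector in the radical is the same as a
  singular point of the conic: smoothness is nondegeneracy of the polar form.\<close>

definition smoothq :: "(complex ^ 3 \<Rightarrow> complex) \<Rightarrow> bool" where
  "smoothq q \<longleftrightarrow> form 2 q \<and> (\<forall>v. (\<forall>w. polar q v w = 0) \<longrightarrow> v = 0)"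

lemma polar_form2:
  assumes "\<And>v. q v = a * v $ 1 ^ 2 + b * v $ 2 ^ 2 + c * v $ 3 ^ 2
     + d * v $ 1 * v $ 2 + e * v $ 1 * v $ 3 + f * v $ 2 * v $ 3"
  shows "polar q u v = 2 * a * u $ 1 * v $ 1 + 2 * b * u $ 2 * v $ 2 + 2 * c * u $ 3 * v $ 3
     + d * (u $ 1 * v $ 2 + u $ 2 * v $ 1) + e * (u $ 1 * v $ 3 + u $ 3 * v $ 1)
     + f * (u $ 2 * v $ 3 + u $ 3 * v $ 2)"
  unfolding polar_def assms by (simp add: power2_eq_square algebra_simps)

lemma polar_commute: "polar q u v = polar q v u"
  by (simp add: polar_def add.commute)

context
  fixes q assumes q: "form 2 q"
begin

lemma polar_add_right: "polar q u (v + w) = polar q u v + polar q u w"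
  and polar_add_left: "polar q (u + v) w = polar q u w + polar q v w"
  and polar_scale_right: "polar q u (c *s v) = c * polar q u v"
  and polar_scale_left: "polar q (c *s u) v = c * polar q u v"
  and polar_self: "polar q u u = 2 * q u"
  and quad_scale: "q (c *s v) = c ^ 2 * q v"
proof -
  obtain a b c' d e f where E: "\<And>v. q v = a * v $ 1 ^ 2 + b * v $ 2 ^ 2 + c' * v $ 3 ^ 2
     + d * v $ 1 * v $ 2 + e * v $ 1 * v $ 3 + f * v $ 2 * v $ 3" using form2E[OF q] by blast
  note P = polar_form2[of q, OF E]
  show "polar q u (v + w) = polar q u v + polar q u w"
    "polar q (u + v) w = polar q u w + polar q v w"
    "polar q u (c *s v) = c * polar q u v"
    "polar q (c *s u) v = c * polar q u v"
    "polar q u u = 2 * q u"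
    "q (c *s v) = c ^ 2 * q v"
    unfolding P E by (simp_all add: power2_eq_square algebra_simps)
qed

lemma quad_add: "q (u + v) = q u + q v + polar q u v"
  by (simp add: polar_def)

lemma polar_diff_right: "polar q u (v - w) = polar q u v - polar q u w"
  using polar_add_right[of u v "(-1) *s w"] polar_scale_right[of u "-1" w] by simp

lemma polar_diff_left: "polar q (u - v) w = polar q u w - polar q v w"
  using polar_diff_right[of w u v] by (simp add: polar_commute)

lemma quad_diff: "q (u - v) = q u + q v - polar q u v"
  using quad_add[of u "(-1) *s v"] polar_scale_right[of u "-1" v] quad_scale[of "-1" v] by simp

lemma polar_0: "polar q u 0 = 0" "polar q 0 u = 0"
  using polar_scale_right[of u 0 0] polar_scale_left[of 0 0 u] by simp_all

end

lemma smoothq_form: "smoothq q \<Longrightarrow> form 2 q"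
  by (simp add: smoothq_def)

lemma polar_subst: "polar (\<lambda>v. q (T *v v)) u v = polar q (T *v u) (T *v v)"
  by (simp add: polar_def matrix_vector_right_distrib)

lemma polar_cmult: "polar (\<lambda>v. c * q v) u v = c * polar q u v"
  by (simp add: polar_def algebra_simps)

lemma smoothq_subst:
  assumes "smoothq q" "invertible T" "c \<noteq> 0"
  shows "smoothq (\<lambda>v. c * q (T *v v))"
  unfolding smoothq_def
proof (intro conjI allI impI)
  show "form 2 (\<lambda>v. c * q (T *v v))"
    using assms(1) by (intro form_cmult form_subst) (simp add: smoothq_def)
  fix v assume "\<forall>w. polar (\<lambda>v. c * q (T *v v)) v w = 0"
  then have *: "polar q (T *v v) (T *v w) = 0" for w
    using assms(3) by (simp add: polar_cmult polar_subst)
  obtain T' where "\<And>v. T *v (T' *v v) = v" using invertible_obtain_inverse[OF assms(2)] by metis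
  then have "polar q (T *v v) w = 0" for w
    using *[of "T' *v w"] by simp
  then have "T *v v = 0" using assms(1) by (auto simp: smoothq_def)
  then show "v = 0" using invertible_mult_eq_0[OF assms(2)] by simp
qed

lemma smoothq_nonzero: "smoothq q \<Longrightarrow> \<exists>v. q v \<noteq> 0"
proof (rule ccontr)
  assume "smoothq q" "\<nexists>v. q v \<noteq> 0"
  then have "vec3 1 0 0 = (0 :: complex ^ 3)"
    unfolding smoothq_def polar_def by simp
  then show False by (simp add: vec3_eq_iff)
qed

declare form.simps [simp del]

lemma indep_det3:
  assumes "p \<noteq> 0" "\<And>c. r \<noteq> c *s p"
  shows "\<exists>w. det3 p r w \<noteq> 0"
proof (rule ccontr)
  assume "\<nexists>w. det3 p r w \<noteq> 0"
  then have *: "det3 p r w = 0" for w by auto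
  have c: "p $ 1 * r $ 2 = p $ 2 * r $ 1" "p $ 1 * r $ 3 = p $ 3 * r $ 1" "p $ 2 * r $ 3 = p $ 3 * r $ 2"
    using *[of "vec3 0 0 1"] *[of "vec3 0 1 0"] *[of "vec3 1 0 0"] by (simp_all add: det3_def algebra_simps)
  have "p $ 1 \<noteq> 0 \<or> p $ 2 \<noteq> 0 \<or> p $ 3 \<noteq> 0" using assms(1) by (auto simp: vec3_eq_iff)
  then have "r = (r $ 1 / p $ 1) *s p \<or> r = (r $ 2 / p $ 2) *s p \<or> r = (r $ 3 / p $ 3) *s p"
    using c by (auto simp: vec3_eq_iff field_simps)
  then show False using assms(2) by blast
qed

lemma smoothq_basis:
  assumes "smoothq q" "det3 a b c \<noteq> 0" "polar q u a = 0" "polar q u b = 0" "polar q u c = 0"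
  shows "u = 0"
proof -
  note q = smoothq_form[OF assms(1)]
  have "polar q u w = 0" for w
  proof -
    have "invertible (columns3 a b c)" using assms(2) by (simp add: invertible_columns3)
    then obtain T' where "columns3 a b c *v (T' *v w) = w" using invertible_obtain_inverse by metis
    then have "w = (T' *v w) $ 1 *s a + (T' *v w) $ 2 *s b + (T' *v w) $ 3 *s c"
      by (simp add: columns3_mult)
    then show ?thesis
      using assms(3-5) polar_add_right[OF q] polar_scale_right[OF q] by (metis add.right_neutral mult_zero_right)
  qed
  then show ?thesis using assms(1) by (simp add: smoothq_def)
qed

section \<open>The standard conic, its rational parametrization, and coordinates adapted to two
  points of a conic\<close>

definition std :: "complex ^ 3 \<Rightarrow> complex" where "std v = v $ 1 ^ 2 - v $ 2 * v $ 3"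

text \<open>The parametrization misses exactly the point \<open>vec3 0 1 0\<close>, the parameter
  infinity. Statements about parameters therefore need a separate look at that point.\<close>

definition phi :: "complex \<Rightarrow> complex ^ 3" where "phi x = vec3 x (x ^ 2) 1"

lemma phi_nth [simp]: "phi x $ 1 = x" "phi x $ 2 = x ^ 2" "phi x $ 3 = 1"
  by (simp_all add: phi_def)

lemma std_phi [simp]: "std (phi x) = 0"
  by (simp add: std_def)

lemma form_std: "form 2 std"
proof -
  have "form 2 (\<lambda>v. v $ 1 * v $ 1 - v $ 2 * v $ 3)" by (intro form_diff form_monom2)
  moreover have "(\<lambda>v. v $ 1 * v $ 1 - v $ 2 * v $ 3) = std" by (auto simp: std_def power2_eq_square)
  ultimately show ?thesis by simp
qed

lemma polar_std: "polar std u v = 2 * u $ 1 * v $ 1 - u $ 2 * v $ 3 - u $ 3 * v $ 2"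
  by (simp add: polar_def std_def power2_eq_square algebra_simps)

text \<open>A nondegenerate form in three variables has no isotropic plane: if the two points were
  orthogonal, their span would lie in its own orthogonal complement, which is only a line.\<close>

lemma polar_pos_neq:
  assumes q: "smoothq q" and "q p = 0" "q r = 0" "p \<noteq> 0" "\<And>c. r \<noteq> c *s p"
  shows "polar q p r \<noteq> 0"
proof
  assume z: "polar q p r = 0"
  note f = smoothq_form[OF q]
  obtain w where w: "det3 p r w \<noteq> 0" using indep_det3[OF assms(4,5)] by auto
  \<comment> \<open>This combination is orthogonal to \<open>p\<close> and \<open>r\<close> because
    these span an isotropic plane; its coefficients make it orthogonal to \<open>w\<close> as
    well.\<close>
  let ?u = "polar q r w *s p + (- polar q p w) *s r"
  have "polar q ?u p = 0" "polar q ?u r = 0" "polar q ?u w = 0"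
    using assms(2,3) z polar_self[OF f, of p] polar_self[OF f, of r]
    by (simp_all add: polar_add_left[OF f] polar_diff_left[OF f] polar_scale_left[OF f] polar_commute[of q r p])
  then have "?u = 0" using smoothq_basis[OF q w] by blast
  then have "polar q p w *s r = polar q r w *s p" by (simp add: algebra_simps)
  moreover have "polar q p w \<noteq> 0"
  proof
    assume "polar q p w = 0"
    then have "p = 0" using smoothq_basis[OF q w, of p] z assms(2) polar_self[OF f, of p] by simp
    then show False using assms(4) by simp
  qed
  ultimately have "r = (polar q r w / polar q p w) *s p"
    by (auto simp: vec3_eq_iff field_simps)
  then show False using assms(5) by blast
qed

text \<open>The two points span a hyperbolic plane, and \<open>e\<close> spans its orthogonal
  complement: geometrically it is the intersection of the tangents at \<open>p\<close> and
  \<open>r\<close>. In the basis \<open>e\<close>, \<open>l *s r\<close>, \<open>p\<close> the form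
  is a multiple of X^2 - YZ. All normal forms below start from two chosen points placed at these
  vertices.\<close>

lemma conic_coordinates:
  assumes q: "smoothq q" and "q p = 0" "q r = 0" "p \<noteq> 0" "\<And>c. r \<noteq> c *s p"
  obtains T c l where "invertible T" "c \<noteq> 0" "l \<noteq> 0" "\<And>v. q (T *v v) = c * std v"
    "T *v vec3 0 0 1 = p" "T *v vec3 0 1 0 = l *s r"
proof -
  note f = smoothq_form[OF q]
  have B: "polar q p r \<noteq> 0" by (rule polar_pos_neq[OF assms])
  obtain w where w: "det3 p r w \<noteq> 0" using indep_det3[OF assms(4,5)] by auto
  define e where "e = w + (- polar q r w / polar q p r) *s p + (- polar q p w / polar q p r) *s r"
  have pe: "polar q p e = 0" "polar q r e = 0"
    using B assms(2,3) polar_self[OF f, of p] polar_self[OF f, of r]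
    by (simp_all add: e_def polar_add_right[OF f] polar_diff_right[OF f] polar_scale_right[OF f] polar_commute[of q r p])
  have "det3 p r e = det3 p r w" by (simp add: e_def det3_def algebra_simps)
  then have d: "det3 p r e \<noteq> 0" using w by simp
  have qe: "q e \<noteq> 0"
  proof
    assume "q e = 0"
    then have "e = 0"
      using smoothq_basis[OF q d, of e] pe polar_self[OF f, of e] by (simp add: polar_commute)
    then show False using d by (simp add: det3_def)
  qed
  \<comment> \<open>Rescaling \<open>r\<close> makes the coefficient of YZ equal to minus that of
    X^2.\<close>
  define l where "l = - q e / polar q p r"
  have l: "l \<noteq> 0" using qe B by (simp add: l_def)
  have "det3 e (l *s r) p = - l * det3 p r e" by (simp add: det3_def algebra_simps)
  then have inv: "invertible (columns3 e (l *s r) p)" using l d by (simp add: invertible_columns3)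
  show thesis
  proof (rule that[OF inv qe l])
    fix v
    have "q (columns3 e (l *s r) p *v v) = q e * v $ 1 ^ 2 + v $ 2 * v $ 3 * (l * polar q p r)"
      using pe assms(2,3)
      by (simp add: columns3_mult quad_add[OF f] quad_diff[OF f] quad_scale[OF f] polar_add_left[OF f] polar_diff_left[OF f] polar_scale_left[OF f]
          polar_scale_right[OF f] polar_commute[of q e] polar_commute[of q r p])
    also have "l * polar q p r = - q e" using B by (simp add: l_def)
    finally show "q (columns3 e (l *s r) p *v v) = q e * std v" by (simp add: std_def algebra_simps)
  qed (simp_all add: columns3_mult)
qed

lemma csquare_root: "\<exists>z::complex. z ^ 2 = w"
  by (rule exI[of _ "csqrt w"]) simp

lemma quadratic_root: "a \<noteq> 0 \<Longrightarrow> \<exists>x::complex. a * x ^ 2 + b * x + c = 0"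
proof -
  assume a: "a \<noteq> 0"
  obtain s where s: "s ^ 2 = b ^ 2 - 4 * a * c" using csquare_root by blast
  have "a * ((s - b) / (2 * a)) ^ 2 + b * ((s - b) / (2 * a)) + c = (s ^ 2 - b ^ 2 + 4 * a * c) / (4 * a)"
    using a by (simp add: field_simps power2_eq_square)
  also have "\<dots> = 0" using s by simp
  finally show ?thesis by blast
qed

lemma smoothq_two_points:
  assumes q: "smoothq q"
  obtains p r where "q p = 0" "q r = 0" "p \<noteq> 0" "\<And>c. r \<noteq> c *s p"
proof -
  note f = smoothq_form[OF q]
  have "\<exists>p. p \<noteq> 0 \<and> q p = 0"
  proof (cases "q (vec3 1 0 0) = 0")
    case True
    then show ?thesis by (intro exI[of _ "vec3 1 0 0"]) (simp add: vec3_eq_iff)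
  next
    case False
    obtain x where x: "q (vec3 1 0 0) * x ^ 2 + polar q (vec3 1 0 0) (vec3 0 1 0) * x + q (vec3 0 1 0) = 0"
      using quadratic_root[OF False] by blast
    have "q (x *s vec3 1 0 0 + vec3 0 1 0) = 0"
      using x by (simp only: quad_add[OF f] quad_diff[OF f] quad_scale[OF f] polar_scale_left[OF f]) (simp add: algebra_simps)
    moreover have "x *s vec3 1 0 0 + vec3 0 1 0 \<noteq> (0 :: complex ^ 3)" by (simp add: vec3_eq_iff)
    ultimately show ?thesis by blast
  qed
  then obtain p where p: "p \<noteq> 0" "q p = 0" by blast
  then obtain w where w: "polar q p w \<noteq> 0" using q by (auto simp: smoothq_def)
  \<comment> \<open>The line through \<open>p\<close> and \<open>w\<close> is not tangent at
    \<open>p\<close>, so it has a second point on the conic; this is that point.\<close>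
  define r where "r = w + (- q w / polar q p w) *s p"
  have "q r = 0" using w p by (simp add: r_def quad_add[OF f] quad_diff[OF f] quad_scale[OF f] polar_scale_right[OF f] polar_commute[of q w p])
  moreover have pr: "polar q p r \<noteq> 0"
    using w p polar_self[OF f, of p] by (simp add: r_def polar_add_right[OF f] polar_diff_right[OF f] polar_scale_right[OF f])
  moreover have "r \<noteq> c *s p" for c
    using pr p polar_self[OF f, of p] by (auto simp: polar_scale_right[OF f])
  ultimately show thesis using that p by blast
qed

lemma poly_zero_list:
  assumes "\<And>x::complex. poly p x = 0" shows "p = 0"
  using assms poly_all_0_iff_0 by blast

text \<open>Restriction to the conic doubles degrees, and the coefficient in degree
  \<open>2 * n\<close> is the value at the point at infinity. So a form that does not vanish there
  has a restriction of full degree, with all its zeros at finite parameters.\<close>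

lemma form_phi_poly:
  "form n F \<Longrightarrow> \<exists>p. degree p \<le> 2 * n \<and> (\<forall>x. F (phi x) = poly p x) \<and> coeff p (2 * n) = F (vec3 0 1 0)"
proof (induction n arbitrary: F)
  case 0
  then obtain c where "\<forall>v. F v = c" by (auto simp: form.simps)
  then show ?case by (intro exI[of _ "[:c:]"]) simp
next
  case (Suc n)
  obtain A B C where 1: "form n A" "form n B" "form n C"
    "\<forall>v. F v = v $ 1 * A v + v $ 2 * B v + v $ 3 * C v"
    using Suc.prems(1) by (auto simp: form.simps)
  obtain a where a: "degree a \<le> 2 * n" "\<forall>x. A (phi x) = poly a x" using Suc.IH[OF 1(1)] by blast
  obtain b where b: "degree b \<le> 2 * n" "\<forall>x. B (phi x) = poly b x" "coeff b (2 * n) = B (vec3 0 1 0)"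
    using Suc.IH[OF 1(2)] by blast
  obtain c where c: "degree c \<le> 2 * n" "\<forall>x. C (phi x) = poly c x" using Suc.IH[OF 1(3)] by blast
  let ?p = "pCons 0 a + pCons 0 (pCons 0 b) + c"
  have "degree ?p \<le> 2 * Suc n"
    using a(1) b(1) c(1) by (intro degree_add_le order.trans[OF degree_pCons_le]) auto
  moreover have "F (phi x) = poly ?p x" for x
    using 1(4) a b c by (simp add: power2_eq_square algebra_simps)
  moreover have "coeff ?p (2 * Suc n) = F (vec3 0 1 0)"
    using 1(4) a(1) b c(1) by (simp add: coeff_eq_0 coeff_pCons)
  ultimately show ?case by blast
qed

text \<open>Monomials with the same pullback differ by multiples of X^2 - YZ, so the vanishing of
  the pullback is a list of linear conditions on the coefficients from which the quotient can be
  read off. Degrees 2, 3 and 4 are those of the derivative of a quadratic form along a field of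
  degree 1, 2 or 3.\<close>

lemma std_divides2:
  assumes "form 2 F" "\<And>x. F (phi x) = 0"
  shows "\<exists>c. \<forall>v. F v = c * std v"
proof -
  obtain a b c d e f where E: "\<And>v. F v = a * v $ 1 ^ 2 + b * v $ 2 ^ 2 + c * v $ 3 ^ 2
     + d * v $ 1 * v $ 2 + e * v $ 1 * v $ 3 + f * v $ 2 * v $ 3" using form2E[OF assms(1)] by blast
  have "poly [:c, e, a + f, d, b:] x = 0" for x
    using assms(2)[of x] unfolding E by (simp add: power2_eq_square algebra_simps)
  then have "[:c, e, a + f, d, b:] = 0" by (rule poly_zero_list)
  then have "c = 0" "e = 0" "f = - a" "d = 0" "b = 0" by (simp_all add: add_eq_0_iff)
  then show ?thesis unfolding E std_def by (intro exI[of _ a]) (simp add: algebra_simps)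
qed

lemma std_divides3:
  assumes "form 3 F" "\<And>x. F (phi x) = 0"
  shows "\<exists>a b c. \<forall>v. F v = std v * (a * v $ 1 + b * v $ 2 + c * v $ 3)"
proof -
  obtain a b c d e f g h i j where E: "\<And>v. F v = a * v $ 1 ^ 3 + b * v $ 2 ^ 3 + c * v $ 3 ^ 3
     + d * v $ 1 ^ 2 * v $ 2 + e * v $ 1 ^ 2 * v $ 3 + f * v $ 2 ^ 2 * v $ 1 + g * v $ 2 ^ 2 * v $ 3
     + h * v $ 3 ^ 2 * v $ 1 + i * v $ 3 ^ 2 * v $ 2 + j * v $ 1 * v $ 2 * v $ 3" using form3E[OF assms(1)] by blast
  have "poly [:c, h, e + i, a + j, d + g, f, b:] x = 0" for x
    using assms(2)[of x] unfolding E by (simp add: power2_eq_square power3_eq_cube algebra_simps)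
  then have "[:c, h, e + i, a + j, d + g, f, b:] = 0" by (rule poly_zero_list)
  then have "c = 0" "h = 0" "i = - e" "j = - a" "g = - d" "f = 0" "b = 0" by (simp_all add: add_eq_0_iff)
  then show ?thesis unfolding E std_def
    by (intro exI[of _ a] exI[of _ d] exI[of _ e]) (simp add: power2_eq_square power3_eq_cube algebra_simps)
qed

lemma std_divides4:
  assumes "form 4 F" "\<And>x. F (phi x) = 0"
  shows "\<exists>G. form 2 G \<and> (\<forall>v. F v = std v * G v)"
proof -
  obtain a1 a2 a3 a4 a5 a6 a7 a8 a9 a10 a11 a12 a13 a14 a15
  where E: "\<And>v. F v = a1 * v $ 1 ^ 4 + a2 * v $ 1 ^ 3 * v $ 2 + a3 * v $ 1 ^ 3 * v $ 3
    + a4 * v $ 1 ^ 2 * v $ 2 ^ 2 + a5 * v $ 1 ^ 2 * v $ 2 * v $ 3 + a6 * v $ 1 ^ 2 * v $ 3 ^ 2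
    + a7 * v $ 1 * v $ 2 ^ 3 + a8 * v $ 1 * v $ 2 ^ 2 * v $ 3 + a9 * v $ 1 * v $ 2 * v $ 3 ^ 2
    + a10 * v $ 1 * v $ 3 ^ 3 + a11 * v $ 2 ^ 4 + a12 * v $ 2 ^ 3 * v $ 3
    + a13 * v $ 2 ^ 2 * v $ 3 ^ 2 + a14 * v $ 2 * v $ 3 ^ 3 + a15 * v $ 3 ^ 4"
    using form4E[OF assms(1)] by blast
  have "poly [:a15, a10, a6 + a14, a3 + a9, a1 + a5 + a13, a2 + a8, a4 + a12, a7, a11:] x = 0" for x
    using assms(2)[of x] unfolding E
    by (simp add: power2_eq_square power3_eq_cube power4_eq_xxxx algebra_simps)
  then have "[:a15, a10, a6 + a14, a3 + a9, a1 + a5 + a13, a2 + a8, a4 + a12, a7, a11:] = 0"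
    by (rule poly_zero_list)
  then have *: "a15 = 0" "a10 = 0" "a14 = - a6" "a9 = - a3" "a13 = - a1 - a5" "a8 = - a2" "a12 = - a4" "a7 = 0" "a11 = 0"
    by (simp_all add: add_eq_0_iff)
  have "F v = std v * (a1 * v $ 1 ^ 2 + a4 * v $ 2 ^ 2 + a6 * v $ 3 ^ 2
     + a2 * v $ 1 * v $ 2 + a3 * v $ 1 * v $ 3 + (a1 + a5) * v $ 2 * v $ 3)" for v
    unfolding E std_def * by (simp add: power2_eq_square power3_eq_cube power4_eq_xxxx algebra_simps)
  then show ?thesis using form2I by blast
qed

lemma linear_split3:
  fixes a b c :: complex
  obtains r s t where "\<And>x. x ^ 3 + a * x ^ 2 + b * x + c = (x - r) * (x - s) * (x - t)"
    "a = - (r + s + t)" "b = r * s + r * t + s * t" "c = - (r * s * t)"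
proof -
  have "\<not> constant (poly [:c, b, a, 1:])" by (simp add: constant_degree)
  from Fundamental_Theorem_Algebra.fundamental_theorem_of_algebra[OF this]
  obtain r where r: "poly [:c, b, a, 1:] r = 0" by (elim exE)
  have r': "c + r * (b + r * (a + r)) = 0" using r by simp
  obtain s where s: "1 * s ^ 2 + (a + r) * s + (b + a * r + r ^ 2) = 0"
    using quadratic_root[OF one_neq_zero, of "a + r" "b + a * r + r ^ 2"] by (elim exE)
  define t where "t = - a - r - s"
  have a: "a = - (r + s + t)" using t_def by algebra
  have b: "b = r * s + r * t + s * t" using s a by algebra
  have c: "c = - (r * s * t)" using r' a b by algebra
  show thesis
  proof (rule that[OF _ a b c])
    show "x ^ 3 + a * x ^ 2 + b * x + c = (x - r) * (x - s) * (x - t)" for x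
      using a b c by algebra
  qed
qed


section \<open>Points of intersection\<close>

text \<open>A projective point as the set of its nonzero representatives, so that distinct points
  can be counted with \<open>card\<close>.\<close>

definition pt :: "complex ^ 3 \<Rightarrow> (complex ^ 3) set" where
  "pt v = {c *s v |c. c \<noteq> 0}"

lemma pt_self: "v \<in> pt v"
  unfolding pt_def by (rule CollectI, rule exI[of _ 1]) simp

lemma pt_eq_iff: "pt v = pt w \<longleftrightarrow> (\<exists>c. c \<noteq> 0 \<and> w = c *s v)"
proof
  assume "pt v = pt w"
  then have "w \<in> pt v" using pt_self by blast
  then show "\<exists>c. c \<noteq> 0 \<and> w = c *s v" by (auto simp: pt_def)
next
  assume "\<exists>c. c \<noteq> 0 \<and> w = c *s v"
  then obtain c where c: "c \<noteq> 0" "w = c *s v" by blast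
  show "pt v = pt w"
    unfolding pt_def
  proof (intro equalityI subsetI; elim CollectE exE conjE)
    fix x d assume d: "x = d *s v" "d \<noteq> 0"
    then have "x = (d / c) *s w" "d / c \<noteq> 0" using c by (simp_all add: vector_smult_assoc)
    then show "x \<in> {c *s w |c. c \<noteq> 0}" by blast
  next
    fix x d assume d: "x = d *s w" "d \<noteq> 0"
    then have "x = (d * c) *s v" "d * c \<noteq> 0" using c by (simp_all add: vector_smult_assoc)
    then show "x \<in> {c *s v |c. c \<noteq> 0}" by blast
  qed
qed

lemma pt_scale: "c \<noteq> 0 \<Longrightarrow> pt (c *s v) = pt v"
  using pt_eq_iff by blast

lemma pt_neq: "v \<noteq> 0 \<Longrightarrow> w \<noteq> 0 \<Longrightarrow> pt v \<noteq> pt w \<Longrightarrow> w \<noteq> c *s v"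
  using pt_eq_iff[of v w] by (cases "c = 0") auto

lemma pt_mult: "invertible T \<Longrightarrow> pt (T *v v) = pt (T *v w) \<longleftrightarrow> pt v = pt w"
  unfolding pt_eq_iff by (simp add: vector_scalar_commute[symmetric] invertible_inj)

lemma pt_phi: "pt (phi x) = pt (phi y) \<longleftrightarrow> x = y"
  by (auto simp: pt_eq_iff vec3_eq_iff)

lemma pt_phi_infinity: "pt (phi x) \<noteq> pt (vec3 0 1 0)"
  by (auto simp: pt_eq_iff vec3_eq_iff)

lemma std_zero_cases:
  assumes "std v = 0" "v \<noteq> 0"
  shows "(\<exists>x. pt v = pt (phi x)) \<or> pt v = pt (vec3 0 1 0)"
proof (cases "v $ 3 = 0")
  case True
  then have "v $ 1 = 0" using assms(1) by (simp add: std_def)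
  then have "v = (v $ 2) *s vec3 0 1 0" "v $ 2 \<noteq> 0" using True assms(2) by (auto simp: vec3_eq_iff)
  then show ?thesis using pt_scale by metis
next
  case False
  then have "v = (v $ 3) *s phi (v $ 1 / v $ 3)"
    using assms(1) by (simp add: vec3_eq_iff std_def field_simps power2_eq_square)
  then show ?thesis using pt_scale False by metis
qed

definition common :: "(complex ^ 3 \<Rightarrow> complex) \<Rightarrow> (complex ^ 3 \<Rightarrow> complex) \<Rightarrow> (complex ^ 3) set set" where
  "common q1 q2 = pt ` {v. v \<noteq> 0 \<and> q1 v = 0 \<and> q2 v = 0}"

lemma common_commute: "common q1 q2 = common q2 q1"
  unfolding common_def by metis

lemma pt_in_common:
  assumes "form 2 q1" "form 2 q2" "v \<noteq> 0"
  shows "pt v \<in> common q1 q2 \<longleftrightarrow> q1 v = 0 \<and> q2 v = 0"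
proof
  assume "pt v \<in> common q1 q2"
  then obtain w where w: "pt v = pt w" "q1 w = 0" "q2 w = 0" by (auto simp: common_def)
  then obtain c where "c \<noteq> 0" "w = c *s v" using pt_eq_iff by blast
  then show "q1 v = 0 \<and> q2 v = 0" using w quad_scale[OF assms(1)] quad_scale[OF assms(2)] by auto
qed (use assms in \<open>auto simp: common_def\<close>)

lemma form_line_poly:
  "form n F \<Longrightarrow> \<exists>p. degree p \<le> n \<and> (\<forall>s. F (u + s *s w) = poly p s) \<and> coeff p n = F w"
proof (induction n arbitrary: F)
  case 0
  then obtain c where "\<forall>v. F v = c" by (auto simp: form.simps)
  then show ?case by (intro exI[of _ "[:c:]"]) simp
next
  case (Suc n)
  obtain A B C where 1: "form n A" "form n B" "form n C"
    "\<forall>v. F v = v $ 1 * A v + v $ 2 * B v + v $ 3 * C v"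
    using Suc.prems(1) by (auto simp: form.simps)
  obtain a where a: "degree a \<le> n" "\<forall>s. A (u + s *s w) = poly a s" "coeff a n = A w" using Suc.IH[OF 1(1)] by blast
  obtain b where b: "degree b \<le> n" "\<forall>s. B (u + s *s w) = poly b s" "coeff b n = B w" using Suc.IH[OF 1(2)] by blast
  obtain c where c: "degree c \<le> n" "\<forall>s. C (u + s *s w) = poly c s" "coeff c n = C w" using Suc.IH[OF 1(3)] by blast
  let ?p = "[:u $ 1, w $ 1:] * a + [:u $ 2, w $ 2:] * b + [:u $ 3, w $ 3:] * c"
  have "degree ([:x, y:] * q) \<le> Suc n" if "degree q \<le> n" for x y :: complex and q
    using that by (intro order.trans[OF degree_mult_le]) (simp add: degree_pCons_eq_if)
  then have "degree ?p \<le> Suc n"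
    using a(1) b(1) c(1) by (intro degree_add_le) auto
  moreover have "F (u + s *s w) = poly ?p s" for s
    using 1(4) a b c by (simp add: algebra_simps)
  moreover have "coeff ?p (Suc n) = F w"
    using 1(4) a b c by (simp add: coeff_eq_0 coeff_pCons)
  ultimately show ?case by blast
qed

text \<open>On the line through \<open>u\<close> in direction \<open>w\<close> the restriction of
  \<open>F\<close> is nonzero at parameter 0 and that of \<open>G\<close> has nonzero top
  coefficient, so their product is a nonzero polynomial.\<close>

lemma form_integral:
  assumes "form m F" "form n G" "F u \<noteq> 0" "G w \<noteq> 0"
  shows "\<exists>v. F v \<noteq> 0 \<and> G v \<noteq> 0"
proof -
  obtain p where p: "\<forall>s. F (u + s *s w) = poly p s" using form_line_poly[OF assms(1)] by blast
  obtain q where q: "\<forall>s. G (u + s *s w) = poly q s" "coeff q n = G w" using form_line_poly[OF assms(2)] by blast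
  have "poly p 0 \<noteq> 0" using p[rule_format, of 0] assms(3) by simp
  then have "p * q \<noteq> 0" using q assms(4) by auto
  then obtain s where "poly (p * q) s \<noteq> 0" using poly_all_0_iff_0 by blast
  then show ?thesis using p q by (intro exI[of _ "u + s *s w"]) auto
qed

lemma smoothq_exists_nonzero:
  assumes "smoothq q1" "smoothq q2" "smoothq q3"
  shows "\<exists>v. q1 v \<noteq> 0 \<and> q2 v \<noteq> 0 \<and> q3 v \<noteq> 0"
proof -
  obtain u where "q1 u \<noteq> 0 \<and> q2 u \<noteq> 0"
    using form_integral smoothq_form smoothq_nonzero assms by meson
  moreover obtain w where "q3 w \<noteq> 0" using smoothq_nonzero assms by blast
  ultimately have "\<exists>v. q1 v * q2 v \<noteq> 0 \<and> q3 v \<noteq> 0"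
    using form_integral[OF form_mult[OF smoothq_form smoothq_form] smoothq_form, of q1 q2 q3] assms by auto
  then show ?thesis by auto
qed

lemma smoothq_standard:
  assumes "smoothq q"
  obtains T c where "invertible T" "c \<noteq> 0" "\<And>v. q (T *v v) = c * std v"
proof -
  obtain p r where "q p = 0" "q r = 0" "p \<noteq> 0" "\<And>c. r \<noteq> c *s p" using smoothq_two_points[OF assms] by blast
  from conic_coordinates[OF assms this] show thesis using that by metis
qed

text \<open>A conic parametrized by a line is irreducible: the pullback of the product vanishes in
  \<open>complex poly\<close>, which has no zero divisors.\<close>

lemma smoothq_prime:
  assumes q: "smoothq q" and F: "form m F" and G: "form n G"
    and FG: "\<And>v. q v = 0 \<Longrightarrow> F v * G v = 0"
  shows "(\<forall>v. q v = 0 \<longrightarrow> F v = 0) \<or> (\<forall>v. q v = 0 \<longrightarrow> G v = 0)"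
proof -
  obtain T c where T: "invertible T" "c \<noteq> 0" "\<And>v. q (T *v v) = c * std v" using smoothq_standard[OF q] by blast
  have F': "form m (\<lambda>v. F (T *v v))" and G': "form n (\<lambda>v. G (T *v v))" using F G form_subst by blast+
  obtain f where f: "\<forall>x. F (T *v phi x) = poly f x" "coeff f (2 * m) = F (T *v vec3 0 1 0)"
    using form_phi_poly[OF F'] by blast
  obtain g where g: "\<forall>x. G (T *v phi x) = poly g x" "coeff g (2 * n) = G (T *v vec3 0 1 0)"
    using form_phi_poly[OF G'] by blast
  have "poly (f * g) x = 0" for x
    using FG[of "T *v phi x"] T(3)[of "phi x"] f g by simp
  then have "f * g = 0" by (rule poly_zero_list)
  then have fg: "f = 0 \<or> g = 0" by simp
  \<comment> \<open>Vanishing at the finite parameters and at infinity spreads to all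
    representatives by homogeneity.\<close>
  have *: "\<forall>v. q v = 0 \<longrightarrow> H v = 0"
    if H: "form k H" and h0: "\<And>x. H (T *v phi x) = 0" "H (T *v vec3 0 1 0) = 0" for H k
  proof (intro allI impI)
    fix v assume v: "q v = 0"
    obtain T' where T': "T *v (T' *v v) = v" using invertible_obtain_inverse[OF T(1)] by metis
    show "H v = 0"
    proof (cases "T' *v v = 0")
      case True
      then have "v = 0" using T' by simp
      then have "v = T *v (0 *s phi 0)" by simp
      moreover have "H (T *v (0 *s phi 0)) = 0"
        using form_homogeneous[OF form_subst[OF H], of T 0 "phi 0"] h0(1)[of 0] by simp
      ultimately show ?thesis by simp
    next
      case False
      have "std (T' *v v) = 0" using v T(2) T(3)[of "T' *v v"] T' by simp
      then obtain c x where "T' *v v = c *s phi x \<or> T' *v v = c *s vec3 0 1 0"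
        using std_zero_cases False unfolding pt_eq_iff by (metis pt_eq_iff)
      then have "H (T *v (T' *v v)) = 0"
        using form_homogeneous[OF form_subst[OF H], of T] h0 by auto
      then show ?thesis using T' by simp
    qed
  qed
  show ?thesis
    using fg *[OF F] *[OF G] f g by auto
qed

lemma form_vanish_linear:
  assumes q: "smoothq q" and F: "form 1 F" and z: "\<And>v. q v = 0 \<Longrightarrow> F v = 0"
  shows "F v = 0"
proof -
  obtain T c where T: "invertible T" "c \<noteq> 0" "\<And>v. q (T *v v) = c * std v" using smoothq_standard[OF q] by blast
  obtain a b d where E: "\<And>v. F (T *v v) = a * v $ 1 + b * v $ 2 + d * v $ 3"
    using form1E[OF form_subst[OF F]] by blast
  have "poly [:d, a, b:] x = 0" for x
    using z[of "T *v phi x"] T(3)[of "phi x"] E[of "phi x"] by (simp add: power2_eq_square algebra_simps)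
  then have "[:d, a, b:] = 0" by (rule poly_zero_list)
  then have "F (T *v v) = 0" for v using E by simp
  moreover obtain T' where "T *v (T' *v v) = v" using invertible_obtain_inverse[OF T(1)] by metis
  ultimately show ?thesis by metis
qed

lemma smoothq_divides:
  assumes q: "smoothq q" and F: "form n F" "n = 2 \<or> n = 3 \<or> n = 4" and z: "\<And>v. q v = 0 \<Longrightarrow> F v = 0"
  shows "\<exists>G. form (n - 2) G \<and> (\<forall>v. F v = q v * G v)"
proof -
  obtain T c where T: "invertible T" "c \<noteq> 0" "\<And>v. q (T *v v) = c * std v" using smoothq_standard[OF q] by blast
  obtain T' where T': "\<And>v. T *v (T' *v v) = v" using invertible_obtain_inverse[OF T(1)] by metis
  have F': "form n (\<lambda>v. F (T *v v))" using F form_subst by blast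
  have z': "F (T *v phi x) = 0" for x using z T(3) by simp
  have "\<exists>G. form (n - 2) G \<and> (\<forall>v. F (T *v v) = std v * G v)"
    using F(2)
  proof (elim disjE)
    assume "n = 2"
    then obtain c where "\<forall>v. F (T *v v) = c * std v" using std_divides2[of "\<lambda>v. F (T *v v)"] F' z' by auto
    then show ?thesis using \<open>n = 2\<close> by (intro exI[of _ "\<lambda>v. c"]) (simp add: form_const)
  next
    assume "n = 3"
    then obtain a b c where "\<forall>v. F (T *v v) = std v * (a * v $ 1 + b * v $ 2 + c * v $ 3)"
      using std_divides3[of "\<lambda>v. F (T *v v)"] F' z' by auto
    then show ?thesis using \<open>n = 3\<close> form1I[of a b c] by (intro exI[of _ "\<lambda>v. a * v $ 1 + b * v $ 2 + c * v $ 3"]) simp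
  next
    assume "n = 4"
    then show ?thesis using std_divides4[of "\<lambda>v. F (T *v v)"] F' z' by simp
  qed
  then obtain G where G: "form (n - 2) G" "\<forall>v. F (T *v v) = std v * G v" by blast
  have "F v = q v * (1 / c * G (T' *v v))" for v
    using G(2)[rule_format, of "T' *v v"] T(3)[of "T' *v v"] T(2) T' by simp
  moreover have "form (n - 2) (\<lambda>v. 1 / c * G (T' *v v))" by (intro form_cmult form_subst G)
  ultimately show ?thesis by blast
qed


section \<open>Tangent vector fields\<close>

definition vform :: "nat \<Rightarrow> (complex ^ 3 \<Rightarrow> complex ^ 3) \<Rightarrow> bool" where
  "vform n \<theta> \<longleftrightarrow> (\<forall>i. form n (\<lambda>v. \<theta> v $ i))"

text \<open>\<open>polar q v (\<theta> v)\<close> is the derivative of \<open>q\<close> along the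
  field at \<open>v\<close>; a field with this property is also called logarithmic along the
  conic.\<close>

definition tangent :: "(complex ^ 3 \<Rightarrow> complex) \<Rightarrow> (complex ^ 3 \<Rightarrow> complex ^ 3) \<Rightarrow> bool" where
  "tangent q \<theta> \<longleftrightarrow> (\<forall>v. q v = 0 \<longrightarrow> polar q v (\<theta> v) = 0)"

lemma form_polar:
  assumes "form 2 q" "vform m \<theta>"
  shows "form (Suc m) (\<lambda>v. polar q v (\<theta> v))"
proof -
  obtain a b c d e f where E: "\<And>v. q v = a * v $ 1 ^ 2 + b * v $ 2 ^ 2 + c * v $ 3 ^ 2
     + d * v $ 1 * v $ 2 + e * v $ 1 * v $ 3 + f * v $ 2 * v $ 3" using form2E[OF assms(1)] by blast
  have m: "form (Suc m) (\<lambda>v. v $ i * \<theta> v $ j)" for i j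
    using assms(2) by (intro form_coord_mult) (simp add: vform_def)
  show ?thesis
    unfolding polar_form2[of q, OF E] mult.assoc by (intro form_add form_cmult m)
qed

lemma form_polar_const: "form 2 q \<Longrightarrow> form 1 (\<lambda>v. polar q v c)"
  using form_polar[of q 0 "\<lambda>v. c"] by (simp add: vform_def form_const)

lemma tangent_divides:
  assumes "smoothq q" "tangent q \<theta>" "vform n \<theta>" "n = 1 \<or> n = 2 \<or> n = 3"
  shows "\<exists>G. form (n - 1) G \<and> (\<forall>v. polar q v (\<theta> v) = q v * G v)"
proof -
  have "form (Suc n) (\<lambda>v. polar q v (\<theta> v))" using assms form_polar smoothq_form by blast
  then show ?thesis
    using smoothq_divides[OF assms(1), of "Suc n"] assms(2,4) by (auto simp: tangent_def)
qed

lemma tangent_std_phi: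
  assumes "tangent std \<theta>"
  shows "\<theta> (phi x) $ 2 = 2 * x * \<theta> (phi x) $ 1 - x ^ 2 * \<theta> (phi x) $ 3"
  using assms[unfolded tangent_def, rule_format, of "phi x"] by (simp add: polar_std algebra_simps)

lemma tangent_component_poly:
  assumes "tangent std \<theta>" "vform n \<theta>"
  shows "\<exists>t. degree t \<le> 2 * n \<and> (\<forall>x. \<theta> (phi x) $ 1 - x * \<theta> (phi x) $ 3 = poly t x)"
proof -
  obtain a where a: "degree a \<le> 2 * n" "\<forall>x. \<theta> (phi x) $ 1 = poly a x"
    using form_phi_poly[of n "\<lambda>v. \<theta> v $ 1"] assms(2) by (auto simp: vform_def)
  obtain e where e: "degree e \<le> 2 * n" "\<forall>x. \<theta> (phi x) $ 3 = poly e x" "coeff e (2 * n) = \<theta> (vec3 0 1 0) $ 3"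
    using form_phi_poly[of n "\<lambda>v. \<theta> v $ 3"] assms(2) by (auto simp: vform_def)
  \<comment> \<open>The tangent at the point at infinity is Z = 0, so tangency there removes the top
    coefficient of the third component and with it the term of degree
    \<open>2 * n + 1\<close>.\<close>
  have "\<theta> (vec3 0 1 0) $ 3 = 0"
    using assms(1)[unfolded tangent_def, rule_format, of "vec3 0 1 0"] by (simp add: std_def polar_std)
  then have "degree (pCons 0 e) \<le> 2 * n"
  proof (intro degree_le allI impI)
    fix i assume "2 * n < i" "\<theta> (vec3 0 1 0) $ 3 = 0"
    then obtain j where "i = Suc j" "2 * n \<le> j" by (cases i) auto
    then show "coeff (pCons 0 e) i = 0"
      using e(1,3) \<open>\<theta> (vec3 0 1 0) $ 3 = 0\<close> by (cases "j = 2 * n") (auto simp: coeff_eq_0)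
  qed
  then show ?thesis
    using a e by (intro exI[of _ "a - pCons 0 e"]) (auto intro: degree_diff_le)
qed

lemma poly_pderiv_phi:
  assumes "form 2 q" "\<And>x. q (phi x) = poly r x"
  shows "poly (pderiv r) x = polar q (phi x) (vec3 1 (2 * x) 0)"
proof -
  obtain a b c d e f where E: "\<And>v. q v = a * v $ 1 ^ 2 + b * v $ 2 ^ 2 + c * v $ 3 ^ 2
     + d * v $ 1 * v $ 2 + e * v $ 1 * v $ 3 + f * v $ 2 * v $ 3" using form2E[OF assms(1)] by blast
  have "poly [:c, e, a + f, d, b:] x = poly r x" for x
    using assms(2)[of x] unfolding E by (simp add: power2_eq_square algebra_simps)
  then have "r = [:c, e, a + f, d, b:]" by (intro poly_eq_poly_eq_iff[THEN iffD1]) auto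
  then show ?thesis
    unfolding polar_form2[of q, OF E] by (simp add: pderiv_pCons power2_eq_square algebra_simps)
qed

text \<open>A zero of \<open>r\<close> of order k is a zero of \<open>pderiv r\<close> of order
  exactly k - 1, so the factor \<open>t\<close> has to supply the missing order.\<close>

lemma poly_log_derivative_root:
  fixes r t g :: "complex poly"
  assumes "t * pderiv r = g * r" "r \<noteq> 0" "poly r x = 0"
  shows "poly t x = 0"
proof (rule ccontr)
  assume t: "poly t x \<noteq> 0"
  have "degree r \<noteq> 0"
  proof
    assume "degree r = 0"
    then obtain c where "r = [:c:]" by (meson degree_eq_zeroE)
    then show False using assms(2,3) by simp
  qed
  then have d: "pderiv r \<noteq> 0" by (simp add: pderiv_eq_0_iff)
  have nz: "t * pderiv r \<noteq> 0" using d t by auto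
  have "order x (t * pderiv r) = order x (pderiv r)"
    using order_mult[OF nz, of x] order_0I[OF t] by simp
  moreover have "order x (g * r) \<ge> order x r"
    using order_mult[of g r x] nz assms(1) by simp
  ultimately show False using order_pderiv[OF assms(2,3)] assms(1) by simp
qed

text \<open>With \<open>r\<close> the restriction of \<open>q\<close> to the conic, divisibility of
  the derivative of \<open>q\<close> by \<open>q\<close> becomes
  \<open>t * pderiv r = (g - 2 * e) * r\<close>; the term \<open>2 * e\<close> is the contribution
  of the radial part. Hence \<open>t\<close> vanishes wherever the second conic meets the
  first.\<close>

lemma tangent_component_root:
  assumes "tangent std \<theta>" "vform n \<theta>" "n = 1 \<or> n = 2 \<or> n = 3" "smoothq q" "tangent q \<theta>"
    and t: "\<And>x. \<theta> (phi x) $ 1 - x * \<theta> (phi x) $ 3 = poly t x"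
    and nz: "\<exists>x. q (phi x) \<noteq> 0" and x: "q (phi x) = 0"
  shows "poly t x = 0"
proof -
  note f = smoothq_form[OF assms(4)]
  obtain r where r: "\<forall>x. q (phi x) = poly r x" using form_phi_poly[OF f] by blast
  obtain G where G: "form (n - 1) G" "\<forall>v. polar q v (\<theta> v) = q v * G v"
    using tangent_divides assms by blast
  obtain g where g: "\<forall>x. G (phi x) = poly g x" using form_phi_poly[OF G(1)] by blast
  obtain e where e: "\<forall>x. \<theta> (phi x) $ 3 = poly e x"
    using form_phi_poly[of n "\<lambda>v. \<theta> v $ 3"] assms(2) by (auto simp: vform_def)
  have "poly (t * pderiv r) x = poly ((g - 2 * e) * r) x" for x
  proof -
    have "\<theta> (phi x) = poly e x *s phi x + poly t x *s vec3 1 (2 * x) 0"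
    proof -
      have 1: "\<theta> (phi x) $ 1 = poly t x + x * poly e x" using t[of x] e by (simp add: algebra_simps)
      have 3: "\<theta> (phi x) $ 3 = poly e x" using e by simp
      show ?thesis using tangent_std_phi[OF assms(1), of x] unfolding 1 3
        by (simp add: vec3_eq_iff 1 3 power2_eq_square algebra_simps)
    qed
    then have "polar q (phi x) (\<theta> (phi x)) = poly e x * (2 * q (phi x)) + poly t x * poly (pderiv r) x"
      using poly_pderiv_phi[OF f, of r x] r
      by (simp add: polar_add_right[OF f] polar_scale_right[OF f] polar_self[OF f])
    then show ?thesis using G(2) g r by (simp add: algebra_simps)
  qed
  then have "t * pderiv r = (g - 2 * e) * r" by (intro poly_eq_poly_eq_iff[THEN iffD1]) auto
  moreover have "r \<noteq> 0" using nz r by auto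
  ultimately show ?thesis using poly_log_derivative_root x r by metis
qed

lemma degree_times_square:
  assumes "degree b \<le> m + 2" "\<And>x::complex. poly b x = x ^ 2 * poly e x"
  shows "degree e \<le> m"
proof (cases "e = 0")
  case False
  have "b = pCons 0 (pCons 0 e)"
    using assms(2) by (intro poly_eq_poly_eq_iff[THEN iffD1]) (auto simp: power2_eq_square algebra_simps)
  then show ?thesis using assms(1) False by simp
qed simp

text \<open>A field that is radial along the conic agrees there with a linear form \<open>M\<close>
  times the Euler field. The difference vanishes on the conic, so it is divisible by
  \<open>std\<close>, and by degree the quotient is a constant vector.\<close>

lemma radial_field2:
  assumes "tangent std \<theta>" "vform 2 \<theta>" "\<And>x. \<theta> (phi x) $ 1 = x * \<theta> (phi x) $ 3"
  shows "\<exists>c M. form 1 M \<and> (\<forall>v. \<theta> v = std v *s c + M v *s v)"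
proof -
  have F: "form 2 (\<lambda>v. \<theta> v $ i)" for i using assms(2) by (simp add: vform_def)
  obtain b where b: "degree b \<le> 2 * 2" "\<forall>x. \<theta> (phi x) $ 2 = poly b x" using form_phi_poly[OF F] by blast
  obtain e where e: "\<forall>x. \<theta> (phi x) $ 3 = poly e x" using form_phi_poly[OF F] by blast
  have b2: "\<theta> (phi x) $ 2 = x ^ 2 * \<theta> (phi x) $ 3" for x
    using tangent_std_phi[OF assms(1), of x] assms(3)[of x] by (simp add: power2_eq_square algebra_simps)
  have d: "degree e \<le> 2" by (rule degree_times_square[of b]) (use b e b2 in auto)
  \<comment> \<open>The restriction \<open>e\<close> of the third component has degree at most 2,
    hence is itself the restriction of a linear form.\<close>
  define M where "M v = coeff e 1 * v $ 1 + coeff e 2 * v $ 2 + coeff e 0 * v $ 3" for v :: "complex ^ 3"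
  have M: "form 1 M" unfolding M_def[abs_def] by (rule form1I)
  have "e = [:coeff e 0, coeff e 1, coeff e 2:]"
    using d by (intro poly_eqI) (auto simp: coeff_pCons coeff_eq_0 numeral_2_eq_2 split: nat.splits)
  then have "poly e x = poly [:coeff e 0, coeff e 1, coeff e 2:] x" for x by simp
  then have Me: "M (phi x) = \<theta> (phi x) $ 3" for x
    using e by (simp add: M_def power2_eq_square algebra_simps)
  have "\<exists>c. \<forall>v. \<theta> v $ i - v $ i * M v = c * std v" for i
  proof (rule std_divides2)
    show "form 2 (\<lambda>v. \<theta> v $ i - v $ i * M v)"
      using form_diff[OF F[of i], of "\<lambda>v. v $ i * M v"] form_coord_mult[OF M, of i] by (simp add: numeral_2_eq_2)
    show "\<theta> (phi x) $ i - phi x $ i * M (phi x) = 0" for x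
      using exhaust_3[of i] assms(3)[of x] b2[of x] by (auto simp: Me)
  qed
  then obtain c where c: "\<And>i v. \<theta> v $ i - v $ i * M v = c i * std v" by metis
  have "\<theta> v = std v *s (\<chi> i. c i) + M v *s v" for v
    using c by (simp add: vec_eq_iff algebra_simps)
  then show ?thesis using M by blast
qed

lemma radial_field3:
  assumes "tangent std \<theta>" "vform 3 \<theta>" "\<And>x. \<theta> (phi x) $ 1 = x * \<theta> (phi x) $ 3"
  shows "\<exists>A M. form 2 M \<and> (\<forall>v. \<theta> v = std v *s (A *v v) + M v *s v)"
proof -
  have F: "form 3 (\<lambda>v. \<theta> v $ i)" for i using assms(2) by (simp add: vform_def)
  obtain b where b: "degree b \<le> 2 * 3" "\<forall>x. \<theta> (phi x) $ 2 = poly b x" using form_phi_poly[OF F] by blast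
  obtain e where e: "\<forall>x. \<theta> (phi x) $ 3 = poly e x" using form_phi_poly[OF F] by blast
  have b2: "\<theta> (phi x) $ 2 = x ^ 2 * \<theta> (phi x) $ 3" for x
    using tangent_std_phi[OF assms(1), of x] assms(3)[of x] by (simp add: power2_eq_square algebra_simps)
  have d: "degree e \<le> 4" by (rule degree_times_square[of b]) (use b e b2 in auto)
  \<comment> \<open>A quadratic form restricting to \<open>e\<close>; the coefficient of YZ may be
    taken as 0 because YZ and X^2 coincide on the conic.\<close>
  define M where "M v = coeff e 2 * v $ 1 ^ 2 + coeff e 4 * v $ 2 ^ 2 + coeff e 0 * v $ 3 ^ 2
     + coeff e 3 * v $ 1 * v $ 2 + coeff e 1 * v $ 1 * v $ 3 + 0 * v $ 2 * v $ 3" for v :: "complex ^ 3"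
  have M: "form 2 M" unfolding M_def[abs_def] by (rule form2I)
  have "e = [:coeff e 0, coeff e 1, coeff e 2, coeff e 3, coeff e 4:]"
    using d by (intro poly_eqI) (auto simp: coeff_pCons coeff_eq_0 eval_nat_numeral split: nat.splits)
  then have "poly e x = poly [:coeff e 0, coeff e 1, coeff e 2, coeff e 3, coeff e 4:] x" for x by simp
  then have Me: "M (phi x) = \<theta> (phi x) $ 3" for x
    using e by (simp add: M_def eval_nat_numeral algebra_simps)
  have "\<exists>a b c. \<forall>v. \<theta> v $ i - v $ i * M v = std v * (a * v $ 1 + b * v $ 2 + c * v $ 3)" for i
  proof (rule std_divides3)
    show "form 3 (\<lambda>v. \<theta> v $ i - v $ i * M v)"
      using form_diff[OF F[of i], of "\<lambda>v. v $ i * M v"] form_coord_mult[OF M, of i] by (simp add: numeral_3_eq_3)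
    show "\<theta> (phi x) $ i - phi x $ i * M (phi x) = 0" for x
      using exhaust_3[of i] assms(3)[of x] b2[of x] by (auto simp: Me)
  qed
  then obtain a b c where c: "\<And>i v. \<theta> v $ i - v $ i * M v = std v * (a i * v $ 1 + b i * v $ 2 + c i * v $ 3)" by metis
  define A :: "complex ^ 3 ^ 3" where "A = (\<chi> i. vec3 (a i) (b i) (c i))"
  have "\<theta> v = std v *s (A *v v) + M v *s v" for v
  proof (unfold vec_eq_iff, intro allI)
    fix i show "\<theta> v $ i = (std v *s (A *v v) + M v *s v) $ i"
      using c[of v i] by (simp add: A_def matrix_vector_mult_3 algebra_simps)
  qed
  then show ?thesis using M by blast
qed

section \<open>Arrangements\<close>

definition indepq :: "(complex ^ 3 \<Rightarrow> complex) \<Rightarrow> (complex ^ 3 \<Rightarrow> complex) \<Rightarrow> bool" where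
  "indepq q1 q2 \<longleftrightarrow> \<not> (\<exists>c. \<forall>v. q2 v = c * q1 v)"

text \<open>Saito's criterion with exponents 2 and 3: together with the Euler field, the two
  logarithmic fields are independent at every point off the curve.\<close>

definition fields :: "(complex ^ 3 \<Rightarrow> complex) \<Rightarrow> (complex ^ 3 \<Rightarrow> complex) \<Rightarrow> (complex ^ 3 \<Rightarrow> complex) \<Rightarrow> bool" where
  "fields q1 q2 q3 \<longleftrightarrow> (\<exists>\<theta> \<eta>. vform 2 \<theta> \<and> vform 3 \<eta> \<and>
     (\<forall>q\<in>{q1, q2, q3}. tangent q \<theta> \<and> tangent q \<eta>) \<and>
     (\<forall>v. q1 v \<noteq> 0 \<and> q2 v \<noteq> 0 \<and> q3 v \<noteq> 0 \<longrightarrow> det3 v (\<theta> v) (\<eta> v) \<noteq> 0))"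

text \<open>The conics \<open>q1\<close>, \<open>q2\<close> meet at \<open>v\<close> with multiplicity at least 3, and \<open>q3\<close> is tangent
  to them there.\<close>

definition bad :: "(complex ^ 3 \<Rightarrow> complex) \<Rightarrow> (complex ^ 3 \<Rightarrow> complex) \<Rightarrow> (complex ^ 3 \<Rightarrow> complex) \<Rightarrow> bool" where
  "bad q1 q2 q3 \<longleftrightarrow> (\<exists>v. v \<noteq> 0 \<and> q1 v = 0 \<and>
     (\<exists>\<mu> l. form 1 l \<and> l v = 0 \<and> (\<forall>w. q2 w = \<mu> * q1 w + polar q1 v w * l w)) \<and>
     (\<exists>\<mu> l. form 1 l \<and> (\<forall>w. q3 w = \<mu> * q1 w + polar q1 v w * l w)))"

text \<open>The interface between the geometric hypotheses and the classification, stable under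
  permutations and linear substitutions. \<open>bad\<close> distinguishes its three arguments, hence
  the six instances.\<close>

definition arrangement :: "(complex ^ 3 \<Rightarrow> complex) \<Rightarrow> (complex ^ 3 \<Rightarrow> complex) \<Rightarrow> (complex ^ 3 \<Rightarrow> complex) \<Rightarrow> bool" where
  "arrangement q1 q2 q3 \<longleftrightarrow> smoothq q1 \<and> smoothq q2 \<and> smoothq q3 \<and>
     indepq q1 q2 \<and> indepq q1 q3 \<and> indepq q2 q3 \<and> fields q1 q2 q3 \<and>
     \<not> bad q1 q2 q3 \<and> \<not> bad q1 q3 q2 \<and> \<not> bad q2 q1 q3 \<and>
     \<not> bad q2 q3 q1 \<and> \<not> bad q3 q1 q2 \<and> \<not> bad q3 q2 q1"

lemma indepq_commute: "smoothq q1 \<Longrightarrow> smoothq q2 \<Longrightarrow> indepq q1 q2 \<Longrightarrow> indepq q2 q1"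
  unfolding indepq_def
proof
  assume a: "smoothq q1" "smoothq q2" "\<not> (\<exists>c. \<forall>v. q2 v = c * q1 v)" "\<exists>c. \<forall>v. q1 v = c * q2 v"
  then obtain c where c: "\<forall>v. q1 v = c * q2 v" by blast
  then have "c \<noteq> 0" using smoothq_nonzero[OF a(1)] by auto
  then have "\<forall>v. q2 v = (1 / c) * q1 v" using c by simp
  then show False using a(3) by blast
qed

lemma arrangement_swap12: "arrangement q1 q2 q3 \<Longrightarrow> arrangement q2 q1 q3"
  unfolding arrangement_def fields_def using indepq_commute by (auto simp: conj_ac insert_commute)

lemma arrangement_swap23: "arrangement q1 q2 q3 \<Longrightarrow> arrangement q1 q3 q2"
  unfolding arrangement_def fields_def using indepq_commute by (auto simp: conj_ac insert_commute)

lemma indepq_subst: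
  assumes "indepq q1 q2" "invertible T" "c1 \<noteq> 0" "c2 \<noteq> 0"
  shows "indepq (\<lambda>v. c1 * q1 (T *v v)) (\<lambda>v. c2 * q2 (T *v v))"
  unfolding indepq_def
proof
  assume "\<exists>c. \<forall>v. c2 * q2 (T *v v) = c * (c1 * q1 (T *v v))"
  then obtain c where c: "\<And>v. c2 * q2 (T *v v) = c * (c1 * q1 (T *v v))" by blast
  obtain T' where T': "\<And>v. T *v (T' *v v) = v" using invertible_obtain_inverse[OF assms(2)] by metis
  have "q2 v = (c * c1 / c2) * q1 v" for v
    using c[of "T' *v v"] assms(4) by (simp add: T' field_simps)
  then have "\<exists>c. \<forall>v. q2 v = c * q1 v" by blast
  then show False using assms(1) unfolding indepq_def by blast
qed

lemma vform_subst:
  assumes "vform n \<theta>"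
  shows "vform n (\<lambda>v. T' *v \<theta> (T *v v))"
  using assms unfolding vform_def matrix_vector_mult_3
  by (auto intro!: form_add form_cmult form_subst)

lemma tangent_subst:
  assumes "tangent q \<theta>" "\<And>v. T *v (T' *v v) = v" "c \<noteq> 0"
  shows "tangent (\<lambda>v. c * q (T *v v)) (\<lambda>v. T' *v \<theta> (T *v v))"
  using assms by (auto simp: tangent_def polar_cmult polar_subst)

lemma fields_subst:
  assumes "fields q1 q2 q3" "invertible T" "c1 \<noteq> 0" "c2 \<noteq> 0" "c3 \<noteq> 0"
  shows "fields (\<lambda>v. c1 * q1 (T *v v)) (\<lambda>v. c2 * q2 (T *v v)) (\<lambda>v. c3 * q3 (T *v v))"
proof -
  obtain T' where T': "\<And>v. T *v (T' *v v) = v" using invertible_obtain_inverse[OF assms(2)] by metis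
  obtain \<theta> \<eta> where *: "vform 2 \<theta>" "vform 3 \<eta>" "\<forall>q\<in>{q1, q2, q3}. tangent q \<theta> \<and> tangent q \<eta>"
    "\<forall>v. q1 v \<noteq> 0 \<and> q2 v \<noteq> 0 \<and> q3 v \<noteq> 0 \<longrightarrow> det3 v (\<theta> v) (\<eta> v) \<noteq> 0"
    using assms(1) unfolding fields_def by blast
  have "det3 v (T' *v \<theta> (T *v v)) (T' *v \<eta> (T *v v)) \<noteq> 0"
    if "c1 * q1 (T *v v) \<noteq> 0" "c2 * q2 (T *v v) \<noteq> 0" "c3 * q3 (T *v v) \<noteq> 0" for v
    using det3_mult[of T v "T' *v \<theta> (T *v v)" "T' *v \<eta> (T *v v)"] *(4)[rule_format, of "T *v v"] that
    by (auto simp: T')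
  moreover have "tangent (\<lambda>v. c * q (T *v v)) (\<lambda>v. T' *v \<theta> (T *v v))"
    "tangent (\<lambda>v. c * q (T *v v)) (\<lambda>v. T' *v \<eta> (T *v v))"
    if "q \<in> {q1, q2, q3}" "c \<noteq> 0" for q c
    using tangent_subst[OF _ T' that(2)] *(3) that(1) by blast+
  ultimately show ?thesis
    unfolding fields_def using vform_subst[OF *(1), of T' T] vform_subst[OF *(2), of T' T] assms(3-5)
    by (rule_tac exI[of _ "\<lambda>v. T' *v \<theta> (T *v v)"], rule_tac exI[of _ "\<lambda>v. T' *v \<eta> (T *v v)"]) simp
qed

text \<open>Goes from the transformed forms back to the original ones, since it is applied to the
  negation of \<open>bad\<close>.\<close>

lemma bad_subst:
  assumes T: "invertible T" and c: "c1 \<noteq> 0" "c2 \<noteq> 0" "c3 \<noteq> 0"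
    and bad: "bad (\<lambda>v. c1 * q1 (T *v v)) (\<lambda>v. c2 * q2 (T *v v)) (\<lambda>v. c3 * q3 (T *v v))"
  shows "bad q1 q2 q3"
proof -
  obtain T' where T': "\<And>v. T *v (T' *v v) = v" "\<And>v. T' *v (T *v v) = v" using invertible_obtain_inverse[OF T] by metis
  obtain v \<mu> l \<mu>' l' where v: "v \<noteq> 0" "c1 * q1 (T *v v) = 0" "form 1 l" "l v = 0"
    "\<And>w. c2 * q2 (T *v w) = \<mu> * (c1 * q1 (T *v w)) + polar (\<lambda>v. c1 * q1 (T *v v)) v w * l w"
    "form 1 l'" "\<And>w. c3 * q3 (T *v w) = \<mu>' * (c1 * q1 (T *v w)) + polar (\<lambda>v. c1 * q1 (T *v v)) v w * l' w"
    using bad unfolding bad_def by blast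
  have *: "q w = (\<mu> * c1 / c) * q1 w + polar q1 (T *v v) w * ((c1 / c) * l (T' *v w))"
    if "c \<noteq> 0" "\<And>w. c * q (T *v w) = \<mu> * (c1 * q1 (T *v w)) + polar (\<lambda>v. c1 * q1 (T *v v)) v w * l w"
    for q c \<mu> l w
    using that(1) that(2)[of "T' *v w"] by (simp add: polar_cmult polar_subst T' field_simps)
  have F: "form 1 (\<lambda>w. (c1 / c) * l (T' *v w))" if "form 1 l" for c l
    using that by (intro form_cmult form_subst)
  show ?thesis
    unfolding bad_def
  proof (intro exI conjI allI)
    show "T *v v \<noteq> 0" using v(1) invertible_mult_eq_0[OF T] by blast
    show "q1 (T *v v) = 0" using v(2) c by simp
    show "form 1 (\<lambda>w. (c1 / c2) * l (T' *v w))" "form 1 (\<lambda>w. (c1 / c3) * l' (T' *v w))" using F v by blast+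
    show "(c1 / c2) * l (T' *v (T *v v)) = 0" using v T' by simp
    show "q2 w = (\<mu> * c1 / c2) * q1 w + polar q1 (T *v v) w * ((c1 / c2) * l (T' *v w))" for w
      by (rule *[OF c(2)]) (rule v)
    show "q3 w = (\<mu>' * c1 / c3) * q1 w + polar q1 (T *v v) w * ((c1 / c3) * l' (T' *v w))" for w
      by (rule *[OF c(3)]) (rule v)
  qed
qed

lemma arrangement_subst:
  assumes "arrangement q1 q2 q3" "invertible T" "c1 \<noteq> 0" "c2 \<noteq> 0" "c3 \<noteq> 0"
  shows "arrangement (\<lambda>v. c1 * q1 (T *v v)) (\<lambda>v. c2 * q2 (T *v v)) (\<lambda>v. c3 * q3 (T *v v))"
  using assms unfolding arrangement_def
  by (auto intro: smoothq_subst indepq_subst fields_subst dest: bad_subst[rotated -1])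

lemma common_subst:
  assumes "invertible T" "c1 \<noteq> 0" "c2 \<noteq> 0"
  shows "common q1 q2 = (\<lambda>P. (*v) T ` P) ` common (\<lambda>v. c1 * q1 (T *v v)) (\<lambda>v. c2 * q2 (T *v v))"
proof -
  obtain T' where T': "\<And>v. T *v (T' *v v) = v" "\<And>v. T' *v (T *v v) = v" using invertible_obtain_inverse[OF assms(1)] by metis
  have pt: "(*v) T ` pt v = pt (T *v v)" for v
  proof -
    have p: "pt v = (\<lambda>c. c *s v) ` {c. c \<noteq> 0}" for v by (auto simp: pt_def)
    show ?thesis unfolding p image_image vector_scalar_commute ..
  qed
  have *: "{v. v \<noteq> 0 \<and> q1 v = 0 \<and> q2 v = 0} = (*v) T ` {v. v \<noteq> 0 \<and> c1 * q1 (T *v v) = 0 \<and> c2 * q2 (T *v v) = 0}"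
  proof (intro equalityI subsetI)
    fix v assume v: "v \<in> {v. v \<noteq> 0 \<and> q1 v = 0 \<and> q2 v = 0}"
    have "T' *v v \<noteq> 0"
    proof
      assume "T' *v v = 0"
      then have "v = 0" using T'(1)[of v] by simp
      then show False using v by simp
    qed
    then show "v \<in> (*v) T ` {v. v \<noteq> 0 \<and> c1 * q1 (T *v v) = 0 \<and> c2 * q2 (T *v v) = 0}"
      using v T' by (intro image_eqI[of _ _ "T' *v v"]) auto
  qed (use assms in \<open>auto simp: invertible_mult_eq_0\<close>)
  show ?thesis unfolding common_def * by (simp add: image_image pt)
qed

lemma inj_image_points: "invertible T \<Longrightarrow> inj (\<lambda>P. (*v) T ` P)" for T :: "complex ^ 3 ^ 3"
proof -
  assume "invertible T"
  then have "inj ((*v) T)" by (simp add: inj_def invertible_inj)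
  then show ?thesis by (simp add: inj_def inj_image_eq_iff)
qed

lemma card_common_subst:
  assumes "invertible T" "c1 \<noteq> 0" "c2 \<noteq> 0"
  shows "card (common (\<lambda>v. c1 * q1 (T *v v)) (\<lambda>v. c2 * q2 (T *v v))) = card (common q1 q2)"
  unfolding common_subst[OF assms, of q1 q2]
  by (rule card_image[OF inj_on_subset[OF inj_image_points[OF assms(1)] subset_UNIV], symmetric])


section \<open>Excluded configurations\<close>

lemma form2_zero:
  fixes a b c d e f :: complex
  assumes "\<And>v :: complex ^ 3. a * v $ 1 ^ 2 + b * v $ 2 ^ 2 + c * v $ 3 ^ 2
     + d * v $ 1 * v $ 2 + e * v $ 1 * v $ 3 + f * v $ 2 * v $ 3 = 0"
  shows "a = 0" "b = 0" "c = 0" "d = 0" "e = 0" "f = 0"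
  using assms[of "vec3 1 0 0"] assms[of "vec3 0 1 0"] assms[of "vec3 0 0 1"]
    assms[of "vec3 1 1 0"] assms[of "vec3 1 0 1"] assms[of "vec3 0 1 1"] by auto

lemma form3_zero:
  fixes a b c d e f g h i j :: complex
  assumes "\<And>v :: complex ^ 3. a * v $ 1 ^ 3 + b * v $ 2 ^ 3 + c * v $ 3 ^ 3
     + d * v $ 1 ^ 2 * v $ 2 + e * v $ 1 ^ 2 * v $ 3 + f * v $ 2 ^ 2 * v $ 1 + g * v $ 2 ^ 2 * v $ 3
     + h * v $ 3 ^ 2 * v $ 1 + i * v $ 3 ^ 2 * v $ 2 + j * v $ 1 * v $ 2 * v $ 3 = 0"
  shows "a = 0" "b = 0" "c = 0" "d = 0" "e = 0" "f = 0" "g = 0" "h = 0" "i = 0" "j = 0"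
proof -
  show 1: "a = 0" "b = 0" "c = 0"
    using assms[of "vec3 1 0 0"] assms[of "vec3 0 1 0"] assms[of "vec3 0 0 1"] by auto
  have "d + f = 0" "d - f = 0" using assms[of "vec3 1 1 0"] assms[of "vec3 1 (-1) 0"] 1 by (simp_all add: algebra_simps)
  then show 2: "d = 0" "f = 0" by algebra+
  have "e + h = 0" "e - h = 0" using assms[of "vec3 1 0 1"] assms[of "vec3 1 0 (-1)"] 1 by (simp_all add: algebra_simps)
  then show 3: "e = 0" "h = 0" by algebra+
  have "g + i = 0" "g - i = 0" using assms[of "vec3 0 1 1"] assms[of "vec3 0 1 (-1)"] 1 by (simp_all add: algebra_simps)
  then show 4: "g = 0" "i = 0" by algebra+
  show "j = 0" using assms[of "vec3 1 1 1"] 1 2 3 4 by simp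
qed

lemma line_leaves_conic:
  assumes q: "smoothq q" and u: "u \<noteq> 0" "\<And>c. w \<noteq> c *s u"
  shows "\<exists>p. p \<noteq> 0 \<and> (\<forall>s. q (u + s *s w) = poly p s)"
proof -
  note f = smoothq_form[OF q]
  obtain p where p: "\<forall>s. q (u + s *s w) = poly p s" "coeff p 2 = q w"
    using form_line_poly[OF f] by blast
  have "p \<noteq> 0"
  proof
    assume "p = 0"
    then have "q u = 0" "q w = 0" "q (u + w) = 0"
      using p p(1)[rule_format, of 0] p(1)[rule_format, of 1] by simp_all
    then have "polar q u w = 0" by (simp add: polar_def)
    then show False using polar_pos_neq[OF q \<open>q u = 0\<close> \<open>q w = 0\<close> u] by simp
  qed
  then show ?thesis using p by blast
qed

lemma line_leaves_conics:
  assumes q: "smoothq q1" "smoothq q2" "smoothq q3" and u: "u \<noteq> 0" "\<And>c. w \<noteq> c *s u"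
  shows "\<exists>s. q1 (u + s *s w) \<noteq> 0 \<and> q2 (u + s *s w) \<noteq> 0 \<and> q3 (u + s *s w) \<noteq> 0"
proof -
  obtain p1 p2 p3 where p: "p1 \<noteq> 0" "p2 \<noteq> 0" "p3 \<noteq> 0" "\<forall>s. q1 (u + s *s w) = poly p1 s"
    "\<forall>s. q2 (u + s *s w) = poly p2 s" "\<forall>s. q3 (u + s *s w) = poly p3 s"
    using line_leaves_conic[OF q(1) u] line_leaves_conic[OF q(2) u] line_leaves_conic[OF q(3) u] by blast
  then have "p1 * p2 * p3 \<noteq> 0" by simp
  then obtain s where "poly (p1 * p2 * p3) s \<noteq> 0" using poly_all_0_iff_0 by blast
  then show ?thesis using p by auto
qed

lemma line_exists:
  fixes a b c :: complex
  shows "\<exists>u w. u \<noteq> (0 :: complex ^ 3) \<and> (\<forall>c. w \<noteq> c *s u) \<and>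
    (\<forall>s. a * (u + s *s w) $ 1 + b * (u + s *s w) $ 2 + c * (u + s *s w) $ 3 = 0)"
proof (cases "a = 0")
  case False
  then show ?thesis
    by (rule_tac exI[of _ "vec3 b (- a) 0"], rule_tac exI[of _ "vec3 c 0 (- a)"]) (auto simp: vec3_eq_iff algebra_simps)
next
  case a: True
  show ?thesis
  proof (cases "b = 0 \<and> c = 0")
    case True
    then show ?thesis using a
      by (rule_tac exI[of _ "vec3 1 0 0"], rule_tac exI[of _ "vec3 0 1 0"]) (auto simp: vec3_eq_iff)
  next
    case False
    then show ?thesis using a
      by (rule_tac exI[of _ "vec3 1 0 0"], rule_tac exI[of _ "vec3 0 c (- b)"]) (auto simp: vec3_eq_iff algebra_simps)
  qed
qed

lemma smoothq_diag:
  assumes "smoothq q" "\<And>v. q v = a * v $ 1 ^ 2 + f * v $ 2 * v $ 3"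
  shows "a \<noteq> 0" "f \<noteq> 0"
proof -
  have P: "polar q u v = 2 * a * u $ 1 * v $ 1 + f * (u $ 2 * v $ 3 + u $ 3 * v $ 2)" for u v
    by (simp add: polar_def assms(2) power2_eq_square algebra_simps)
  show "a \<noteq> 0"
  proof
    assume "a = 0"
    then have "\<forall>w. polar q (vec3 1 0 0) w = 0" by (simp add: P)
    then have "vec3 1 0 0 = (0 :: complex ^ 3)" using assms(1) by (auto simp: smoothq_def)
    then show False by (simp add: vec3_eq_iff)
  qed
  show "f \<noteq> 0"
  proof
    assume "f = 0"
    then have "\<forall>w. polar q (vec3 0 1 0) w = 0" by (simp add: P)
    then have "vec3 0 1 0 = (0 :: complex ^ 3)" using assms(1) by (auto simp: smoothq_def)
    then show False by (simp add: vec3_eq_iff)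
  qed
qed

text \<open>For a bitangent pair the quadratic field is, modulo the Euler field, a linear form \<open>N\<close> times
  the linear field \<open>Y\<partial>\<^sub>Y - Z\<partial>\<^sub>Z\<close>, so that it degenerates along a line.\<close>

lemma no_bitangent_pair:
  assumes "arrangement std q2 q3" "\<And>v. q2 v = a * v $ 1 ^ 2 + f * v $ 2 * v $ 3"
  shows False
proof -
  have s: "smoothq std" "smoothq q2" "smoothq q3" "indepq std q2" "fields std q2 q3"
    using assms(1) by (auto simp: arrangement_def)
  have af: "a \<noteq> 0" "f \<noteq> 0" using smoothq_diag[OF s(2) assms(2)] by auto
  have af': "a + f \<noteq> 0"
  proof
    assume "a + f = 0"
    then have "f = - a" by algebra
    then have "\<forall>v. q2 v = a * std v" by (simp add: assms(2) std_def algebra_simps)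
    then show False using s(4) by (auto simp: indepq_def)
  qed
  obtain \<theta> \<eta> where th: "vform 2 \<theta>" "tangent std \<theta>" "tangent q2 \<theta>"
    "\<And>v. std v \<noteq> 0 \<Longrightarrow> q2 v \<noteq> 0 \<Longrightarrow> q3 v \<noteq> 0 \<Longrightarrow> det3 v (\<theta> v) (\<eta> v) \<noteq> 0"
    using s(5) unfolding fields_def by blast
  obtain G where G: "form 1 G" "\<forall>v. polar std v (\<theta> v) = std v * G v"
    using tangent_divides[OF s(1) th(2) th(1)] by auto
  obtain H where H: "form 1 H" "\<forall>v. polar q2 v (\<theta> v) = q2 v * H v"
    using tangent_divides[OF s(2) th(3) th(1)] by auto
  obtain l1 l2 l3 where l: "\<And>v. G v = l1 * v $ 1 + l2 * v $ 2 + l3 * v $ 3" using form1E[OF G(1)] by blast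
  obtain m1 m2 m3 where m: "\<And>v. H v = m1 * v $ 1 + m2 * v $ 2 + m3 * v $ 3" using form1E[OF H(1)] by blast
  have F: "form 2 (\<lambda>v. \<theta> v $ i)" for i using th(1) by (simp add: vform_def)
  obtain a1 a2 a3 a4 a5 a6 where A: "\<And>v. \<theta> v $ 1 = a1 * v $ 1 ^ 2 + a2 * v $ 2 ^ 2 + a3 * v $ 3 ^ 2
     + a4 * v $ 1 * v $ 2 + a5 * v $ 1 * v $ 3 + a6 * v $ 2 * v $ 3" using form2E[OF F[of 1]] by blast
  obtain b1 b2 b3 b4 b5 b6 where B: "\<And>v. \<theta> v $ 2 = b1 * v $ 1 ^ 2 + b2 * v $ 2 ^ 2 + b3 * v $ 3 ^ 2
     + b4 * v $ 1 * v $ 2 + b5 * v $ 1 * v $ 3 + b6 * v $ 2 * v $ 3" using form2E[OF F[of 2]] by blast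
  obtain e1 e2 e3 e4 e5 e6 where E: "\<And>v. \<theta> v $ 3 = e1 * v $ 1 ^ 2 + e2 * v $ 2 ^ 2 + e3 * v $ 3 ^ 2
     + e4 * v $ 1 * v $ 2 + e5 * v $ 1 * v $ 3 + e6 * v $ 2 * v $ 3" using form2E[OF F[of 3]] by blast
  have P: "polar q2 u v = 2 * a * u $ 1 * v $ 1 + f * (u $ 2 * v $ 3 + u $ 3 * v $ 2)" for u v
    by (simp add: polar_def assms(2) power2_eq_square algebra_simps)
  \<comment> \<open>The ten coefficients of the cubic identity that expresses tangency to the
    standard conic; the next block does the same for the second one.\<close>
  have "(2 * a1 - l1) * v $ 1 ^ 3 + (- e2) * v $ 2 ^ 3 + (- b3) * v $ 3 ^ 3
     + (2 * a4 - e1 - l2) * v $ 1 ^ 2 * v $ 2 + (2 * a5 - b1 - l3) * v $ 1 ^ 2 * v $ 3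
     + (2 * a2 - e4) * v $ 2 ^ 2 * v $ 1 + (l2 - b2 - e6) * v $ 2 ^ 2 * v $ 3
     + (2 * a3 - b5) * v $ 3 ^ 2 * v $ 1 + (l3 - b6 - e3) * v $ 3 ^ 2 * v $ 2
     + (2 * a6 - b4 - e5 + l1) * v $ 1 * v $ 2 * v $ 3 = 0" for v :: "complex ^ 3"
    using G(2)[rule_format, of v] unfolding polar_std A B E l std_def
    by (simp add: power2_eq_square power3_eq_cube algebra_simps)
  note eq1 = form3_zero[OF this]
  have "(2 * a * a1 - a * m1) * v $ 1 ^ 3 + (f * e2) * v $ 2 ^ 3 + (f * b3) * v $ 3 ^ 3
     + (2 * a * a4 + f * e1 - a * m2) * v $ 1 ^ 2 * v $ 2 + (2 * a * a5 + f * b1 - a * m3) * v $ 1 ^ 2 * v $ 3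
     + (2 * a * a2 + f * e4) * v $ 2 ^ 2 * v $ 1 + (f * (b2 + e6 - m2)) * v $ 2 ^ 2 * v $ 3
     + (2 * a * a3 + f * b5) * v $ 3 ^ 2 * v $ 1 + (f * (b6 + e3 - m3)) * v $ 3 ^ 2 * v $ 2
     + (2 * a * a6 + f * (b4 + e5 - m1)) * v $ 1 * v $ 2 * v $ 3 = 0" for v :: "complex ^ 3"
    using H(2)[rule_format, of v] unfolding P A B E m assms(2)
    by (simp add: power2_eq_square power3_eq_cube algebra_simps)
  note eq2 = form3_zero[OF this]
  \<comment> \<open>The cofactors of the two conics agree, so subtracting half their common value
    times the Euler field leaves a field annihilating both quadratic forms.\<close>
  have m1: "m1 = l1" "m2 = l2" "m3 = l3" using eq1 eq2 af by auto
  have "(a + f) * e4 = 0" "(a + f) * b5 = 0" "(a + f) * e1 = 0" "(a + f) * b1 = 0" "(a + f) * a6 = 0"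
    using eq1 eq2 m1 by algebra+
  then have z: "e4 = 0" "b5 = 0" "e1 = 0" "b1 = 0" "a6 = 0" "a2 = 0" "a3 = 0" "e2 = 0" "b3 = 0"
    using af' eq1 by auto
  have a: "a1 = l1 / 2" "a4 = l2 / 2" "a5 = l3 / 2" "e5 = l1 - b4" "e6 = l2 - b2" "e3 = l3 - b6"
    using eq1 z by (simp_all add: field_simps)
  \<comment> \<open>Two points spanning the line \<open>N = 0\<close>, or any line if
    \<open>N\<close> vanishes identically. No line lies in a smooth conic, so some point of it is
    off the curve.\<close>
  obtain u w where uw: "u \<noteq> (0 :: complex ^ 3)" "\<And>c. w \<noteq> c *s u"
    "\<And>s. (b4 - l1 / 2) * (u + s *s w) $ 1 + (b2 - l2 / 2) * (u + s *s w) $ 2 + (b6 - l3 / 2) * (u + s *s w) $ 3 = 0"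
    using line_exists by metis
  obtain s where s': "std (u + s *s w) \<noteq> 0" "q2 (u + s *s w) \<noteq> 0" "q3 (u + s *s w) \<noteq> 0"
    using line_leaves_conics[OF s(1-3) uw(1,2)] by blast
  define v where "v = u + s *s w"
  have N: "(b4 - l1 / 2) * v $ 1 + (b2 - l2 / 2) * v $ 2 + (b6 - l3 / 2) * v $ 3 = 0"
    unfolding v_def by (rule uw)
  have "\<theta> v $ 1 = v $ 1 * (G v / 2)"
    unfolding A l z a by (simp add: power2_eq_square algebra_simps)
  moreover have "\<theta> v $ 2 = v $ 2 * (G v / 2 + ((b4 - l1 / 2) * v $ 1 + (b2 - l2 / 2) * v $ 2 + (b6 - l3 / 2) * v $ 3))"
    unfolding B l z by (simp add: power2_eq_square field_simps)
  moreover have "\<theta> v $ 3 = v $ 3 * (G v / 2 - ((b4 - l1 / 2) * v $ 1 + (b2 - l2 / 2) * v $ 2 + (b6 - l3 / 2) * v $ 3))"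
    unfolding E l z a by (simp add: power2_eq_square field_simps)
  ultimately have "\<theta> v = (G v / 2) *s v"
    unfolding N by (simp add: vec3_eq_iff)
  then have "det3 v (\<theta> v) (\<eta> v) = 0" by (simp add: det3_def algebra_simps)
  then show False using th(4)[of v] s' unfolding v_def by simp
qed

lemma vform1_matrix: "vform 1 (\<lambda>v. A *v v)"
  unfolding vform_def matrix_vector_mult_3 by (auto intro!: form1I[unfolded One_nat_def])

text \<open>The Gram matrix has determinant \<open>2 * f * (d * e - a * f)\<close>; the two claims
  are its two factors, each refuted as zero by explicit vectors in the radical.\<close>

lemma smoothq_no_squares:
  assumes "smoothq q" "\<And>v. q v = a * v $ 1 ^ 2 + d * v $ 1 * v $ 2 + e * v $ 1 * v $ 3 + f * v $ 2 * v $ 3"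
  shows "f \<noteq> 0" "a * f \<noteq> d * e"
proof -
  have P: "polar q u v = 2 * a * u $ 1 * v $ 1 + d * (u $ 1 * v $ 2 + u $ 2 * v $ 1)
    + e * (u $ 1 * v $ 3 + u $ 3 * v $ 1) + f * (u $ 2 * v $ 3 + u $ 3 * v $ 2)" for u v
    by (simp add: polar_def assms(2) power2_eq_square algebra_simps)
  have z: "v = 0" if "\<And>w. polar q v w = 0" for v using assms(1) that by (auto simp: smoothq_def)
  show f: "f \<noteq> 0"
  proof
    assume f: "f = 0"
    have "vec3 0 e (- d) = (0 :: complex ^ 3)" by (rule z) (simp add: P f algebra_simps)
    then have "d = 0" "e = 0" by (simp_all add: vec3_eq_iff)
    then have "vec3 0 1 0 = (0 :: complex ^ 3)" by (intro z) (simp add: P f)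
    then show False by (simp add: vec3_eq_iff)
  qed
  show "a * f \<noteq> d * e"
  proof
    assume "a * f = d * e"
    then have "vec3 f (- e) (- d) = (0 :: complex ^ 3)"
      by (intro z, unfold P vector_3) algebra
    then show False using f by (simp add: vec3_eq_iff)
  qed
qed

text \<open>A linear field preserving a conic is a scalar plus an element of so(3). With the two
  common points at the vertices, the scalar is \<open>\<delta>\<close>, the torus part
  \<open>h\<close> and the nilpotent parts \<open>\<beta>\<close>, \<open>\<gamma>\<close>. Tangency
  to a second conic through the same points kills the nilpotent parts, and a nonzero torus part
  leaves only its invariants X^2 and YZ in the second form.\<close>

lemma linear_field_diagonal:
  assumes q: "smoothq q2" "smoothq q3" "indepq q2 q3"
    and A: "tangent q2 (\<lambda>v. A *v v)" "tangent q3 (\<lambda>v. A *v v)" "\<exists>v. \<forall>c. A *v v \<noteq> c *s v"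
    and p: "p \<noteq> 0" "\<And>c. r \<noteq> c *s p" "q2 p = 0" "q3 p = 0" "q2 r = 0" "q3 r = 0"
  obtains T c a f \<delta> h where "invertible T" "c \<noteq> 0" "\<And>v. q2 (T *v v) = c * std v"
    "\<And>v. q3 (T *v v) = a * v $ 1 ^ 2 + f * v $ 2 * v $ 3"
    "\<And>v. A *v (T *v v) = T *v (vec3 (\<delta> * v $ 1) ((\<delta> + h) * v $ 2) ((\<delta> - h) * v $ 3))"
proof -
  obtain T c l where T: "invertible T" "c \<noteq> 0" "l \<noteq> 0" "\<And>v. q2 (T *v v) = c * std v"
    "T *v vec3 0 0 1 = p" "T *v vec3 0 1 0 = l *s r"
    using conic_coordinates[OF q(1) p(3,5,1,2)] by blast
  obtain T' where T': "\<And>v. T *v (T' *v v) = v" "\<And>v. T' *v (T *v v) = v" using invertible_obtain_inverse[OF T(1)] by metis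
  define B where "B = T' ** A ** T"
  have B: "B *v v = T' *v (A *v (T *v v))" for v by (simp add: B_def matrix_vector_mul_assoc matrix_mul_assoc)
  have AB: "A *v (T *v v) = T *v (B *v v)" for v by (simp add: B T')
  have t2: "tangent std (\<lambda>v. B *v v)"
    using tangent_subst[OF A(1) T'(1), of "1 / c"] T(2) by (simp add: T(4) B)
  define q where "q v = q3 (T *v v)" for v
  have q_def': "q = (\<lambda>v. 1 * q3 (T *v v))" by (simp add: q_def fun_eq_iff)
  have sq: "smoothq q" unfolding q_def' by (rule smoothq_subst[OF q(2) T(1)]) simp
  have t3: "tangent q (\<lambda>v. B *v v)"
    using tangent_subst[OF A(2) T'(1), of 1] by (simp add: B q_def')
  have "indepq (\<lambda>v. (1 / c) * q2 (T *v v)) q" unfolding q_def' by (rule indepq_subst[OF q(3) T(1)]) (use T in auto)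
  then have ind: "indepq std q" using T(2) by (simp add: T(4))
  obtain a b c' d e f where E0: "\<And>v. q v = a * v $ 1 ^ 2 + b * v $ 2 ^ 2 + c' * v $ 3 ^ 2
     + d * v $ 1 * v $ 2 + e * v $ 1 * v $ 3 + f * v $ 2 * v $ 3" using form2E[OF smoothq_form[OF sq]] by blast
  have "q (vec3 0 0 1) = 0" "q (vec3 0 1 0) = 0"
    using p T(5,6) quad_scale[OF smoothq_form[OF q(2)], of l r] by (simp_all add: q_def)
  then have "b = 0" "c' = 0" by (simp_all add: E0)
  then have E: "q v = a * v $ 1 ^ 2 + d * v $ 1 * v $ 2 + e * v $ 1 * v $ 3 + f * v $ 2 * v $ 3" for v
    using E0 by simp
  have s: "f \<noteq> 0" "a * f \<noteq> d * e" using smoothq_no_squares[OF sq E] by auto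
  have ns: "\<not> (a + f = 0 \<and> d = 0 \<and> e = 0)"
  proof
    assume "a + f = 0 \<and> d = 0 \<and> e = 0"
    then have "f = - a" "d = 0" "e = 0" by (auto simp: add_eq_0_iff)
    then have "\<forall>v. q v = a * std v" by (simp add: E std_def algebra_simps)
    then show False using ind unfolding indepq_def by blast
  qed
  \<comment> \<open>Tangency along the parametrization gives five linear conditions on the nine
    matrix entries, leaving the four parameters named below.\<close>
  have "poly [:- B$2$3, 2 * B$1$3 - B$2$1, 2 * B$1$1 - B$3$3 - B$2$2, 2 * B$1$2 - B$3$1, - B$3$2:] x = 0" for x
    using tangent_std_phi[OF t2, of x] by (simp add: matrix_vector_mult_3 power2_eq_square algebra_simps)
  then have "[:- B$2$3, 2 * B$1$3 - B$2$1, 2 * B$1$1 - B$3$3 - B$2$2, 2 * B$1$2 - B$3$1, - B$3$2:] = 0"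
    by (rule poly_zero_list)
  then have b0: "B$2$3 = 0" "B$2$1 = 2 * B$1$3" "2 * B$1$1 - B$3$3 - B$2$2 = 0" "B$3$1 = 2 * B$1$2" "B$3$2 = 0"
    by simp_all
  have "B$3$3 = 2 * B$1$1 - B$2$2" using b0(3) by algebra
  note b = b0(1,2,4,5) this
  obtain G where G: "form 0 G" "\<forall>v. polar q v (B *v v) = q v * G v"
    using tangent_divides[OF sq t3 vform1_matrix] by auto
  then obtain \<kappa> where k: "\<And>v. polar q v (B *v v) = \<kappa> * q v" by (auto simp: form.simps mult.commute)
  define \<delta> h \<beta> \<gamma> where dh: "\<delta> = B$1$1" "h = B$2$2 - B$1$1" "\<beta> = B$1$3" "\<gamma> = B$1$2"
  have B11: "B$1$1 = \<delta>" "B$2$2 = \<delta> + h" "B$1$3 = \<beta>" "B$1$2 = \<gamma>" "B$2$1 = 2 * \<beta>"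
    "B$3$3 = \<delta> - h" "B$3$1 = 2 * \<gamma>" "B$2$3 = 0" "B$3$2 = 0"
    using b by (simp_all add: dh)
  have P: "polar q u v = 2 * a * u $ 1 * v $ 1 + d * (u $ 1 * v $ 2 + u $ 2 * v $ 1)
    + e * (u $ 1 * v $ 3 + u $ 3 * v $ 1) + f * (u $ 2 * v $ 3 + u $ 3 * v $ 2)" for u v
    by (simp add: polar_def E power2_eq_square algebra_simps)
  have "(2 * a * \<delta> + 2 * d * \<beta> + 2 * e * \<gamma> - \<kappa> * a) * v $ 1 ^ 2 + (d * \<gamma>) * v $ 2 ^ 2 + (e * \<beta>) * v $ 3 ^ 2
     + (2 * (a + f) * \<gamma> + d * h + 2 * d * \<delta> - \<kappa> * d) * v $ 1 * v $ 2
     + (2 * (a + f) * \<beta> - e * h + 2 * e * \<delta> - \<kappa> * e) * v $ 1 * v $ 3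
     + (d * \<beta> + e * \<gamma> + 2 * f * \<delta> - \<kappa> * f) * v $ 2 * v $ 3 = 0" for v :: "complex ^ 3"
    using k[of v] unfolding P E matrix_vector_mult_3 B11
    by (simp add: power2_eq_square algebra_simps)
  note eqs = form2_zero[OF this]
  define k' where "k' = \<kappa> - 2 * \<delta>"
  have eq: "2 * d * \<beta> + 2 * e * \<gamma> = k' * a" "d * \<gamma> = 0" "e * \<beta> = 0"
    "2 * (a + f) * \<gamma> + d * h = k' * d" "2 * (a + f) * \<beta> - e * h = k' * e" "d * \<beta> + e * \<gamma> = k' * f"
    using eqs unfolding k'_def by (simp_all add: algebra_simps)
  \<comment> \<open>A nonzero nilpotent part would make the second form a multiple of
    \<open>std\<close>.\<close>
  have beta: "\<beta> = 0"
  proof (rule ccontr)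
    assume nb: "\<beta> \<noteq> 0"
    then have e: "e = 0" using eq(3) by simp
    show False
    proof (cases "\<gamma> = 0")
      case True
      then have "2 * (a + f) * \<beta> = 0" using eq(5) e by (simp only: mult_zero_right diff_zero mult_zero_left)
      then have "a + f = 0" using nb by (metis mult_eq_0_iff zero_neq_numeral)
      moreover have "3 * (d * \<beta>) = 0" using eq(1,6) \<open>a + f = 0\<close> e by algebra
      then have "d = 0" using nb by simp
      ultimately show False using ns e by simp
    next
      case False
      then have d: "d = 0" using eq(2) by simp
      then have "k' = 0" using eq(6) e s(1) by simp
      then have "2 * (a + f) * \<beta> = 0" using eq(5) e by (simp only: mult_zero_right diff_zero mult_zero_left)
      then have "a + f = 0" using nb by (metis mult_eq_0_iff zero_neq_numeral)
      then show False using ns e d by simp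
    qed
  qed
  have gamma: "\<gamma> = 0"
  proof (rule ccontr)
    assume ng: "\<gamma> \<noteq> 0"
    then have d: "d = 0" using eq(2) by simp
    then have "2 * (a + f) * \<gamma> = 0" using eq(4) by (simp only: mult_zero_right add_0_right mult_zero_left)
    then have "a + f = 0" using ng by (metis mult_eq_0_iff zero_neq_numeral)
    moreover have "3 * (e * \<gamma>) = 0" using eq(1,6) \<open>a + f = 0\<close> d by algebra
    then have "e = 0" using ng by simp
    ultimately show False using ns d by simp
  qed
  have k0: "k' = 0" using eq(6) beta gamma s(1) by simp
  have Bv: "B *v v = vec3 (\<delta> * v $ 1) ((\<delta> + h) * v $ 2) ((\<delta> - h) * v $ 3)" for v
    by (simp add: vec3_eq_iff matrix_vector_mult_3 B11 beta gamma)
  \<comment> \<open>Without torus part the field would be a scalar, hence radial everywhere.\<close>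
  have "h \<noteq> 0"
  proof
    assume "h = 0"
    then have "B *v v = \<delta> *s v" for v unfolding Bv by (simp add: vec3_eq_iff)
    then have "A *v v = \<delta> *s v" for v using AB[of "T' *v v"] by (simp add: T' vector_scalar_commute)
    then show False using A(3) by blast
  qed
  then have de: "d = 0" "e = 0" using eq(4,5) beta gamma k0 by auto
  show thesis
    by (rule that[of T c a f \<delta> h, OF T(1,2,4)]) (use E de AB Bv in \<open>auto simp: q_def\<close>)
qed

text \<open>In the diagonalizing coordinates the pair is X^2 - YZ and aX^2 + fYZ, which is bitangent
  and thus already excluded.\<close>

lemma no_linear_field:
  assumes "arrangement q1 q2 q3"
    and A: "tangent q2 (\<lambda>v. A *v v)" "tangent q3 (\<lambda>v. A *v v)" "\<exists>v. \<forall>c. A *v v \<noteq> c *s v"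
    and p: "p \<noteq> 0" "\<And>c. r \<noteq> c *s p" "q2 p = 0" "q3 p = 0" "q2 r = 0" "q3 r = 0"
  shows False
proof -
  have q: "smoothq q2" "smoothq q3" "indepq q2 q3" using assms(1) by (auto simp: arrangement_def)
  obtain T c a f where T: "invertible T" "c \<noteq> 0" "\<And>v. q2 (T *v v) = c * std v"
    "\<And>v. q3 (T *v v) = a * v $ 1 ^ 2 + f * v $ 2 * v $ 3"
    using linear_field_diagonal[OF q A p] by metis
  have "arrangement q2 q3 q1" using assms(1) arrangement_swap12 arrangement_swap23 by blast
  from arrangement_subst[OF this T(1), of "1 / c" 1 1]
  have "arrangement std (\<lambda>v. 1 * q3 (T *v v)) (\<lambda>v. 1 * q1 (T *v v))" using T(2) by (simp add: T(3))
  then show False by (rule no_bitangent_pair) (simp add: T(4))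
qed

section \<open>Bounding the number of intersection points on one conic\<close>

lemma indepq_nonzero_phi: "form 2 q \<Longrightarrow> indepq std q \<Longrightarrow> \<exists>x. q (phi x) \<noteq> 0"
  using std_divides2[of q] by (auto simp: indepq_def)

lemma indepq_not_vanish:
  assumes "smoothq q1" "smoothq q2" "indepq q1 q2"
  shows "\<exists>v. q1 v = 0 \<and> q2 v \<noteq> 0"
proof (rule ccontr)
  assume "\<not> ?thesis"
  then obtain G where G: "form 0 G" "\<forall>v. q2 v = q1 v * G v"
    using smoothq_divides[OF assms(1) smoothq_form[OF assms(2)]] by auto
  then obtain c where "\<forall>v. q2 v = c * q1 v" by (auto simp: form.simps mult.commute)
  then show False using assms(3) by (auto simp: indepq_def)
qed

lemma root_product_dvd:
  fixes p :: "complex poly"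
  assumes "finite A" "\<And>a. a \<in> A \<Longrightarrow> poly p a = 0"
  shows "(\<Prod>a\<in>A. [:- a, 1:]) dvd p"
  using assms
proof (induction A arbitrary: p rule: finite_induct)
  case (insert a A)
  obtain p' where p': "p = [:- a, 1:] * p'" using insert.prems[of a] poly_eq_0_iff_dvd by (metis dvdE insertI1)
  have "poly p' b = 0" if "b \<in> A" for b
  proof -
    have "(b - a) * poly p' b = 0" using insert.prems[of b] that p' by (simp add: algebra_simps)
    then show ?thesis using insert.hyps(2) that by auto
  qed
  then have "(\<Prod>a\<in>A. [:- a, 1:]) dvd p'" by (rule insert.IH)
  then show ?case using insert.hyps p' by (simp add: mult_dvd_mono del: mult_pCons_left mult_pCons_right)
qed simp

lemma degree_root_product: "degree (\<Prod>a\<in>A. [:- a, 1 :: complex:]) = card A"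
  by (subst degree_prod_eq_sum_degree) auto

text \<open>\<open>t\<close> has as many roots as its degree allows, so it is a constant times the
  product of the linear factors, and this product divides every polynomial with these roots.\<close>

lemma multiple_by_roots:
  fixes t u :: "complex poly"
  assumes "finite A" "\<And>a. a \<in> A \<Longrightarrow> poly t a = 0" "\<And>a. a \<in> A \<Longrightarrow> poly u a = 0"
    "t \<noteq> 0" "degree t \<le> card A"
  shows "\<exists>s. u = s * t"
proof -
  let ?P = "\<Prod>a\<in>A. [:- a, 1 :: complex:]"
  have "?P dvd t" "?P dvd u" using root_product_dvd assms(1-3) by blast+
  then obtain k m where k: "t = ?P * k" and m: "u = ?P * m" by (elim dvdE)
  have nz: "?P \<noteq> 0" "k \<noteq> 0" using k assms(4) by auto
  have "degree t = card A + degree k" unfolding k using degree_mult_eq[OF nz] degree_root_product by simp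
  then have "degree k = 0" using assms(5) by simp
  then obtain c where c: "k = [:c:]" by (meson degree_eq_zeroE)
  then have "c \<noteq> 0" using nz by simp
  then have "u = smult (1 / c) m * t" unfolding k m c by (simp add: mult.commute)
  then show ?thesis ..
qed

lemma vform_combine:
  assumes "vform 3 \<eta>" "vform 2 \<theta>" "form 1 S"
  shows "vform 3 (\<lambda>v. \<eta> v - S v *s \<theta> v)"
  unfolding vform_def
proof
  fix i
  have "form (1 + 2) (\<lambda>v. S v * \<theta> v $ i)" using assms by (intro form_mult) (auto simp: vform_def)
  then have "form 3 (\<lambda>v. S v * \<theta> v $ i)" by (simp add: numeral_3_eq_3)
  then show "form 3 (\<lambda>v. (\<eta> v - S v *s \<theta> v) $ i)"
    using assms form_diff[of 3 "\<lambda>v. \<eta> v $ i"] by (simp add: vform_def)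
qed

text \<open>\<open>t\<close> and \<open>u\<close> are the restrictions of the quadratic and the
  cubic field as vector fields on the line. Four points exhaust the roots of \<open>t\<close>, so
  \<open>u\<close> is a multiple of \<open>t\<close>; subtracting a linear form times the quadratic
  field from the cubic one gives a field radial along the conic, and removing the factor
  \<open>std\<close> leaves a linear field tangent to the other two conics. Such a field is
  impossible if these share two points.\<close>

lemma arrangement_std_bound:
  assumes arr: "arrangement std q2 q3"
  defines "A \<equiv> {x. q2 (phi x) = 0 \<or> q3 (phi x) = 0}"
  shows "finite A" "card A \<le> 4"
    "card A = 4 \<Longrightarrow> p \<noteq> 0 \<Longrightarrow> (\<And>c. r \<noteq> c *s p) \<Longrightarrow> q2 p = 0 \<Longrightarrow> q3 p = 0 \<Longrightarrow> q2 r = 0 \<Longrightarrow> q3 r = 0 \<Longrightarrow> False"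
proof -
  have s: "smoothq std" "smoothq q2" "smoothq q3" "indepq std q2" "indepq std q3" "fields std q2 q3"
    using arr by (auto simp: arrangement_def)
  obtain \<theta> \<eta> where th: "vform 2 \<theta>" "vform 3 \<eta>" "tangent std \<theta>" "tangent q2 \<theta>" "tangent q3 \<theta>"
    "tangent std \<eta>" "tangent q2 \<eta>" "tangent q3 \<eta>"
    "\<And>v. std v \<noteq> 0 \<Longrightarrow> q2 v \<noteq> 0 \<Longrightarrow> q3 v \<noteq> 0 \<Longrightarrow> det3 v (\<theta> v) (\<eta> v) \<noteq> 0"
    using s(6) unfolding fields_def by blast
  obtain v0 where v0: "std v0 \<noteq> 0" "q2 v0 \<noteq> 0" "q3 v0 \<noteq> 0" using smoothq_exists_nonzero[OF s(1-3)] by blast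
  obtain t where t: "degree t \<le> 2 * 2" "\<And>x. \<theta> (phi x) $ 1 - x * \<theta> (phi x) $ 3 = poly t x"
    using tangent_component_poly[OF th(3,1)] by blast
  obtain u where u: "degree u \<le> 2 * 3" "\<And>x. \<eta> (phi x) $ 1 - x * \<eta> (phi x) $ 3 = poly u x"
    using tangent_component_poly[OF th(6,2)] by blast
  note nz = indepq_nonzero_phi[OF smoothq_form[OF s(2)] s(4)] indepq_nonzero_phi[OF smoothq_form[OF s(3)] s(5)]
  have tA: "poly t x = 0" if "x \<in> A" for x
    using that tangent_component_root[OF th(3,1) _ s(2) th(4) t(2) nz(1)]
      tangent_component_root[OF th(3,1) _ s(3) th(5) t(2) nz(2)] by (auto simp: A_def)
  have uA: "poly u x = 0" if "x \<in> A" for x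
    using that tangent_component_root[OF th(6,2) _ s(2) th(7) u(2) nz(1)]
      tangent_component_root[OF th(6,2) _ s(3) th(8) u(2) nz(2)] by (auto simp: A_def)
  \<comment> \<open>Otherwise the quadratic field would be \<open>std v *s c\<close> modulo the
    Euler field. Tangency to \<open>q2\<close> makes \<open>c\<close> orthogonal to everything, so
    the field would be radial.\<close>
  have t0: "t \<noteq> 0"
  proof
    assume "t = 0"
    then have "\<theta> (phi x) $ 1 = x * \<theta> (phi x) $ 3" for x using t(2)[of x] by simp
    then obtain c M where cM: "form 1 M" "\<And>v. \<theta> v = std v *s c + M v *s v"
      using radial_field2[OF th(3,1)] by blast
    note f2 = smoothq_form[OF s(2)]
    have "std v * polar q2 v c = 0" if "q2 v = 0" for v
      using th(4) that unfolding tangent_def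
      by (simp add: cM(2) polar_add_right[OF f2] polar_scale_right[OF f2] polar_self[OF f2])
    moreover have "\<exists>v. q2 v = 0 \<and> std v \<noteq> 0" using indepq_not_vanish s indepq_commute by blast
    ultimately have "\<forall>v. q2 v = 0 \<longrightarrow> polar q2 v c = 0"
      using smoothq_prime[OF s(2) form_std form_polar_const[OF f2, of c]] by blast
    then have "polar q2 v c = 0" for v
      using form_vanish_linear[OF s(2) form_polar_const[OF f2, of c]] by blast
    then have "c = 0" using s(2) by (auto simp: smoothq_def polar_commute)
    then have "det3 v0 (\<theta> v0) (\<eta> v0) = 0" by (simp add: cM(2) det3_def algebra_simps)
    then show False using th(9)[of v0] v0 by simp
  qed
  have sub: "A \<subseteq> {x. poly t x = 0}" using tA by blast
  show fin: "finite A" using sub poly_roots_finite[OF t0] finite_subset by blast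
  have "card A \<le> card {x. poly t x = 0}" using sub poly_roots_finite[OF t0] card_mono by blast
  also have "\<dots> \<le> degree t" by (rule card_poly_roots_bound[OF t0])
  finally show "card A \<le> 4" using t(1) by simp
  assume A4: "card A = 4" and p: "p \<noteq> 0" "\<And>c. r \<noteq> c *s p" "q2 p = 0" "q3 p = 0" "q2 r = 0" "q3 r = 0"
  obtain s' where s': "u = s' * t" using multiple_by_roots[OF fin tA uA t0] t(1) A4 by auto
  have dt: "degree t = 4"
  proof -
    have "4 \<le> card {x. poly t x = 0}" using sub poly_roots_finite[OF t0] card_mono A4 by metis
    then show ?thesis using card_poly_roots_bound[OF t0] t(1) by simp
  qed
  have ds: "degree s' \<le> 2"
  proof (cases "s' = 0")
    case False
    then have "degree u = degree s' + 4" using degree_mult_eq[OF _ t0] dt unfolding s' by simp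
    then show ?thesis using u(1) by simp
  qed simp
  \<comment> \<open>The degrees 6 and 4 leave \<open>s'\<close> of degree at most 2, so it is the
    restriction of a linear form.\<close>
  define S where "S v = coeff s' 1 * v $ 1 + coeff s' 2 * v $ 2 + coeff s' 0 * v $ 3" for v :: "complex ^ 3"
  have S: "form 1 S" unfolding S_def[abs_def] by (rule form1I)
  have "s' = [:coeff s' 0, coeff s' 1, coeff s' 2:]"
    using ds by (intro poly_eqI) (auto simp: coeff_pCons coeff_eq_0 numeral_2_eq_2 split: nat.splits)
  then have "poly s' x = poly [:coeff s' 0, coeff s' 1, coeff s' 2:] x" for x by simp
  then have Sp: "S (phi x) = poly s' x" for x by (simp add: S_def power2_eq_square algebra_simps)
  define \<zeta> where "\<zeta> v = \<eta> v - S v *s \<theta> v" for v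
  have vz: "vform 3 \<zeta>" unfolding \<zeta>_def[abs_def] by (rule vform_combine[OF th(2,1) S])
  have tz: "tangent q \<zeta>" if "tangent q \<theta>" "tangent q \<eta>" "smoothq q" for q
    using that unfolding tangent_def \<zeta>_def
    by (simp add: polar_diff_right[OF smoothq_form] polar_scale_right[OF smoothq_form])
  have "\<zeta> (phi x) $ 1 = x * \<zeta> (phi x) $ 3" for x
    using t(2)[of x] u(2)[of x] unfolding s' \<zeta>_def by (simp add: Sp algebra_simps)
  then obtain B M where BM: "form 2 M" "\<And>v. \<zeta> v = std v *s (B *v v) + M v *s v"
    using radial_field3[OF tz[OF th(3,6) s(1)] vz] by blast
  have tB: "tangent q (\<lambda>v. B *v v)" if q: "smoothq q" "tangent q \<zeta>" "indepq std q" for q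
  proof -
    note f = smoothq_form[OF q(1)]
    have "std v * polar q v (B *v v) = 0" if "q v = 0" for v
      using q(2) that unfolding tangent_def
      by (simp add: BM(2) polar_add_right[OF f] polar_scale_right[OF f] polar_self[OF f])
    moreover have "\<exists>v. q v = 0 \<and> std v \<noteq> 0" using indepq_not_vanish q s(1) indepq_commute by blast
    ultimately show ?thesis
      using smoothq_prime[OF q(1) form_std form_polar[OF f vform1_matrix[of B]]] unfolding tangent_def by blast
  qed
  \<comment> \<open>If the linear field were radial at \<open>v0\<close>, the cubic field there
    would be a combination of \<open>v0\<close> and the quadratic field, against the determinant
    condition.\<close>
  have ns: "\<forall>c. B *v v0 \<noteq> c *s v0"
  proof (intro allI notI)
    fix c assume c: "B *v v0 = c *s v0"
    have "\<eta> v0 = \<zeta> v0 + S v0 *s \<theta> v0" by (simp add: \<zeta>_def)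
    then have "\<eta> v0 = (std v0 * c + M v0) *s v0 + S v0 *s \<theta> v0"
      by (simp add: BM(2) c vec3_eq_iff algebra_simps)
    then have "det3 v0 (\<theta> v0) (\<eta> v0) = 0" by (simp add: det3_def algebra_simps)
    then show False using th(9)[of v0] v0 by simp
  qed
  show False
    using no_linear_field[OF arr tB[OF s(2) tz[OF th(4,7) s(2)] s(4)] tB[OF s(3) tz[OF th(5,8) s(3)] s(5)] _ p] ns
    by blast
qed

text \<open>A point of \<open>q1\<close> on neither of the other conics is moved to infinity, so
  that every intersection point on \<open>q1\<close> gets a finite parameter. It exists because the
  restrictions of \<open>q2\<close> and \<open>q3\<close> to \<open>q1\<close> are nonzero
  polynomials.\<close>

lemma generic_coordinates:
  assumes q: "smoothq q1" "smoothq q2" "smoothq q3" "indepq q1 q2" "indepq q1 q3"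
  obtains T c where "invertible T" "c \<noteq> 0" "\<And>v. q1 (T *v v) = c * std v"
    "q2 (T *v vec3 0 1 0) \<noteq> 0" "q3 (T *v vec3 0 1 0) \<noteq> 0"
proof -
  obtain T c where T: "invertible T" "c \<noteq> 0" "\<And>v. q1 (T *v v) = c * std v" using smoothq_standard[OF q(1)] by blast
  have *: "\<exists>r. r \<noteq> 0 \<and> (\<forall>x. q (T *v phi x) = poly r x)" if "smoothq q" "indepq q1 q" for q
  proof -
    have f: "form 2 (\<lambda>v. 1 * q (T *v v))" using smoothq_form[OF that(1)] by (intro form_cmult form_subst)
    have "indepq (\<lambda>v. (1 / c) * q1 (T *v v)) (\<lambda>v. 1 * q (T *v v))"
      by (rule indepq_subst[OF that(2) T(1)]) (use T(2) in auto)
    then have "indepq std (\<lambda>v. 1 * q (T *v v))" using T(2) by (simp add: T(3))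
    then obtain x where "q (T *v phi x) \<noteq> 0" using indepq_nonzero_phi[OF f] by auto
    moreover obtain r where "\<forall>x. q (T *v phi x) = poly r x" using form_phi_poly[OF f] by auto
    ultimately show ?thesis by (intro exI[of _ r]) auto
  qed
  obtain r2 r3 where r: "r2 \<noteq> 0" "\<forall>x. q2 (T *v phi x) = poly r2 x" "r3 \<noteq> 0" "\<forall>x. q3 (T *v phi x) = poly r3 x"
    using *[OF q(2,4)] *[OF q(3,5)] by blast
  then have "r2 * r3 \<noteq> 0" by simp
  then obtain x where x: "poly (r2 * r3) x \<noteq> 0" using poly_all_0_iff_0 by blast
  have z: "q1 (T *v phi y) = 0" for y using T(3) by simp
  have nz: "T *v phi (x + 1) \<noteq> 0" using invertible_mult_eq_0[OF T(1)] by (simp add: vec3_eq_iff)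
  have ne: "T *v phi x \<noteq> c *s (T *v phi (x + 1))" for c
    unfolding vector_scalar_commute[symmetric] invertible_inj[OF T(1)] by (auto simp: vec3_eq_iff)
  obtain T' c' l where T': "invertible T'" "c' \<noteq> 0" "l \<noteq> 0" "\<And>v. q1 (T' *v v) = c' * std v"
    "T' *v vec3 0 1 0 = l *s (T *v phi x)"
    using conic_coordinates[OF q(1) z z nz ne] by metis
  show thesis
    by (rule that[OF T'(1,2,4)])
      (use T'(3,5) x r quad_scale[OF smoothq_form[OF q(2)]] quad_scale[OF smoothq_form[OF q(3)]] in auto)
qed

lemma common_std_eq:
  assumes "form 2 q" "q (vec3 0 1 0) \<noteq> 0"
  shows "common std q = (\<lambda>x. pt (phi x)) ` {x. q (phi x) = 0}"
proof (intro equalityI subsetI)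
  fix P assume "P \<in> common std q"
  then obtain v where v: "v \<noteq> 0" "std v = 0" "q v = 0" "P = pt v" by (auto simp: common_def)
  have "pt v \<in> common std q" using v by (auto simp: common_def)
  then have "pt v \<noteq> pt (vec3 0 1 0)"
    using pt_in_common[OF form_std assms(1), of "vec3 0 1 0"] assms(2) by (auto simp: vec3_eq_iff)
  then obtain x where x: "pt v = pt (phi x)" using std_zero_cases[OF v(2,1)] by blast
  then have "pt (phi x) \<in> common std q" using \<open>pt v \<in> common std q\<close> by simp
  then have "q (phi x) = 0" using pt_in_common[OF form_std assms(1), of "phi x"] by (auto simp: vec3_eq_iff)
  then show "P \<in> (\<lambda>x. pt (phi x)) ` {x. q (phi x) = 0}" using x v(4) by blast
next
  fix P assume "P \<in> (\<lambda>x. pt (phi x)) ` {x. q (phi x) = 0}"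
  then obtain x where "P = pt (phi x)" "q (phi x) = 0" by blast
  moreover have "phi x \<noteq> 0" by (auto simp: vec3_eq_iff)
  ultimately show "P \<in> common std q" by (auto simp: common_def)
qed

lemma arrangement_common:
  assumes arr: "arrangement q1 q2 q3"
  shows "finite (common q1 q2 \<union> common q1 q3)" "card (common q1 q2 \<union> common q1 q3) \<le> 4"
    "card (common q1 q2 \<union> common q1 q3) = 4 \<Longrightarrow> P \<in> common q2 q3 \<Longrightarrow> R \<in> common q2 q3 \<Longrightarrow> P = R"
proof -
  have q: "smoothq q1" "smoothq q2" "smoothq q3" "indepq q1 q2" "indepq q1 q3"
    using arr by (auto simp: arrangement_def)
  obtain T c where T: "invertible T" "c \<noteq> 0" "\<And>v. q1 (T *v v) = c * std v"
    "q2 (T *v vec3 0 1 0) \<noteq> 0" "q3 (T *v vec3 0 1 0) \<noteq> 0"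
    using generic_coordinates[OF q] by blast
  define p2 p3 where "p2 v = 1 * q2 (T *v v)" and "p3 v = 1 * q3 (T *v v)" for v
  have arr': "arrangement std p2 p3"
    using arrangement_subst[OF arr T(1), of "1 / c" 1 1] T(2) by (simp add: T(3) p2_def[abs_def] p3_def[abs_def])
  then have f: "form 2 p2" "form 2 p3" using smoothq_form by (auto simp: arrangement_def)
  define A where "A = {x. p2 (phi x) = 0 \<or> p3 (phi x) = 0}"
  note bound = arrangement_std_bound[OF arr', folded A_def]
  have e: "common q1 q2 \<union> common q1 q3 = (\<lambda>P. (*v) T ` P) ` (\<lambda>x. pt (phi x)) ` A"
  proof -
    have "common std p2 \<union> common std p3 = (\<lambda>x. pt (phi x)) ` A"
      using common_std_eq[OF f(1)] common_std_eq[OF f(2)] T(4,5) by (auto simp: A_def p2_def p3_def)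
    moreover have "common q1 q2 = (\<lambda>P. (*v) T ` P) ` common std p2"
      using common_subst[OF T(1), of "1 / c" 1 q1 q2] T(2) by (simp add: T(3) p2_def[abs_def])
    moreover have "common q1 q3 = (\<lambda>P. (*v) T ` P) ` common std p3"
      using common_subst[OF T(1), of "1 / c" 1 q1 q3] T(2) by (simp add: T(3) p3_def[abs_def])
    ultimately show ?thesis by (metis image_Un)
  qed
  have "inj_on (\<lambda>x. pt (phi x)) A" by (simp add: inj_on_def pt_phi)
  then have card: "card (common q1 q2 \<union> common q1 q3) = card A"
    unfolding e using card_image inj_on_subset[OF inj_image_points[OF T(1)] subset_UNIV] by metis
  show "finite (common q1 q2 \<union> common q1 q3)" unfolding e using bound(1) by blast
  show "card (common q1 q2 \<union> common q1 q3) \<le> 4" using bound(2) card by simp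
  assume a: "card (common q1 q2 \<union> common q1 q3) = 4" "P \<in> common q2 q3" "R \<in> common q2 q3"
  obtain p r where pr: "P = pt p" "p \<noteq> 0" "q2 p = 0" "q3 p = 0" "R = pt r" "r \<noteq> 0" "q2 r = 0" "q3 r = 0"
    using a by (auto simp: common_def)
  obtain T' where T': "invertible T'" "\<And>v. T *v (T' *v v) = v" using invertible_obtain_inverse[OF T(1)] by metis
  show "P = R"
  proof (rule ccontr)
    assume "P \<noteq> R"
    then have ne: "r \<noteq> c *s p" for c using pr pt_neq by blast
    show False
    proof (rule bound(3)[of "T' *v p" "T' *v r"])
      show "card A = 4" using card a by simp
      show "T' *v p \<noteq> 0" using pr invertible_mult_eq_0[OF T'(1)] by simp
      show "T' *v r \<noteq> c *s (T' *v p)" for c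
        unfolding vector_scalar_commute[symmetric] invertible_inj[OF T'(1)] by (rule ne)
    qed (use pr T' in \<open>simp_all add: p2_def p3_def\<close>)
  qed
qed

section \<open>Pairs of conics meeting in one or two points\<close>

lemma det3_parallel: "det3 v (c *s v) w = 0"
  by (simp add: det3_def algebra_simps)

text \<open>\<open>ct4\<close> is contact of order 4 at \<open>p\<close>; \<open>osc\<close> is contact of order 3 at \<open>p\<close> and a transversal
  intersection at \<open>r\<close>.\<close>

definition ct4 :: "(complex ^ 3 \<Rightarrow> complex) \<Rightarrow> (complex ^ 3 \<Rightarrow> complex) \<Rightarrow> complex ^ 3 \<Rightarrow> bool" where
  "ct4 q1 q2 p \<longleftrightarrow> p \<noteq> 0 \<and> q1 p = 0 \<and> (\<exists>\<mu> k. \<forall>w. q2 w = \<mu> * q1 w + k * (polar q1 p w) ^ 2)"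

definition osc :: "(complex ^ 3 \<Rightarrow> complex) \<Rightarrow> (complex ^ 3 \<Rightarrow> complex) \<Rightarrow> complex ^ 3 \<Rightarrow> complex ^ 3 \<Rightarrow> bool" where
  "osc q1 q2 p r \<longleftrightarrow> p \<noteq> 0 \<and> r \<noteq> 0 \<and> (\<forall>c. r \<noteq> c *s p) \<and> q1 p = 0 \<and> q1 r = 0 \<and>
     (\<exists>\<mu> k. \<forall>w. q2 w = \<mu> * q1 w + k * (polar q1 p w * det3 p r w))"

lemma ct4_subst:
  assumes "invertible T" "c1 \<noteq> 0" "c2 \<noteq> 0"
  shows "ct4 (\<lambda>v. c1 * q1 (T *v v)) (\<lambda>v. c2 * q2 (T *v v)) p \<longleftrightarrow> ct4 q1 q2 (T *v p)"
proof -
  obtain T' where T': "\<And>v. T *v (T' *v v) = v" using invertible_obtain_inverse[OF assms(1)] by metis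
  have "(\<exists>\<mu> k. \<forall>w. c2 * q2 (T *v w) = \<mu> * (c1 * q1 (T *v w)) + k * (c1 * polar q1 (T *v p) (T *v w)) ^ 2) \<longleftrightarrow>
      (\<exists>\<mu> k. \<forall>w. q2 w = \<mu> * q1 w + k * (polar q1 (T *v p) w) ^ 2)" (is "?l \<longleftrightarrow> ?r")
  proof
    assume ?l
    then obtain \<mu> k where *: "\<And>w. c2 * q2 (T *v w) = \<mu> * (c1 * q1 (T *v w)) + k * (c1 * polar q1 (T *v p) (T *v w)) ^ 2" by blast
    have "q2 w = (\<mu> * c1 / c2) * q1 w + (k * c1 ^ 2 / c2) * (polar q1 (T *v p) w) ^ 2" for w
      using *[of "T' *v w"] assms(3) by (simp add: T' field_simps)
    then show ?r by blast
  next
    assume ?r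
    then obtain \<mu> k where *: "\<And>w. q2 w = \<mu> * q1 w + k * (polar q1 (T *v p) w) ^ 2" by blast
    have "c2 * q2 (T *v w) = (\<mu> * c2 / c1) * (c1 * q1 (T *v w)) + (k * c2 / c1 ^ 2) * (c1 * polar q1 (T *v p) (T *v w)) ^ 2" for w
      using *[of "T *v w"] assms by (simp add: field_simps)
    then show ?l by blast
  qed
  then show ?thesis using assms
    by (simp add: ct4_def polar_cmult polar_subst invertible_mult_eq_0)
qed

lemma osc_subst:
  assumes "invertible T" "c1 \<noteq> 0" "c2 \<noteq> 0"
  shows "osc (\<lambda>v. c1 * q1 (T *v v)) (\<lambda>v. c2 * q2 (T *v v)) p r \<longleftrightarrow> osc q1 q2 (T *v p) (T *v r)"
proof -
  obtain T' where T': "\<And>v. T *v (T' *v v) = v" using invertible_obtain_inverse[OF assms(1)] by metis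
  have d: "det T \<noteq> 0" using assms(1) by (simp add: invertible_det_nz)
  have D: "det3 p r w = det3 (T *v p) (T *v r) (T *v w) / det T" for w using d by (simp add: det3_mult)
  have "(\<exists>\<mu> k. \<forall>w. c2 * q2 (T *v w) = \<mu> * (c1 * q1 (T *v w)) + k * (c1 * polar q1 (T *v p) (T *v w) * det3 p r w)) \<longleftrightarrow>
      (\<exists>\<mu> k. \<forall>w. q2 w = \<mu> * q1 w + k * (polar q1 (T *v p) w * det3 (T *v p) (T *v r) w))" (is "?l \<longleftrightarrow> ?r")
  proof
    assume ?l
    then obtain \<mu> k where *: "\<And>w. c2 * q2 (T *v w) = \<mu> * (c1 * q1 (T *v w)) + k * (c1 * polar q1 (T *v p) (T *v w) * det3 p r w)" by blast
    have "q2 w = (\<mu> * c1 / c2) * q1 w + (k * c1 / c2 / det T) * (polar q1 (T *v p) w * det3 (T *v p) (T *v r) w)" for w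
      using *[of "T' *v w"] assms(3) d by (simp add: T' D field_simps)
    then show ?r by blast
  next
    assume ?r
    then obtain \<mu> k where *: "\<And>w. q2 w = \<mu> * q1 w + k * (polar q1 (T *v p) w * det3 (T *v p) (T *v r) w)" by blast
    have "c2 * q2 (T *v w) = (\<mu> * c2 / c1) * (c1 * q1 (T *v w)) + (k * c2 / c1 * det T) * (c1 * polar q1 (T *v p) (T *v w) * det3 p r w)" for w
      using *[of "T *v w"] assms d by (simp add: D field_simps)
    then show ?l by blast
  qed
  then show ?thesis using assms
    by (simp add: osc_def polar_cmult polar_subst invertible_mult_eq_0 vector_scalar_commute[symmetric] invertible_inj)
qed

lemma osc_scale_right: "l \<noteq> 0 \<Longrightarrow> osc q1 q2 p (l *s r) \<Longrightarrow> form 2 q1 \<Longrightarrow> osc q1 q2 p r"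
proof -
  assume l: "l \<noteq> 0" and o: "osc q1 q2 p (l *s r)" and f: "form 2 q1"
  have d: "det3 p (l *s r) w = l * det3 p r w" for w by (simp add: det3_def algebra_simps)
  obtain \<mu> k where *: "\<forall>w. q2 w = \<mu> * q1 w + k * (polar q1 p w * det3 p (l *s r) w)"
    using o by (auto simp: osc_def)
  have "\<forall>w. q2 w = \<mu> * q1 w + (k * l) * (polar q1 p w * det3 p r w)" using * by (simp add: d algebra_simps)
  moreover have "r \<noteq> c *s p" for c
  proof
    assume "r = c *s p"
    then have "l *s r = (l * c) *s p" by (simp add: vector_smult_assoc)
    then show False using o by (auto simp: osc_def)
  qed
  ultimately show ?thesis using o l quad_scale[OF f, of l r] unfolding osc_def by auto
qed

lemma ct4_bad: "ct4 q1 q2 p \<Longrightarrow> form 2 q1 \<Longrightarrow> form 1 l \<Longrightarrow> (\<And>w. q3 w = \<mu> * q1 w + polar q1 p w * l w) \<Longrightarrow> bad q1 q2 q3"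
proof -
  assume a: "ct4 q1 q2 p" "form 2 q1" "form 1 l" "\<And>w. q3 w = \<mu> * q1 w + polar q1 p w * l w"
  obtain \<mu>' k where *: "\<forall>w. q2 w = \<mu>' * q1 w + k * (polar q1 p w) ^ 2" using a by (auto simp: ct4_def)
  have "form 1 (\<lambda>w. k * polar q1 p w)"
    unfolding polar_commute[of q1 p] by (intro form_cmult form_polar_const a)
  moreover have "k * polar q1 p p = 0" using a polar_self[OF a(2), of p] by (simp add: ct4_def)
  moreover have "\<forall>w. q2 w = \<mu>' * q1 w + polar q1 p w * (k * polar q1 p w)"
    using * by (simp add: power2_eq_square algebra_simps)
  ultimately show ?thesis using a unfolding bad_def ct4_def by blast
qed

lemma form_det3: "form 1 (\<lambda>w. det3 p r w)"
proof -
  have "form 1 (\<lambda>w. (p $ 2 * r $ 3 - p $ 3 * r $ 2) * w $ 1 + (p $ 3 * r $ 1 - p $ 1 * r $ 3) * w $ 2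
     + (p $ 1 * r $ 2 - p $ 2 * r $ 1) * w $ 3)" by (rule form1I)
  then show ?thesis by (simp add: det3_def algebra_simps)
qed

lemma osc_bad: "osc q1 q2 p r \<Longrightarrow> form 2 q1 \<Longrightarrow> form 1 l \<Longrightarrow> (\<And>w. q3 w = \<mu> * q1 w + polar q1 p w * l w) \<Longrightarrow> bad q1 q2 q3"
proof -
  assume a: "osc q1 q2 p r" "form 2 q1" "form 1 l" "\<And>w. q3 w = \<mu> * q1 w + polar q1 p w * l w"
  obtain \<mu>' k where *: "\<forall>w. q2 w = \<mu>' * q1 w + k * (polar q1 p w * det3 p r w)" using a by (auto simp: osc_def)
  have "form 1 (\<lambda>w. k * det3 p r w)" by (intro form_cmult form_det3)
  moreover have "k * det3 p r p = 0" by (simp add: det3_def algebra_simps)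
  moreover have "\<forall>w. q2 w = \<mu>' * q1 w + polar q1 p w * (k * det3 p r w)"
    using * by (simp add: algebra_simps)
  ultimately show ?thesis using a unfolding bad_def osc_def by blast
qed

text \<open>Supplies the condition that \<open>bad\<close> puts on its third conic.\<close>

lemma ct4_tangent: "ct4 q1 q2 p \<Longrightarrow> form 2 q1 \<Longrightarrow> \<exists>l \<mu>. form 1 l \<and> (\<forall>w. q2 w = \<mu> * q1 w + polar q1 p w * l w)"
proof -
  assume a: "ct4 q1 q2 p" "form 2 q1"
  obtain \<mu>' k where *: "\<forall>w. q2 w = \<mu>' * q1 w + k * (polar q1 p w) ^ 2" using a by (auto simp: ct4_def)
  have "form 1 (\<lambda>w. k * polar q1 p w)"
    unfolding polar_commute[of q1 p] by (intro form_cmult form_polar_const a)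
  moreover have "\<forall>w. q2 w = \<mu>' * q1 w + polar q1 p w * (k * polar q1 p w)"
    using * by (simp add: power2_eq_square algebra_simps)
  ultimately show ?thesis by blast
qed

lemma osc_tangent: "osc q1 q2 p r \<Longrightarrow> \<exists>l \<mu>. form 1 l \<and> (\<forall>w. q2 w = \<mu> * q1 w + polar q1 p w * l w)"
proof -
  assume a: "osc q1 q2 p r"
  obtain \<mu>' k where *: "\<forall>w. q2 w = \<mu>' * q1 w + k * (polar q1 p w * det3 p r w)" using a by (auto simp: osc_def)
  have "form 1 (\<lambda>w. k * det3 p r w)" by (intro form_cmult form_det3)
  moreover have "\<forall>w. q2 w = \<mu>' * q1 w + polar q1 p w * (k * det3 p r w)"
    using * by (simp add: algebra_simps)
  ultimately show ?thesis by blast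
qed

text \<open>As a binary form its roots lie at 0 and infinity, so at most one monomial
  survives.\<close>

lemma quadratic_no_nonzero_root:
  fixes d g e :: complex
  assumes "\<And>x. x \<noteq> 0 \<Longrightarrow> d * x ^ 2 + g * x + e \<noteq> 0"
  shows "(g = 0 \<and> e = 0) \<or> (d = 0 \<and> e = 0) \<or> (d = 0 \<and> g = 0)"
proof (cases "d = 0")
  case True
  then show ?thesis using assms[of "- e / g"] by (cases "g = 0"; cases "e = 0") auto
next
  case False
  obtain x where x: "d * x ^ 2 + g * x + e = 0" using quadratic_root[OF False] by blast
  then have "x = 0" using assms by blast
  then have e: "e = 0" using x by simp
  have "d * (- g / d) ^ 2 + g * (- g / d) + e = 0" using False e by (simp add: field_simps power2_eq_square)
  then have "- g / d = 0" using assms by blast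
  then show ?thesis using e False by simp
qed

lemma phi_neq_0: "phi x \<noteq> 0"
  by (simp add: vec3_eq_iff)

text \<open>The restriction of \<open>q2\<close> to the parametrized \<open>q1\<close> has degree at
  most 4: either its top coefficient vanishes and the point at infinity is common, or it is not
  constant and has a root.\<close>

lemma common_empty: "smoothq q1 \<Longrightarrow> smoothq q2 \<Longrightarrow> common q1 q2 \<noteq> {}"
proof -
  assume q: "smoothq q1" "smoothq q2"
  obtain T c where T: "invertible T" "c \<noteq> 0" "\<And>v. q1 (T *v v) = c * std v" using smoothq_standard[OF q(1)] by blast
  obtain r where r: "degree r \<le> 2 * 2" "\<forall>x. q2 (T *v phi x) = poly r x" "coeff r (2 * 2) = q2 (T *v vec3 0 1 0)"
    using form_phi_poly[OF form_subst[OF smoothq_form[OF q(2)]]] by blast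
  have "\<exists>v. v \<noteq> 0 \<and> std v = 0 \<and> q2 (T *v v) = 0"
  proof (cases "coeff r 4 = 0")
    case True
    then show ?thesis using r(3) by (intro exI[of _ "vec3 0 1 0"]) (auto simp: vec3_eq_iff std_def)
  next
    case False
    have "degree r \<noteq> 0" using False by (intro notI) (simp add: coeff_eq_0)
    then have "\<not> constant (poly r)" by (simp add: constant_degree)
    from Fundamental_Theorem_Algebra.fundamental_theorem_of_algebra[OF this]
    obtain x where "poly r x = 0" by blast
    then show ?thesis using r(2) phi_neq_0[of x] std_phi[of x] by metis
  qed
  then obtain v where v: "v \<noteq> 0" "std v = 0" "q2 (T *v v) = 0" by blast
  then have "pt (T *v v) \<in> common q1 q2"
    using invertible_mult_eq_0[OF T(1)] T(3) by (auto simp: common_def)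
  then show ?thesis by blast
qed

text \<open>With the common point at parameter 0 and another point of \<open>q1\<close> at infinity,
  the restriction of \<open>q2\<close> is x times a cubic with nonzero leading coefficient and no
  nonzero root, hence a multiple of x^4. So \<open>q2\<close> lies in the pencil of
  \<open>q1\<close> and the doubled tangent.\<close>

lemma pair_single:
  assumes q: "smoothq q1" "smoothq q2" and p: "p \<noteq> 0" and c: "common q1 q2 = {pt p}"
  shows "ct4 q1 q2 p"
proof -
  note f = smoothq_form[OF q(1)] smoothq_form[OF q(2)]
  have pz: "q1 p = 0" "q2 p = 0" using pt_in_common[OF f p] c by auto
  obtain a b where ab: "q1 a = 0" "q1 b = 0" "a \<noteq> 0" "\<And>c. b \<noteq> c *s a" using smoothq_two_points[OF q(1)] by blast
  have "b \<noteq> 0" using ab(4)[of 0] by simp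
  obtain r where r: "q1 r = 0" "\<And>c. r \<noteq> c *s p"
  proof (cases "\<exists>c. a = c *s p")
    case True
    then obtain c where c: "a = c *s p" by blast
    have "b \<noteq> d *s p" for d
    proof
      assume "b = d *s p"
      moreover have "c \<noteq> 0" using c ab(3) by auto
      ultimately have "b = (d / c) *s a" using c by (simp add: vector_smult_assoc)
      then show False using ab(4) by blast
    qed
    then show thesis using that ab(2) by blast
  qed (use that ab(1) in blast)
  obtain T c l where T: "invertible T" "c \<noteq> 0" "l \<noteq> 0" "\<And>v. q1 (T *v v) = c * std v"
    "T *v vec3 0 0 1 = p" "T *v vec3 0 1 0 = l *s r"
    using conic_coordinates[OF q(1) pz(1) r(1) p r(2)] by blast
  obtain a b c' d e g where E: "\<And>v. q2 (T *v v) = a * v $ 1 ^ 2 + b * v $ 2 ^ 2 + c' * v $ 3 ^ 2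
     + d * v $ 1 * v $ 2 + e * v $ 1 * v $ 3 + g * v $ 2 * v $ 3" using form2E[OF form_subst[OF f(2)]] by blast
  have "c' = 0" using pz(2) E[of "vec3 0 0 1"] T(5) by simp
  have nz: "b * x ^ 3 + d * x ^ 2 + (a + g) * x + e \<noteq> 0" if "x \<noteq> 0" for x
  proof
    assume *: "b * x ^ 3 + d * x ^ 2 + (a + g) * x + e = 0"
    have "q2 (T *v phi x) = x * (b * x ^ 3 + d * x ^ 2 + (a + g) * x + e)"
      unfolding E \<open>c' = 0\<close> by (simp add: power2_eq_square power3_eq_cube algebra_simps)
    then have "pt (T *v phi x) \<in> common q1 q2"
      using pt_in_common[OF f, of "T *v phi x"] * T(4)[of "phi x"] phi_neq_0[of x] invertible_mult_eq_0[OF T(1)] by simp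
    then have "pt (T *v phi x) = pt (T *v vec3 0 0 1)" using c T(5) by simp
    then have "pt (phi x) = pt (phi 0)" using pt_mult[OF T(1)] by (simp add: phi_def)
    then show False using that by (simp add: pt_phi)
  qed
  have b: "b \<noteq> 0"
  proof
    assume "b = 0"
    then have "q2 (l *s r) = 0" using E[of "vec3 0 1 0"] T(6) by simp
    then have "pt r \<in> common q1 q2"
      using pt_in_common[OF f, of r] r quad_scale[OF f(2), of l r] T(3) r(2)[of 0] by auto
    then have "pt p = pt r" using c by simp
    then show False using r(2) by (auto simp: pt_eq_iff)
  qed
  \<comment> \<open>All three roots of the cubic are 0, so its lower coefficients, being symmetric
    functions of them, vanish.\<close>
  obtain x y z where xyz: "\<And>t. t ^ 3 + (d / b) * t ^ 2 + ((a + g) / b) * t + e / b = (t - x) * (t - y) * (t - z)"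
    "d / b = - (x + y + z)" "(a + g) / b = x * y + x * z + y * z" "e / b = - (x * y * z)"
    using linear_split3 by blast
  have root: "t = 0" if "(t - x) * (t - y) * (t - z) = 0" for t
  proof (rule ccontr)
    assume "t \<noteq> 0"
    have "b * t ^ 3 + d * t ^ 2 + (a + g) * t + e = b * (t ^ 3 + (d / b) * t ^ 2 + ((a + g) / b) * t + e / b)"
      using b by (simp add: field_simps)
    also have "\<dots> = 0" using xyz(1)[of t] that by simp
    finally show False using nz[OF \<open>t \<noteq> 0\<close>] by simp
  qed
  have "x = 0" "y = 0" "z = 0" using root[of x] root[of y] root[of z] by simp_all
  then have de: "d = 0" "e = 0" "g = - a" using xyz(2-4) b by (simp_all add: eq_neg_iff_add_eq_0 add.commute)
  have "ct4 std (\<lambda>v. 1 * q2 (T *v v)) (vec3 0 0 1)"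
    unfolding ct4_def
  proof (intro conjI exI allI)
    show "1 * q2 (T *v w) = a * std w + b * (polar std (vec3 0 0 1) w) ^ 2" for w
      unfolding E polar_std std_def de \<open>c' = 0\<close> by (simp add: algebra_simps)
  qed (simp_all add: vec3_eq_iff std_def)
  then show ?thesis
    using ct4_subst[OF T(1), of "1 / c" 1 q1 q2] T(2,5) by (simp add: T(4))
qed

text \<open>With the two points at parameters 0 and infinity the restriction of \<open>q2\<close> is
  a multiple of x, x^2 or x^3. The middle case is a bitangent pair, which is where freeness enters;
  the others are contact 3 at one point and 1 at the other.\<close>

lemma pair_double:
  assumes arr: "arrangement q1 q2 q3" and p: "p \<noteq> 0" "r \<noteq> 0" "pt p \<noteq> pt r" and c: "common q1 q2 = {pt p, pt r}"
  shows "osc q1 q2 p r \<or> osc q1 q2 r p"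
proof -
  have q: "smoothq q1" "smoothq q2" using arr by (auto simp: arrangement_def)
  note f = smoothq_form[OF q(1)] smoothq_form[OF q(2)]
  have pz: "q1 p = 0" "q2 p = 0" "q1 r = 0" "q2 r = 0" using pt_in_common[OF f p(1)] pt_in_common[OF f p(2)] c by auto
  have ne: "r \<noteq> c *s p" for c using pt_neq p by blast
  have ne': "p \<noteq> c *s r" for c using pt_neq p by metis
  obtain T c l where T: "invertible T" "c \<noteq> 0" "l \<noteq> 0" "\<And>v. q1 (T *v v) = c * std v"
    "T *v vec3 0 0 1 = p" "T *v vec3 0 1 0 = l *s r"
    using conic_coordinates[OF q(1) pz(1) pz(3) p(1) ne] by blast
  obtain a b c' d e g where E: "\<And>v. q2 (T *v v) = a * v $ 1 ^ 2 + b * v $ 2 ^ 2 + c' * v $ 3 ^ 2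
     + d * v $ 1 * v $ 2 + e * v $ 1 * v $ 3 + g * v $ 2 * v $ 3" using form2E[OF form_subst[OF f(2)]] by blast
  have c': "c' = 0" using pz(2) E[of "vec3 0 0 1"] T(5) by simp
  have b: "b = 0" using pz(4) E[of "vec3 0 1 0"] T(6) quad_scale[OF f(2), of l r] by simp
  have nz: "d * x ^ 2 + (a + g) * x + e \<noteq> 0" if "x \<noteq> 0" for x
  proof
    assume *: "d * x ^ 2 + (a + g) * x + e = 0"
    have "q2 (T *v phi x) = x * (d * x ^ 2 + (a + g) * x + e)"
      unfolding E c' b by (simp add: power2_eq_square algebra_simps)
    then have "pt (T *v phi x) \<in> common q1 q2"
      using pt_in_common[OF f, of "T *v phi x"] * T(4)[of "phi x"] phi_neq_0[of x] invertible_mult_eq_0[OF T(1)] by simp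
    then have "pt (T *v phi x) = pt (T *v vec3 0 0 1) \<or> pt (T *v phi x) = pt (T *v vec3 0 1 0)"
      using c T(3,5,6) pt_scale by auto
    then have "pt (phi x) = pt (phi 0) \<or> pt (phi x) = pt (vec3 0 1 0)" using pt_mult[OF T(1)] by (simp add: phi_def)
    then show False using that by (simp add: pt_phi pt_phi_infinity)
  qed
  have st: "1 / c * (c * x) = x" for x using T(2) by simp
  have "(a + g = 0 \<and> e = 0) \<or> (d = 0 \<and> e = 0) \<or> (d = 0 \<and> a + g = 0)"
    by (rule quadratic_no_nonzero_root) (rule nz)
  then show ?thesis
  proof (elim disjE conjE)
    assume z: "a + g = 0" "e = 0"
    have ga: "g = - a" using z(1) by algebra
    have "osc std (\<lambda>v. 1 * q2 (T *v v)) (vec3 0 0 1) (vec3 0 1 0)"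
      unfolding osc_def
    proof (intro conjI exI allI)
      show "1 * q2 (T *v w) = a * std w + d * (polar std (vec3 0 0 1) w * det3 (vec3 0 0 1) (vec3 0 1 0) w)" for w
        unfolding E polar_std std_def det3_def ga z(2) c' b by (simp add: algebra_simps)
    qed (simp_all add: vec3_eq_iff std_def)
    then have "osc q1 q2 p (l *s r)"
      using osc_subst[OF T(1), of "1 / c" 1 q1 q2] T(2,5,6) by (simp add: T(4))
    then show ?thesis using osc_scale_right T(3) f by blast
  next
    assume z: "d = 0" "e = 0"
    have "arrangement std (\<lambda>v. 1 * q2 (T *v v)) (\<lambda>v. 1 * q3 (T *v v))"
      using arrangement_subst[OF arr T(1), of "1 / c" 1 1] T(2) by (simp add: T(4))
    moreover have "1 * q2 (T *v v) = a * v $ 1 ^ 2 + g * v $ 2 * v $ 3" for v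
      unfolding E z c' b by simp
    ultimately show ?thesis using no_bitangent_pair by blast
  next
    assume z: "d = 0" "a + g = 0"
    have ga: "g = - a" using z(2) by algebra
    have "osc std (\<lambda>v. 1 * q2 (T *v v)) (vec3 0 1 0) (vec3 0 0 1)"
      unfolding osc_def
    proof (intro conjI exI allI)
      show "1 * q2 (T *v w) = a * std w + (- e) * (polar std (vec3 0 1 0) w * det3 (vec3 0 1 0) (vec3 0 0 1) w)" for w
        unfolding E polar_std std_def det3_def ga z(1) c' b by (simp add: algebra_simps)
    qed (simp_all add: vec3_eq_iff std_def)
    then have o: "osc q1 q2 (l *s r) p"
      using osc_subst[OF T(1), of "1 / c" 1 q1 q2] T(2,5,6) by (simp add: T(4))
    then obtain \<mu> k where *: "\<forall>w. q2 w = \<mu> * q1 w + k * (polar q1 (l *s r) w * det3 (l *s r) p w)"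
      by (auto simp: osc_def)
    have "\<forall>w. q2 w = \<mu> * q1 w + (k * l ^ 2) * (polar q1 r w * det3 r p w)"
      using * by (simp add: polar_scale_left[OF f(1)] det3_def power2_eq_square algebra_simps)
    then have "osc q1 q2 r p" unfolding osc_def using p pz ne' by blast
    then show ?thesis ..
  qed
qed

text \<open>Three conics through three common points: here the quadratic field is determined by the first
  two conics up to two parameters, and it degenerates at a point of the common tangent of these
  which lies on neither of them.\<close>

lemma three_common_points_core:
  assumes arr: "arrangement q1 q2 q3"
    and q1: "\<And>v. q1 v = v $ 2 * v $ 3 + v $ 1 * v $ 3 + v $ 1 * v $ 2"
    and q2: "\<And>v. q2 v = k * v $ 2 * v $ 3 + k * v $ 1 * v $ 3 + v $ 1 * v $ 2"
    and q3: "\<And>v. q3 v = \<beta> * v $ 2 * v $ 3 + \<alpha> * v $ 1 * v $ 3 + v $ 1 * v $ 2"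
    and nz: "k \<noteq> 0" "\<alpha> \<noteq> 0" "\<beta> \<noteq> 0"
  shows False
proof -
  have s: "smoothq q1" "smoothq q2" "smoothq q3" "indepq q1 q2" "fields q1 q2 q3"
    using arr by (auto simp: arrangement_def)
  have k1: "k \<noteq> 1" using s(4) q1 q2 by (auto simp: indepq_def)
  obtain \<theta> \<eta> where th: "vform 2 \<theta>" "tangent q1 \<theta>" "tangent q2 \<theta>" "tangent q3 \<theta>"
    "\<And>v. q1 v \<noteq> 0 \<Longrightarrow> q2 v \<noteq> 0 \<Longrightarrow> q3 v \<noteq> 0 \<Longrightarrow> det3 v (\<theta> v) (\<eta> v) \<noteq> 0"
    using s(5) unfolding fields_def by blast
  obtain G where G: "form 1 G" "\<forall>v. polar q1 v (\<theta> v) = q1 v * G v"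
    using tangent_divides[OF s(1) th(2) th(1)] by auto
  obtain H where H: "form 1 H" "\<forall>v. polar q2 v (\<theta> v) = q2 v * H v"
    using tangent_divides[OF s(2) th(3) th(1)] by auto
  obtain J where J: "form 1 J" "\<forall>v. polar q3 v (\<theta> v) = q3 v * J v"
    using tangent_divides[OF s(3) th(4) th(1)] by auto
  obtain l1 l2 l3 where l: "\<And>v. G v = l1 * v $ 1 + l2 * v $ 2 + l3 * v $ 3" using form1E[OF G(1)] by blast
  obtain m1 m2 m3 where m: "\<And>v. H v = m1 * v $ 1 + m2 * v $ 2 + m3 * v $ 3" using form1E[OF H(1)] by blast
  obtain n1 n2 n3 where n: "\<And>v. J v = n1 * v $ 1 + n2 * v $ 2 + n3 * v $ 3" using form1E[OF J(1)] by blast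
  have F: "form 2 (\<lambda>v. \<theta> v $ i)" for i using th(1) by (simp add: vform_def)
  obtain a1 a2 a3 a4 a5 a6 where A: "\<And>v. \<theta> v $ 1 = a1 * v $ 1 ^ 2 + a2 * v $ 2 ^ 2 + a3 * v $ 3 ^ 2
     + a4 * v $ 1 * v $ 2 + a5 * v $ 1 * v $ 3 + a6 * v $ 2 * v $ 3" using form2E[OF F[of 1]] by blast
  obtain b1 b2 b3 b4 b5 b6 where B: "\<And>v. \<theta> v $ 2 = b1 * v $ 1 ^ 2 + b2 * v $ 2 ^ 2 + b3 * v $ 3 ^ 2
     + b4 * v $ 1 * v $ 2 + b5 * v $ 1 * v $ 3 + b6 * v $ 2 * v $ 3" using form2E[OF F[of 2]] by blast
  obtain e1 e2 e3 e4 e5 e6 where E: "\<And>v. \<theta> v $ 3 = e1 * v $ 1 ^ 2 + e2 * v $ 2 ^ 2 + e3 * v $ 3 ^ 2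
     + e4 * v $ 1 * v $ 2 + e5 * v $ 1 * v $ 3 + e6 * v $ 2 * v $ 3" using form2E[OF F[of 3]] by blast
  have P: "polar q u v = b * (u $ 2 * v $ 3 + u $ 3 * v $ 2) + a * (u $ 1 * v $ 3 + u $ 3 * v $ 1)
      + (u $ 1 * v $ 2 + u $ 2 * v $ 1)"
    if "\<And>v. q v = b * v $ 2 * v $ 3 + a * v $ 1 * v $ 3 + v $ 1 * v $ 2" for q a b u v
    by (simp add: polar_def that algebra_simps)
  \<comment> \<open>The coefficients of the cubic tangency identity for a conic with coefficients
    \<open>b\<close>, \<open>a\<close>, 1, to be used for all three conics.\<close>
  have key: "(b1 + a * e1) * v $ 1 ^ 3 + (a2 + b * e2) * v $ 2 ^ 3 + (a * a3 + b * b3) * v $ 3 ^ 3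
     + (a1 + b4 + a * e4 + b * e1 - l1) * v $ 1 ^ 2 * v $ 2 + (a * a1 + b5 + a * e5 + b * b1 - a * l1) * v $ 1 ^ 2 * v $ 3
     + (a4 + b2 + b * e4 + a * e2 - l2) * v $ 2 ^ 2 * v $ 1 + (a6 + b * b2 + b * e6 + a * a2 - b * l2) * v $ 2 ^ 2 * v $ 3
     + (a * a5 + b * b5 + b3 + a * e3 - a * l3) * v $ 3 ^ 2 * v $ 1 + (a * a6 + b * b6 + a3 + b * e3 - b * l3) * v $ 3 ^ 2 * v $ 2
     + (a5 + b6 + a * a4 + b * b4 + a * e6 + b * e5 - l3 - a * l2 - b * l1) * v $ 1 * v $ 2 * v $ 3 = 0"
    if q: "\<And>v. q v = b * v $ 2 * v $ 3 + a * v $ 1 * v $ 3 + v $ 1 * v $ 2"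
      and G: "\<And>v. polar q v (\<theta> v) = q v * (l1 * v $ 1 + l2 * v $ 2 + l3 * v $ 3)"
    for q a b l1 l2 l3 and v :: "complex ^ 3"
    using G[of v] unfolding P[OF q] A B E q
    by (simp add: power2_eq_square power3_eq_cube algebra_simps)
  have q1': "q1 v = 1 * v $ 2 * v $ 3 + 1 * v $ 1 * v $ 3 + v $ 1 * v $ 2" for v by (simp add: q1)
  have G': "polar q1 v (\<theta> v) = q1 v * (l1 * v $ 1 + l2 * v $ 2 + l3 * v $ 3)" for v using G(2) l by simp
  have H': "polar q2 v (\<theta> v) = q2 v * (m1 * v $ 1 + m2 * v $ 2 + m3 * v $ 3)" for v using H(2) m by simp
  have J': "polar q3 v (\<theta> v) = q3 v * (n1 * v $ 1 + n2 * v $ 2 + n3 * v $ 3)" for v using J(2) n by simp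
  note x = form3_zero[OF key[OF q1' G']]
  note y = form3_zero[OF key[OF q2 H']]
  note z = form3_zero[OF key[OF q3 J']]
  have k1': "k - 1 \<noteq> 0" using k1 by simp
  have "(k - 1) * e1 = 0" "(k - 1) * e2 = 0" using x(1,2) y(1,2) by algebra+
  then have e12: "e1 = 0" "e2 = 0" using k1' by simp_all
  then have ab: "b1 = 0" "a2 = 0" using x(1,2) by simp_all
  have ab3: "a3 = - b3" using x(3) by algebra
  have 1: "l1 = a1 + b4 + e4" "m1 = a1 + b4 + k * e4" "l2 = a4 + b2 + e4" "m2 = a4 + b2 + k * e4"
    using x(4,6) y(4,6) e12 by (simp_all add: algebra_simps)
  have e5: "b5 = b4 + e4 - e5" "a6 = a4 + e4 - e6" using x(5,7) 1 ab by (simp_all, algebra+)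
  have "(k - 1) * (e5 - b4 - (k + 1) * e4) = 0" "(k - 1) * (e6 - a4 - (k + 1) * e4) = 0"
    using y(5,7) 1 ab e5 by algebra+
  then have "e5 - b4 - (k + 1) * e4 = 0" "e6 - a4 - (k + 1) * e4 = 0" using k1' by simp_all
  then have e56: "e5 = b4 + (k + 1) * e4" "e6 = a4 + (k + 1) * e4" by algebra+
  have ab56: "b5 = - k * e4" "a6 = - k * e4" using e5 e56 by (simp_all add: algebra_simps)
  have l3: "l3 = a5 + b5 + b3 + e3" "l3 = a6 + b6 + a3 + e3" using x(8,9) by (algebra)+
  have m3: "k * m3 = k * a5 + k * b5 + b3 + k * e3" "k * m3 = k * a6 + k * b6 + a3 + k * e3" using y(8,9) by (algebra)+
  have "(k - 1) * b3 = 0" using l3 m3 ab3 ab56 k1' nz(1) by algebra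
  then have b3: "b3 = 0" "a3 = 0" using k1' ab3 by simp_all
  have ab5: "a5 = b6" using l3 b3 ab56 by algebra
  have m3': "m3 = l3" using m3(1) l3(1) b3 nz(1) by (simp, algebra)
  have X10: "a5 + b6 + a4 + b4 + e6 + e5 - l3 - l2 - l1 = 0" using x(10) by (simp add: algebra_simps)
  have Y10: "a5 + b6 + k * (a4 + b4 + e6 + e5) - m3 - k * m2 - k * m1 = 0" using y(10) by (simp add: algebra_simps)
  have I: "a5 + a4 + b4 + 3 * k * e4 - e3 - a1 - b2 = 0" using X10 l3(1) b3 ab5 ab56 e56 1 by algebra
  have II: "a5 - e3 + 3 * k * e4 + k * (a4 + b4 - a1 - b2) = 0" using Y10 m3' l3(1) b3 ab5 ab56 e56 1 by algebra
  have "(k - 1) * (a4 + b4 - a1 - b2) = 0" using I II by algebra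
  then have "a4 + b4 - a1 - b2 = 0" using k1' by simp
  then have r1: "b2 = a4 + b4 - a1" by algebra
  have r2: "e3 = a5 + 3 * k * e4" using I r1 by algebra
  \<comment> \<open>The line X + Y = 0 is the common tangent of the first two conics at
    \<open>vec3 0 0 1\<close>. On it the field is radial as soon as one binary quadratic vanishes,
    and by the determinant condition such a point lies on the curve: it is the point of tangency
    (\<open>x = 0\<close>) or a point of the third conic.\<close>
  have col: "x = 0 \<or> x = z * (\<alpha> - \<beta>)" if xz: "e4 * x ^ 2 + (a1 - b4) * x * z - 2 * k * e4 * z ^ 2 = 0" for x z
  proof (rule ccontr)
    assume n: "\<not> (x = 0 \<or> x = z * (\<alpha> - \<beta>))"
    let ?v = "vec3 x (- x) z"
    let ?\<mu> = "(a1 - a4) * x + (a5 + k * e4) * z"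
    have "\<theta> ?v $ 1 = ?\<mu> * x" "\<theta> ?v $ 2 = ?\<mu> * (- x)"
      unfolding A B vector_3 e12 ab b3 ab56 ab5 r1 by algebra+
    moreover have "\<theta> ?v $ 3 = ?\<mu> * z"
      using xz unfolding E vector_3 e12 e56 r2 by algebra
    ultimately have "\<theta> ?v = ?\<mu> *s ?v" by (auto simp: vec3_eq_iff algebra_simps)
    then have "det3 ?v (\<theta> ?v) (\<eta> ?v) = 0" using det3_parallel by metis
    moreover have "q1 ?v = - (x ^ 2)" "q2 ?v = - (x ^ 2)" "q3 ?v = x * (z * (\<alpha> - \<beta>) - x)"
      unfolding q1 q2 q3 vector_3 by algebra+
    moreover have "x \<noteq> 0" "z * (\<alpha> - \<beta>) - x \<noteq> 0" using n by auto
    ultimately show False using th(5)[of ?v] by simp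
  qed
  \<comment> \<open>With \<open>e4 = 0\<close> the point \<open>vec3 1 (- 1) 0\<close> would be a
    root of the quadratic off all three conics.\<close>
  have e4: "e4 \<noteq> 0"
  proof
    assume "e4 = 0"
    then show False using col[of 1 0] by simp
  qed
  have "e4 * ((\<alpha> - 1) * (k - \<alpha>)) = 0" using z(4,5) e12 ab ab56 e56 by algebra
  then have al: "\<alpha> = 1 \<or> \<alpha> = k" using e4 by auto
  have "e4 * ((\<beta> - 1) * (k - \<beta>)) = 0" using z(6,7) e12 ab ab56 e56 by algebra
  then have be: "\<beta> = 1 \<or> \<beta> = k" using e4 by auto
  have "k * e4 * (\<alpha> ^ 2 - \<beta> ^ 2) = 0" using z(8,9) b3 ab56 ab5 by algebra
  then have sq: "\<alpha> ^ 2 = \<beta> ^ 2" using e4 nz(1) by simp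
  \<comment> \<open>Both roots of the quadratic must equal \<open>\<alpha> - \<beta>\<close>, and
    their product is \<open>- 2 * k\<close>, so \<open>x ^ 2 = - 2 * k\<close>. This is incompatible
    with \<open>\<alpha> ^ 2 = \<beta> ^ 2\<close> when \<open>\<alpha>\<close> and
    \<open>\<beta>\<close> are 1 and \<open>k\<close> in some order.\<close>
  obtain x where x': "e4 * x ^ 2 + (a1 - b4) * x + (- 2 * k * e4) = 0" using quadratic_root[OF e4] by blast
  then have x0: "x \<noteq> 0" using e4 nz(1) by auto
  have x1: "x = \<alpha> - \<beta>" using col[of x 1] x' x0 by simp
  have "(a1 - b4) * x = 2 * k * e4 - e4 * x ^ 2" using x' by algebra
  then have "x ^ 2 * (e4 * (- 2 * k / x) ^ 2 + (a1 - b4) * (- 2 * k / x) * 1 - 2 * k * e4 * 1 ^ 2) = 0"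
    using x0 by (simp add: field_simps power2_eq_square) algebra
  then have "e4 * (- 2 * k / x) ^ 2 + (a1 - b4) * (- 2 * k / x) * 1 - 2 * k * e4 * 1 ^ 2 = 0"
    using x0 by simp
  then have "- 2 * k / x = \<alpha> - \<beta>" using col[of "- 2 * k / x" 1] x0 nz(1) by simp
  then have "- 2 * k / x = x" using x1 by simp
  then have xx: "x ^ 2 = - 2 * k" using x0 by (simp add: field_simps power2_eq_square)
  have "\<alpha> \<noteq> \<beta>" using x1 x0 by auto
  then have "k ^ 2 = 1 \<and> (k - 1) ^ 2 = - 2 * k" using al be sq xx x1 by (auto simp: power2_commute)
  then have "k ^ 2 = 1" "2 = (0 :: complex)" by (auto, algebra)
  then show False by simp
qed

lemma smoothq_hollow:
  assumes "smoothq q" "\<And>v. q v = a * v $ 2 * v $ 3 + b * v $ 1 * v $ 3 + c * v $ 1 * v $ 2"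
  shows "a \<noteq> 0" "b \<noteq> 0" "c \<noteq> 0"
proof -
  have P: "polar q u v = a * (u $ 2 * v $ 3 + u $ 3 * v $ 2) + b * (u $ 1 * v $ 3 + u $ 3 * v $ 1)
    + c * (u $ 1 * v $ 2 + u $ 2 * v $ 1)" for u v
    by (simp add: polar_def assms(2) algebra_simps)
  have z: "v = 0" if "\<And>w. polar q v w = 0" for v using assms(1) that by (auto simp: smoothq_def)
  show "a \<noteq> 0"
  proof
    assume a: "a = 0"
    have "vec3 0 b (- c) = (0 :: complex ^ 3)" by (rule z) (simp add: P a algebra_simps)
    then have "b = 0" "c = 0" by (simp_all add: vec3_eq_iff)
    then have "vec3 0 1 0 = (0 :: complex ^ 3)" by (intro z) (simp add: P a)
    then show False by (simp add: vec3_eq_iff)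
  qed
  show "b \<noteq> 0"
  proof
    assume b: "b = 0"
    have "vec3 a 0 (- c) = (0 :: complex ^ 3)" by (rule z) (simp add: P b algebra_simps)
    then have "a = 0" "c = 0" by (simp_all add: vec3_eq_iff)
    then have "vec3 1 0 0 = (0 :: complex ^ 3)" by (intro z) (simp add: P b)
    then show False by (simp add: vec3_eq_iff)
  qed
  show "c \<noteq> 0"
  proof
    assume c: "c = 0"
    have "vec3 a (- b) 0 = (0 :: complex ^ 3)" by (rule z) (simp add: P c algebra_simps)
    then have "a = 0" "b = 0" by (simp_all add: vec3_eq_iff)
    then have "vec3 1 0 0 = (0 :: complex ^ 3)" by (intro z) (simp add: P c)
    then show False by (simp add: vec3_eq_iff)
  qed
qed

text \<open>The hypothesis \<open>t\<close> says that the tangents of \<open>q1\<close> and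
  \<open>q2\<close> at \<open>o3\<close> coincide. With the three points as vertices the forms
  contain no squares, and scaling the coordinates by the coefficients of \<open>q1\<close> makes
  these all equal, which is the normal form treated before.\<close>

lemma three_common_points_tangent:
  assumes arr: "arrangement q1 q2 q3" and d: "det3 o1 o2 o3 \<noteq> 0"
    and z: "\<And>q. q \<in> {q1, q2, q3} \<Longrightarrow> q o1 = 0 \<and> q o2 = 0 \<and> q o3 = 0"
    and t: "polar q1 o2 o3 * polar q2 o1 o3 = polar q1 o1 o3 * polar q2 o2 o3"
  shows False
proof -
  have s: "smoothq q1" "smoothq q2" "smoothq q3" using arr by (auto simp: arrangement_def)
  let ?C = "columns3 o1 o2 o3"
  have iC: "invertible ?C" using d by (simp add: invertible_columns3)
  have E: "q (?C *v v) = polar q o2 o3 * v $ 2 * v $ 3 + polar q o1 o3 * v $ 1 * v $ 3 + polar q o1 o2 * v $ 1 * v $ 2"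
    if "q \<in> {q1, q2, q3}" for q v
  proof -
    have f: "form 2 q" using that s smoothq_form by blast
    show ?thesis using z[OF that]
      by (simp add: columns3_mult quad_add[OF f] quad_scale[OF f] polar_add_left[OF f] polar_add_right[OF f] polar_scale_left[OF f]
          polar_scale_right[OF f] algebra_simps)
  qed
  have nz: "polar q o2 o3 \<noteq> 0" "polar q o1 o3 \<noteq> 0" "polar q o1 o2 \<noteq> 0" if "q \<in> {q1, q2, q3}" for q
  proof -
    have "smoothq (\<lambda>v. 1 * q (?C *v v))" using that s by (intro smoothq_subst iC) auto
    from smoothq_hollow[OF this, of "polar q o2 o3" "polar q o1 o3" "polar q o1 o2"]
    show "polar q o2 o3 \<noteq> 0" "polar q o1 o3 \<noteq> 0" "polar q o1 o2 \<noteq> 0" using E[OF that] by auto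
  qed
  define a b c where abc: "a = polar q1 o2 o3" "b = polar q1 o1 o3" "c = polar q1 o1 o2"
  define a' b' c' where abc': "a' = polar q2 o2 o3" "b' = polar q2 o1 o3" "c' = polar q2 o1 o2"
  define a'' b'' c'' where abc'': "a'' = polar q3 o2 o3" "b'' = polar q3 o1 o3" "c'' = polar q3 o1 o2"
  have n1: "a \<noteq> 0" "b \<noteq> 0" "c \<noteq> 0" "a' \<noteq> 0" "b' \<noteq> 0" "c' \<noteq> 0" "a'' \<noteq> 0" "b'' \<noteq> 0" "c'' \<noteq> 0"
    using nz[of q1] nz[of q2] nz[of q3] unfolding abc abc' abc'' by auto
  have t': "a * b' = b * a'" using t by (simp add: abc abc')
  define D where "D = columns3 (vec3 a 0 0) (vec3 0 b 0) (vec3 0 0 c)"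
  have "invertible D" using n1 unfolding D_def by (simp add: invertible_columns3 det3_def)
  then have iD: "invertible (?C ** D)" using iC invertible_mult by blast
  have Dv: "D *v v = vec3 (a * v $ 1) (b * v $ 2) (c * v $ 3)" for v
    by (simp add: D_def columns3_mult vec3_eq_iff)
  have CD: "q ((?C ** D) *v v) = polar q o2 o3 * (b * v $ 2) * (c * v $ 3) + polar q o1 o3 * (a * v $ 1) * (c * v $ 3)
      + polar q o1 o2 * (a * v $ 1) * (b * v $ 2)" if "q \<in> {q1, q2, q3}" for q v
    using E[OF that, of "D *v v"] by (simp add: matrix_vector_mul_assoc[symmetric] Dv)
  show False
  proof (rule three_common_points_core[where k = "a' * c / (a * c')" and \<beta> = "a'' * c / (a * c'')" and \<alpha> = "b'' * c / (b * c'')"])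
    show "arrangement (\<lambda>v. 1 / (a * b * c) * q1 ((?C ** D) *v v)) (\<lambda>v. 1 / (a * b * c') * q2 ((?C ** D) *v v))
        (\<lambda>v. 1 / (a * b * c'') * q3 ((?C ** D) *v v))"
      using n1 by (intro arrangement_subst arr iD) auto
    show "1 / (a * b * c) * q1 ((?C ** D) *v v) = v $ 2 * v $ 3 + v $ 1 * v $ 3 + v $ 1 * v $ 2" for v
      using n1 unfolding CD[OF insertI1] by (simp add: abc[symmetric] field_simps)
    show "1 / (a * b * c') * q2 ((?C ** D) *v v) = a' * c / (a * c') * v $ 2 * v $ 3 + a' * c / (a * c') * v $ 1 * v $ 3 + v $ 1 * v $ 2" for v
    proof -
      have "b' = b * a' / a" using t' n1 by (simp add: field_simps)
      then show ?thesis
        using n1 unfolding CD[OF insertI2[OF insertI1]] by (simp add: abc'[symmetric] field_simps)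
    qed
    show "1 / (a * b * c'') * q3 ((?C ** D) *v v) = a'' * c / (a * c'') * v $ 2 * v $ 3 + b'' * c / (b * c'') * v $ 1 * v $ 3 + v $ 1 * v $ 2" for v
      using n1 unfolding CD[OF insertI2[OF insertI2[OF insertI1]]] by (simp add: abc''[symmetric] field_simps)
  qed (use n1 in auto)
qed

section \<open>The six arrangements\<close>

definition zset :: "(complex ^ 3 \<Rightarrow> complex) \<Rightarrow> (complex ^ 3) set" where
  "zset q = {v. v \<noteq> 0 \<and> q v = 0}"

text \<open>The six triples written over \<open>std\<close>, with \<open>w\<close> for the square
  root of -3: the arguments below use nothing of it but \<open>w ^ 2 = - 3\<close>.\<close>

definition models :: "complex \<Rightarrow> ((complex ^ 3 \<Rightarrow> complex) \<times> (complex ^ 3 \<Rightarrow> complex) \<times> (complex ^ 3 \<Rightarrow> complex)) set" where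
  "models w = {
    (std, \<lambda>v. std v - 2 * v $ 1 * v $ 2, \<lambda>v. std v + 2 * v $ 1 * v $ 3),
    (std, \<lambda>v. 3 * std v + v $ 2 ^ 2 + 3 * v $ 1 * v $ 2, \<lambda>v. std v + 27 * v $ 3 ^ 2 + 9 * v $ 1 * v $ 3),
    (std, \<lambda>v. std v + w * v $ 3 ^ 2, \<lambda>v. 8 * std v - 3 * (w + 1) * v $ 2 ^ 2 + 8 * w * v $ 1 * v $ 2),
    (std, \<lambda>v. std v - 2 * v $ 3 ^ 2, \<lambda>v. 2 * std v - v $ 2 ^ 2),
    (std, \<lambda>v. std v + 18 * (w + 3) * v $ 2 ^ 2 - 18 * v $ 1 * v $ 2, \<lambda>v. 12 * std v + (w + 3) * v $ 1 * v $ 3),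
    (std, \<lambda>v. std v - 3 * v $ 3 ^ 2, \<lambda>v. 2 * std v + 3 * v $ 1 * v $ 2)}"

definition model_equivalent :: "complex \<Rightarrow> (complex ^ 3 \<Rightarrow> complex) \<Rightarrow> (complex ^ 3 \<Rightarrow> complex) \<Rightarrow> (complex ^ 3 \<Rightarrow> complex) \<Rightarrow> bool" where
  "model_equivalent w q1 q2 q3 \<longleftrightarrow> (\<exists>m1 m2 m3 (T :: complex ^ 3 ^ 3). (m1, m2, m3) \<in> models w \<and> invertible T \<and>
     (\<lambda>C. (*v) T ` C) ` {zset q1, zset q2, zset q3} = {zset m1, zset m2, zset m3})"

lemma model_equivalent_swap12: "model_equivalent w q2 q1 q3 \<Longrightarrow> model_equivalent w q1 q2 q3"
  unfolding model_equivalent_def by (simp add: insert_commute)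

lemma model_equivalent_swap23: "model_equivalent w q1 q3 q2 \<Longrightarrow> model_equivalent w q1 q2 q3"
  unfolding model_equivalent_def by (simp add: insert_commute)

lemma zset_subst:
  assumes "\<And>v. T *v (T' *v v) = v" "\<And>v. T' *v (T *v v) = v" "c \<noteq> 0" "\<And>v. q (T *v v) = c * p v"
  shows "(*v) T' ` zset q = zset p"
proof (intro equalityI subsetI)
  fix u assume "u \<in> (*v) T' ` zset q"
  then obtain v where v: "u = T' *v v" "v \<noteq> 0" "q v = 0" by (auto simp: zset_def)
  have "u \<noteq> 0"
  proof
    assume "u = 0"
    then have "v = 0" using assms(1)[of v] v(1) by simp
    then show False using v(2) by simp
  qed
  moreover have "p u = 0" using assms(4)[of u] assms(1)[of v] assms(3) v by simp
  ultimately show "u \<in> zset p" by (simp add: zset_def)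
next
  fix u assume u: "u \<in> zset p"
  have "T *v u \<noteq> 0"
  proof
    assume "T *v u = 0"
    then have "u = 0" using assms(2)[of u] by simp
    then show False using u by (simp add: zset_def)
  qed
  then have "T *v u \<in> zset q" using assms(4)[of u] u by (simp add: zset_def)
  then show "u \<in> (*v) T' ` zset q" using assms(2)[of u] by (metis image_eqI)
qed

lemma model_equivalentI:
  assumes "(m1, m2, m3) \<in> models w" "invertible T" "c1 \<noteq> 0" "c2 \<noteq> 0" "c3 \<noteq> 0"
    "\<And>v. q1 (T *v v) = c1 * m1 v" "\<And>v. q2 (T *v v) = c2 * m2 v" "\<And>v. q3 (T *v v) = c3 * m3 v"
  shows "model_equivalent w q1 q2 q3"
proof -
  obtain T' where T': "invertible T'" "\<And>v. T *v (T' *v v) = v" "\<And>v. T' *v (T *v v) = v"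
    using invertible_obtain_inverse[OF assms(2)] by metis
  have "(\<lambda>C. (*v) T' ` C) ` {zset q1, zset q2, zset q3} = {zset m1, zset m2, zset m3}"
    using zset_subst[of T T' c1 q1 m1] zset_subst[of T T' c2 q2 m2] zset_subst[of T T' c3 q3 m3] T' assms(3-8) by simp
  then show ?thesis unfolding model_equivalent_def using assms(1) T'(1) by blast
qed

lemma model_equivalent_subst:
  assumes c: "model_equivalent w p1 p2 p3" and T: "invertible T" "c1 \<noteq> 0" "c2 \<noteq> 0" "c3 \<noteq> 0"
    "\<And>v. q1 (T *v v) = c1 * p1 v" "\<And>v. q2 (T *v v) = c2 * p2 v" "\<And>v. q3 (T *v v) = c3 * p3 v"
  shows "model_equivalent w q1 q2 q3"
proof -
  obtain T' where T': "invertible T'" "\<And>v. T *v (T' *v v) = v" "\<And>v. T' *v (T *v v) = v"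
    using invertible_obtain_inverse[OF T(1)] by metis
  obtain m1 m2 m3 U where U: "(m1, m2, m3) \<in> models w" "invertible U"
    "(\<lambda>C. (*v) U ` C) ` {zset p1, zset p2, zset p3} = {zset m1, zset m2, zset m3}"
    using c unfolding model_equivalent_def by (elim exE conjE)
  have z: "(*v) T' ` zset q1 = zset p1" "(*v) T' ` zset q2 = zset p2" "(*v) T' ` zset q3 = zset p3"
    using zset_subst[of T T' c1 q1 p1] zset_subst[of T T' c2 q2 p2] zset_subst[of T T' c3 q3 p3] T' T(2-7) by auto
  have "(\<lambda>C. (*v) (U ** T') ` C) ` {zset q1, zset q2, zset q3} = {zset m1, zset m2, zset m3}"
    unfolding U(3)[symmetric] z[symmetric]
    by (simp add: image_image matrix_vector_mul_assoc)
  moreover have "invertible (U ** T')" using U(2) T'(1) invertible_mult by blast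
  ultimately show ?thesis unfolding model_equivalent_def using U(1) by blast
qed

text \<open>Two lines have a common point, and their product is singular there.\<close>

lemma smoothq_not_product:
  assumes "smoothq q" "form 1 l" "form 1 m"
  shows "\<exists>v. q v \<noteq> l v * m v"
proof (rule ccontr)
  assume "\<not> ?thesis"
  then have q: "q v = l v * m v" for v by auto
  obtain a b c where l: "\<And>v. l v = a * v $ 1 + b * v $ 2 + c * v $ 3" using form1E[OF assms(2)] by blast
  obtain a' b' c' where m: "\<And>v. m v = a' * v $ 1 + b' * v $ 2 + c' * v $ 3" using form1E[OF assms(3)] by blast
  \<comment> \<open>Two linear equations in three unknowns, padded by a zero row, have a nonzero
    solution.\<close>
  have "det3 (vec3 a a' 0) (vec3 b b' 0) (vec3 c c' 0) = 0" by (simp add: det3_def)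
  from det3_eq_0_imp[OF this] obtain x y z where x: "(x, y, z) \<noteq> (0, 0, 0)"
    "x *s vec3 a a' 0 + y *s vec3 b b' 0 + z *s vec3 c c' 0 = 0" by blast
  then have z: "l (vec3 x y z) = 0" "m (vec3 x y z) = 0"
    by (simp_all add: l m vec3_eq_iff algebra_simps)
  have "l (u + v) = l u + l v" "m (u + v) = m u + m v" for u v
    by (simp_all add: l m algebra_simps)
  then have "polar q (vec3 x y z) u = 0" for u
    using z unfolding polar_def q by simp
  then have "vec3 x y z = 0" using assms(1) by (auto simp: smoothq_def)
  then show False using x(1) by (simp add: vec3_eq_iff)
qed

section \<open>Solving the normal forms: pencils, explicit common points and the diagonal
  torus\<close>

lemma pencil_coefficients:
  assumes "smoothq q" "indepq std q" "form 1 l" "form 1 m" "\<And>w. q w = \<mu> * std w + k * (l w * m w)"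
  shows "\<mu> \<noteq> 0" "k \<noteq> 0"
proof -
  show "\<mu> \<noteq> 0"
  proof
    assume "\<mu> = 0"
    then have "q w = (k * l w) * m w" for w using assms(5) by simp
    moreover have "form 1 (\<lambda>w. k * l w)" by (rule form_cmult[OF assms(3)])
    ultimately show False using smoothq_not_product[OF assms(1) _ assms(4)] by blast
  qed
  show "k \<noteq> 0"
  proof
    assume "k = 0"
    then have "\<forall>w. q w = \<mu> * std w" using assms(5) by simp
    then show False using assms(2) by (auto simp: indepq_def)
  qed
qed

text \<open>After the change of coordinates the triple \<open>std\<close>, \<open>f2\<close>,
  \<open>f3\<close> inherits the hypotheses of each case and hands the conclusion back.\<close>

lemma normalise:
  assumes arr: "arrangement q1 q2 q3" and T: "invertible T" "c \<noteq> 0" "\<And>v. q1 (T *v v) = c * std v"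
    and f: "\<mu> \<noteq> 0" "\<And>v. q2 (T *v v) = \<mu> * f2 v" "\<nu> \<noteq> 0" "\<And>v. q3 (T *v v) = \<nu> * f3 v"
  shows "arrangement std f2 f3" "card (common f2 f3) = card (common q2 q3)"
    "model_equivalent w std f2 f3 \<Longrightarrow> model_equivalent w q1 q2 q3" "osc q2 q3 (T *v p) (T *v r) \<Longrightarrow> osc f2 f3 p r"
    "finite (common f2 f3)"
proof -
  have e: "std = (\<lambda>v. 1 / c * q1 (T *v v))" "f2 = (\<lambda>v. 1 / \<mu> * q2 (T *v v))" "f3 = (\<lambda>v. 1 / \<nu> * q3 (T *v v))"
    using T f by auto
  show a: "arrangement std f2 f3" unfolding e by (rule arrangement_subst[OF arr T(1)]) (use T(2) f(1,3) in auto)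
  show "card (common f2 f3) = card (common q2 q3)" unfolding e by (rule card_common_subst[OF T(1)]) (use f(1,3) in auto)
  show "model_equivalent w std f2 f3 \<Longrightarrow> model_equivalent w q1 q2 q3" using model_equivalent_subst[of w std f2 f3 T c \<mu> \<nu>] T f by blast
  show "osc q2 q3 (T *v p) (T *v r) \<Longrightarrow> osc f2 f3 p r" unfolding e by (rule osc_subst[OF T(1), THEN iffD2]) (use f(1,3) in auto)
  have "arrangement f2 std f3" using a arrangement_swap12 by blast
  then have "finite (common f2 std \<union> common f2 f3)" by (rule arrangement_common)
  then show "finite (common f2 f3)" by simp
qed

text \<open>Used to force coincidences: four common points of \<open>q2\<close> and
  \<open>q3\<close> are written down, and since at most three exist two of them are equal, which is
  an equation for the parameters of the normal form.\<close>

lemma four_common_points: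
  assumes "finite (common q2 q3)" "card (common q2 q3) \<le> 3"
    "\<And>v. v \<in> {a, b, c, d} \<Longrightarrow> v \<noteq> 0 \<and> q2 v = 0 \<and> q3 v = 0"
  shows "\<not> distinct [pt a, pt b, pt c, pt d]"
proof
  assume "distinct [pt a, pt b, pt c, pt d]"
  then have "card {pt a, pt b, pt c, pt d} = 4" using distinct_card[of "[pt a, pt b, pt c, pt d]"] by simp
  moreover have "{pt a, pt b, pt c, pt d} \<subseteq> common q2 q3" using assms(3) unfolding common_def by auto
  note card_mono[OF assms(1) this]
  ultimately show False using assms(2) by linarith
qed

text \<open>The one-parameter group fixing the standard conic and the two vertices on it. It removes
  the last free parameter of each normal form.\<close>

definition torus :: "complex \<Rightarrow> complex ^ 3 ^ 3" where
  "torus s = columns3 (vec3 1 0 0) (vec3 0 s 0) (vec3 0 0 (1 / s))"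

lemma torus_mult: "torus s *v v = vec3 (v $ 1) (s * v $ 2) (v $ 3 / s)"
  by (simp add: torus_def columns3_mult vec3_eq_iff)

lemma torus_invertible: "s \<noteq> 0 \<Longrightarrow> invertible (torus s)"
  by (simp add: torus_def invertible_columns3 det3_def)

lemma std_torus: "s \<noteq> 0 \<Longrightarrow> std (torus s *v v) = std v"
  by (simp add: torus_mult std_def)

lemma model_equivalent_torus:
  assumes "(std, m2, m3) \<in> models w" "s \<noteq> 0" "c2 \<noteq> 0" "c3 \<noteq> 0"
    "\<And>v. q2 (torus s *v v) = c2 * m2 v" "\<And>v. q3 (torus s *v v) = c3 * m3 v"
  shows "model_equivalent w std q2 q3"
  using model_equivalentI[OF assms(1) torus_invertible[OF assms(2)] one_neq_zero assms(3,4)] assms std_torus by simp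

lemma polar_std_axes: "polar std (vec3 0 0 1) w = - w $ 2" "polar std (vec3 0 1 0) w = - w $ 3"
  by (simp_all add: polar_std)

lemma form_coord': "form 1 (\<lambda>w. - w $ i)"
  using form_cmult[OF form_coord, of "-1" i] by simp

lemma osc_scale:
  assumes "osc q1 q2 p r" "form 2 q1" "l \<noteq> 0" "m \<noteq> 0"
  shows "osc q1 q2 (l *s p) (m *s r)"
proof -
  have d: "det3 (l *s p) (m *s r) w = l * m * det3 p r w" for w by (simp add: det3_def algebra_simps)
  obtain \<mu> k where *: "\<forall>w. q2 w = \<mu> * q1 w + k * (polar q1 p w * det3 p r w)"
    using assms(1) by (auto simp: osc_def)
  then have "\<forall>w. q2 w = \<mu> * q1 w + (k / (l ^ 2 * m)) * (polar q1 (l *s p) w * det3 (l *s p) (m *s r) w)"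
    using assms(3,4) by (simp add: d polar_scale_left[OF assms(2)] power2_eq_square)
  moreover have "m *s r \<noteq> c *s (l *s p)" for c
  proof
    assume "m *s r = c *s (l *s p)"
    then have "r = (c * l / m) *s p" using assms(4) by (auto simp: vec3_eq_iff field_simps)
    then show False using assms(1) by (auto simp: osc_def)
  qed
  moreover have "l *s p \<noteq> 0" "m *s r \<noteq> 0" "q1 (l *s p) = 0" "q1 (m *s r) = 0"
    using assms quad_scale[OF assms(2)] by (auto simp: osc_def)
  ultimately show ?thesis unfolding osc_def by blast
qed

lemma ct4_scale:
  assumes "ct4 q1 q2 p" "form 2 q1" "l \<noteq> 0"
  shows "ct4 q1 q2 (l *s p)"
proof -
  obtain \<mu> k where *: "\<forall>w. q2 w = \<mu> * q1 w + k * (polar q1 p w) ^ 2" using assms(1) by (auto simp: ct4_def)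
  then have "\<forall>w. q2 w = \<mu> * q1 w + (k / l ^ 2) * (polar q1 (l *s p) w) ^ 2"
    using assms(3) by (simp add: polar_scale_left[OF assms(2)] power_mult_distrib)
  moreover have "l *s p \<noteq> 0" "q1 (l *s p) = 0"
    using assms quad_scale[OF assms(2)] by (auto simp: ct4_def)
  ultimately show ?thesis unfolding ct4_def by blast
qed

text \<open>The tangents of \<open>q1\<close> and \<open>q2\<close> at \<open>p\<close> coincide, so
  up to scaling the same product of tangent and chord describes the pencil from either side;
  \<open>\<mu>\<close> is nonzero because a smooth conic is not a pair of lines.\<close>

lemma osc_commute:
  assumes "osc q1 q2 p r" "smoothq q1" "smoothq q2"
  shows "osc q2 q1 p r"
proof -
  note f = smoothq_form[OF assms(2)] smoothq_form[OF assms(3)]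
  obtain \<mu> k where *: "\<And>w. q2 w = \<mu> * q1 w + k * (polar q1 p w * det3 p r w)"
    using assms(1) by (auto simp: osc_def)
  have z: "q1 p = 0" "q1 r = 0" using assms(1) by (auto simp: osc_def)
  have pp: "polar q1 p p = 0" using polar_self[OF f(1), of p] z by simp
  have dp: "det3 p r p = 0" "det3 p r r = 0" by (simp_all add: det3_def algebra_simps)
  have "\<mu> \<noteq> 0"
  proof
    assume "\<mu> = 0"
    then have "q2 w = (k * polar q1 p w) * det3 p r w" for w using * by simp
    moreover have "form 1 (\<lambda>w. k * polar q1 p w)"
      unfolding polar_commute[of q1 p] by (intro form_cmult form_polar_const f)
    ultimately show False using smoothq_not_product[OF assms(3) _ form_det3] by blast
  qed
  moreover have "polar q2 p w = \<mu> * polar q1 p w" for w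
  proof -
    have "det3 p r (p + w) = det3 p r w" by (simp add: det3_def algebra_simps)
    then show ?thesis
      unfolding polar_def[of q2] * polar_add_right[OF f(1)] pp dp quad_add[OF f(1)]
      using z by (simp add: algebra_simps)
  qed
  ultimately have "\<forall>w. q1 w = (1 / \<mu>) * q2 w + (- k / \<mu> ^ 2) * (polar q2 p w * det3 p r w)"
    using * by (simp add: field_simps power2_eq_square)
  moreover have "q2 p = 0" "q2 r = 0" using *[of p] *[of r] z dp by simp_all
  ultimately show ?thesis using assms(1) unfolding osc_def by blast
qed

text \<open>Leads to (iv). The other conics become \<open>std + a Y^2\<close> and
  \<open>std + b Z^2\<close>, whose common points satisfy \<open>(Z / Y)^2 = a / b\<close>. Over
  each of the two ratios lie two values of X, and they coalesce over one of them exactly if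
  \<open>a * b = 1\<close>.\<close>

lemma classified_iv:
  assumes arr: "arrangement q1 q2 q3" and c: "ct4 q1 q2 p" "ct4 q1 q3 r" "pt p \<noteq> pt r"
    and card: "card (common q2 q3) \<le> 3"
  shows "model_equivalent w q1 q2 q3"
proof -
  have s: "smoothq q1" "smoothq q2" "smoothq q3" using arr by (auto simp: arrangement_def)
  have pr: "p \<noteq> 0" "r \<noteq> 0" "q1 p = 0" "q1 r = 0" using c by (auto simp: ct4_def)
  have ne: "r \<noteq> c *s p" for c using pt_neq[OF pr(1,2) c(3)] .
  obtain T c l where T: "invertible T" "c \<noteq> 0" "l \<noteq> 0" "\<And>v. q1 (T *v v) = c * std v"
    "T *v vec3 0 0 1 = p" "T *v vec3 0 1 0 = l *s r"
    using conic_coordinates[OF s(1) pr(3,4,1) ne] by blast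
  have e1: "std = (\<lambda>v. 1 / c * q1 (T *v v))" using T by auto
  define p2 where "p2 = (\<lambda>v. 1 * q2 (T *v v))"
  define p3 where "p3 = (\<lambda>v. 1 * q3 (T *v v))"
  have a: "arrangement std p2 p3" unfolding e1 p2_def p3_def by (rule arrangement_subst[OF arr T(1)]) (use T(2) in auto)
  have "ct4 std p2 (vec3 0 0 1)" unfolding e1 p2_def by (rule ct4_subst[OF T(1), THEN iffD2]) (use c(1) T(2,5) in auto)
  then obtain \<mu> k where q2: "\<And>w. p2 w = \<mu> * std w + k * (polar std (vec3 0 0 1) w) ^ 2" by (auto simp: ct4_def)
  have "ct4 std p3 (vec3 0 1 0)" unfolding e1 p3_def
    by (rule ct4_subst[OF T(1), THEN iffD2]) (use ct4_scale[OF c(2) smoothq_form[OF s(1)] T(3)] T(2,6) in auto)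
  then obtain \<nu> k' where q3: "\<And>w. p3 w = \<nu> * std w + k' * (polar std (vec3 0 1 0) w) ^ 2" by (auto simp: ct4_def)
  have s': "smoothq p2" "smoothq p3" "indepq std p2" "indepq std p3" using a by (auto simp: arrangement_def)
  have n2: "\<mu> \<noteq> 0" "k \<noteq> 0" using pencil_coefficients[OF s'(1,3) form_coord[of 2] form_coord[of 2], of \<mu> k] q2
    by (auto simp: polar_std_axes power2_eq_square)
  have n3: "\<nu> \<noteq> 0" "k' \<noteq> 0" using pencil_coefficients[OF s'(2,4) form_coord[of 3] form_coord[of 3], of \<nu> k'] q3
    by (auto simp: polar_std_axes power2_eq_square)
  define a b where "a = k / \<mu>" and "b = k' / \<nu>"
  have ab: "a \<noteq> 0" "b \<noteq> 0" using n2 n3 by (auto simp: a_def b_def)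
  define f2 f3 where "f2 v = std v + a * v $ 2 ^ 2" and "f3 v = std v + b * v $ 3 ^ 2" for v
  have f: "q2 (T *v v) = \<mu> * f2 v" "q3 (T *v v) = \<nu> * f3 v" for v
    using q2[of v] q3[of v] n2 n3 by (simp_all add: p2_def p3_def f2_def f3_def a_def b_def polar_std_axes field_simps)
  note N = normalise[OF arr T(1,2,4) n2(1) f(1) n3(1) f(2)]
  have "a * b = 1"
  proof (rule ccontr)
    assume ab1: "a * b \<noteq> 1"
    obtain e where e: "e ^ 2 = a / b" using csquare_root by blast
    obtain x where x: "x ^ 2 = e - a" using csquare_root by blast
    obtain y where y: "y ^ 2 = - e - a" using csquare_root by blast
    have e0: "e \<noteq> 0" using e ab by auto
    have be: "b * e ^ 2 = a" using e ab by simp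
    have "e ^ 2 \<noteq> a ^ 2"
    proof
      assume "e ^ 2 = a ^ 2"
      then have "a * (a * b - 1) = 0" using be by algebra
      then show False using ab ab1 by simp
    qed
    then have "x \<noteq> 0" "y \<noteq> 0" using x y by (auto simp: power2_eq_square)
    have z: "f2 v = 0 \<and> f3 v = 0" if "v \<in> {vec3 x 1 e, vec3 (- x) 1 e, vec3 y 1 (- e), vec3 (- y) 1 (- e)}" for v
      using that x y be by (auto simp: f2_def f3_def std_def power2_eq_square)
    have "\<not> distinct [pt (vec3 x 1 e), pt (vec3 (- x) 1 e), pt (vec3 y 1 (- e)), pt (vec3 (- y) 1 (- e))]"
      by (rule four_common_points[OF N(5)]) (use N(2) card z in \<open>auto simp: vec3_eq_iff\<close>)
    then show False using \<open>x \<noteq> 0\<close> \<open>y \<noteq> 0\<close> e0 by (auto simp: pt_eq_iff vec3_eq_iff)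
  qed
  then have b: "b = 1 / a" using ab by (simp add: field_simps)
  \<comment> \<open>This torus parameter makes the coefficient of Z^2 equal to -2 and that of Y^2
    equal to -1/2; the list has the two conics in exchanged order.\<close>
  obtain s where s: "s ^ 2 = - 1 / (2 * a)" using csquare_root by blast
  have s0: "s \<noteq> 0" using s ab by auto
  have "model_equivalent w std f3 f2"
  proof (rule model_equivalent_torus[OF _ s0, of "\<lambda>v. std v - 2 * v $ 3 ^ 2" "\<lambda>v. 2 * std v - v $ 2 ^ 2" w 1 "1 / 2"])
    show "(std, \<lambda>v. std v - 2 * v $ 3 ^ 2, \<lambda>v. 2 * std v - v $ 2 ^ 2) \<in> models w" by (simp add: models_def)
    show "f3 (torus s *v v) = 1 * (std v - 2 * v $ 3 ^ 2)" for v
      using s0 ab unfolding f3_def std_torus[OF s0] by (simp add: torus_mult power_divide s b)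
    show "f2 (torus s *v v) = 1 / 2 * (2 * std v - v $ 2 ^ 2)" for v
      using s0 ab unfolding f2_def std_torus[OF s0] by (simp add: torus_mult power_mult_distrib s field_simps)
  qed simp_all
  then show ?thesis using N(3) model_equivalent_swap23 by blast
qed

text \<open>Leads to (i). The other conics become \<open>std + a X Y\<close> and
  \<open>std + b X Z\<close>. Besides the two vertices they share the points
  \<open>vec3 x b a\<close> with \<open>x ^ 2 + a * b * x - a * b = 0\<close>; at most three common
  points force a double root, whence \<open>a * b = - 4\<close>.\<close>

lemma classified_i:
  assumes arr: "arrangement q1 q2 q3" and c: "osc q1 q2 p r" "osc q1 q3 r p"
    and card: "card (common q2 q3) \<le> 3"
  shows "model_equivalent w q1 q2 q3"
proof -
  have s: "smoothq q1" "smoothq q2" "smoothq q3" using arr by (auto simp: arrangement_def)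
  note f1 = smoothq_form[OF s(1)]
  have pr: "p \<noteq> 0" "r \<noteq> 0" "q1 p = 0" "q1 r = 0" and ne: "\<And>c. r \<noteq> c *s p" using c by (auto simp: osc_def)
  obtain T c l where T: "invertible T" "c \<noteq> 0" "l \<noteq> 0" "\<And>v. q1 (T *v v) = c * std v"
    "T *v vec3 0 0 1 = p" "T *v vec3 0 1 0 = l *s r"
    using conic_coordinates[OF s(1) pr(3,4,1) ne] by blast
  have e1: "std = (\<lambda>v. 1 / c * q1 (T *v v))" using T by auto
  define p2 where "p2 = (\<lambda>v. 1 * q2 (T *v v))"
  define p3 where "p3 = (\<lambda>v. 1 * q3 (T *v v))"
  have a: "arrangement std p2 p3" unfolding e1 p2_def p3_def by (rule arrangement_subst[OF arr T(1)]) (use T(2) in auto)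
  have "osc std p2 (vec3 0 0 1) (vec3 0 1 0)"
    unfolding e1 p2_def
    by (rule osc_subst[OF T(1), THEN iffD2]) (use osc_scale[OF c(1) f1 one_neq_zero T(3)] T(2,5,6) in auto)
  then obtain \<mu> k where q2: "\<And>w. p2 w = \<mu> * std w + k * (polar std (vec3 0 0 1) w * det3 (vec3 0 0 1) (vec3 0 1 0) w)"
    by (auto simp: osc_def)
  have "osc std p3 (vec3 0 1 0) (vec3 0 0 1)"
    unfolding e1 p3_def
    by (rule osc_subst[OF T(1), THEN iffD2]) (use osc_scale[OF c(2) f1 T(3) one_neq_zero] T(2,5,6) in auto)
  then obtain \<nu> k' where q3: "\<And>w. p3 w = \<nu> * std w + k' * (polar std (vec3 0 1 0) w * det3 (vec3 0 1 0) (vec3 0 0 1) w)"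
    by (auto simp: osc_def)
  have q2': "p2 w = \<mu> * std w + k * (w $ 1 * w $ 2)" and q3': "p3 w = \<nu> * std w + (- k') * (w $ 1 * w $ 3)" for w
    unfolding q2 q3 by (simp_all add: polar_std_axes det3_def)
  have s': "smoothq p2" "smoothq p3" "indepq std p2" "indepq std p3" using a by (auto simp: arrangement_def)
  note n2 = pencil_coefficients[OF s'(1,3) form_coord form_coord q2']
  note n3 = pencil_coefficients[OF s'(2,4) form_coord form_coord q3']
  define a b where "a = k / \<mu>" and "b = - k' / \<nu>"
  have ab: "a \<noteq> 0" "b \<noteq> 0" using n2 n3 by (auto simp: a_def b_def)
  define f2 f3 where "f2 v = std v + a * v $ 1 * v $ 2" and "f3 v = std v + b * v $ 1 * v $ 3" for v
  have f: "q2 (T *v v) = \<mu> * f2 v" "q3 (T *v v) = \<nu> * f3 v" for v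
    using q2'[of v] q3'[of v] n2(1) n3(1)
    by (simp_all add: p2_def p3_def f2_def f3_def a_def b_def distrib_left right_diff_distrib)
  note N = normalise[OF arr T(1,2,4) n2(1) f(1) n3(1) f(2)]
  obtain x where x: "1 * x ^ 2 + (a * b) * x + (- a * b) = 0"
    using quadratic_root[OF one_neq_zero, of "a * b" "- a * b"] by blast
  define y where "y = - a * b - x"
  have x0: "x \<noteq> 0" using x ab by auto
  have xy: "x * y = - a * b" using x unfolding y_def by algebra
  then have y0: "y \<noteq> 0" using ab by auto
  have y: "1 * y ^ 2 + (a * b) * y + (- a * b) = 0" using x unfolding y_def by algebra
  have "x = y"
  proof (rule ccontr)
    assume "x \<noteq> y"
    have z: "f2 v = 0 \<and> f3 v = 0" if "v \<in> {vec3 x b a, vec3 y b a, vec3 0 1 0, vec3 0 0 1}" for v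
      using that x y by (auto simp: f2_def f3_def std_def algebra_simps)
    have "\<not> distinct [pt (vec3 x b a), pt (vec3 y b a), pt (vec3 0 1 0), pt (vec3 0 0 1)]"
      by (rule four_common_points[OF N(5)]) (use N(2) card z ab in \<open>auto simp: vec3_eq_iff\<close>)
    then show False using ab x0 y0 \<open>x \<noteq> y\<close> by (auto simp: pt_eq_iff vec3_eq_iff)
  qed
  then have yx: "y = x" by simp
  have e: "a * b = - 2 * x" using y_def unfolding yx by algebra
  have e': "x ^ 2 = - a * b" using xy unfolding yx by algebra
  have "x * (x - 2) = 0" using e e' by algebra
  then have x2: "x = 2" using x0 by simp
  have "a * b = - 4" using e unfolding x2 by simp
  then have b: "b = - 4 / a" using ab by (simp add: field_simps)
  have "model_equivalent w std f2 f3"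
  proof (rule model_equivalent_torus[of "\<lambda>v. std v - 2 * v $ 1 * v $ 2" "\<lambda>v. std v + 2 * v $ 1 * v $ 3" w "- 2 / a" 1 1])
    show "(std, \<lambda>v. std v - 2 * v $ 1 * v $ 2, \<lambda>v. std v + 2 * v $ 1 * v $ 3) \<in> models w" by (simp add: models_def)
    have s0: "- 2 / a \<noteq> 0" using ab by simp
    show "f2 (torus (- 2 / a) *v v) = 1 * (std v - 2 * v $ 1 * v $ 2)" for v
      using ab unfolding f2_def std_torus[OF s0] by (simp add: torus_mult field_simps)
    show "f3 (torus (- 2 / a) *v v) = 1 * (std v + 2 * v $ 1 * v $ 3)" for v
      using ab unfolding f3_def std_torus[OF s0] by (simp add: torus_mult b field_simps)
  qed (use ab in simp_all)
  then show ?thesis using N(3) by blast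
qed

text \<open>On the parametrized conic the tangent at \<open>phi a\<close> restricts to -(x - a)^2
  and the chord to a Vandermonde product, so contact of order 3 becomes a triple root. The value at
  infinity fixes the leading coefficient.\<close>

lemma osc_cubic:
  assumes "osc std q p r" "form 2 q" "q (vec3 0 1 0) = b" "b \<noteq> 0"
  obtains a d l m where "\<And>x. q (phi x) = b * ((x - a) ^ 3 * (x - d))" "a \<noteq> d" "l \<noteq> 0" "m \<noteq> 0"
    "p = l *s phi a" "r = m *s phi d"
proof -
  obtain \<mu> k where *: "\<And>w. q w = \<mu> * std w + k * (polar std p w * det3 p r w)"
    using assms(1) by (auto simp: osc_def)
  have pr: "p \<noteq> 0" "r \<noteq> 0" "std p = 0" "std r = 0" "\<And>c. r \<noteq> c *s p" using assms(1) by (auto simp: osc_def)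
  have "polar std p p = 0" using pr by (simp add: polar_self[OF form_std])
  then have qz: "q p = 0" "q r = 0" using *[of p] *[of r] pr by (simp_all add: det3_def)
  have fin: "\<exists>l x. l \<noteq> 0 \<and> v = l *s phi x" if v: "v \<noteq> 0" "std v = 0" "q v = 0" for v
  proof -
    have "pt v \<noteq> pt (vec3 0 1 0)"
    proof
      assume "pt v = pt (vec3 0 1 0)"
      then obtain c where "vec3 0 1 0 = c *s v" by (auto simp: pt_eq_iff)
      then have "b = c ^ 2 * q v" using quad_scale[OF assms(2), of c v] assms(3) by simp
      then show False using v assms(4) by simp
    qed
    then obtain x where "pt (phi x) = pt v" using std_zero_cases[OF v(2,1)] by auto
    then show ?thesis by (auto simp: pt_eq_iff)
  qed
  obtain l a where l: "l \<noteq> 0" "p = l *s phi a" using fin[OF pr(1,3) qz(1)] by blast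
  obtain m d where m: "m \<noteq> 0" "r = m *s phi d" using fin[OF pr(2,4) qz(2)] by blast
  have ad: "a \<noteq> d"
  proof
    assume "a = d"
    then have "r = (m / l) *s p" using l m by (simp add: vector_smult_assoc)
    then show False using pr(5) by blast
  qed
  define K where "K = k * l ^ 2 * m * (a - d)"
  have "q (phi x) = K * ((x - a) ^ 3 * (x - d))" for x
    unfolding * polar_std det3_def l m K_def vector_smult_component phi_nth std_phi by algebra
  then have K: "q (phi x) = K * ((x - a) ^ 3 * (x - d))" for x .
  have "K = b"
  proof -
    obtain r where r: "degree r \<le> 4" "\<And>x. q (phi x) = poly r x" "coeff r 4 = b"
      using form_phi_poly[OF assms(2)] assms(3) by auto
    have "poly r x = poly (smult K ([:- a, 1:] ^ 3 * [:- d, 1:])) x" for x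
      using r(2)[of x] K[of x] by (simp add: algebra_simps)
    then have "r = smult K ([:- a, 1:] ^ 3 * [:- d, 1:])" by (intro poly_eq_poly_eq_iff[THEN iffD1]) auto
    then have "coeff r 4 = K" by (simp add: power3_eq_cube eval_nat_numeral coeff_pCons)
    then show ?thesis using r(3) by simp
  qed
  then show thesis using that[of a d l m] K ad l m by simp
qed

lemma quartic_coefficients:
  fixes a0 a1 a2 a3 a4 b0 b1 b2 b3 b4 :: complex
  assumes "\<And>x. a4 * x ^ 4 + a3 * x ^ 3 + a2 * x ^ 2 + a1 * x + a0 = b4 * x ^ 4 + b3 * x ^ 3 + b2 * x ^ 2 + b1 * x + b0"
  shows "a0 = b0" "a1 = b1" "a2 = b2" "a3 = b3" "a4 = b4"
proof -
  have "poly [:a0, a1, a2, a3, a4:] x = poly [:b0, b1, b2, b3, b4:] x" for x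
    using assms[of x] by (simp add: eval_nat_numeral algebra_simps)
  then have "[:a0, a1, a2, a3, a4:] = [:b0, b1, b2, b3, b4:]" by (intro poly_eq_poly_eq_iff[THEN iffD1]) auto
  then show "a0 = b0" "a1 = b1" "a2 = b2" "a3 = b3" "a4 = b4" by simp_all
qed

text \<open>The shear \<open>Y \<mapsto> Y + b X + k Z\<close> turns \<open>X\<^sup>2 + b X Z + k Z\<^sup>2 - Y Z\<close> into the standard conic.\<close>

definition shear :: "complex \<Rightarrow> complex \<Rightarrow> complex ^ 3 ^ 3" where
  "shear b k = columns3 (vec3 1 b 0) (vec3 0 1 0) (vec3 0 k 1)"

lemma shear_mult: "shear b k *v v = vec3 (v $ 1) (v $ 2 + b * v $ 1 + k * v $ 3) (v $ 3)"
  by (simp add: shear_def columns3_mult vec3_eq_iff algebra_simps)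

lemma shear_invertible: "invertible (shear b k)"
  by (simp add: shear_def invertible_columns3 det3_def)

lemma shear_phi: "shear b k *v phi x = vec3 x (x ^ 2 + b * x + k) 1"
  by (simp add: shear_mult vec3_eq_iff)

text \<open>Conics with this equation are images of the standard one under a shear fixing the point
  at infinity, with parametrization \<open>vec3 x (x ^ 2 + b * x + k) 1\<close>. This gives the
  triple root also for a pair in which neither conic is standard.\<close>

lemma osc_shear_cubic:
  assumes "osc q1 q p r" "\<And>v. q1 v = std v + b * v $ 1 * v $ 3 + k * v $ 3 ^ 2" "form 2 q"
    "q (vec3 0 1 0) = c" "c \<noteq> 0"
  obtains a d l m where "\<And>x. q (vec3 x (x ^ 2 + b * x + k) 1) = c * ((x - a) ^ 3 * (x - d))" "a \<noteq> d"
    "l \<noteq> 0" "m \<noteq> 0" "p = l *s vec3 a (a ^ 2 + b * a + k) 1" "r = m *s vec3 d (d ^ 2 + b * d + k) 1"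
proof -
  obtain S' where S': "\<And>v. shear b k *v (S' *v v) = v" using invertible_obtain_inverse[OF shear_invertible] by metis
  have e: "std = (\<lambda>v. 1 * q1 (shear b k *v v))"
    by (rule ext) (simp add: assms(2) shear_mult std_def power2_eq_square algebra_simps)
  have o: "osc std (\<lambda>v. 1 * q (shear b k *v v)) (S' *v p) (S' *v r)"
    unfolding e by (rule osc_subst[OF shear_invertible, THEN iffD2]) (use assms(1) S' in auto)
  have f: "form 2 (\<lambda>v. 1 * q (shear b k *v v))" by (intro form_cmult form_subst assms)
  have q: "1 * q (shear b k *v vec3 0 1 0) = c"
  proof -
    have "shear b k *v vec3 0 1 0 = vec3 0 1 0" by (simp add: shear_mult vec3_eq_iff)
    then show ?thesis using assms(4) by simp
  qed
  obtain a d l m where A: "\<And>x. 1 * q (shear b k *v phi x) = c * ((x - a) ^ 3 * (x - d))" "a \<noteq> d" "l \<noteq> 0" "m \<noteq> 0"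
    "S' *v p = l *s phi a" "S' *v r = m *s phi d" using osc_cubic[OF o f q assms(5)] by metis
  have "shear b k *v (S' *v p) = l *s (shear b k *v phi a)" "shear b k *v (S' *v r) = m *s (shear b k *v phi d)"
    unfolding A(5,6) vector_scalar_commute by simp_all
  then show thesis using that[of a d l m] A(1-4) by (simp add: S' shear_phi)
qed

text \<open>Leads to (vi). The restriction of \<open>f3\<close> to the parametrized
  \<open>f2\<close> is \<open>d * (t ^ 3 + k * t - k / d)\<close>, and infinity is a further common
  point, so the cubic must have a multiple root. Roots r, r, -2r give \<open>k = - 3 * r ^ 2\<close>
  and \<open>2 * d * r = 3\<close>, and the torus absorbs \<open>r\<close>.\<close>

lemma classified_vi:
  assumes arr: "arrangement q1 q2 q3" and c: "ct4 q1 q2 p" "osc q1 q3 r p"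
    and card: "card (common q2 q3) \<le> 3"
  shows "model_equivalent w q1 q2 q3"
proof -
  have s: "smoothq q1" "smoothq q2" "smoothq q3" using arr by (auto simp: arrangement_def)
  note f1 = smoothq_form[OF s(1)]
  have pr: "r \<noteq> 0" "p \<noteq> 0" "q1 r = 0" "q1 p = 0" and ne: "\<And>c. p \<noteq> c *s r" using c by (auto simp: osc_def)
  obtain T c l where T: "invertible T" "c \<noteq> 0" "l \<noteq> 0" "\<And>v. q1 (T *v v) = c * std v"
    "T *v vec3 0 0 1 = r" "T *v vec3 0 1 0 = l *s p"
    using conic_coordinates[OF s(1) pr(3,4,1) ne] by blast
  have e1: "std = (\<lambda>v. 1 / c * q1 (T *v v))" using T by auto
  define p2 where "p2 = (\<lambda>v. 1 * q2 (T *v v))"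
  define p3 where "p3 = (\<lambda>v. 1 * q3 (T *v v))"
  have a: "arrangement std p2 p3" unfolding e1 p2_def p3_def by (rule arrangement_subst[OF arr T(1)]) (use T(2) in auto)
  have "ct4 std p2 (vec3 0 1 0)" unfolding e1 p2_def
    by (rule ct4_subst[OF T(1), THEN iffD2]) (use ct4_scale[OF c(1) f1 T(3)] T(2,6) in auto)
  then obtain \<mu> k' where q2: "\<And>w. p2 w = \<mu> * std w + k' * (polar std (vec3 0 1 0) w) ^ 2" by (auto simp: ct4_def)
  have "osc std p3 (vec3 0 0 1) (vec3 0 1 0)" unfolding e1 p3_def
    by (rule osc_subst[OF T(1), THEN iffD2]) (use osc_scale[OF c(2) f1 one_neq_zero T(3)] T(2,5,6) in auto)
  then obtain \<nu> d' where q3: "\<And>w. p3 w = \<nu> * std w + d' * (polar std (vec3 0 0 1) w * det3 (vec3 0 0 1) (vec3 0 1 0) w)"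
    by (auto simp: osc_def)
  have q2': "p2 w = \<mu> * std w + k' * (w $ 3 * w $ 3)" and q3': "p3 w = \<nu> * std w + d' * (w $ 1 * w $ 2)" for w
    unfolding q2 q3 by (simp_all add: polar_std_axes det3_def power2_eq_square)
  have s': "smoothq p2" "smoothq p3" "indepq std p2" "indepq std p3" using a by (auto simp: arrangement_def)
  note n2 = pencil_coefficients[OF s'(1,3) form_coord form_coord q2']
  note n3 = pencil_coefficients[OF s'(2,4) form_coord form_coord q3']
  define k d where "k = k' / \<mu>" and "d = d' / \<nu>"
  have kd: "k \<noteq> 0" "d \<noteq> 0" using n2 n3 by (auto simp: k_def d_def)
  define f2 f3 where "f2 v = std v + k * v $ 3 ^ 2" and "f3 v = std v + d * v $ 1 * v $ 2" for v
  have f: "q2 (T *v v) = \<mu> * f2 v" "q3 (T *v v) = \<nu> * f3 v" for v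
    using q2'[of v] q3'[of v] n2(1) n3(1)
    by (simp_all add: p2_def p3_def f2_def f3_def k_def d_def distrib_left power2_eq_square)
  note N = normalise[OF arr T(1,2,4) n2(1) f(1) n3(1) f(2)]
  obtain x y z where xyz: "\<And>t. t ^ 3 + 0 * t ^ 2 + k * t + (- k / d) = (t - x) * (t - y) * (t - z)"
    "0 = - (x + y + z)" "k = x * y + x * z + y * z" "- k / d = - (x * y * z)"
    using linear_split3[of 0 k "- k / d"] by metis
  have kxyz: "k = d * (x * y * z)" using xyz(4) kd by (simp add: field_simps)
  have root: "f2 (vec3 t (t ^ 2 + k) 1) = 0 \<and> f3 (vec3 t (t ^ 2 + k) 1) = 0" if "t \<in> {x, y, z}" for t
  proof -
    have "t ^ 3 + k * t = k / d" using xyz(1)[of t] that by (auto simp: add_eq_0_iff)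
    then have "d * (t ^ 3 + k * t) = k" using kd by simp
    then have "f3 (vec3 t (t ^ 2 + k) 1) = 0"
      unfolding f3_def std_def by (simp add: power2_eq_square power3_eq_cube algebra_simps)
    then show ?thesis by (simp add: f2_def std_def)
  qed
  have "\<not> distinct [x, y, z]"
  proof
    assume "distinct [x, y, z]"
    moreover have "\<not> distinct [pt (vec3 0 1 0), pt (vec3 x (x ^ 2 + k) 1), pt (vec3 y (y ^ 2 + k) 1), pt (vec3 z (z ^ 2 + k) 1)]"
    proof (rule four_common_points[OF N(5)])
      fix v assume "v \<in> {vec3 0 1 0, vec3 x (x\<^sup>2 + k) 1, vec3 y (y\<^sup>2 + k) 1, vec3 z (z\<^sup>2 + k) 1}"
      then show "v \<noteq> 0 \<and> f2 v = 0 \<and> f3 v = 0"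
        using root[of x] root[of y] root[of z] by (auto simp: vec3_eq_iff f2_def f3_def std_def)
    qed (use N(2) card in simp)
    ultimately show False by (auto simp: pt_eq_iff vec3_eq_iff)
  qed
  then have "\<exists>r. k = - 3 * r ^ 2 \<and> 2 * d * r = 3"
  proof -
    have *: "k = - 3 * r ^ 2 \<and> 2 * d * r = 3" if t: "t = - 2 * r" and k: "k = r * r + r * t + r * t" and k': "k = d * (r * r * t)" for r t
    proof -
      have 1: "k = - 3 * r ^ 2" using k unfolding t by algebra
      then have r: "r \<noteq> 0" using kd by auto
      have "r ^ 2 * (2 * d * r - 3) = 0" using k' 1 unfolding t by algebra
      then have "2 * d * r - 3 = 0" using r by simp
      then show ?thesis using 1 by simp
    qed
    from \<open>\<not> distinct [x, y, z]\<close> consider "y = x" | "z = x" | "z = y" by auto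
    then show ?thesis
    proof cases
      case 1
      have "z = - 2 * x" using xyz(2) unfolding 1 by algebra
      then show ?thesis using *[of z x] xyz(3) kxyz unfolding 1 by (metis add.commute add.left_commute mult.commute mult.left_commute)
    next
      case 2
      have "y = - 2 * x" using xyz(2) unfolding 2 by algebra
      then show ?thesis using *[of y x] xyz(3) kxyz unfolding 2 by (metis add.commute add.left_commute mult.commute mult.left_commute)
    next
      case 3
      have "x = - 2 * y" using xyz(2) unfolding 3 by algebra
      then show ?thesis using *[of x y] xyz(3) kxyz unfolding 3 by (metis add.commute add.left_commute mult.commute mult.left_commute)
    qed
  qed
  then obtain t where t: "k = - 3 * t ^ 2" "2 * d * t = 3" by blast
  have t0: "t \<noteq> 0" using t(2) by auto
  have d: "d = 3 / (2 * t)" using t(2) t0 by (simp add: field_simps)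
  have "model_equivalent w std f2 f3"
  proof (rule model_equivalent_torus[of "\<lambda>v. std v - 3 * v $ 3 ^ 2" "\<lambda>v. 2 * std v + 3 * v $ 1 * v $ 2" w t 1 "1 / 2"])
    show "(std, \<lambda>v. std v - 3 * v $ 3 ^ 2, \<lambda>v. 2 * std v + 3 * v $ 1 * v $ 2) \<in> models w" by (simp add: models_def)
    show "f2 (torus t *v v) = 1 * (std v - 3 * v $ 3 ^ 2)" for v
      using t0 unfolding f2_def std_torus[OF t0] t(1) by (simp add: torus_mult power_divide)
    show "f3 (torus t *v v) = 1 / 2 * (2 * std v + 3 * v $ 1 * v $ 2)" for v
      using t0 unfolding f3_def std_torus[OF t0] d by (simp add: torus_mult field_simps)
  qed (use t0 in simp_all)
  then show ?thesis using N(3) by blast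
qed

text \<open>The family of solutions found for (iii): \<open>c\<close> is the torus parameter, and
  \<open>w ^ 2 = - 3\<close> matches the third form up to the factor
  \<open>c ^ 2 * (w - 1) / 12\<close>.\<close>

lemma model_iii:
  assumes w: "w ^ 2 = - 3" and c: "c \<noteq> 0"
    and f2: "\<And>v. f2 v = std v + c ^ 2 * w * v $ 3 ^ 2"
    and f3: "\<And>v. f3 v = c ^ 2 * (2 * w - 2) / 3 * std v + v $ 2 ^ 2 - c * (6 + 2 * w) / 3 * v $ 1 * v $ 2"
  shows "model_equivalent w std f2 f3"
proof (rule model_equivalent_torus[of "\<lambda>v. std v + w * v $ 3 ^ 2" "\<lambda>v. 8 * std v - 3 * (w + 1) * v $ 2 ^ 2 + 8 * w * v $ 1 * v $ 2" w c 1 "c ^ 2 * (w - 1) / 12"])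
  show "(std, \<lambda>v. std v + w * v $ 3 ^ 2, \<lambda>v. 8 * std v - 3 * (w + 1) * v $ 2 ^ 2 + 8 * w * v $ 1 * v $ 2) \<in> models w" by (simp add: models_def)
  show "f2 (torus c *v v) = 1 * (std v + w * v $ 3 ^ 2)" for v
    using c unfolding f2 std_torus[OF c] by (simp add: torus_mult power_divide)
  show "f3 (torus c *v v) = c ^ 2 * (w - 1) / 12 * (8 * std v - 3 * (w + 1) * v $ 2 ^ 2 + 8 * w * v $ 1 * v $ 2)" for v
  proof -
    have "12 * f3 (torus c *v v) = c ^ 2 * (w - 1) * (8 * std v - 3 * (w + 1) * v $ 2 ^ 2 + 8 * w * v $ 1 * v $ 2)"
    proof -
      have f3': "3 * f3 u = c ^ 2 * (2 * w - 2) * std u + 3 * u $ 2 ^ 2 - c * (6 + 2 * w) * u $ 1 * u $ 2" for u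
        unfolding f3 by (simp add: field_simps)
      have "12 * f3 (torus c *v v) = 4 * (3 * f3 (torus c *v v))" by simp
      also have "\<dots> = c ^ 2 * (8 * w - 8) * std v + 12 * c ^ 2 * v $ 2 ^ 2 - c ^ 2 * (24 + 8 * w) * v $ 1 * v $ 2"
        unfolding f3' std_torus[OF c] by (simp add: torus_mult power_mult_distrib power2_eq_square algebra_simps)
      also have "\<dots> = c ^ 2 * (w - 1) * (8 * std v - 3 * (w + 1) * v $ 2 ^ 2 + 8 * w * v $ 1 * v $ 2)"
        using w by algebra
      finally show ?thesis .
    qed
    then show ?thesis by (simp add: field_simps)
  qed
  show "c ^ 2 * (w - 1) / 12 \<noteq> 0" using w c by auto
qed (use c in simp_all)

text \<open>Leads to (iii). The third conic restricts to the first one as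
  \<open>x ^ 3 * (x - b)\<close> and to the second one, in its own parameter, as
  \<open>(x - g) ^ 3 * (x - h)\<close>. Comparing the two quartics determines everything up to
  scaling, except for the sign of a square root of -3.\<close>

lemma classified_iii:
  assumes w: "w ^ 2 = - 3" and arr: "arrangement q1 q2 q3" and c: "ct4 q1 q2 p" "osc q1 q3 r r'" "osc q2 q3 r1 r1'"
    and p3: "q3 p \<noteq> 0"
  shows "model_equivalent w q1 q2 q3"
proof -
  have s: "smoothq q1" "smoothq q2" "smoothq q3" using arr by (auto simp: arrangement_def)
  note f1 = smoothq_form[OF s(1)]
  have pr: "r \<noteq> 0" "p \<noteq> 0" "q1 r = 0" "q1 p = 0" using c by (auto simp: osc_def ct4_def)
  have q3r: "q3 r = 0"
    using c(2) polar_self[OF f1, of r] pr by (auto simp: osc_def)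
  have ne: "p \<noteq> c *s r" for c using p3 q3r quad_scale[OF smoothq_form[OF s(3)], of c r] by auto
  obtain T c l where T: "invertible T" "c \<noteq> 0" "l \<noteq> 0" "\<And>v. q1 (T *v v) = c * std v"
    "T *v vec3 0 0 1 = r" "T *v vec3 0 1 0 = l *s p"
    using conic_coordinates[OF s(1) pr(3,4,1) ne] by blast
  obtain T' where T': "\<And>v. T *v (T' *v v) = v" using invertible_obtain_inverse[OF T(1)] by metis
  have e1: "std = (\<lambda>v. 1 / c * q1 (T *v v))" using T by auto
  define p2 where "p2 = (\<lambda>v. 1 * q2 (T *v v))"
  have a: "arrangement std p2 (\<lambda>v. 1 * q3 (T *v v))" unfolding e1 p2_def by (rule arrangement_subst[OF arr T(1)]) (use T(2) in auto)
  have "ct4 std p2 (vec3 0 1 0)" unfolding e1 p2_def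
    by (rule ct4_subst[OF T(1), THEN iffD2]) (use ct4_scale[OF c(1) f1 T(3)] T(2,6) in auto)
  then obtain \<mu> k' where q2: "\<And>w. p2 w = \<mu> * std w + k' * (polar std (vec3 0 1 0) w) ^ 2" by (auto simp: ct4_def)
  have q2': "p2 w = \<mu> * std w + k' * (w $ 3 * w $ 3)" for w
    unfolding q2 by (simp add: polar_std_axes power2_eq_square)
  have s': "smoothq p2" "indepq std p2" using a by (auto simp: arrangement_def)
  note n2 = pencil_coefficients[OF s' form_coord form_coord q2']
  define k where "k = k' / \<mu>"
  have k0: "k \<noteq> 0" using n2 by (auto simp: k_def)
  define \<nu> where "\<nu> = q3 (T *v vec3 0 1 0)"
  have nu: "\<nu> \<noteq> 0" using T(3,6) p3 quad_scale[OF smoothq_form[OF s(3)], of l p] by (simp add: \<nu>_def)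
  define f2 f3 where "f2 v = std v + k * v $ 3 ^ 2" and "f3 v = 1 / \<nu> * q3 (T *v v)" for v
  have f: "q2 (T *v v) = \<mu> * f2 v" "q3 (T *v v) = \<nu> * f3 v" for v
    using q2'[of v] n2(1) nu
    by (simp_all add: p2_def f2_def f3_def k_def distrib_left power2_eq_square)
  note N = normalise[OF arr T(1,2,4) n2(1) f(1) nu f(2)]
  have F3: "form 2 f3" unfolding f3_def[abs_def] by (intro form_cmult form_subst smoothq_form s)
  have f3e: "f3 (vec3 0 1 0) = 1" using nu by (simp add: f3_def \<nu>_def)
  have o13: "osc std f3 (vec3 0 0 1) (T' *v r')" unfolding e1 f3_def[abs_def]
    by (rule osc_subst[OF T(1), THEN iffD2]) (use c(2) T(2,5) nu T' in auto)
  have o23: "osc f2 f3 (T' *v r1) (T' *v r1')" by (rule N(4)) (use c(3) T' in simp)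
  obtain a b l' m' where ab: "\<And>x. f3 (phi x) = 1 * ((x - a) ^ 3 * (x - b))" "a \<noteq> b" "l' \<noteq> 0" "m' \<noteq> 0"
    "vec3 0 0 1 = l' *s phi a" "T' *v r' = m' *s phi b"
    by (rule osc_cubic[OF o13 F3 f3e one_neq_zero]) (rule that)
  have a0: "a = 0" using ab(3,5) by (auto simp: vec3_eq_iff)
  have f2': "f2 v = std v + 0 * v $ 1 * v $ 3 + k * v $ 3 ^ 2" for v by (simp add: f2_def)
  obtain g h l' m' where gh: "\<And>x. f3 (vec3 x (x ^ 2 + 0 * x + k) 1) = 1 * ((x - g) ^ 3 * (x - h))" "g \<noteq> h"
    "l' \<noteq> 0" "m' \<noteq> 0" "T' *v r1 = l' *s vec3 g (g ^ 2 + 0 * g + k) 1" "T' *v r1' = m' *s vec3 h (h ^ 2 + 0 * h + k) 1"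
    by (rule osc_shear_cubic[OF o23 f2' F3 f3e one_neq_zero]) (rule that)
  obtain A B C D E F where E: "\<And>v. f3 v = A * v $ 1 ^ 2 + B * v $ 2 ^ 2 + C * v $ 3 ^ 2
     + D * v $ 1 * v $ 2 + E * v $ 1 * v $ 3 + F * v $ 2 * v $ 3" using form2E[OF F3] by blast
  have B: "B = 1" using f3e E by simp
  have "1 * x ^ 4 + D * x ^ 3 + (A + F) * x ^ 2 + E * x + C = 1 * x ^ 4 + (- b) * x ^ 3 + 0 * x ^ 2 + 0 * x + 0" for x
    using ab(1)[of x] unfolding E a0 B by (simp add: eval_nat_numeral algebra_simps)
  note x1 = quartic_coefficients[OF this]
  have "1 * x ^ 4 + D * x ^ 3 + (A + F + 2 * k) * x ^ 2 + (E + D * k) * x + (C + F * k + k ^ 2)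
     = 1 * x ^ 4 + (- 3 * g - h) * x ^ 3 + (3 * g ^ 2 + 3 * g * h) * x ^ 2 + (- (g ^ 3) - 3 * g ^ 2 * h) * x + g ^ 3 * h" for x
    using gh(1)[of x] unfolding E B by (simp add: eval_nat_numeral algebra_simps)
  note x2 = quartic_coefficients[OF this]
  have F: "F = - A" using x1(3) by (simp add: eq_neg_iff_add_eq_0 add.commute)
  have 2: "2 * k = 3 * g ^ 2 + 3 * g * h" using x2(3) unfolding F by simp
  have 1: "(3 * g + h) * k = g ^ 3 + 3 * g ^ 2 * h" using x2(2,4) unfolding x1(2) by algebra
  have 0: "k ^ 2 - A * k = g ^ 3 * h" using x2(1) unfolding x1(1) F by simp
  define \<gamma> where "\<gamma> = g / 3"
  have g: "g = 3 * \<gamma>" by (simp add: \<gamma>_def)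
  have c0: "\<gamma> \<noteq> 0" using 2 k0 unfolding g by auto
  \<comment> \<open>The scale-free ratio of the surviving parameters; the equations reduce to
    \<open>w' ^ 2 = - 3\<close>.\<close>
  define w' where "w' = k / g ^ 2"
  have k: "k = 9 * \<gamma> ^ 2 * w'" using c0 unfolding w'_def g by simp
  have "\<gamma> * (h - \<gamma> * (2 * w' - 3)) = 0" using 2 unfolding k g by algebra
  then have h: "h = \<gamma> * (2 * w' - 3)" using c0 by simp
  have "\<gamma> ^ 3 * (w' ^ 2 + 3) = 0" using 1 unfolding k g h by algebra
  then have "w' ^ 2 + 3 = 0" using c0 by simp
  then have w'2: "w' ^ 2 = - 3" by algebra
  then have w'0: "w' \<noteq> 0" by auto
  have "\<gamma> ^ 2 * w' * (A - \<gamma> ^ 2 * (6 * w' - 6)) = 0" using 0 w'2 unfolding k g h by algebra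
  then have A: "A = \<gamma> ^ 2 * (6 * w' - 6)" using c0 w'0 by simp
  have D: "D = - (\<gamma> * (6 + 2 * w'))" using x2(4) unfolding g h by algebra
  have f3': "f3 v = \<gamma> ^ 2 * (6 * w' - 6) * std v + v $ 2 ^ 2 - \<gamma> * (6 + 2 * w') * v $ 1 * v $ 2" for v
    unfolding E B x1(1,2) F std_def A D by algebra
  have g0: "g \<noteq> 0" using c0 g by simp
  have "(w' - w) * (w' + w) = 0" using w w'2 by algebra
  then consider "w' = w" | "w' = - w" by (auto simp: add_eq_0_iff)
  then have "model_equivalent w std f2 f3"
  proof cases
    case 1
    show ?thesis
    proof (rule model_iii[OF w g0])
      show "f2 v = std v + g ^ 2 * w * v $ 3 ^ 2" for v by (simp add: f2_def k g 1 power_mult_distrib)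
      show "f3 v = g ^ 2 * (2 * w - 2) / 3 * std v + v $ 2 ^ 2 - g * (6 + 2 * w) / 3 * v $ 1 * v $ 2" for v
        unfolding f3' g 1 by (simp add: power_mult_distrib field_simps)
    qed
  next
    case 2
    \<comment> \<open>For the other root the first two conics trade places: \<open>U\<close> carries
      the parametrization of the standard conic to that of \<open>f2\<close>, with the parameter
      shifted by \<open>g\<close>, so pulling back along it turns \<open>f2\<close> into
      \<open>std\<close> and \<open>std\<close> into the shape that \<open>f2\<close> has for the
      root \<open>w\<close>.\<close>
    define U where "U = columns3 (vec3 1 (2 * g) 0) (vec3 0 1 0) (vec3 g (g ^ 2 + k) 1)"
    have U: "U *v v = vec3 (v $ 1 + g * v $ 3) (v $ 2 + 2 * g * v $ 1 + (g ^ 2 + k) * v $ 3) (v $ 3)" for v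
      by (simp add: U_def columns3_mult vec3_eq_iff algebra_simps)
    have iU: "invertible U" by (simp add: U_def invertible_columns3 det3_def)
    define h2 where "h2 v = std v + (- g) ^ 2 * w * v $ 3 ^ 2" for v
    define h3 where "h3 v = (- g) ^ 2 * (2 * w - 2) / 3 * std v + v $ 2 ^ 2 - (- g) * (6 + 2 * w) / 3 * v $ 1 * v $ 2" for v
    have "model_equivalent w std h2 h3" by (rule model_iii[OF w _ h2_def h3_def]) (use g0 in simp)
    then have "model_equivalent w h2 std h3" by (rule model_equivalent_swap12)
    then show ?thesis
    proof (rule model_equivalent_subst[OF _ iU one_neq_zero one_neq_zero one_neq_zero])
      show "std (U *v v) = 1 * h2 v" for v
        unfolding U std_def h2_def vector_3 k 2 g by algebra
      show "f2 (U *v v) = 1 * std v" for v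
        unfolding U std_def f2_def vector_3 by algebra
      have h3: "h3 v = \<gamma> ^ 2 * (6 * w - 6) * std v + v $ 2 ^ 2 + \<gamma> * (6 + 2 * w) * v $ 1 * v $ 2" for v
        by (simp add: h3_def g power_mult_distrib field_simps)
      show "f3 (U *v v) = 1 * h3 v" for v
        unfolding f3' h3 2 U std_def vector_3 k g using w by algebra
    qed
  qed
  then show ?thesis using N(3) by blast
qed

text \<open>The torus parameter is found from the coefficient of XZ alone:
  \<open>6 * \<beta> / s\<close> has to be \<open>(w + 3) / 12\<close>, and
  \<open>(3 - w) * (3 + w) = 12\<close>.\<close>

lemma model_v:
  assumes w: "w ^ 2 = - 3" and b: "\<beta> \<noteq> 0"
    and f2: "\<And>v. f2 v = std v + w / (12 * \<beta> ^ 2) * v $ 2 * (v $ 2 - 3 * \<beta> * (1 - w) * v $ 1)"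
    and f3: "\<And>v. f3 v = std v + 6 * \<beta> * v $ 1 * v $ 3"
  shows "model_equivalent w std f2 f3"
proof -
  have w3: "(3 - w) * (3 + w) = 12" using w by algebra
  then have n: "3 - w \<noteq> 0" and n': "3 + w \<noteq> 0" by auto
  define s where "s = 6 * \<beta> * (3 - w)"
  have s0: "s \<noteq> 0" using n b by (simp add: s_def)
  show ?thesis
  proof (rule model_equivalent_torus[of "\<lambda>v. std v + 18 * (w + 3) * v $ 2 ^ 2 - 18 * v $ 1 * v $ 2" "\<lambda>v. 12 * std v + (w + 3) * v $ 1 * v $ 3" w s 1 "1 / 12"])
    show "(std, \<lambda>v. std v + 18 * (w + 3) * v $ 2 ^ 2 - 18 * v $ 1 * v $ 2, \<lambda>v. 12 * std v + (w + 3) * v $ 1 * v $ 3) \<in> models w"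
      by (simp add: models_def)
    show "f2 (torus s *v v) = 1 * (std v + 18 * (w + 3) * v $ 2 ^ 2 - 18 * v $ 1 * v $ 2)" for v
    proof -
      have "f2 (torus s *v v) = std v + w / (12 * \<beta> ^ 2) * (s * v $ 2) * (s * v $ 2 - 3 * \<beta> * (1 - w) * v $ 1)"
        unfolding f2 std_torus[OF s0] by (simp add: torus_mult)
      also have "\<dots> = std v + 3 * w * (3 - w) * v $ 2 * ((3 - w) * v $ 2 - (1 - w) / 2 * v $ 1)"
        unfolding s_def using b by (simp add: power2_eq_square field_simps)
      also have "\<dots> = std v + 18 * (w + 3) * v $ 2 ^ 2 - 18 * v $ 1 * v $ 2"
      proof -
        have 1: "3 * w * (3 - w) * (3 - w) = 18 * (w + 3)" using w by algebra
        have 2: "3 * w * (3 - w) * (1 - w) = 36" using w by algebra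
        have "3 * w * (3 - w) * v $ 2 * ((3 - w) * v $ 2 - (1 - w) / 2 * v $ 1)
          = (3 * w * (3 - w) * (3 - w)) * v $ 2 ^ 2 - (3 * w * (3 - w) * (1 - w)) / 2 * v $ 1 * v $ 2"
          by (simp add: power2_eq_square field_simps)
        then show ?thesis unfolding 1 2 by simp
      qed
      finally show ?thesis by simp
    qed
    show "f3 (torus s *v v) = 1 / 12 * (12 * std v + (w + 3) * v $ 1 * v $ 3)" for v
    proof -
      have "6 * \<beta> / s = 1 / (3 - w)" using b by (simp add: s_def)
      also have "\<dots> = (3 + w) / ((3 - w) * (3 + w))" using n n' by simp
      finally have e: "6 * \<beta> / s = (3 + w) / 12" unfolding w3 .
      have "f3 (torus s *v v) = std v + 6 * \<beta> / s * v $ 1 * v $ 3"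
        unfolding f3 std_torus[OF s0] by (simp add: torus_mult)
      then show ?thesis unfolding e by (simp add: field_simps)
    qed
  qed (use s0 in simp_all)
qed

text \<open>Leads to (v). The common point of all three conics is put at parameter 0 and the contact
  point of \<open>q1\<close> and \<open>q3\<close> at infinity. In the parametrization of
  \<open>f3\<close>, the form \<open>f2\<close> restricts to \<open>a * x * (x - g) ^ 3\<close>, and
  comparing coefficients again leaves a quadratic equation.\<close>

lemma classified_v:
  assumes w: "w ^ 2 = - 3" and arr: "arrangement q1 q2 q3" and c: "osc q1 q2 p r" "osc q1 q3 p' p" "osc q2 q3 p'' p"
    and r: "q3 r \<noteq> 0"
  shows "model_equivalent w q1 q2 q3"
proof -
  have s: "smoothq q1" "smoothq q2" "smoothq q3" using arr by (auto simp: arrangement_def)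
  note f1 = smoothq_form[OF s(1)] and f3 = smoothq_form[OF s(3)]
  have pr: "p \<noteq> 0" "p' \<noteq> 0" "r \<noteq> 0" "q1 p = 0" "q1 p' = 0" "q1 r = 0" and ne0: "\<And>c. p \<noteq> c *s p'" and ner: "\<And>c. r \<noteq> c *s p"
    using c by (auto simp: osc_def)
  have q3p': "q3 p' = 0" using c(2) polar_self[OF f1, of p'] by (auto simp: osc_def)
  have ne: "p' \<noteq> c *s p" for c
  proof
    assume e: "p' = c *s p"
    then have "c \<noteq> 0" using pr by auto
    then have "p = (1 / c) *s p'" using e by (simp add: vector_smult_assoc)
    then show False using ne0 by blast
  qed
  obtain T c l where T: "invertible T" "c \<noteq> 0" "l \<noteq> 0" "\<And>v. q1 (T *v v) = c * std v"
    "T *v vec3 0 0 1 = p" "T *v vec3 0 1 0 = l *s p'"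
    using conic_coordinates[OF s(1) pr(4,5,1) ne] by blast
  obtain T' where T': "\<And>v. T *v (T' *v v) = v" using invertible_obtain_inverse[OF T(1)] by metis
  have e1: "std = (\<lambda>v. 1 / c * q1 (T *v v))" using T by auto
  define p2 where "p2 = (\<lambda>v. 1 * q2 (T *v v))"
  define p3 where "p3 = (\<lambda>v. 1 * q3 (T *v v))"
  have a: "arrangement std p2 p3" unfolding e1 p2_def p3_def by (rule arrangement_subst[OF arr T(1)]) (use T(2) in auto)
  have o12: "osc std p2 (vec3 0 0 1) (T' *v r)" unfolding e1 p2_def
    by (rule osc_subst[OF T(1), THEN iffD2]) (use c(1) T(2,5) T' in auto)
  have o13: "osc std p3 (vec3 0 1 0) (vec3 0 0 1)" unfolding e1 p3_def
    by (rule osc_subst[OF T(1), THEN iffD2]) (use osc_scale[OF c(2) f1 T(3) one_neq_zero] T(2,5,6) in auto)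
  obtain m \<rho> where m: "m \<noteq> 0" "T' *v r = m *s phi \<rho>"
  proof -
    have v: "T' *v r \<noteq> 0" "std (T' *v r) = 0" using o12 by (auto simp: osc_def)
    have "pt (T' *v r) \<noteq> pt (vec3 0 1 0)"
    proof
      assume "pt (T' *v r) = pt (vec3 0 1 0)"
      then obtain d where d: "d \<noteq> 0" "T' *v r = d *s vec3 0 1 0" using pt_eq_iff by metis
      then have "r = (d * l) *s p'" using T' T(6) by (metis vector_scalar_commute vector_smult_assoc)
      then show False using r q3p' quad_scale[OF f3] by simp
    qed
    then obtain x where "pt (phi x) = pt (T' *v r)" using std_zero_cases[OF v(2,1)] by auto
    then show thesis using that by (auto simp: pt_eq_iff)
  qed
  obtain \<mu> k where q2: "\<And>w. p2 w = \<mu> * std w + k * (polar std (vec3 0 0 1) w * det3 (vec3 0 0 1) (T' *v r) w)"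
    using o12 by (auto simp: osc_def)
  obtain \<nu> k' where q3: "\<And>w. p3 w = \<nu> * std w + k' * (polar std (vec3 0 1 0) w * det3 (vec3 0 1 0) (vec3 0 0 1) w)"
    using o13 by (auto simp: osc_def)
  have q2': "p2 w = \<mu> * std w + (k * m * \<rho>) * (w $ 2 * (\<rho> * w $ 1 + (-1) * w $ 2 + 0 * w $ 3))" for w
    unfolding q2 polar_std_axes m(2) det3_def by (simp add: power2_eq_square algebra_simps)
  have q3': "p3 w = \<nu> * std w + (- k') * (w $ 1 * w $ 3)" for w
    unfolding q3 by (simp add: polar_std_axes det3_def)
  have s': "smoothq p2" "smoothq p3" "indepq std p2" "indepq std p3" using a by (auto simp: arrangement_def)
  note n2 = pencil_coefficients[OF s'(1,3) form_coord form1I q2']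
  note n3 = pencil_coefficients[OF s'(2,4) form_coord form_coord q3']
  define a b where "a = - k * m * \<rho> / \<mu>" and "b = - k' / \<nu>"
  have ab: "a \<noteq> 0" "b \<noteq> 0" using n2 n3 by (auto simp: a_def b_def)
  define f2 f3 where "f2 v = std v + a * v $ 2 * (v $ 2 - \<rho> * v $ 1)" and "f3 v = std v + b * v $ 1 * v $ 3" for v
  have f: "q2 (T *v v) = \<mu> * f2 v" "q3 (T *v v) = \<nu> * f3 v" for v
  proof -
    have "\<mu> * f2 v = \<mu> * std v + (\<mu> * a) * (v $ 2 * (v $ 2 - \<rho> * v $ 1))" by (simp add: f2_def algebra_simps)
    also have "\<mu> * a = - (k * m * \<rho>)" using n2(1) by (simp add: a_def)
    finally have e: "\<mu> * f2 v = \<mu> * std v + - (k * m * \<rho>) * (v $ 2 * (v $ 2 - \<rho> * v $ 1))" .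
    have Q: "q2 (T *v v) = \<mu> * std v + (k * m * \<rho>) * (v $ 2 * (\<rho> * v $ 1 - v $ 2))" using q2'[of v] by (simp add: p2_def)
    show "q2 (T *v v) = \<mu> * f2 v" unfolding e Q by algebra
    show "q3 (T *v v) = \<nu> * f3 v"
      using q3'[of v] n3(1) by (simp add: p3_def f3_def b_def distrib_left right_diff_distrib)
  qed
  note N = normalise[OF arr T(1,2,4) n2(1) f(1) n3(1) f(2)]
  have sf: "smoothq f2" "smoothq f3" using N(1) by (auto simp: arrangement_def)
  have "osc f2 f3 (T' *v p'') (vec3 0 0 1)" by (rule N(4)) (use c(3) T' T(5) in simp)
  then have o32: "osc f3 f2 (T' *v p'') (vec3 0 0 1)" by (rule osc_commute[OF _ sf])
  have f3': "f3 v = std v + b * v $ 1 * v $ 3 + 0 * v $ 3 ^ 2" for v by (simp add: f3_def)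
  have f2e: "f2 (vec3 0 1 0) = a" by (simp add: f2_def std_def)
  obtain g h l' m' where gh: "\<And>x. f2 (vec3 x (x ^ 2 + b * x + 0) 1) = a * ((x - g) ^ 3 * (x - h))" "g \<noteq> h"
    "l' \<noteq> 0" "m' \<noteq> 0" "T' *v p'' = l' *s vec3 g (g ^ 2 + b * g + 0) 1" "vec3 0 0 1 = m' *s vec3 h (h ^ 2 + b * h + 0) 1"
    by (rule osc_shear_cubic[OF o32 f3' smoothq_form[OF sf(1)] f2e ab(1)]) (rule that)
  have h0: "h = 0" using gh(4,6) by (auto simp: vec3_eq_iff)
  have "a * x ^ 4 + a * (2 * b - \<rho>) * x ^ 3 + a * b * (b - \<rho>) * x ^ 2 + (- b) * x + 0
      = a * x ^ 4 + (- 3 * a * g) * x ^ 3 + (3 * a * g ^ 2) * x ^ 2 + (- (a * g ^ 3)) * x + 0" for x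
    using gh(1)[of x] unfolding f2_def std_def h0 vector_3 by (simp add: eval_nat_numeral algebra_simps)
  note x = quartic_coefficients[OF this]
  have "a * (2 * b - \<rho> + 3 * g) = 0" using x(4) by algebra
  then have "2 * b - \<rho> + 3 * g = 0" using ab by simp
  then have rho: "\<rho> = 2 * b + 3 * g" by algebra
  have "a * (b * (b - \<rho>) - 3 * g ^ 2) = 0" using x(3) by algebra
  then have bg: "b * (b - \<rho>) = 3 * g ^ 2" using ab by simp
  have 2: "b = a * g ^ 3" using x(2) by simp
  have g0: "g \<noteq> 0" using 2 ab by auto
  \<comment> \<open>Completes the square in \<open>b ^ 2 + 3 * b * g + 3 * g ^ 2 = 0\<close>: the
    shift by 3 makes \<open>w'\<close> a square root of -3.\<close>
  define \<beta> w' where "\<beta> = b / 6" and "w' = 3 + g / \<beta>"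
  have b6: "b = 6 * \<beta>" by (simp add: \<beta>_def)
  have be0: "\<beta> \<noteq> 0" using ab b6 by auto
  have g: "g = \<beta> * (w' - 3)" using be0 by (simp add: w'_def)
  have "\<beta> ^ 2 * (w' ^ 2 + 3) = 0" using bg unfolding rho b6 g by algebra
  then have "w' ^ 2 + 3 = 0" using be0 by simp
  then have w'2: "w' ^ 2 = - 3" by algebra
  have "\<beta> * (4 * a * \<beta> ^ 2 * w' - 1) = 0" using 2 w'2 unfolding b6 g by algebra
  then have aw: "4 * a * \<beta> ^ 2 * w' = 1" using be0 by simp
  have aw': "12 * a * \<beta> ^ 2 = - w'" using aw w'2 by algebra
  have a': "a = - w' / (12 * \<beta> ^ 2)" using aw' be0 by (simp add: field_simps)
  have rho': "\<rho> = 3 * \<beta> * (1 + w')" unfolding rho b6 g by algebra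
  have "(w' - w) * (w' + w) = 0" using w w'2 by algebra
  then consider "w' = w" | "w' = - w" by (auto simp: add_eq_0_iff)
  then have "model_equivalent w std f2 f3"
  proof cases
    case 2
    show ?thesis
      by (rule model_v[OF w be0]) (simp_all add: f2_def f3_def a' rho' b6 2)
  next
    case 1
    \<comment> \<open>Exchanges the roles of the first two conics: projectively \<open>U\<close>
      fixes the common point \<open>vec3 0 0 1\<close>, sends \<open>vec3 0 1 0\<close> to the
      contact point of \<open>f2\<close> and \<open>f3\<close>, and \<open>vec3 1 0 0\<close> to the
      intersection of the tangents of \<open>f2\<close> at these two points. The columns are scaled
      so that it carries \<open>std\<close> to \<open>f2\<close>.\<close>
    define U where "U = columns3 (vec3 (g ^ 2) 0 (2 * g + b)) (vec3 g (g * (g + b)) 1) (vec3 0 0 ((g + b) ^ 2))"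
    have U: "U *v v = vec3 (g ^ 2 * v $ 1 + g * v $ 2) (g * (g + b) * v $ 2) ((2 * g + b) * v $ 1 + v $ 2 + (g + b) ^ 2 * v $ 3)" for v
      by (simp add: U_def columns3_mult vec3_eq_iff algebra_simps)
    have gb: "g + b = \<beta> * (w' + 3)" unfolding g b6 by algebra
    have "(w' - 3) * (w' + 3) = - 12" using w'2 by algebra
    then have gb0: "g + b \<noteq> 0" using gb be0 by auto
    have iU: "invertible U" using g0 gb0 by (simp add: U_def invertible_columns3 det3_def)
    define h2 where "h2 v = std v + w / (12 * \<beta> ^ 2) * v $ 2 * (v $ 2 - 3 * \<beta> * (1 - w) * v $ 1)" for v
    define h3 where "h3 v = std v + 6 * \<beta> * v $ 1 * v $ 3" for v
    have "model_equivalent w std h2 h3" by (rule model_v[OF w be0 h2_def h3_def])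
    then have "model_equivalent w h2 std h3" by (rule model_equivalent_swap12)
    then show ?thesis
    proof (rule model_equivalent_subst[OF _ iU])
      show "g ^ 4 \<noteq> 0" "g ^ 4 \<noteq> 0" "g ^ 2 * (g + b) ^ 2 \<noteq> 0" using g0 gb0 by auto
      have I: "b ^ 2 + 3 * b * g + 3 * g ^ 2 = 0" using bg unfolding rho by algebra
      have J: "a * g ^ 3 - b = 0" using 2 by simp
      have w'a: "w / (12 * \<beta> ^ 2) = - a" unfolding a' 1 by simp
      have w'r: "3 * \<beta> * (1 - w) = - (b + 3 * g)" unfolding b6 g 1 by algebra
      have h2: "h2 v = std v - a * v $ 2 * (v $ 2 + (b + 3 * g) * v $ 1)" for v
        unfolding h2_def w'a w'r by algebra
      show "std (U *v v) = g ^ 4 * h2 v" for v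
        unfolding h2 U std_def vector_3 using I J by algebra
      show "f2 (U *v v) = g ^ 4 * std v" for v
      proof -
        have "g * f2 (U *v v) = g * (g ^ 4 * std v)"
          unfolding f2_def rho U std_def vector_3 using I J by algebra
        then show ?thesis using g0 by simp
      qed
      show "f3 (U *v v) = g ^ 2 * (g + b) ^ 2 * h3 v" for v
        unfolding f3_def h3_def b6[symmetric] U std_def vector_3 by algebra
    qed
  qed
  then show ?thesis using N(3) by blast
qed

text \<open>Leads to (ii). The contact points of \<open>q1\<close> with the other two conics are put
  at parameters 0 and infinity, the common point of all three at \<open>m\<close>. Here the
  equations for the third pair have one solution up to the torus, with no square root to
  choose.\<close>

lemma classified_ii:
  assumes arr: "arrangement q1 q2 q3" and c: "osc q1 q2 p r" "osc q1 q3 p' r" "osc q2 q3 p'' r"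
    and r: "q3 p \<noteq> 0" "q2 p' \<noteq> 0"
  shows "model_equivalent w q1 q2 q3"
proof -
  have s: "smoothq q1" "smoothq q2" "smoothq q3" using arr by (auto simp: arrangement_def)
  note f1 = smoothq_form[OF s(1)] and f3 = smoothq_form[OF s(3)]
  have pr: "p \<noteq> 0" "p' \<noteq> 0" "r \<noteq> 0" "q1 p = 0" "q1 p' = 0" "q1 r = 0" and ner: "\<And>c. r \<noteq> c *s p'"
    using c by (auto simp: osc_def)
  have q3p': "q3 p' = 0" using c(2) polar_self[OF f1, of p'] by (auto simp: osc_def)
  have ne: "p' \<noteq> c *s p" for c
  proof
    assume e: "p' = c *s p"
    then have "c \<noteq> 0" using pr by auto
    then have "q3 p = (1 / c) ^ 2 * q3 p'" using e quad_scale[OF f3, of c p] by (simp add: field_simps)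
    then show False using r(1) q3p' by simp
  qed
  obtain T c l where T: "invertible T" "c \<noteq> 0" "l \<noteq> 0" "\<And>v. q1 (T *v v) = c * std v"
    "T *v vec3 0 0 1 = p" "T *v vec3 0 1 0 = l *s p'"
    using conic_coordinates[OF s(1) pr(4,5,1) ne] by blast
  obtain T' where T': "\<And>v. T *v (T' *v v) = v" using invertible_obtain_inverse[OF T(1)] by metis
  have e1: "std = (\<lambda>v. 1 / c * q1 (T *v v))" using T by auto
  define p2 where "p2 = (\<lambda>v. 1 * q2 (T *v v))"
  define p3 where "p3 = (\<lambda>v. 1 * q3 (T *v v))"
  have a: "arrangement std p2 p3" unfolding e1 p2_def p3_def by (rule arrangement_subst[OF arr T(1)]) (use T(2) in auto)
  have o12: "osc std p2 (vec3 0 0 1) (T' *v r)" unfolding e1 p2_def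
    by (rule osc_subst[OF T(1), THEN iffD2]) (use c(1) T(2,5) T' in auto)
  have o13: "osc std p3 (vec3 0 1 0) (T' *v r)" unfolding e1 p3_def
    by (rule osc_subst[OF T(1), THEN iffD2]) (use osc_scale[OF c(2) f1 T(3) one_neq_zero] T(2,6) T' in auto)
  obtain n m where n: "n \<noteq> 0" "T' *v r = n *s phi m"
  proof -
    have v: "T' *v r \<noteq> 0" "std (T' *v r) = 0" using o12 by (auto simp: osc_def)
    have "pt (T' *v r) \<noteq> pt (vec3 0 1 0)"
    proof
      assume "pt (T' *v r) = pt (vec3 0 1 0)"
      then obtain d where d: "d \<noteq> 0" "T' *v r = d *s vec3 0 1 0" using pt_eq_iff by metis
      then show False using o13 by (auto simp: osc_def)
    qed
    then obtain x where "pt (phi x) = pt (T' *v r)" using std_zero_cases[OF v(2,1)] by auto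
    then show thesis using that by (auto simp: pt_eq_iff)
  qed
  have m0: "m \<noteq> 0"
  proof
    assume "m = 0"
    then have "T' *v r = n *s vec3 0 0 1" using n by (simp add: phi_def)
    then show False using o12 by (auto simp: osc_def)
  qed
  obtain \<mu> k where q2: "\<And>w. p2 w = \<mu> * std w + k * (polar std (vec3 0 0 1) w * det3 (vec3 0 0 1) (T' *v r) w)"
    using o12 by (auto simp: osc_def)
  obtain \<nu> k' where q3: "\<And>w. p3 w = \<nu> * std w + k' * (polar std (vec3 0 1 0) w * det3 (vec3 0 1 0) (T' *v r) w)"
    using o13 by (auto simp: osc_def)
  have q2': "p2 w = \<mu> * std w + (k * n * m) * (w $ 2 * (m * w $ 1 + (-1) * w $ 2 + 0 * w $ 3))" for w
    unfolding q2 polar_std_axes n(2) det3_def by (simp add: power2_eq_square algebra_simps)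
  have q3': "p3 w = \<nu> * std w + (- k' * n) * (w $ 3 * (1 * w $ 1 + 0 * w $ 2 + (- m) * w $ 3))" for w
    unfolding q3 polar_std_axes n(2) det3_def by (simp add: power2_eq_square algebra_simps)
  have s': "smoothq p2" "smoothq p3" "indepq std p2" "indepq std p3" using a by (auto simp: arrangement_def)
  note n2 = pencil_coefficients[OF s'(1,3) form_coord form1I q2']
  note n3 = pencil_coefficients[OF s'(2,4) form_coord form1I q3']
  define a b where "a = k * n * m / \<mu>" and "b = - k' * n / \<nu>"
  have ab: "a \<noteq> 0" "b \<noteq> 0" using n2 n3 by (auto simp: a_def b_def)
  define f2 f3 where "f2 v = std v + a * v $ 2 * (m * v $ 1 - v $ 2)" and "f3 v = std v + b * v $ 3 * (v $ 1 - m * v $ 3)" for v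
  have f: "q2 (T *v v) = \<mu> * f2 v" "q3 (T *v v) = \<nu> * f3 v" for v
  proof -
    have "\<mu> * f2 v = \<mu> * std v + (\<mu> * a) * (v $ 2 * (m * v $ 1 - v $ 2))" by (simp add: f2_def algebra_simps)
    also have "\<mu> * a = k * n * m" using n2(1) by (simp add: a_def)
    finally show "q2 (T *v v) = \<mu> * f2 v" using q2'[of v] by (simp add: p2_def)
    have "\<nu> * f3 v = \<nu> * std v + (\<nu> * b) * (v $ 3 * (v $ 1 - m * v $ 3))" by (simp add: f3_def algebra_simps)
    also have "\<nu> * b = - k' * n" using n3(1) by (simp add: b_def)
    finally show "q3 (T *v v) = \<nu> * f3 v" using q3'[of v] by (simp add: p3_def)
  qed
  note N = normalise[OF arr T(1,2,4) n2(1) f(1) n3(1) f(2)]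
  have sf: "smoothq f2" "smoothq f3" using N(1) by (auto simp: arrangement_def)
  have "osc f2 f3 (T' *v p'') (n *s phi m)" by (rule N(4)) (use c(3) T' n(2)[symmetric] in simp)
  then have o32: "osc f3 f2 (T' *v p'') (n *s phi m)" by (rule osc_commute[OF _ sf])
  have f3': "f3 v = std v + b * v $ 1 * v $ 3 + (- b * m) * v $ 3 ^ 2" for v by (simp add: f3_def power2_eq_square algebra_simps)
  have f2e: "f2 (vec3 0 1 0) = - a" by (simp add: f2_def std_def)
  have na: "- a \<noteq> 0" using ab by simp
  obtain g h l' m' where gh: "\<And>x. f2 (vec3 x (x ^ 2 + b * x + - b * m) 1) = - a * ((x - g) ^ 3 * (x - h))" "g \<noteq> h"
    "l' \<noteq> 0" "m' \<noteq> 0" "T' *v p'' = l' *s vec3 g (g ^ 2 + b * g + - b * m) 1" "n *s phi m = m' *s vec3 h (h ^ 2 + b * h + - b * m) 1"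
    by (rule osc_shear_cubic[OF o32 f3' smoothq_form[OF sf(1)] f2e na]) (rule that)
  have hm: "h = m" using gh(4,6) n(1) by (auto simp: vec3_eq_iff)
  have "(- a) * x ^ 4 + a * (m - 2 * b) * x ^ 3 + a * (3 * b * m - b ^ 2) * x ^ 2 + (a * (2 * b ^ 2 * m - b * m ^ 2) - b) * x + (b * m - a * b ^ 2 * m ^ 2)
      = (- a) * x ^ 4 + a * (3 * g + m) * x ^ 3 + (- 3 * a * (g ^ 2 + g * m)) * x ^ 2 + a * (g ^ 3 + 3 * g ^ 2 * m) * x + (- (a * g ^ 3 * m))" for x
    using gh(1)[of x] unfolding f2_def std_def hm vector_3 by (simp add: eval_nat_numeral algebra_simps)
  note x = quartic_coefficients[OF this]
  have "a * (2 * b + 3 * g) = 0" using x(4) by algebra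
  then have bg: "2 * b + 3 * g = 0" using ab by simp
  define \<gamma> where "\<gamma> = g / 2"
  have g: "g = 2 * \<gamma>" by (simp add: \<gamma>_def)
  have b: "b = - 3 * \<gamma>" using bg unfolding g by algebra
  have "a * \<gamma> * (\<gamma> - m) = 0" using x(3) unfolding b g by algebra
  moreover have "\<gamma> \<noteq> 0" using b ab by auto
  ultimately have gm: "\<gamma> = m" using ab by simp
  have "m ^ 2 * (a * m ^ 2 + 3) = 0" using x(1) unfolding b g gm by algebra
  then have "a * m ^ 2 + 3 = 0" using m0 by simp
  then have am: "a * m ^ 2 = - 3" by algebra
  have a': "a = - 3 / m ^ 2" using am m0 by (simp add: field_simps)
  have s0: "- m / 3 \<noteq> 0" using m0 by simp
  have "model_equivalent w std f2 f3"
  proof (rule model_equivalent_torus[of "\<lambda>v. 3 * std v + v $ 2 ^ 2 + 3 * v $ 1 * v $ 2" "\<lambda>v. std v + 27 * v $ 3 ^ 2 + 9 * v $ 1 * v $ 3" w "- m / 3" "1 / 3" 1])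
    show "(std, \<lambda>v. 3 * std v + v $ 2 ^ 2 + 3 * v $ 1 * v $ 2, \<lambda>v. std v + 27 * v $ 3 ^ 2 + 9 * v $ 1 * v $ 3) \<in> models w"
      by (simp add: models_def)
    show "f2 (torus (- m / 3) *v v) = 1 / 3 * (3 * std v + v $ 2 ^ 2 + 3 * v $ 1 * v $ 2)" for v
      unfolding f2_def std_torus[OF s0] a' using m0 by (simp add: torus_mult power2_eq_square field_simps)
    show "f3 (torus (- m / 3) *v v) = 1 * (std v + 27 * v $ 3 ^ 2 + 9 * v $ 1 * v $ 3)" for v
      unfolding f3_def std_torus[OF s0] b gm using m0 by (simp add: torus_mult power2_eq_square field_simps)
  qed (use s0 in simp_all)
  then show ?thesis using N(3) by blast
qed

text \<open>The Gram matrix of the three points has zero diagonal and nonzero entries elsewhere,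
  hence nonzero determinant.\<close>

lemma conic_points_independent:
  assumes q: "smoothq q" "q a = 0" "q b = 0" "q c = 0" and n: "a \<noteq> 0" "b \<noteq> 0" "c \<noteq> 0"
    and d: "pt a \<noteq> pt b" "pt a \<noteq> pt c" "pt b \<noteq> pt c"
  shows "det3 a b c \<noteq> 0"
proof
  assume "det3 a b c = 0"
  from det3_eq_0_imp[OF this] obtain x y z where xyz: "(x, y, z) \<noteq> (0, 0, 0)" "x *s a + y *s b + z *s c = 0" by blast
  note f = smoothq_form[OF q(1)]
  have ab: "polar q a b \<noteq> 0" using polar_pos_neq[OF q(1,2,3) n(1) pt_neq[OF n(1,2) d(1)]] .
  have ac: "polar q a c \<noteq> 0" using polar_pos_neq[OF q(1,2,4) n(1) pt_neq[OF n(1,3) d(2)]] .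
  have bc: "polar q b c \<noteq> 0" using polar_pos_neq[OF q(1,3,4) n(2) pt_neq[OF n(2,3) d(3)]] .
  have z: "polar q u (x *s a + y *s b + z *s c) = 0" for u using polar_0[OF f] xyz(2) by simp
  have 1: "y * polar q a b + z * polar q a c = 0" "x * polar q a b + z * polar q b c = 0" "x * polar q a c + y * polar q b c = 0"
    using z[of a] z[of b] z[of c] q(2-4) polar_self[OF f]
    by (simp_all add: polar_add_right[OF f] polar_scale_right[OF f] polar_commute[of q b a] polar_commute[of q c a] polar_commute[of q c b])
  have "2 * x * polar q a b * polar q a c = 0" using 1 by algebra
  then have x: "x = 0" using ab ac by simp
  then have "y = 0" "z = 0" using 1 bc ab by auto
  then show False using xyz(1) x by simp
qed

text \<open>With the three points as vertices, each form is XYZ times a linear form in the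
  reciprocals of the coordinates. So the fourth intersection of \<open>q1\<close> and
  \<open>q2\<close> has as reciprocals the cross product \<open>u\<close> of their coefficient
  vectors. At most three common points means that a component of \<open>u\<close> vanishes, that is,
  that \<open>q1\<close> and \<open>q2\<close> are tangent at one of the points.\<close>

lemma no_three_common_points:
  assumes arr: "arrangement q1 q2 q3" and n: "o1 \<noteq> 0" "o2 \<noteq> 0" "o3 \<noteq> 0"
    and d: "pt o1 \<noteq> pt o2" "pt o1 \<noteq> pt o3" "pt o2 \<noteq> pt o3"
    and z: "\<And>q. q \<in> {q1, q2, q3} \<Longrightarrow> q o1 = 0 \<and> q o2 = 0 \<and> q o3 = 0"
    and card: "card (common q1 q2) \<le> 3"
  shows False
proof -
  have s: "smoothq q1" "smoothq q2" "smoothq q3" using arr by (auto simp: arrangement_def)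
  have det: "det3 o1 o2 o3 \<noteq> 0" using conic_points_independent[OF s(1) _ _ _ n d] z by simp
  let ?C = "columns3 o1 o2 o3"
  have iC: "invertible ?C" using det by (simp add: invertible_columns3)
  have fin: "finite (common q1 q2)" using arrangement_common(1)[OF arr] by simp
  define a b c where abc: "a = polar q1 o2 o3" "b = polar q1 o1 o3" "c = polar q1 o1 o2"
  define a' b' c' where abc': "a' = polar q2 o2 o3" "b' = polar q2 o1 o3" "c' = polar q2 o1 o2"
  have E: "q (?C *v v) = polar q o2 o3 * v $ 2 * v $ 3 + polar q o1 o3 * v $ 1 * v $ 3 + polar q o1 o2 * v $ 1 * v $ 2"
    if "q \<in> {q1, q2, q3}" for q v
  proof -
    have f: "form 2 q" using that s smoothq_form by blast
    show ?thesis using z[OF that]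
      by (simp add: columns3_mult quad_add[OF f] quad_scale[OF f] polar_add_left[OF f] polar_add_right[OF f]
          polar_scale_left[OF f] polar_scale_right[OF f] algebra_simps)
  qed
  define u where "u = vec3 (b * c' - c * b') (c * a' - a * c') (a * b' - b * a')"
  have "u $ 1 = 0 \<or> u $ 2 = 0 \<or> u $ 3 = 0"
  proof (rule ccontr)
    assume "\<not> ?thesis"
    then have un: "u $ 1 \<noteq> 0" "u $ 2 \<noteq> 0" "u $ 3 \<noteq> 0" by auto
    let ?v = "vec3 (u $ 2 * u $ 3) (u $ 1 * u $ 3) (u $ 1 * u $ 2)"
    have "q1 (?C *v ?v) = u $ 1 * u $ 2 * u $ 3 * (a * u $ 1 + b * u $ 2 + c * u $ 3)"
      by (subst E) (simp_all add: abc[symmetric] algebra_simps)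
    moreover have "a * u $ 1 + b * u $ 2 + c * u $ 3 = 0" by (simp add: u_def algebra_simps)
    moreover have "q2 (?C *v ?v) = u $ 1 * u $ 2 * u $ 3 * (a' * u $ 1 + b' * u $ 2 + c' * u $ 3)"
      by (subst E) (simp_all add: abc'[symmetric] algebra_simps)
    moreover have "a' * u $ 1 + b' * u $ 2 + c' * u $ 3 = 0" by (simp add: u_def algebra_simps)
    ultimately have vz: "q1 (?C *v ?v) = 0" "q2 (?C *v ?v) = 0" by simp_all
    have Ce: "?C *v vec3 1 0 0 = o1" "?C *v vec3 0 1 0 = o2" "?C *v vec3 0 0 1 = o3"
      by (simp_all add: columns3_mult)
    have "pt (?C *v ?v) \<noteq> pt (?C *v e)" if "e \<in> {vec3 1 0 0, vec3 0 1 0, vec3 0 0 1}" for e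
      unfolding pt_mult[OF iC] using that un by (auto simp: pt_eq_iff vec3_eq_iff)
    then have "pt (?C *v ?v) \<noteq> pt o1" "pt (?C *v ?v) \<noteq> pt o2" "pt (?C *v ?v) \<noteq> pt o3"
      using Ce by (metis insertCI)+
    moreover have "?C *v ?v \<noteq> 0" using un unfolding invertible_mult_eq_0[OF iC] by (simp add: vec3_eq_iff)
    ultimately have "distinct [pt (?C *v ?v), pt o1, pt o2, pt o3]" using d by auto
    moreover have "\<not> distinct [pt (?C *v ?v), pt o1, pt o2, pt o3]"
      by (rule four_common_points[OF fin card]) (use vz n z \<open>?C *v ?v \<noteq> 0\<close> in auto)
    ultimately show False by blast
  qed
  then consider "b * c' = c * b'" | "c * a' = a * c'" | "a * b' = b * a'" by (auto simp: u_def)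
  then show False
  proof cases
    case 1
    have "det3 o2 o3 o1 \<noteq> 0" using det by (simp add: det3_def algebra_simps)
    from three_common_points_tangent[OF arr this] show False
      using z 1 by (simp add: abc abc' polar_commute[of q1 o3 o1] polar_commute[of q2 o3 o1] polar_commute[of q1 o2 o1] polar_commute[of q2 o2 o1])
  next
    case 2
    have "det3 o3 o1 o2 \<noteq> 0" using det by (simp add: det3_def algebra_simps)
    from three_common_points_tangent[OF arr this] show False
      using z 2 by (simp add: abc abc' polar_commute[of q1 o3 o2] polar_commute[of q2 o3 o2])
  next
    case 3
    from three_common_points_tangent[OF arr det] show False using z 3 by (simp add: abc abc')
  qed
qed

section \<open>Counting intersection points and the resulting case distinction\<close>

lemma common_elem: "P \<in> common q1 q2 \<Longrightarrow> \<exists>p. p \<noteq> 0 \<and> P = pt p \<and> q1 p = 0 \<and> q2 p = 0"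
  by (auto simp: common_def)

lemma common_single: "card (common q1 q2) = 1 \<Longrightarrow> \<exists>p. p \<noteq> 0 \<and> common q1 q2 = {pt p}"
  using common_elem by (metis card_1_singletonE insertI1)

lemma common_pair:
  assumes "card (common q1 q2) = 2" "pt a \<in> common q1 q2"
  shows "\<exists>b. b \<noteq> 0 \<and> pt a \<noteq> pt b \<and> common q1 q2 = {pt a, pt b}"
proof -
  obtain P R where PR: "common q1 q2 = {P, R}" "P \<noteq> R" using assms(1) by (auto simp: card_2_iff)
  then have "pt a = P \<or> pt a = R" using assms(2) by auto
  then obtain Q where Q: "common q1 q2 = {pt a, Q}" "pt a \<noteq> Q" using PR by (metis insert_commute)
  then obtain b where "b \<noteq> 0" "Q = pt b" using common_elem[of Q q1 q2] by blast
  then show ?thesis using Q by blast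
qed

lemma common_Int:
  assumes "form 2 q1" "form 2 q2" "form 2 q3"
  shows "common q1 q2 \<inter> common q1 q3 = common q1 q2 \<inter> common q2 q3"
proof (intro equalityI subsetI; elim IntE)
  fix P assume P: "P \<in> common q1 q2" "P \<in> common q1 q3"
  then obtain p where "p \<noteq> 0" "P = pt p" using common_elem by blast
  then show "P \<in> common q1 q2 \<inter> common q2 q3" using P pt_in_common assms by auto
next
  fix P assume P: "P \<in> common q1 q2" "P \<in> common q2 q3"
  then obtain p where "p \<noteq> 0" "P = pt p" using common_elem by blast
  then show "P \<in> common q1 q2 \<inter> common q1 q3" using P pt_in_common assms by auto
qed

text \<open>\<open>a\<close>, \<open>b\<close>, \<open>c\<close> are the numbers of intersection
  points of the pairs and \<open>t\<close> the number of points on all three conics, so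
  \<open>a + b - t\<close> counts the points on one conic. The inequalities encode the bound by
  four, the implications its sharpening in case of equality.\<close>

lemma intersection_patterns:
  fixes a b c t :: nat
  assumes "1 \<le> a" "a \<le> b" "b \<le> c" "t \<le> a" "a + b \<le> 4 + t" "a + c \<le> 4 + t" "b + c \<le> 4 + t"
    "a + b = 4 + t \<longrightarrow> c \<le> 1" "a + c = 4 + t \<longrightarrow> b \<le> 1" "b + c = 4 + t \<longrightarrow> a \<le> 1"
  shows "(a, b, t) = (1, 1, 0) \<and> c \<le> 3 \<or> (a, b, t) = (1, 1, 1) \<or> (a, b, c, t) = (1, 2, 2, 0)
    \<or> (a, b, t) = (1, 2, 1) \<and> c \<le> 3 \<or> (a, b, c, t) = (2, 2, 2, 1) \<or> (a, b, t) = (2, 2, 2) \<and> c \<le> 3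
    \<or> (a, b, c, t) = (3, 3, 3, 3)"
proof -
  have "a = 1 \<or> a = 2 \<or> a = 3 \<or> a = 4" "b = 1 \<or> b = 2 \<or> b = 3 \<or> b = 4" "t = 0 \<or> t = 1 \<or> t = 2 \<or> t = 3 \<or> t = 4"
    using assms by linarith+
  then show ?thesis using assms by (elim disjE) simp_all
qed
text \<open>Cases A, B, D and E give (iv), (iii), (vi) and (i), and case G gives (v) or (ii). In
  case A' two pairs have contact 4 at one point, which \<open>bad\<close> excludes; case H
  contradicts \<open>no_three_common_points\<close>.\<close>

lemma arrangement_sorted:
  assumes w: "w ^ 2 = - 3" and arr: "arrangement q1 q2 q3"
    and le: "card (common q1 q2) \<le> card (common q1 q3)" "card (common q1 q3) \<le> card (common q2 q3)"
  shows "model_equivalent w q1 q2 q3"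
proof -
  have s: "smoothq q1" "smoothq q2" "smoothq q3" using arr by (auto simp: arrangement_def)
  note f = smoothq_form[OF s(1)] smoothq_form[OF s(2)] smoothq_form[OF s(3)]
  have nb: "\<not> bad q1 q2 q3" "\<not> bad q1 q3 q2" "\<not> bad q2 q1 q3" "\<not> bad q2 q3 q1" "\<not> bad q3 q1 q2" "\<not> bad q3 q2 q1"
    using arr by (auto simp: arrangement_def)
  have arr2: "arrangement q2 q1 q3" and arr3: "arrangement q3 q1 q2" and arr13: "arrangement q1 q3 q2" and arr23: "arrangement q2 q3 q1"
    using arr arrangement_swap12 arrangement_swap23 by blast+
  note A1 = arrangement_common[OF arr] and A2 = arrangement_common[OF arr2] and A3 = arrangement_common[OF arr3]
  define I12 I13 I23 where I: "I12 = common q1 q2" "I13 = common q1 q3" "I23 = common q2 q3"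
  note cc = common_commute[of q2 q1] common_commute[of q3 q1] common_commute[of q3 q2]
  define t where "t = card (I12 \<inter> I13)"
  have fin: "finite I12" "finite I13" "finite I23" using A1(1) A2(1) by (auto simp: I)
  have ne: "I12 \<noteq> {}" "I13 \<noteq> {}" "I23 \<noteq> {}" unfolding I using common_empty s by blast+
  have i2: "I12 \<inter> I13 = I12 \<inter> I23" unfolding I by (rule common_Int[OF f])
  have i3: "I12 \<inter> I13 = I13 \<inter> I23" unfolding I
    using common_Int[OF f(1,3,2)] by (auto simp: cc)
  have u1: "card (I12 \<union> I13) + t = card I12 + card I13" unfolding t_def using card_Un_Int[OF fin(1,2)] by simp
  have u2: "card (I12 \<union> I23) + t = card I12 + card I23" unfolding t_def i2 using card_Un_Int[OF fin(1,3)] by simp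
  have u3: "card (I13 \<union> I23) + t = card I13 + card I23" unfolding t_def i3 using card_Un_Int[OF fin(2,3)] by simp
  have b1: "card (I12 \<union> I13) \<le> 4" "card (I12 \<union> I13) = 4 \<Longrightarrow> card I23 \<le> 1"
    using A1(2) A1(3) fin(3) unfolding I by (auto simp: card_le_Suc0_iff_eq)
  have b2: "card (I12 \<union> I23) \<le> 4" "card (I12 \<union> I23) = 4 \<Longrightarrow> card I13 \<le> 1"
    using A2(2) A2(3) fin(2) unfolding I cc by (auto simp: card_le_Suc0_iff_eq)
  have b3: "card (I13 \<union> I23) \<le> 4" "card (I13 \<union> I23) = 4 \<Longrightarrow> card I12 \<le> 1"
    using A3(2) A3(3) fin(1) unfolding I cc by (auto simp: card_le_Suc0_iff_eq)
  have t: "t \<le> card I12" "t \<le> card I13" unfolding t_def using fin by (auto intro: card_mono)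
  have pos: "card I12 \<ge> 1" "card I13 \<ge> 1" "card I23 \<ge> 1" using fin ne by (simp_all add: Suc_le_eq card_gt_0_iff)
  have le': "card I12 \<le> card I13" "card I13 \<le> card I23" using le by (simp_all add: I)
  have pat: "(card I12, card I13, t) = (1, 1, 0) \<and> card I23 \<le> 3 \<or> (card I12, card I13, t) = (1, 1, 1)
    \<or> (card I12, card I13, card I23, t) = (1, 2, 2, 0) \<or> (card I12, card I13, t) = (1, 2, 1) \<and> card I23 \<le> 3
    \<or> (card I12, card I13, card I23, t) = (2, 2, 2, 1) \<or> (card I12, card I13, t) = (2, 2, 2) \<and> card I23 \<le> 3
    \<or> (card I12, card I13, card I23, t) = (3, 3, 3, 3)"
    by (rule intersection_patterns) (use u1 u2 u3 b1 b2 b3 t pos le' in auto)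
  consider
      (A) "card I12 = 1" "card I13 = 1" "t = 0" "card I23 \<le> 3" | (A') "card I12 = 1" "card I13 = 1" "t = 1"
    | (B) "card I12 = 1" "card I13 = 2" "card I23 = 2" "t = 0" | (D) "card I12 = 1" "card I13 = 2" "card I23 \<le> 3" "t = 1"
    | (G) "card I12 = 2" "card I13 = 2" "card I23 = 2" "t = 1" | (E) "card I12 = 2" "card I13 = 2" "card I23 \<le> 3" "t = 2"
    | (H) "card I12 = 3" "card I13 = 3" "card I23 = 3" "t = 3"
    using pat by auto
  then show ?thesis
  proof cases
    case A
    obtain p where p: "p \<noteq> 0" "common q1 q2 = {pt p}" using common_single A(1) unfolding I by blast
    obtain r where r: "r \<noteq> 0" "common q1 q3 = {pt r}" using common_single A(2) unfolding I by blast
    have "pt p \<noteq> pt r" using A(3) p r unfolding t_def I by auto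
    then show ?thesis
      using classified_iv[OF arr pair_single[OF s(1,2) p] pair_single[OF s(1,3) r]] A(4) unfolding I by blast
  next
    case A'
    obtain p where p: "p \<noteq> 0" "common q1 q2 = {pt p}" using common_single A'(1) unfolding I by blast
    obtain r where r: "r \<noteq> 0" "common q1 q3 = {pt r}" using common_single A'(2) unfolding I by blast
    have "common q1 q3 = {pt p}" using A'(3) p r unfolding t_def I by (cases "pt p = pt r") auto
    from pair_single[OF s(1,3) p(1) this] have "ct4 q1 q3 p" .
    from ct4_tangent[OF this f(1)] obtain l \<mu> where l: "form 1 l" "\<And>w. q3 w = \<mu> * q1 w + polar q1 p w * l w" by blast
    have "bad q1 q2 q3" by (rule ct4_bad[OF pair_single[OF s(1,2) p] f(1) l])
    then show ?thesis using nb by blast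
  next
    case B
    obtain p where p: "p \<noteq> 0" "common q1 q2 = {pt p}" using common_single B(1) unfolding I by blast
    obtain a where "a \<noteq> 0" "pt a \<in> common q1 q3" using ne(2) common_elem unfolding I by blast
    then obtain b where ab: "a \<noteq> 0" "b \<noteq> 0" "pt a \<noteq> pt b" "common q1 q3 = {pt a, pt b}"
      using common_pair[of q1 q3 a] B(2) unfolding I by blast
    obtain c where "c \<noteq> 0" "pt c \<in> common q2 q3" using ne(3) common_elem unfolding I by blast
    then obtain d where cd: "c \<noteq> 0" "d \<noteq> 0" "pt c \<noteq> pt d" "common q2 q3 = {pt c, pt d}"
      using common_pair[of q2 q3 c] B(3) unfolding I by blast
    have "pt p \<notin> common q1 q3" using B(4) p fin unfolding t_def I by auto
    moreover have "q1 p = 0" using pt_in_common[OF f(1,2) p(1)] p(2) by simp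
    ultimately have p3: "q3 p \<noteq> 0" using pt_in_common[OF f(1,3) p(1)] by simp
    obtain e g where o13: "osc q1 q3 e g" using pair_double[OF arr13 ab] by blast
    obtain e' g' where o23: "osc q2 q3 e' g'" using pair_double[OF arr23 cd] by blast
    show ?thesis by (rule classified_iii[OF w arr pair_single[OF s(1,2) p] o13 o23 p3])
  next
    case D
    obtain p where p: "p \<noteq> 0" "common q1 q2 = {pt p}" using common_single D(1) unfolding I by blast
    have "pt p \<in> common q1 q3" using D(4) p fin unfolding t_def I by (cases "pt p \<in> common q1 q3") auto
    then obtain r where r: "r \<noteq> 0" "pt p \<noteq> pt r" "common q1 q3 = {pt p, pt r}"
      using common_pair[of q1 q3 p] D(2) unfolding I by blast
    note c4 = pair_single[OF s(1,2) p]
    from ct4_tangent[OF c4 f(1)] obtain l \<mu> where l: "form 1 l" "\<And>w. q2 w = \<mu> * q1 w + polar q1 p w * l w" by blast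
    have "\<not> osc q1 q3 p r" using osc_bad[OF _ f(1) l] nb by blast
    then have "osc q1 q3 r p" using pair_double[OF arr13 p(1) r] by blast
    then show ?thesis using classified_vi[OF arr c4] D(3) unfolding I by blast
  next
    case E
    have "card (I12 \<inter> I13) = card I12" "card (I12 \<inter> I13) = card I13" using E by (simp_all add: t_def)
    then have eq: "I12 \<inter> I13 = I12" "I12 \<inter> I13 = I13" using card_subset_eq fin by (metis inf_le1, metis inf_le2)
    obtain a where "a \<noteq> 0" "pt a \<in> common q1 q2" using ne(1) common_elem unfolding I by blast
    then obtain b where ab: "a \<noteq> 0" "b \<noteq> 0" "pt a \<noteq> pt b" "common q1 q2 = {pt a, pt b}"
      using common_pair[of q1 q2 a] E(1) unfolding I by blast
    then have ab3: "common q1 q3 = {pt a, pt b}" using eq unfolding I by simp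
    have no: "\<not> (osc q1 q2 p r \<and> osc q1 q3 p r)" for p r
    proof
      assume o: "osc q1 q2 p r \<and> osc q1 q3 p r"
      from osc_tangent[OF conjunct2[OF o]] obtain l \<mu> where l: "form 1 l" "\<And>w. q3 w = \<mu> * q1 w + polar q1 p w * l w" by blast
      have "bad q1 q2 q3" by (rule osc_bad[OF conjunct1[OF o] f(1) l])
      then show False using nb by blast
    qed
    have "(osc q1 q2 a b \<and> osc q1 q3 b a) \<or> (osc q1 q2 b a \<and> osc q1 q3 a b)"
      using pair_double[OF arr ab] pair_double[OF arr13 ab(1-3) ab3] no by blast
    then show ?thesis using classified_i[OF arr] E(3) unfolding I by blast
  next
    case G
    obtain P where P: "I12 \<inter> I13 = {P}" using G(4) unfolding t_def by (meson card_1_singletonE)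
    then obtain p where p: "p \<noteq> 0" "P = pt p" "pt p \<in> common q1 q2" "pt p \<in> common q1 q3" "pt p \<in> common q2 q3"
      using common_elem[of P q1 q2] i2 unfolding I by blast
    obtain a where a: "a \<noteq> 0" "pt p \<noteq> pt a" "common q1 q2 = {pt p, pt a}" using common_pair[OF _ p(3)] G(1) unfolding I by blast
    obtain b where b: "b \<noteq> 0" "pt p \<noteq> pt b" "common q1 q3 = {pt p, pt b}" using common_pair[OF _ p(4)] G(2) unfolding I by blast
    obtain c where c: "c \<noteq> 0" "pt p \<noteq> pt c" "common q2 q3 = {pt p, pt c}" using common_pair[OF _ p(5)] G(3) unfolding I by blast
    have az: "q1 a = 0" "q2 a = 0" using pt_in_common[OF f(1,2) a(1)] a(3) by auto
    have bz: "q1 b = 0" "q3 b = 0" using pt_in_common[OF f(1,3) b(1)] b(3) by auto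
    have cz: "q2 c = 0" "q3 c = 0" using pt_in_common[OF f(2,3) c(1)] c(3) by auto
    have "pt a \<notin> common q1 q3"
    proof
      assume "pt a \<in> common q1 q3"
      then have "pt a \<in> I12 \<inter> I13" using a(3) by (simp add: I)
      then show False using P p(2) a(2) by simp
    qed
    moreover have "pt b \<notin> common q1 q2"
    proof
      assume "pt b \<in> common q1 q2"
      then have "pt b \<in> I12 \<inter> I13" using b(3) by (simp add: I)
      then show False using P p(2) b(2) by simp
    qed
    moreover have "pt c \<notin> common q1 q2"
    proof
      assume "pt c \<in> common q1 q2"
      then have "pt c \<in> I12 \<inter> I23" using c(3) by (simp add: I)
      then have "pt c \<in> I12 \<inter> I13" unfolding i2 .
      then show False using P p(2) c(2) by simp
    qed
    ultimately have "pt a \<notin> common q1 q3" "pt b \<notin> common q1 q2" "pt c \<notin> common q1 q2" by blast+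
    then have n: "q3 a \<noteq> 0" "q2 b \<noteq> 0" "q1 c \<noteq> 0"
      using pt_in_common[OF f(1,3) a(1)] pt_in_common[OF f(1,2) b(1)] pt_in_common[OF f(1,2) c(1)] az bz cz by auto
    \<comment> \<open>Contact of order 3 at \<open>p\<close> for two pairs with a common member
      makes all three conics tangent there.\<close>
    have no: "\<not> (osc x y p u \<and> osc x z p v)" if "\<not> bad x y z" "form 2 x" for x y z u v
    proof
      assume o: "osc x y p u \<and> osc x z p v"
      from osc_tangent[OF conjunct2[OF o]] obtain l \<mu> where l: "form 1 l" "\<And>w. z w = \<mu> * x w + polar x p w * l w" by blast
      have "bad x y z" by (rule osc_bad[OF conjunct1[OF o] that(2) l])
      then show False using that(1) by blast
    qed
    have o12: "osc q1 q2 p a \<or> osc q1 q2 a p" using pair_double[OF arr p(1) a] .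
    have o13: "osc q1 q3 p b \<or> osc q1 q3 b p" using pair_double[OF arr13 p(1) b] .
    have o23: "osc q2 q3 p c \<or> osc q2 q3 c p" using pair_double[OF arr23 p(1) c] .
    \<comment> \<open>At most one pair has contact 3 at the common point \<open>p\<close>: exactly
      one gives (v), none gives (ii).\<close>
    consider "osc q1 q2 p a" | "osc q1 q3 p b" "osc q1 q2 a p" | "osc q2 q3 p c" "osc q1 q2 a p" "osc q1 q3 b p"
      | "osc q1 q2 a p" "osc q1 q3 b p" "osc q2 q3 c p" using o12 o13 o23 by blast
    then show ?thesis
    proof cases
      case 1
      have "\<not> osc q1 q3 p b" using no[OF nb(1) f(1)] 1 by blast
      then have 2: "osc q1 q3 b p" using o13 by blast
      have "\<not> osc q2 q3 p c" using no[OF nb(3) f(2)] osc_commute[OF 1 s(1,2)] by blast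
      then have 3: "osc q2 q3 c p" using o23 by blast
      show ?thesis by (rule classified_v[OF w arr 1 2 3 n(1)])
    next
      case 2
      have "\<not> osc q3 q2 p c" using no[OF nb(5) f(3)] osc_commute[OF 2(1) s(1,3)] by blast
      then have "\<not> osc q2 q3 p c" using osc_commute[OF _ s(2,3)] by blast
      then have "osc q3 q2 c p" using o23 osc_commute[OF _ s(2,3)] by blast
      from classified_v[OF w arr13 2 this n(2)] show ?thesis by (rule model_equivalent_swap23)
    next
      case 3
      from classified_v[OF w arr23 3(1) osc_commute[OF 3(2) s(1,2)] osc_commute[OF 3(3) s(1,3)] n(3)]
      have "model_equivalent w q2 q3 q1" .
      then show ?thesis using model_equivalent_swap12 model_equivalent_swap23 by blast
    next
      case 4
      show ?thesis by (rule classified_ii[OF arr 4 n(1,2)])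
    qed
  next
    case H
    have "card (I12 \<inter> I13) = 3" using H by (simp add: t_def)
    then obtain A B C where ABC: "I12 \<inter> I13 = {A, B, C}" "A \<noteq> B" "A \<noteq> C" "B \<noteq> C" by (auto simp: card_3_iff)
    then have "A \<in> I12" "A \<in> I13" "B \<in> I12" "B \<in> I13" "C \<in> I12" "C \<in> I13" by auto
    then obtain a b c where abc: "a \<noteq> 0" "A = pt a" "b \<noteq> 0" "B = pt b" "c \<noteq> 0" "C = pt c"
      using common_elem unfolding I by meson
    have z: "q a = 0 \<and> q b = 0 \<and> q c = 0" if "q \<in> {q1, q2, q3}" for q
      using that \<open>A \<in> I12\<close> \<open>A \<in> I13\<close> \<open>B \<in> I12\<close> \<open>B \<in> I13\<close> \<open>C \<in> I12\<close> \<open>C \<in> I13\<close>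
        pt_in_common[OF f(1,2)] pt_in_common[OF f(1,3)] abc unfolding I by auto
    have "card (common q1 q2) \<le> 3" using H(1) by (simp add: I)
    then show ?thesis using no_three_common_points[OF arr abc(1,3,5) _ _ _ z] ABC abc by blast
  qed
qed

lemma arrangement_classified:
  assumes w: "w ^ 2 = - 3" and arr: "arrangement q1 q2 q3"
  shows "model_equivalent w q1 q2 q3"
proof -
  note cc = common_commute
  have arr2: "arrangement q2 q1 q3" and arr3: "arrangement q3 q1 q2" and arr13: "arrangement q1 q3 q2"
    and arr23: "arrangement q2 q3 q1" and arr32: "arrangement q3 q2 q1"
    using arr arrangement_swap12 arrangement_swap23 by blast+
  let ?a = "card (common q1 q2)" and ?b = "card (common q1 q3)" and ?c = "card (common q2 q3)"
  consider "?a \<le> ?b" "?b \<le> ?c" | "?a \<le> ?c" "?c \<le> ?b" | "?b \<le> ?a" "?a \<le> ?c" | "?b \<le> ?c" "?c \<le> ?a"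
    | "?c \<le> ?a" "?a \<le> ?b" | "?c \<le> ?b" "?b \<le> ?a" by linarith
  then show ?thesis
  proof cases
    case 1
    then show ?thesis by (rule arrangement_sorted[OF w arr])
  next
    case 2
    then have "model_equivalent w q2 q1 q3" by (intro arrangement_sorted[OF w arr2]) (simp_all add: cc[of q2 q1])
    then show ?thesis by (rule model_equivalent_swap12)
  next
    case 3
    then have "model_equivalent w q1 q3 q2" by (intro arrangement_sorted[OF w arr13]) (simp_all add: cc[of q3 q2])
    then show ?thesis by (rule model_equivalent_swap23)
  next
    case 4
    then have "model_equivalent w q3 q1 q2" by (intro arrangement_sorted[OF w arr3]) (simp_all add: cc[of q3 q2] cc[of q3 q1])
    then show ?thesis using model_equivalent_swap12 model_equivalent_swap23 by blast
  next
    case 5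
    then have "model_equivalent w q2 q3 q1" by (intro arrangement_sorted[OF w arr23]) (simp_all add: cc[of q2 q1] cc[of q3 q1])
    then show ?thesis using model_equivalent_swap12 model_equivalent_swap23 by blast
  next
    case 6
    then have "model_equivalent w q3 q2 q1" by (intro arrangement_sorted[OF w arr32]) (simp_all add: cc[of q3 q2] cc[of q3 q1] cc[of q2 q1])
    then show ?thesis using model_equivalent_swap12 model_equivalent_swap23 by blast
  qed
qed

section \<open>Excluding three mutually tangent branches\<close>

lemma form1_tendsto:
  assumes "form 1 l" "\<And>i. ((\<lambda>x. d x $ i) \<longlongrightarrow> e $ i) F"
  shows "((\<lambda>x. l (d x)) \<longlongrightarrow> l e) F"
proof -
  obtain a b c where E: "\<And>v. l v = a * v $ 1 + b * v $ 2 + c * v $ 3" using form1E[OF assms(1)] by blast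
  show ?thesis unfolding E by (intro tendsto_add tendsto_mult tendsto_const tendsto_power assms(2))
qed

lemma form2_tendsto:
  assumes "form 2 q" "\<And>i. ((\<lambda>x. d x $ i) \<longlongrightarrow> e $ i) F"
  shows "((\<lambda>x. q (d x)) \<longlongrightarrow> q e) F"
proof -
  obtain a b c d' e' f where E: "\<And>v. q v = a * v $ 1 ^ 2 + b * v $ 2 ^ 2 + c * v $ 3 ^ 2
     + d' * v $ 1 * v $ 2 + e' * v $ 1 * v $ 3 + f * v $ 2 * v $ 3" using form2E[OF assms(1)] by blast
  show ?thesis unfolding E by (intro tendsto_add tendsto_mult tendsto_const tendsto_power assms(2))
qed

lemma form1_add: "form 1 l \<Longrightarrow> l (u + v) = l u + l v"
  by (erule form1E) (simp add: algebra_simps)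

lemma form1_scale: "form 1 l \<Longrightarrow> l (c *s v) = c * l v"
  by (erule form1E) (simp add: algebra_simps)

locale bad_point =
  fixes q1 q2 q3 :: "complex ^ 3 \<Rightarrow> complex" and v :: "complex ^ 3" and \<mu> \<mu>' l l'
  assumes form_q1: "form 2 q1" and form_l: "form 1 l" and form_l': "form 1 l'"
    and q1_v: "q1 v = 0" and l_v: "l v = 0"
    and q2_eq: "q2 w = \<mu> * q1 w + polar q1 v w * l w"
    and q3_eq: "q3 w = \<mu>' * q1 w + polar q1 v w * l' w"
begin

definition f where "f w = q1 w * q2 w * q3 w"

lemma form_polar_v: "form 1 (\<lambda>w. polar q1 v w)"
  using form_polar_const[OF form_q1, of v] by (simp add: polar_commute)

lemma polar_vv: "polar q1 v v = 0"
  using polar_self[OF form_q1, of v] q1_v by simp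

text \<open>\<open>polar q1 v d\<close> is the displacement transversal to the common tangent, and
  each factor is expanded in it and in \<open>q1 d\<close>. Because \<open>l v = 0\<close>, the
  factors from \<open>q1\<close> and \<open>q2\<close> differ, up to \<open>\<mu>\<close>, only by
  the higher-order term \<open>polar q1 v d * l d\<close>.\<close>

lemma f_eq: "f (v + d) = (polar q1 v d + q1 d) * (\<mu> * (polar q1 v d + q1 d) + polar q1 v d * l d) *
    (\<mu>' * (polar q1 v d + q1 d) + polar q1 v d * (l' v + l' d))"
  unfolding f_def q2_eq q3_eq quad_add[OF form_q1] polar_add_right[OF form_q1]
    form1_add[OF form_l] form1_add[OF form_l'] polar_vv q1_v l_v by (simp add: add.commute)

lemma tendsto_scaled:
  assumes "\<And>i. ((\<lambda>x. d x $ i / x) \<longlongrightarrow> e $ i) (at 0)"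
  shows "((\<lambda>x. ((1 / x) *s d x) $ i) \<longlongrightarrow> e $ i) (at (0 :: complex))"
  using assms[of i] by simp

text \<open>Weights (1, 1): the cubic part is a multiple of the cube of the common tangent.\<close>

lemma f_tendsto3:
  assumes d: "\<And>i. ((\<lambda>x. d x $ i / x) \<longlongrightarrow> e $ i) (at (0 :: complex))"
  shows "((\<lambda>x. f (v + d x) / x ^ 3) \<longlongrightarrow> \<mu> * (\<mu>' + l' v) * polar q1 v e ^ 3) (at 0)"
proof -
  let ?d = "\<lambda>x. (1 / x) *s d x"
  note t = tendsto_scaled[OF d]
  have x: "((\<lambda>x. x) \<longlongrightarrow> (0 :: complex)) (at 0)" by (rule tendsto_ident_at)
  have "((\<lambda>x. (polar q1 v (?d x) + x * q1 (?d x)) * (\<mu> * (polar q1 v (?d x) + x * q1 (?d x)) + polar q1 v (?d x) * (x * l (?d x))) *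
    (\<mu>' * (polar q1 v (?d x) + x * q1 (?d x)) + polar q1 v (?d x) * (l' v + x * l' (?d x)))) \<longlongrightarrow>
    (polar q1 v e + 0 * q1 e) * (\<mu> * (polar q1 v e + 0 * q1 e) + polar q1 v e * (0 * l e)) *
    (\<mu>' * (polar q1 v e + 0 * q1 e) + polar q1 v e * (l' v + 0 * l' e))) (at 0)"
    by (intro tendsto_intros x form1_tendsto[OF form_polar_v t] form1_tendsto[OF form_l t]
        form1_tendsto[OF form_l' t] form2_tendsto[OF form_q1 t])
  moreover have "\<forall>\<^sub>F x in at 0. (polar q1 v (?d x) + x * q1 (?d x)) * (\<mu> * (polar q1 v (?d x) + x * q1 (?d x)) + polar q1 v (?d x) * (x * l (?d x))) *
    (\<mu>' * (polar q1 v (?d x) + x * q1 (?d x)) + polar q1 v (?d x) * (l' v + x * l' (?d x))) = f (v + d x) / x ^ 3"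
    unfolding eventually_at_filter f_eq polar_scale_right[OF form_q1] quad_scale[OF form_q1] form1_scale[OF form_l] form1_scale[OF form_l']
    by (intro always_eventually allI impI) (simp add: field_simps power2_eq_square power3_eq_cube)
  ultimately show ?thesis
    by (rule Lim_transform_eventually[THEN tendsto_eq_rhs]) (simp add: power3_eq_cube algebra_simps)
qed

text \<open>Weights (2, 1): the tangential displacement has order x, the transversal one order x^2.
  To this order the first two conics are the same arc, so the leading part contains the square of
  \<open>y + q1 e\<close>.\<close>

lemma f_tendsto6:
  assumes d: "\<And>i. ((\<lambda>x. d x $ i / x) \<longlongrightarrow> e $ i) (at (0 :: complex))"
    and y: "((\<lambda>x. polar q1 v (d x) / x ^ 2) \<longlongrightarrow> y) (at 0)"
  shows "((\<lambda>x. f (v + d x) / x ^ 6) \<longlongrightarrow> (y + q1 e) * (\<mu> * (y + q1 e)) * (\<mu>' * (y + q1 e) + y * l' v)) (at 0)"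
proof -
  let ?d = "\<lambda>x. (1 / x) *s d x" and ?y = "\<lambda>x. polar q1 v (d x) / x ^ 2"
  note t = tendsto_scaled[OF d]
  have x: "((\<lambda>x. x) \<longlongrightarrow> (0 :: complex)) (at 0)" by (rule tendsto_ident_at)
  have "((\<lambda>x. (?y x + q1 (?d x)) * (\<mu> * (?y x + q1 (?d x)) + ?y x * (x * l (?d x))) *
    (\<mu>' * (?y x + q1 (?d x)) + ?y x * (l' v + x * l' (?d x)))) \<longlongrightarrow>
    (y + q1 e) * (\<mu> * (y + q1 e) + y * (0 * l e)) * (\<mu>' * (y + q1 e) + y * (l' v + 0 * l' e))) (at 0)"
    by (intro tendsto_add tendsto_mult tendsto_const x y form1_tendsto[OF form_l t]
        form1_tendsto[OF form_l' t] form2_tendsto[OF form_q1 t])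
  moreover have "\<forall>\<^sub>F x in at 0. (?y x + q1 (?d x)) * (\<mu> * (?y x + q1 (?d x)) + ?y x * (x * l (?d x))) *
    (\<mu>' * (?y x + q1 (?d x)) + ?y x * (l' v + x * l' (?d x))) = f (v + d x) / x ^ 6"
    unfolding eventually_at_filter f_eq quad_scale[OF form_q1] form1_scale[OF form_l] form1_scale[OF form_l']
    by (intro always_eventually allI impI) (simp add: field_simps eval_nat_numeral)
  ultimately show ?thesis
    by (rule Lim_transform_eventually[THEN tendsto_eq_rhs]) simp
qed

end

section \<open>Holomorphic functions of two variables along arcs\<close>

lemma holomorphic2_curve:
  assumes "(F has_derivative (\<lambda>(h, k). a * h + b * k)) (at (\<gamma> x, \<delta> x))"
    "(\<gamma> has_field_derivative c) (at x)" "(\<delta> has_field_derivative d) (at x)"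
  shows "((\<lambda>x. F (\<gamma> x, \<delta> x)) has_field_derivative a * c + b * d) (at (x :: complex))"
proof -
  have "((\<lambda>x. (\<gamma> x, \<delta> x)) has_derivative (\<lambda>h. (c * h, d * h))) (at x)"
    using assms(2,3) by (intro has_derivative_Pair) (auto simp: has_field_derivative_def)
  note has_derivative_compose[OF this assms(1)]
  moreover have "(\<lambda>h. case (c * h, d * h) of (h, k) \<Rightarrow> a * h + b * k) = (*) (a * c + b * d)"
    by (rule ext) (simp add: algebra_simps)
  ultimately show ?thesis by (simp add: has_field_derivative_def)
qed

lemma derivative_tendsto_quotient:
  assumes "(g has_field_derivative a) (at (0 :: complex))" "g 0 = 0"
  shows "((\<lambda>x. g x / x) \<longlongrightarrow> a) (at 0)"
  using assms by (simp add: has_field_derivative_iff)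

text \<open>Division by x twice: the first quotient extends holomorphically and vanishes at 0 again,
  because the derivative there is 0.\<close>

lemma second_order_tendsto:
  assumes "g holomorphic_on ball 0 r" "0 < r" "g 0 = 0" "(g has_field_derivative 0) (at (0 :: complex))"
  shows "\<exists>y. ((\<lambda>x. g x / x ^ 2) \<longlongrightarrow> y) (at 0)"
proof -
  define k where "k x = (if x = 0 then deriv g 0 else (g x - g 0) / (x - 0))" for x
  have k: "k holomorphic_on ball 0 r"
    unfolding k_def using pole_lemma_open[OF assms(1) open_ball, of 0] by simp
  have "deriv g 0 = 0" using assms(4) by (rule DERIV_imp_deriv)
  then have k0: "k 0 = 0" by (simp add: k_def)
  have "(k has_field_derivative deriv k 0) (at 0)"
    using holomorphic_derivI[OF k open_ball] assms(2) by simp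
  then have "((\<lambda>x. k x / x) \<longlongrightarrow> deriv k 0) (at 0)" using k0 by (rule derivative_tendsto_quotient)
  moreover have "\<forall>\<^sub>F x in at 0. k x / x = g x / x ^ 2"
    unfolding eventually_at_filter
    by (intro always_eventually allI impI) (simp add: k_def assms(3) power2_eq_square)
  ultimately have "((\<lambda>x. g x / x ^ 2) \<longlongrightarrow> deriv k 0) (at 0)" by (rule Lim_transform_eventually)
  then show ?thesis by blast
qed

text \<open>Cauchy's inequality gives continuity of the partial derivative, which makes the first-order
  expansion in the first variable uniform in the second one.\<close>

lemma partial_derivative_uniform:
  assumes hol: "holomorphic2_on F U" and U: "open U" "(0, 0) \<in> U"
    and D: "(F has_derivative (\<lambda>(h, k). a * h + b * k)) (at (0, 0))"
  shows "((\<lambda>x. (F (c * x ^ 2, x) - F (0, x)) / x ^ 2) \<longlongrightarrow> a * c) (at (0 :: complex))"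
proof -
  obtain A B where AB: "open A" "open B" "0 \<in> A" "0 \<in> B" "A \<times> B \<subseteq> U" using open_prod_elim[OF U] by (metis SigmaE2)
  obtain r where r: "0 < r" "cball 0 (2 * r) \<subseteq> A" "cball 0 (2 * r) \<subseteq> B"
  proof -
    have "open (A \<inter> B)" "0 \<in> A \<inter> B" using AB by auto
    then obtain e where e: "0 < e" "cball 0 e \<subseteq> A \<inter> B" using open_contains_cball by blast
    then show thesis using that[of "e / 2"] by auto
  qed
  define K where "K = cball (0 :: complex) (2 * r) \<times> cball (0 :: complex) (2 * r)"
  have KU: "K \<subseteq> U" using r AB(5) unfolding K_def by blast
  have cont: "continuous_on K F"
  proof (rule continuous_at_imp_continuous_on, intro ballI)
    fix z assume "z \<in> K"
    then have "z \<in> U" using KU by blast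
    from bspec[OF hol[unfolded holomorphic2_on_def] this]
    obtain a b where "(F has_derivative (\<lambda>(h, k). a * h + b * k)) (at z)" by (elim exE)
    then show "isCont F z" by (rule has_derivative_continuous)
  qed
  have "compact K" unfolding K_def by (intro compact_Times compact_cball)
  then have uc: "uniformly_continuous_on K F" using cont compact_uniformly_continuous by blast
  have fd: "\<exists>a. ((\<lambda>\<zeta>. F (\<zeta>, x)) has_field_derivative a) (at \<zeta>)" if "(\<zeta>, x) \<in> K" for \<zeta> x
  proof -
    have "(\<zeta>, x) \<in> U" using KU that by blast
    from bspec[OF hol[unfolded holomorphic2_on_def] this]
    obtain a b where "(F has_derivative (\<lambda>(h, k). a * h + b * k)) (at (\<zeta>, x))" by (elim exE)
    then have "((\<lambda>t. F (t, x)) has_field_derivative a * 1 + b * 0) (at \<zeta>)"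
      using holomorphic2_curve[of F a b "\<lambda>t. t" \<zeta> "\<lambda>t. x" 1 0] by simp
    then show ?thesis by blast
  qed
  have d0: "((\<lambda>\<zeta>. F (\<zeta>, 0)) has_field_derivative a) (at 0)"
    using holomorphic2_curve[of F a b "\<lambda>t. t" 0 "\<lambda>t. 0" 1 0] D by simp
  show ?thesis
  proof (rule tendstoI)
    fix \<epsilon> :: real assume eps: "0 < \<epsilon>"
    \<comment> \<open>The added 1 keeps the denominator positive when \<open>c = 0\<close>.\<close>
    define \<epsilon>' where "\<epsilon>' = \<epsilon> / (norm c + 1)"
    have eps': "0 < \<epsilon>'" using eps by (simp add: \<epsilon>'_def add_nonneg_pos)
    obtain \<delta> where \<delta>: "0 < \<delta>" "\<And>z z'. z \<in> K \<Longrightarrow> z' \<in> K \<Longrightarrow> dist z' z < \<delta> \<Longrightarrow> dist (F z') (F z) < r * \<epsilon>' / 2"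
      using uc eps' r(1) unfolding uniformly_continuous_on_def by (metis half_gt_zero mult_pos_pos)
    define \<rho> where "\<rho> = min r (\<delta> / 2)"
    have rho: "0 < \<rho>" "\<rho> \<le> r" "\<rho> \<le> \<delta> / 2" using r \<delta> by (auto simp: \<rho>_def)
    have bound: "norm (deriv (\<lambda>\<zeta>. F (\<zeta>, x)) \<zeta> - a) \<le> \<epsilon>' / 2" if "norm \<zeta> < \<rho>" "norm x < \<rho>" for \<zeta> x
    proof -
      \<comment> \<open>The difference of two translates of \<open>F\<close> is small on a circle of
        fixed radius by uniform continuity; Cauchy's inequality then bounds the difference of the
        partial derivatives at \<open>(\<zeta>, x)\<close> and at the origin.\<close>
      let ?g = "\<lambda>\<omega>. F (\<zeta> + \<omega>, x) - F (\<omega>, 0)"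
      have inK: "(\<zeta> + \<omega>, x) \<in> K" "(\<omega>, 0) \<in> K" if "norm \<omega> \<le> r" for \<omega>
        using that \<open>norm \<zeta> < \<rho>\<close> \<open>norm x < \<rho>\<close> rho norm_triangle_ineq[of \<zeta> \<omega>] by (auto simp: K_def)
      have gd: "\<exists>d. (?g has_field_derivative d) (at \<omega>)" if \<omega>: "norm \<omega> \<le> r" for \<omega>
      proof -
        obtain d1 where "((\<lambda>\<zeta>. F (\<zeta>, x)) has_field_derivative d1) (at (\<zeta> + \<omega>))" using fd inK(1)[OF \<omega>] by blast
        then have "((\<lambda>\<omega>. F (\<zeta> + \<omega>, x)) has_field_derivative d1) (at \<omega>)"
          using DERIV_shift[of "\<lambda>\<zeta>. F (\<zeta>, x)" d1 \<omega> \<zeta>] by (simp add: add.commute)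
        moreover obtain d2 where "((\<lambda>\<zeta>. F (\<zeta>, 0)) has_field_derivative d2) (at \<omega>)" using fd inK(2)[OF \<omega>] by blast
        ultimately show ?thesis using DERIV_diff by blast
      qed
      have "?g holomorphic_on ball 0 r"
        unfolding holomorphic_on_open[OF open_ball] using gd by (auto simp: less_imp_le)
      moreover have "continuous_on (cball 0 r) ?g"
        by (intro continuous_at_imp_continuous_on ballI) (use gd DERIV_isCont in fastforce)
      moreover have "norm (?g \<omega>) \<le> r * \<epsilon>' / 2" if "norm (0 - \<omega>) = r" for \<omega>
      proof -
        have "norm \<omega> \<le> r" using that by simp
        have "dist (\<zeta> + \<omega>, x) (\<omega>, 0) \<le> norm \<zeta> + norm x"
          using norm_Pair_le[of \<zeta> x] by (simp add: dist_norm)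
        also have "\<dots> < \<delta>" using \<open>norm \<zeta> < \<rho>\<close> \<open>norm x < \<rho>\<close> rho by simp
        finally have "dist (F (\<zeta> + \<omega>, x)) (F (\<omega>, 0)) < r * \<epsilon>' / 2"
          using \<delta>(2)[OF inK(2) inK(1)] \<open>norm \<omega> \<le> r\<close> by blast
        then show ?thesis by (simp add: dist_norm)
      qed
      ultimately have "norm ((deriv ^^ 1) ?g 0) \<le> fact 1 * (r * \<epsilon>' / 2) / r ^ 1"
        by (intro Cauchy_inequality r(1)) auto
      then have "norm (deriv ?g 0) \<le> \<epsilon>' / 2" using r(1) by simp
      moreover have "deriv ?g 0 = deriv (\<lambda>\<zeta>. F (\<zeta>, x)) \<zeta> - a"
      proof (rule DERIV_imp_deriv)
        obtain d1 where d1: "((\<lambda>\<zeta>. F (\<zeta>, x)) has_field_derivative d1) (at (\<zeta> + 0))" using fd inK(1)[of 0] r(1) by force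
        then have "((\<lambda>\<omega>. F (\<zeta> + \<omega>, x)) has_field_derivative d1) (at 0)"
          using DERIV_shift[of "\<lambda>\<zeta>. F (\<zeta>, x)" d1 0 \<zeta>] by (simp add: add.commute)
        moreover have "deriv (\<lambda>\<zeta>. F (\<zeta>, x)) \<zeta> = d1" using d1 DERIV_imp_deriv by simp
        ultimately show "(?g has_field_derivative deriv (\<lambda>\<zeta>. F (\<zeta>, x)) \<zeta> - a) (at 0)"
          using d0 DERIV_diff by blast
      qed
      ultimately show ?thesis by simp
    qed
    have est: "norm (F (\<zeta>, x) - F (0, x) - a * \<zeta>) \<le> \<epsilon>' / 2 * norm \<zeta>" if "norm \<zeta> < \<rho>" "norm x < \<rho>" for \<zeta> x
    proof -
      have "norm ((F (\<zeta>, x) - a * \<zeta>) - (F (0, x) - a * 0)) \<le> \<epsilon>' / 2 * norm (\<zeta> - 0)"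
      proof (rule field_differentiable_bound[of "ball 0 \<rho>" "\<lambda>\<zeta>. F (\<zeta>, x) - a * \<zeta>" "\<lambda>\<zeta>. deriv (\<lambda>\<zeta>. F (\<zeta>, x)) \<zeta> - a"])
        fix \<omega> :: complex assume \<omega>: "\<omega> \<in> ball 0 \<rho>"
        then have "(\<omega>, x) \<in> K" using that rho by (auto simp: K_def)
        from fd[OF this] obtain d where d: "((\<lambda>\<zeta>. F (\<zeta>, x)) has_field_derivative d) (at \<omega>)" by (elim exE)
        then have "((\<lambda>\<zeta>. F (\<zeta>, x)) has_field_derivative deriv (\<lambda>\<zeta>. F (\<zeta>, x)) \<omega>) (at \<omega>)"
          using DERIV_imp_deriv[OF d] by simp
        from DERIV_diff[OF this DERIV_cmult[OF DERIV_ident, of a]]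
        show "((\<lambda>\<zeta>. F (\<zeta>, x) - a * \<zeta>) has_field_derivative deriv (\<lambda>\<zeta>. F (\<zeta>, x)) \<omega> - a) (at \<omega> within ball 0 \<rho>)"
          by (simp add: has_field_derivative_at_within)
        show "norm (deriv (\<lambda>\<zeta>. F (\<zeta>, x)) \<omega> - a) \<le> \<epsilon>' / 2" using bound \<omega> that by simp
      qed (use that rho in auto)
      moreover have "(F (\<zeta>, x) - a * \<zeta>) - (F (0, x) - a * 0) = F (\<zeta>, x) - F (0, x) - a * \<zeta>" by simp
      ultimately show ?thesis by (simp only: diff_zero)
    qed
    \<comment> \<open>Keeps both \<open>x\<close> and \<open>c * x ^ 2\<close> within the radius
      \<open>\<rho>\<close>.\<close>
    define s where "s = min (min \<rho> 1) (\<rho> / (norm c + 1))"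
    have s: "0 < s" using rho by (auto simp: s_def add_nonneg_pos)
    have "dist ((F (c * x ^ 2, x) - F (0, x)) / x ^ 2) (a * c) < \<epsilon>" if x: "x \<noteq> 0" "dist x 0 < s" for x
    proof -
      have x': "norm x < \<rho>" "norm x < 1" "norm x * (norm c + 1) < \<rho>"
        using x(2) by (auto simp: s_def pos_less_divide_eq add_nonneg_pos)
      have "norm (c * x ^ 2) \<le> norm c * norm x"
        using x'(2) by (simp add: norm_mult norm_power power2_eq_square mult_left_le mult_left_mono)
      also have "\<dots> \<le> norm x * (norm c + 1)" by (simp add: algebra_simps)
      also have "\<dots> < \<rho>" by (rule x')
      finally have "norm (F (c * x ^ 2, x) - F (0, x) - a * (c * x ^ 2)) \<le> \<epsilon>' / 2 * norm (c * x ^ 2)"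
        using est x'(1) by blast
      moreover have "(F (c * x ^ 2, x) - F (0, x)) / x ^ 2 - a * c = (F (c * x ^ 2, x) - F (0, x) - a * (c * x ^ 2)) / x ^ 2"
        using x(1) by (simp add: field_simps)
      ultimately have "norm ((F (c * x ^ 2, x) - F (0, x)) / x ^ 2 - a * c) \<le> \<epsilon>' / 2 * norm c"
        using x(1) by (simp add: norm_divide norm_mult pos_divide_le_eq mult.assoc)
      also have "\<dots> < \<epsilon>' * (norm c + 1)" using eps' by (simp add: algebra_simps add_nonneg_pos)
      also have "\<dots> = \<epsilon>" by (simp add: \<epsilon>'_def add_nonneg_pos[THEN less_imp_neq, symmetric])
      finally show ?thesis by (simp add: dist_norm)
    qed
    then show "\<forall>\<^sub>F x in at 0. dist ((F (c * x ^ 2, x) - F (0, x)) / x ^ 2) (a * c) < \<epsilon>"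
      unfolding eventually_at using s by blast
  qed
qed

context bad_point
begin

text \<open>Along each arc \<open>x \<mapsto> z(x)\<close> through the origin the equation \<open>f \<circ> \<phi> = u h\<close> is compared with the
  expansion of \<open>f\<close>.\<close>

lemma germ_data:
  assumes germ: "germ_equivalent (\<lambda>(s, t). f (v + s *s a + t *s b)) h"
  obtains C u0 y1 y2 y \<kappa> \<nu> where "u0 \<noteq> 0"
    "\<And>w1 w2. ((\<lambda>x. h (x * w1, x * w2) / x ^ 3) \<longlongrightarrow> C / u0 * (y1 * w1 + y2 * w2) ^ 3) (at 0)"
    "\<And>c. y2 = 0 \<Longrightarrow> ((\<lambda>x. h (c * x ^ 2, x) / x ^ 6) \<longlongrightarrow>
       \<mu> / u0 * (y1 * c + y + \<kappa>) ^ 2 * (\<mu>' * (y1 * c + y + \<kappa>) + (y1 * c + y) * \<nu>)) (at 0)"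
proof -
  obtain U V \<phi> \<psi> u where g: "biholomorphism U V \<phi> \<psi>" "(0, 0) \<in> U" "\<phi> (0, 0) = (0, 0)" "holomorphic2_on u U"
    "\<forall>z\<in>U. u z \<noteq> 0" "\<forall>z\<in>U. (\<lambda>(s, t). f (v + s *s a + t *s b)) (\<phi> z) = u z * h z"
    using germ unfolding germ_equivalent_def by blast
  have U: "open U" and hol: "holomorphic2_on (fst \<circ> \<phi>) U" "holomorphic2_on (snd \<circ> \<phi>) U"
    using g(1) by (auto simp: biholomorphism_def)
  define p q where "p z = fst (\<phi> z)" and "q z = snd (\<phi> z)" for z
  obtain p1 p2 where p: "(p has_derivative (\<lambda>(h, k). p1 * h + p2 * k)) (at (0, 0))"
    using hol(1) g(2) unfolding holomorphic2_on_def p_def[abs_def] comp_def by blast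
  obtain r1 r2 where q: "(q has_derivative (\<lambda>(h, k). r1 * h + r2 * k)) (at (0, 0))"
    using hol(2) g(2) unfolding holomorphic2_on_def q_def[abs_def] comp_def by blast
  have pq0: "p (0, 0) = 0" "q (0, 0) = 0" using g(3) by (simp_all add: p_def q_def)
  define d where "d z = p z *s a + q z *s b" for z
  define e where "e w1 w2 = (p1 * w1 + p2 * w2) *s a + (r1 * w1 + r2 * w2) *s b" for w1 w2
  define Y where "Y z = polar q1 v (d z)" for z
  define A B where "A = polar q1 v a" and "B = polar q1 v b"
  have Yeq: "Y z = p z * A + q z * B" for z
    by (simp add: Y_def d_def A_def B_def polar_add_right[OF form_q1] polar_scale_right[OF form_q1])
  \<comment> \<open>The differential at the origin of \<open>Y\<close>, the transversal displacement
    in the coordinates of the germ.\<close>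
  define y1 y2 where "y1 = p1 * A + r1 * B" and "y2 = p2 * A + r2 * B"
  have eq: "f (v + d z) = u z * h z" if "z \<in> U" for z
    using g(6) that by (auto simp: d_def p_def q_def case_prod_beta add.assoc)
  have u0: "u (0, 0) \<noteq> 0" using g(2,5) by blast
  have ucont: "isCont u (0, 0)"
    using g(2,4) has_derivative_continuous unfolding holomorphic2_on_def by blast
  \<comment> \<open>Limits for \<open>f\<close> along an arc become limits for \<open>h\<close>,
    since the unit tends to \<open>u (0, 0)\<close>.\<close>
  have arc: "((\<lambda>x. h (\<gamma> x, \<delta> x) / x ^ n) \<longlongrightarrow> L / u (0, 0)) (at 0)"
    if L: "((\<lambda>x. f (v + d (\<gamma> x, \<delta> x)) / x ^ n) \<longlongrightarrow> L) (at 0)"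
      and c: "isCont \<gamma> 0" "isCont \<delta> 0" "\<gamma> 0 = 0" "\<delta> 0 = 0" for \<gamma> \<delta> L and n :: nat
  proof -
    have t: "((\<lambda>x. (\<gamma> x, \<delta> x)) \<longlongrightarrow> (0, 0)) (at 0)"
      using c by (intro tendsto_Pair) (auto simp: isCont_def)
    have "((\<lambda>x. u (\<gamma> x, \<delta> x)) \<longlongrightarrow> u (0, 0)) (at 0)"
      by (rule isCont_tendsto_compose[OF ucont t])
    then have "((\<lambda>x. f (v + d (\<gamma> x, \<delta> x)) / x ^ n / u (\<gamma> x, \<delta> x)) \<longlongrightarrow> L / u (0, 0)) (at 0)"
      using u0 by (intro tendsto_divide L)
    moreover have "\<forall>\<^sub>F x in at 0. (\<gamma> x, \<delta> x) \<in> U"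
      using topological_tendstoD[OF t U g(2)] .
    then have "\<forall>\<^sub>F x in at 0. f (v + d (\<gamma> x, \<delta> x)) / x ^ n / u (\<gamma> x, \<delta> x) = h (\<gamma> x, \<delta> x) / x ^ n"
      by eventually_elim (use eq g(5) in auto)
    ultimately show ?thesis by (rule Lim_transform_eventually)
  qed
  have dlim: "((\<lambda>x. d (\<gamma> x, \<delta> x) $ i / x) \<longlongrightarrow> e w1 w2 $ i) (at 0)"
    if \<gamma>: "(\<gamma> has_field_derivative w1) (at 0)" "\<gamma> 0 = 0" and \<delta>: "(\<delta> has_field_derivative w2) (at 0)" "\<delta> 0 = 0" for \<gamma> \<delta> w1 w2 i
  proof -
    have "((\<lambda>x. p (\<gamma> x, \<delta> x)) has_field_derivative p1 * w1 + p2 * w2) (at 0)"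
      by (rule holomorphic2_curve[OF _ \<gamma>(1) \<delta>(1)]) (use p \<gamma>(2) \<delta>(2) in simp)
    then have 1: "((\<lambda>x. p (\<gamma> x, \<delta> x) / x) \<longlongrightarrow> p1 * w1 + p2 * w2) (at 0)"
      by (rule derivative_tendsto_quotient) (simp add: \<gamma> \<delta> pq0)
    have "((\<lambda>x. q (\<gamma> x, \<delta> x)) has_field_derivative r1 * w1 + r2 * w2) (at 0)"
      by (rule holomorphic2_curve[OF _ \<gamma>(1) \<delta>(1)]) (use q \<gamma>(2) \<delta>(2) in simp)
    then have 2: "((\<lambda>x. q (\<gamma> x, \<delta> x) / x) \<longlongrightarrow> r1 * w1 + r2 * w2) (at 0)"
      by (rule derivative_tendsto_quotient) (simp add: \<gamma> \<delta> pq0)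
    have "((\<lambda>x. p (\<gamma> x, \<delta> x) / x * a $ i + q (\<gamma> x, \<delta> x) / x * b $ i) \<longlongrightarrow> e w1 w2 $ i) (at 0)"
      unfolding e_def vector_add_component vector_smult_component
      by (intro tendsto_add tendsto_mult 1 2 tendsto_const)
    then show ?thesis by (simp add: d_def add_divide_distrib)
  qed
  have ee: "polar q1 v (e w1 w2) = y1 * w1 + y2 * w2" for w1 w2
    by (simp add: e_def y1_def y2_def A_def B_def polar_add_right[OF form_q1] polar_scale_right[OF form_q1] algebra_simps)
  have lin: "((\<lambda>x. h (x * w1, x * w2) / x ^ 3) \<longlongrightarrow> (\<mu> * (\<mu>' + l' v)) / u (0, 0) * (y1 * w1 + y2 * w2) ^ 3) (at 0)" for w1 w2
  proof -
    have D: "((\<lambda>x. x * w) has_field_derivative w) (at (0 :: complex))" for w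
      using DERIV_cmult_right[OF DERIV_ident, of w] by simp
    have "((\<lambda>x. f (v + d (x * w1, x * w2)) / x ^ 3) \<longlongrightarrow> \<mu> * (\<mu>' + l' v) * polar q1 v (e w1 w2) ^ 3) (at 0)"
      by (rule f_tendsto3, rule dlim[OF D _ D]) simp_all
    from arc[OF this] show ?thesis by (simp add: ee)
  qed
  \<comment> \<open>If \<open>y2 = 0\<close>, then along the arcs \<open>(c * x ^ 2, x)\<close> the
    displacement \<open>Y\<close> is of order x^2, with a leading coefficient affine in
    \<open>c\<close>.\<close>
  have par: "\<exists>y. \<forall>c. ((\<lambda>x. h (c * x ^ 2, x) / x ^ 6) \<longlongrightarrow>
       \<mu> / u (0, 0) * (y1 * c + y + q1 (e 0 1)) ^ 2 * (\<mu>' * (y1 * c + y + q1 (e 0 1)) + (y1 * c + y) * l' v)) (at 0)"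
    if y20: "y2 = 0"
  proof -
    have YD: "(Y has_derivative (\<lambda>(h, k). y1 * h + 0 * k)) (at (0, 0))"
    proof -
      have "((\<lambda>z. p z * A + q z * B) has_derivative (\<lambda>z. (case z of (h, k) \<Rightarrow> p1 * h + p2 * k) * A + (case z of (h, k) \<Rightarrow> r1 * h + r2 * k) * B)) (at (0, 0))"
        by (intro has_derivative_add has_derivative_mult_left p q)
      moreover have "(\<lambda>z. (case z of (h, k) \<Rightarrow> p1 * h + p2 * k) * A + (case z of (h, k) \<Rightarrow> r1 * h + r2 * k) * B) = (\<lambda>(h, k). y1 * h + y2 * k)"
        by (rule ext) (auto simp: y1_def y2_def algebra_simps)
      ultimately show ?thesis unfolding Yeq[abs_def] y20 by simp
    qed
    have Yhol: "holomorphic2_on Y U"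
      unfolding holomorphic2_on_def
    proof
      fix z assume z: "z \<in> U"
      from bspec[OF hol(1)[unfolded holomorphic2_on_def comp_def] z] obtain a1 a2
        where 1: "(p has_derivative (\<lambda>(h, k). a1 * h + a2 * k)) (at z)" unfolding p_def[abs_def] by (elim exE)
      from bspec[OF hol(2)[unfolded holomorphic2_on_def comp_def] z] obtain b1 b2
        where 2: "(q has_derivative (\<lambda>(h, k). b1 * h + b2 * k)) (at z)" unfolding q_def[abs_def] by (elim exE)
      have "((\<lambda>z. p z * A + q z * B) has_derivative (\<lambda>z. (case z of (h, k) \<Rightarrow> a1 * h + a2 * k) * A + (case z of (h, k) \<Rightarrow> b1 * h + b2 * k) * B)) (at z)"
        by (intro has_derivative_add has_derivative_mult_left 1 2)
      moreover have "(\<lambda>z. (case z of (h, k) \<Rightarrow> a1 * h + a2 * k) * A + (case z of (h, k) \<Rightarrow> b1 * h + b2 * k) * B)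
          = (\<lambda>(h, k). (a1 * A + b1 * B) * h + (a2 * A + b2 * B) * k)"
        by (rule ext) (auto simp: algebra_simps)
      ultimately have "(Y has_derivative (\<lambda>(h, k). (a1 * A + b1 * B) * h + (a2 * A + b2 * B) * k)) (at z)"
        unfolding Yeq[abs_def] by simp
      then show "\<exists>a b. (Y has_derivative (\<lambda>(h, k). a * h + b * k)) (at z)" by blast
    qed
    have Y0: "Y (0, 0) = 0" by (simp add: Yeq pq0)
    obtain r where r: "0 < r" "\<And>x. norm x < r \<Longrightarrow> (0, x) \<in> U"
    proof -
      obtain r where "0 < r" "ball (0, 0) r \<subseteq> U" using U g(2) open_contains_ball by blast
      moreover have "(0, x) \<in> ball (0, 0) r" if "norm x < r" for x :: complex
        using that by (simp add: dist_Pair_Pair)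
      ultimately show thesis using that[of r] by blast
    qed
    have "(\<lambda>x. Y (0, x)) holomorphic_on ball 0 r"
      unfolding holomorphic_on_open[OF open_ball]
    proof (intro ballI)
      fix x :: complex assume "x \<in> ball 0 r"
      then have "(0, x) \<in> U" using r(2) by simp
      from bspec[OF Yhol[unfolded holomorphic2_on_def] this] obtain a b
        where D: "(Y has_derivative (\<lambda>(h, k). a * h + b * k)) (at (0, x))" by (elim exE)
      have "((\<lambda>x. Y (0, x)) has_field_derivative a * 0 + b * 1) (at x)"
        by (rule holomorphic2_curve[where \<gamma> = "\<lambda>x. 0" and \<delta> = "\<lambda>x. x"]) (use D in simp_all)
      then show "\<exists>f'. ((\<lambda>x. Y (0, x)) has_field_derivative f') (at x)" by blast
    qed
    moreover have "((\<lambda>x. Y (0, x)) has_field_derivative 0) (at 0)"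
    proof -
      have "((\<lambda>x. Y (0, x)) has_field_derivative y1 * 0 + 0 * 1) (at 0)"
        by (rule holomorphic2_curve[where \<gamma> = "\<lambda>x. 0" and \<delta> = "\<lambda>x. x"]) (use YD in simp_all)
      then show ?thesis by simp
    qed
    ultimately obtain y where y: "((\<lambda>x. Y (0, x) / x ^ 2) \<longlongrightarrow> y) (at 0)"
      using second_order_tendsto[of "\<lambda>x. Y (0, x)" r] r(1) Y0 by blast
    show ?thesis
    proof (intro exI allI)
      fix c
      have "((\<lambda>x. (Y (c * x ^ 2, x) - Y (0, x)) / x ^ 2 + Y (0, x) / x ^ 2) \<longlongrightarrow> y1 * c + y) (at 0)"
        by (intro tendsto_add y partial_derivative_uniform[OF Yhol U g(2) YD])
      then have Yc: "((\<lambda>x. polar q1 v (d (c * x ^ 2, x)) / x ^ 2) \<longlongrightarrow> y1 * c + y) (at 0)"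
        by (simp add: diff_divide_distrib Y_def)
      have D: "((\<lambda>x. c * x ^ 2) has_field_derivative 0) (at (0 :: complex))"
        by (auto intro!: derivative_eq_intros)
      have "((\<lambda>x. f (v + d (c * x ^ 2, x)) / x ^ 6) \<longlongrightarrow>
          (y1 * c + y + q1 (e 0 1)) * (\<mu> * (y1 * c + y + q1 (e 0 1))) * (\<mu>' * (y1 * c + y + q1 (e 0 1)) + (y1 * c + y) * l' v)) (at 0)"
        by (rule f_tendsto6[OF _ Yc], rule dlim[OF D _ DERIV_ident]) simp_all
      from arc[OF this] show "((\<lambda>x. h (c * x ^ 2, x) / x ^ 6) \<longlongrightarrow>
        \<mu> / u (0, 0) * (y1 * c + y + q1 (e 0 1)) ^ 2 * (\<mu>' * (y1 * c + y + q1 (e 0 1)) + (y1 * c + y) * l' v)) (at 0)"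
        by (simp add: power2_eq_square mult.assoc mult.left_commute)
    qed
  qed
  show thesis
  proof (cases "y2 = 0")
    case True
    from par[OF True] obtain y where "\<forall>c. ((\<lambda>x. h (c * x ^ 2, x) / x ^ 6) \<longlongrightarrow>
       \<mu> / u (0, 0) * (y1 * c + y + q1 (e 0 1)) ^ 2 * (\<mu>' * (y1 * c + y + q1 (e 0 1)) + (y1 * c + y) * l' v)) (at 0)" ..
    then show thesis using that[of "u (0, 0)" "\<mu> * (\<mu>' + l' v)" y1 y2 y "q1 (e 0 1)" "l' v"] u0 lin by blast
  next
    case False
    then show thesis using that[of "u (0, 0)" "\<mu> * (\<mu>' + l' v)" y1 y2] u0 lin by blast
  qed
qed

lemma limit_at_0:
  fixes g k :: "complex \<Rightarrow> complex"
  assumes "(g \<longlongrightarrow> a) (at 0)" "isCont k 0" "\<And>x. x \<noteq> 0 \<Longrightarrow> g x = k x"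
  shows "a = k 0"
proof -
  have "\<forall>\<^sub>F x in at 0. g x = k x"
    unfolding eventually_at_filter by (intro always_eventually allI impI) (rule assms(3))
  with assms(1) have "(k \<longlongrightarrow> a) (at 0)" by (rule Lim_transform_eventually)
  moreover have "(k \<longlongrightarrow> k 0) (at 0)" using assms(2) by (simp add: isCont_def)
  ultimately show ?thesis by (rule LIM_unique)
qed

text \<open>Along the first axis the germ has order 2, too small for a finite limit after division
  by x^3.\<close>

lemma not_sing_A: "\<not> germ_equivalent (\<lambda>(s, t). f (v + s *s a + t *s b)) (sing_A k)"
proof
  assume "germ_equivalent (\<lambda>(s, t). f (v + s *s a + t *s b)) (sing_A k)"
  then obtain L where "((\<lambda>x. sing_A k (x * 1, x * 0) / x ^ 3) \<longlongrightarrow> L) (at 0)"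
    by (rule germ_data) blast
  then have "((\<lambda>x. x * (sing_A k (x * 1, x * 0) / x ^ 3)) \<longlongrightarrow> 0 * L) (at 0)"
    by (intro tendsto_mult tendsto_ident_at)
  then have "0 * L = 1"
    by (rule limit_at_0[where k = "\<lambda>x. 1"]) (simp_all add: sing_A_def field_simps eval_nat_numeral)
  then show False by simp
qed

text \<open>The cubic part of the germ is xy^2, or xy^2 + x^3 for \<open>k = 4\<close>; neither is a
  multiple of the cube of a linear form.\<close>

lemma not_sing_D:
  assumes "4 \<le> k"
  shows "\<not> germ_equivalent (\<lambda>(s, t). f (v + s *s a + t *s b)) (sing_D k)"
proof
  assume "germ_equivalent (\<lambda>(s, t). f (v + s *s a + t *s b)) (sing_D k)"
  then obtain K y1 y2 where
    L: "\<And>w1 w2. ((\<lambda>x. sing_D k (x * w1, x * w2) / x ^ 3) \<longlongrightarrow> K * (y1 * w1 + y2 * w2) ^ 3) (at 0)"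
    by (rule germ_data) blast
  \<comment> \<open>With this index the term \<open>0 ^ j\<close> covers \<open>k = 4\<close>, where
    it is 1, together with all larger \<open>k\<close>.\<close>
  obtain j where k: "k = j + 4" using assms by (metis add.commute le_Suc_ex)
  have eq: "K * (y1 * w1 + y2 * w2) ^ 3 = w2 ^ 2 * w1 + w1 ^ (j + 3) * 0 ^ j" for w1 w2
    by (rule limit_at_0[OF L[of w1 w2], where k = "\<lambda>x. w2 ^ 2 * w1 + w1 ^ (j + 3) * x ^ j"])
      (simp_all add: sing_D_def k field_simps power_add eval_nat_numeral)
  have "K * y2 ^ 3 = 0" using eq[of 0 1] by simp
  moreover have "K \<noteq> 0" using eq[of 1 1] by (cases j) auto
  ultimately have y2: "y2 = 0" by simp
  have "K * y1 ^ 3 = 0 ^ j" "K * y1 ^ 3 = 1 + 0 ^ j" using eq[of 1 0] eq[of 1 1] y2 by simp_all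
  then show False by simp
qed

text \<open>If the cubic part of the germ is the cube of the first coordinate, comparison with the
  cube of the common tangent gives \<open>y1 \<noteq> 0\<close> and \<open>y2 = 0\<close>, which
  makes the expansion with weights (2, 1) available.\<close>

lemma cuspidal_germ:
  assumes germ: "germ_equivalent (\<lambda>(s, t). f (v + s *s a + t *s b)) h"
    and h: "\<And>w1 w2. \<exists>k. isCont k 0 \<and> k 0 = w1 ^ 3 \<and> (\<forall>x. x \<noteq> 0 \<longrightarrow> h (x * w1, x * w2) / x ^ 3 = k x)"
  obtains m y1 y \<kappa> \<nu> where "y1 \<noteq> 0"
    "\<And>c. ((\<lambda>x. h (c * x ^ 2, x) / x ^ 6) \<longlongrightarrow>
       m * (y1 * c + y + \<kappa>) ^ 2 * (\<mu>' * (y1 * c + y + \<kappa>) + (y1 * c + y) * \<nu>)) (at 0)"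
proof -
  obtain K m y1 y2 y \<kappa> \<nu> where
    L: "\<And>w1 w2. ((\<lambda>x. h (x * w1, x * w2) / x ^ 3) \<longlongrightarrow> K * (y1 * w1 + y2 * w2) ^ 3) (at 0)" and
    P: "\<And>c. y2 = 0 \<Longrightarrow> ((\<lambda>x. h (c * x ^ 2, x) / x ^ 6) \<longlongrightarrow>
       m * (y1 * c + y + \<kappa>) ^ 2 * (\<mu>' * (y1 * c + y + \<kappa>) + (y1 * c + y) * \<nu>)) (at 0)"
    using germ by (rule germ_data) (rule that)
  have eq: "K * (y1 * w1 + y2 * w2) ^ 3 = w1 ^ 3" for w1 w2
  proof -
    obtain k where "isCont k 0" "k 0 = w1 ^ 3" "\<forall>x. x \<noteq> 0 \<longrightarrow> h (x * w1, x * w2) / x ^ 3 = k x"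
      using h by blast
    then show ?thesis using limit_at_0[OF L[of w1 w2], of k] by simp
  qed
  have "K * y1 ^ 3 = 1" "K * y2 ^ 3 = 0" using eq[of 1 0] eq[of 0 1] by simp_all
  then have "y1 \<noteq> 0" "y2 = 0" by auto
  then show thesis using that P by blast
qed

text \<open>Along \<open>(0, x)\<close> the germ has order 4, below the weight 6.\<close>

lemma not_sing_E6: "\<not> germ_equivalent (\<lambda>(s, t). f (v + s *s a + t *s b)) sing_E6"
proof
  assume g: "germ_equivalent (\<lambda>(s, t). f (v + s *s a + t *s b)) sing_E6"
  have "\<exists>k. isCont k 0 \<and> k 0 = w1 ^ 3 \<and> (\<forall>x. x \<noteq> 0 \<longrightarrow> sing_E6 (x * w1, x * w2) / x ^ 3 = k x)" for w1 w2
    by (rule exI[of _ "\<lambda>x. w1 ^ 3 + x * w2 ^ 4"]) (simp add: sing_E6_def field_simps eval_nat_numeral)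
  from cuspidal_germ[OF g this] obtain L where "((\<lambda>x. sing_E6 (0 * x ^ 2, x) / x ^ 6) \<longlongrightarrow> L) (at 0)" by blast
  then have "((\<lambda>x. x ^ 2 * (sing_E6 (0 * x ^ 2, x) / x ^ 6)) \<longlongrightarrow> 0 ^ 2 * L) (at 0)"
    by (intro tendsto_mult tendsto_power tendsto_ident_at)
  then have "0 ^ 2 * L = 1"
    by (rule limit_at_0[where k = "\<lambda>x. 1"]) (simp_all add: sing_E6_def field_simps eval_nat_numeral)
  then show False by simp
qed

text \<open>Along \<open>(0, x)\<close> the germ has order 5, below the weight 6.\<close>

lemma not_sing_E8: "\<not> germ_equivalent (\<lambda>(s, t). f (v + s *s a + t *s b)) sing_E8"
proof
  assume g: "germ_equivalent (\<lambda>(s, t). f (v + s *s a + t *s b)) sing_E8"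
  have "\<exists>k. isCont k 0 \<and> k 0 = w1 ^ 3 \<and> (\<forall>x. x \<noteq> 0 \<longrightarrow> sing_E8 (x * w1, x * w2) / x ^ 3 = k x)" for w1 w2
    by (rule exI[of _ "\<lambda>x. w1 ^ 3 + x ^ 2 * w2 ^ 5"]) (simp add: sing_E8_def field_simps eval_nat_numeral)
  from cuspidal_germ[OF g this] obtain L where "((\<lambda>x. sing_E8 (0 * x ^ 2, x) / x ^ 6) \<longlongrightarrow> L) (at 0)" by blast
  then have "((\<lambda>x. x * (sing_E8 (0 * x ^ 2, x) / x ^ 6)) \<longlongrightarrow> 0 * L) (at 0)"
    by (intro tendsto_mult tendsto_ident_at)
  then have "0 * L = 1"
    by (rule limit_at_0[where k = "\<lambda>x. 1"]) (simp_all add: sing_E8_def field_simps eval_nat_numeral)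
  then show False by simp
qed

text \<open>The germ vanishes along \<open>(0, x)\<close>; the arc \<open>(x ^ 2, x)\<close> shows
  the order 5 instead.\<close>

lemma not_sing_E7: "\<not> germ_equivalent (\<lambda>(s, t). f (v + s *s a + t *s b)) sing_E7"
proof
  assume g: "germ_equivalent (\<lambda>(s, t). f (v + s *s a + t *s b)) sing_E7"
  have "\<exists>k. isCont k 0 \<and> k 0 = w1 ^ 3 \<and> (\<forall>x. x \<noteq> 0 \<longrightarrow> sing_E7 (x * w1, x * w2) / x ^ 3 = k x)" for w1 w2
    by (rule exI[of _ "\<lambda>x. w1 ^ 3 + x * (w1 * w2 ^ 3)"]) (simp add: sing_E7_def field_simps eval_nat_numeral)
  from cuspidal_germ[OF g this] obtain L where "((\<lambda>x. sing_E7 (1 * x ^ 2, x) / x ^ 6) \<longlongrightarrow> L) (at 0)" by blast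
  then have "((\<lambda>x. x * (sing_E7 (1 * x ^ 2, x) / x ^ 6)) \<longlongrightarrow> 0 * L) (at 0)"
    by (intro tendsto_mult tendsto_ident_at)
  then have "0 * L = 0 + 1"
    by (rule limit_at_0[where k = "\<lambda>x. x + 1"]) (simp_all add: sing_E7_def field_simps eval_nat_numeral)
  then show False by simp
qed

text \<open>For weights (2, 1) the germ has leading part \<open>c ^ 3 + \<beta> * c ^ 2 + 1\<close>,
  with discriminant \<open>- (4 * \<beta> ^ 3 + 27)\<close>, whereas two conics agreeing to second
  order contribute a double factor.\<close>

lemma not_sing_J20:
  assumes b': "4 * \<beta> ^ 3 + 27 \<noteq> 0"
  shows "\<not> germ_equivalent (\<lambda>(s, t). f (v + s *s a + t *s b)) (sing_J20 \<beta>)"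
proof
  assume g: "germ_equivalent (\<lambda>(s, t). f (v + s *s a + t *s b)) (sing_J20 \<beta>)"
  have "\<exists>k. isCont k 0 \<and> k 0 = w1 ^ 3 \<and> (\<forall>x. x \<noteq> 0 \<longrightarrow> sing_J20 \<beta> (x * w1, x * w2) / x ^ 3 = k x)" for w1 w2
    by (rule exI[of _ "\<lambda>x. w1 ^ 3 + x * (\<beta> * w1 ^ 2 * w2 ^ 2) + x ^ 3 * w2 ^ 6"])
      (simp add: sing_J20_def field_simps eval_nat_numeral)
  then obtain m y1 y \<kappa> \<nu> where y1: "y1 \<noteq> 0" and
    L: "\<And>c. ((\<lambda>x. sing_J20 \<beta> (c * x ^ 2, x) / x ^ 6) \<longlongrightarrow>
       m * (y1 * c + y + \<kappa>) ^ 2 * (\<mu>' * (y1 * c + y + \<kappa>) + (y1 * c + y) * \<nu>)) (at 0)" by (rule cuspidal_germ[OF g]) (rule that)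
  have eq: "m * (y1 * c + y + \<kappa>) ^ 2 * (\<mu>' * (y1 * c + y + \<kappa>) + (y1 * c + y) * \<nu>) = c ^ 3 + \<beta> * c ^ 2 + 1" for c
    by (rule limit_at_0[OF L[of c], where k = "\<lambda>x. c ^ 3 + \<beta> * c ^ 2 + 1"])
      (simp_all add: sing_J20_def field_simps eval_nat_numeral)
  \<comment> \<open>The value of \<open>c\<close> at which the doubled factor vanishes.\<close>
  define c0 where "c0 = - (y + \<kappa>) / y1"
  define P R where "P = - m * y1 ^ 2 * \<kappa> * \<nu>" and "R = m * y1 ^ 3 * (\<mu>' + \<nu>)"
  have c0: "y1 * c0 + y + \<kappa> = 0" using y1 by (simp add: c0_def)
  have *: "(c0 + t) ^ 3 + \<beta> * (c0 + t) ^ 2 + 1 = t ^ 2 * (P + R * t)" for t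
  proof -
    have 1: "y1 * (c0 + t) + y + \<kappa> = y1 * t" and 2: "y1 * (c0 + t) + y = y1 * t - \<kappa>" using c0 by algebra+
    show ?thesis unfolding eq[symmetric] 1 2 P_def R_def by (simp add: power2_eq_square power3_eq_cube algebra_simps)
  qed
  have r: "c0 ^ 3 + \<beta> * c0 ^ 2 + 1 = 0" using *[of 0] by simp
  \<comment> \<open>The derivative at the double root, extracted from the values at
    \<open>t = 1\<close>, \<open>t = - 1\<close> and \<open>t = 2\<close>.\<close>
  have A: "3 * c0 ^ 2 + 2 * \<beta> * c0 = 0" 
  proof -
    have "(c0 + 1) ^ 3 + \<beta> * (c0 + 1) ^ 2 + 1 = P + R" "(c0 - 1) ^ 3 + \<beta> * (c0 - 1) ^ 2 + 1 = P - R"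
      "(c0 + 2) ^ 3 + \<beta> * (c0 + 2) ^ 2 + 1 = 4 * (P + 2 * R)"
      using *[of 1] *[of "-1"] *[of 2] by (simp_all add: mult.commute)
    with r show ?thesis by algebra
  qed
  have "c0 \<noteq> 0" using r by auto
  then have B: "3 * c0 + 2 * \<beta> = 0" using A by algebra
  have "4 * \<beta> ^ 3 + 27 = 0" using r B by algebra
  then show False using b' by simp
qed

end

section \<open>The degrees of a basis of tangent fields\<close>

definition dot :: "complex ^ 3 \<Rightarrow> complex ^ 3 \<Rightarrow> complex" where
  "dot u v = u $ 1 * v $ 1 + u $ 2 * v $ 2 + u $ 3 * v $ 3"

definition cross :: "complex ^ 3 \<Rightarrow> complex ^ 3 \<Rightarrow> complex ^ 3" where
  "cross u v = vec3 (u $ 2 * v $ 3 - u $ 3 * v $ 2) (u $ 3 * v $ 1 - u $ 1 * v $ 3) (u $ 1 * v $ 2 - u $ 2 * v $ 1)"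

lemma det3_cross: "det3 u v w = dot u (cross v w)"
  by (simp add: det3_def dot_def cross_def algebra_simps)

text \<open>The expansion \<open>d x (u x v) = (d . v) u - (d . u) v\<close>, read off component by
  component.\<close>

lemma cross_orthogonal:
  assumes "dot d u = 0" "dot d v = 0"
  shows "d $ i * cross u v $ j = d $ j * cross u v $ i"
proof -
  have "d $ 1 * cross u v $ 2 = d $ 2 * cross u v $ 1" "d $ 1 * cross u v $ 3 = d $ 3 * cross u v $ 1"
    "d $ 2 * cross u v $ 3 = d $ 3 * cross u v $ 2"
    using assms unfolding dot_def cross_def vector_3 by algebra+
  then show ?thesis using exhaust_3[of i] exhaust_3[of j] by auto
qed

lemma form_det3_fields:
  assumes "vform m \<theta>" "vform n \<eta>"
  shows "form (Suc (m + n)) (\<lambda>v. det3 v (\<theta> v) (\<eta> v))"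
  unfolding det3_def
  by (intro form_add form_diff form_coord_mult form_mult) (use assms in \<open>simp_all add: vform_def\<close>)

lemma vform_cross:
  assumes "vform m \<theta>" "vform n \<eta>"
  shows "vform (m + n) (\<lambda>v. cross (\<theta> v) (\<eta> v))"
proof -
  have "form (m + n) (\<lambda>v. cross (\<theta> v) (\<eta> v) $ i)" for i
  proof -
    have f: "form (m + n) (\<lambda>v. \<theta> v $ j * \<eta> v $ k - \<theta> v $ k * \<eta> v $ j)" for j k
      by (intro form_diff form_mult) (use assms in \<open>simp_all add: vform_def\<close>)
    show ?thesis using exhaust_3[of i] f[of 2 3] f[of 3 1] f[of 1 2] by (auto simp: cross_def)
  qed
  then show ?thesis by (simp add: vform_def)
qed

lemma form_line_degree:
  assumes "form n F" "F w \<noteq> 0"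
  obtains p where "degree p = n" "p \<noteq> 0" "\<And>s. F (u + s *s w) = poly p s"
proof -
  obtain p where p: "degree p \<le> n" "\<forall>s. F (u + s *s w) = poly p s" "coeff p n = F w"
    using form_line_poly[OF assms(1)] by blast
  have "coeff p n \<noteq> 0" using p(3) assms(2) by simp
  then have "n \<le> degree p" "p \<noteq> 0" using le_degree by auto
  show thesis
  proof (rule that)
    show "degree p = n" using p(1) \<open>n \<le> degree p\<close> by (rule le_antisym)
    show "p \<noteq> 0" by fact
    show "F (u + s *s w) = poly p s" for s using p(2) by (rule spec)
  qed
qed

text \<open>Over the complex numbers the degree is the sum of the orders of the roots.\<close>

lemma degree_eq_of_order_eq:
  fixes p r :: "complex poly"
  assumes "p \<noteq> 0" "r \<noteq> 0" "\<And>x. order x p = order x r"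
  shows "degree p = degree r"
proof -
  have deg: "degree s = degree (\<Prod>z | order z s \<noteq> 0. [:- z, 1:] ^ order z s)" if "s \<noteq> 0" for s :: "complex poly"
  proof -
    have "degree s = degree (smult (lead_coeff s) (\<Prod>z | poly s z = 0. [:- z, 1:] ^ order z s))"
      by (simp only: complex_poly_decompose)
    also have "\<dots> = degree (\<Prod>z | poly s z = 0. [:- z, 1:] ^ order z s)"
      using that by (simp only: degree_smult_eq leading_coeff_0_iff if_False)
    also have "{z. poly s z = 0} = {z. order z s \<noteq> 0}" using that by (simp add: order_root)
    finally show ?thesis .
  qed
  show ?thesis using deg[OF assms(1)] deg[OF assms(2)] assms(3) by simp
qed

lemma forms_avoid_zero:
  assumes "finite I" "\<And>i. i \<in> I \<Longrightarrow> form 1 (F i) \<and> (\<exists>v. F i v \<noteq> 0)"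
  shows "\<exists>v :: complex ^ 3. \<forall>i\<in>I. F i v \<noteq> 0"
proof -
  have "\<exists>n G. form n G \<and> (\<exists>v. G v \<noteq> 0) \<and> (\<forall>v. G v \<noteq> 0 \<longrightarrow> (\<forall>i\<in>I. F i v \<noteq> 0))"
    using assms
  proof (induction I rule: finite_induct)
    case empty
    then show ?case using form_const[of 1] by (intro exI[of _ 0] exI[of _ "\<lambda>v. 1"]) simp
  next
    case (insert i I)
    obtain n G u where G: "form n G" "G u \<noteq> 0" "\<forall>v. G v \<noteq> 0 \<longrightarrow> (\<forall>i\<in>I. F i v \<noteq> 0)"
      using insert by auto
    obtain w where w: "form 1 (F i)" "F i w \<noteq> 0" using insert.prems[of i] by blast
    obtain v where "F i v \<noteq> 0" "G v \<noteq> 0" using form_integral[OF w(1) G(1) w(2) G(2)] by blast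
    then show ?case
      using form_mult[OF w(1) G(1)] G(3) by (intro exI[of _ "1 + n"] exI[of _ "\<lambda>v. F i v * G v"]) auto
  qed
  then show ?thesis by blast
qed

lemma finite_common:
  assumes q: "smoothq q1" "smoothq q2" "indepq q1 q2"
  shows "finite (common q1 q2)"
proof -
  obtain T c where T: "invertible T" "c \<noteq> 0" "\<And>v. q1 (T *v v) = c * std v" "q2 (T *v vec3 0 1 0) \<noteq> 0"
    by (rule generic_coordinates[OF q(1,2,2,3,3)]) (rule that)
  have f: "form 2 (\<lambda>v. q2 (T *v v))" by (rule form_subst[OF smoothq_form[OF q(2)]])
  obtain p where p: "\<forall>x. q2 (T *v phi x) = poly p x" "coeff p (2 * 2) = q2 (T *v vec3 0 1 0)"
    using form_phi_poly[OF f] by blast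
  have "p \<noteq> 0" using p(2) T(4) by auto
  then have "finite {x. q2 (T *v phi x) = 0}" using p(1) poly_roots_finite by simp
  then have "finite (common std (\<lambda>v. q2 (T *v v)))" using common_std_eq[OF f T(4)] by simp
  moreover have "common q1 q2 = (\<lambda>P. (*v) T ` P) ` common std (\<lambda>v. 1 * q2 (T *v v))"
    using common_subst[OF T(1), of "1 / c" 1 q1 q2] T(2) by (simp add: T(3))
  ultimately show ?thesis by simp
qed

definition gradient ::
  "(complex ^ 3 \<Rightarrow> complex) \<Rightarrow> (complex ^ 3 \<Rightarrow> complex) \<Rightarrow> (complex ^ 3 \<Rightarrow> complex) \<Rightarrow> complex ^ 3 \<Rightarrow> complex ^ 3" where
  "gradient q1 q2 q3 v = (\<chi> i. polar q1 v (axis i 1) * (q2 v * q3 v) + polar q2 v (axis i 1) * (q1 v * q3 v)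
     + polar q3 v (axis i 1) * (q1 v * q2 v))"

locale three_conics =
  fixes q1 q2 q3 :: "complex ^ 3 \<Rightarrow> complex"
  assumes smooth: "smoothq q1" "smoothq q2" "smoothq q3"
    and indep: "indepq q1 q2" "indepq q1 q3" "indepq q2 q3"
begin

lemmas forms = smooth[THEN smoothq_form]

abbreviation D where "D \<equiv> gradient q1 q2 q3"

lemma dot_gradient: "dot (D v) w = polar q1 v w * (q2 v * q3 v) + polar q2 v w * (q1 v * q3 v) + polar q3 v w * (q1 v * q2 v)"
proof -
  have w: "w = w $ 1 *s axis 1 1 + w $ 2 *s axis 2 1 + w $ 3 *s axis 3 1" by (simp add: vec3_eq_iff axis_def)
  have "polar q v w = w $ 1 * polar q v (axis 1 1) + w $ 2 * polar q v (axis 2 1) + w $ 3 * polar q v (axis 3 1)"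
    if "form 2 q" for q
    by (subst w) (simp only: polar_add_right[OF that] polar_scale_right[OF that])
  from this[OF forms(1)] this[OF forms(2)] this[OF forms(3)]
  show ?thesis by (simp add: dot_def gradient_def algebra_simps)
qed

lemma euler: "dot (D v) v = 6 * (q1 v * q2 v * q3 v)"
  by (simp add: dot_gradient polar_self forms)

lemma vform_gradient: "vform 5 D"
proof -
  have q: "form 5 (\<lambda>v. polar q v c * (p v * r v))" if "form 2 q" "form 2 p" "form 2 r" for q p r c
    using form_mult[OF form_polar_const[OF that(1), of c] form_mult[OF that(2,3)]] by simp
  show ?thesis unfolding vform_def gradient_def vec_lambda_beta by (intro allI form_add q forms)
qed

text \<open>Euler's relation puts a zero of the gradient on some conic. There the gradient is that
  conic's own differential times the other two forms, and smoothness makes one of these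
  vanish.\<close>

lemma gradient_zero:
  assumes "v \<noteq> 0" "D v = 0"
  shows "pt v \<in> common q1 q2 \<union> common q1 q3 \<union> common q2 q3"
proof -
  have z: "polar q1 v w * (q2 v * q3 v) + polar q2 v w * (q1 v * q3 v) + polar q3 v w * (q1 v * q2 v) = 0" for w
    using dot_gradient[of v w] assms(2) by (simp add: dot_def)
  have ex: "\<exists>w. polar q v w \<noteq> 0" if "smoothq q" for q
    using that assms(1) by (auto simp: smoothq_def)
  have "q1 v * q2 v * q3 v = 0" using euler[of v] assms(2) by (simp add: dot_def)
  then consider "q1 v = 0" | "q2 v = 0" | "q3 v = 0" by auto
  then have "q1 v = 0 \<and> q2 v = 0 \<or> q1 v = 0 \<and> q3 v = 0 \<or> q2 v = 0 \<and> q3 v = 0"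
  proof cases
    case 1
    then show ?thesis using z ex[OF smooth(1)] by auto
  next
    case 2
    then show ?thesis using z ex[OF smooth(2)] by auto
  next
    case 3
    then show ?thesis using z ex[OF smooth(3)] by auto
  qed
  then show ?thesis using pt_in_common[OF _ _ assms(1)] forms by auto
qed

lemma generic_line:
  obtains u w where "q1 w * q2 w * q3 w \<noteq> 0" "\<And>s. D (u + s *s w) \<noteq> 0"
proof -
  obtain w where w: "q1 w \<noteq> 0" "q2 w \<noteq> 0" "q3 w \<noteq> 0" using smoothq_exists_nonzero[OF smooth] by blast
  define N where "N = common q1 q2 \<union> common q1 q3 \<union> common q2 q3"
  have "finite N" unfolding N_def using finite_common smooth indep by simp
  have N: "\<exists>p. p \<noteq> 0 \<and> P = pt p \<and> (\<exists>v. det3 v w p \<noteq> 0)" if "P \<in> N" for P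
  proof -
    obtain p where p: "p \<noteq> 0" "P = pt p" "q1 p = 0 \<and> q2 p = 0 \<or> q1 p = 0 \<and> q3 p = 0 \<or> q2 p = 0 \<and> q3 p = 0"
      using \<open>P \<in> N\<close> by (auto simp: N_def common_def)
    have "w \<noteq> c *s p" for c
      using p(3) w forms by (auto simp: quad_scale)
    then obtain v where "det3 p w v \<noteq> 0" using indep_det3[of p w] p(1) by blast
    then have "det3 v w p \<noteq> 0" by (simp add: det3_def algebra_simps)
    then show ?thesis using p by blast
  qed
  define rep where "rep P = (SOME p. p \<noteq> 0 \<and> P = pt p \<and> (\<exists>v. det3 v w p \<noteq> 0))" for P
  have rep: "rep P \<noteq> 0" "P = pt (rep P)" "\<exists>v. det3 v w (rep P) \<noteq> 0" if "P \<in> N" for P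
    using someI_ex[OF N[OF that], folded rep_def] by blast+
  obtain p0 where p0: "p0 \<noteq> 0" "q1 p0 = 0" using smoothq_two_points[OF smooth(1)] by metis
  have "w \<noteq> c *s p0" for c using p0 w forms by (auto simp: quad_scale)
  then obtain v0 where "det3 p0 w v0 \<noteq> 0" using indep_det3[of p0 w] p0(1) by blast
  then have p0w: "det3 v0 w p0 \<noteq> 0" by (simp add: det3_def algebra_simps)
  \<comment> \<open>The line through \<open>u\<close> and \<open>w\<close> misses \<open>p\<close>
    if \<open>det3 u w p\<close> is nonzero. The extra point \<open>p0\<close> keeps
    \<open>u\<close> and \<open>w\<close> independent, so that \<open>u + s *s w\<close> is never
    0.\<close>
  define I where "I = insert p0 (rep ` N)"
  have "\<exists>v. \<forall>p\<in>I. det3 v w p \<noteq> 0"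
  proof (rule forms_avoid_zero)
    show "finite I" using \<open>finite N\<close> by (simp add: I_def)
    fix p assume p: "p \<in> I"
    have "form 1 (\<lambda>v. (w $ 2 * p $ 3 - w $ 3 * p $ 2) * v $ 1 + (w $ 3 * p $ 1 - w $ 1 * p $ 3) * v $ 2
        + (w $ 1 * p $ 2 - w $ 2 * p $ 1) * v $ 3)" by (rule form1I)
    then have "form 1 (\<lambda>v. det3 v w p)" by (simp add: det3_def algebra_simps)
    then show "form 1 (\<lambda>v. det3 v w p) \<and> (\<exists>v. det3 v w p \<noteq> 0)" using p rep p0w by (auto simp: I_def)
  qed
  then obtain u where u: "\<And>p. p \<in> I \<Longrightarrow> det3 u w p \<noteq> 0" by blast
  have d: "det3 (u + s *s w) w p = det3 u w p" for s p by (simp add: det3_def algebra_simps)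
  have "D (u + s *s w) \<noteq> 0" for s
  proof
    assume z: "D (u + s *s w) = 0"
    have "u + s *s w \<noteq> 0"
    proof
      assume "u + s *s w = 0"
      then show False using d[of s p0] u[of p0] by (simp add: I_def det3_def)
    qed
    from gradient_zero[OF this z] have P: "pt (u + s *s w) \<in> N" by (simp add: N_def)
    then have "pt (rep (pt (u + s *s w))) = pt (u + s *s w)" using rep(2) by metis
    then obtain c where "u + s *s w = c *s rep (pt (u + s *s w))" unfolding pt_eq_iff by blast
    moreover have "det3 (c *s p) w p = 0" for c p by (simp add: det3_def algebra_simps)
    ultimately have "det3 (u + s *s w) w (rep (pt (u + s *s w))) = 0" by metis
    then show False using d u P by (simp add: I_def)
  qed
  then show thesis using that[of w u] w by simp
qed

end

locale tangent_basis = three_conics +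
  fixes \<theta> \<eta> m n
  assumes vform: "vform m \<theta>" "vform n \<eta>"
    and syzygy: "\<And>v. dot (D v) (\<theta> v) = 0" "\<And>v. dot (D v) (\<eta> v) = 0"
    and independent: "\<And>v. D v \<noteq> 0 \<Longrightarrow> cross (\<theta> v) (\<eta> v) \<noteq> 0"
begin

text \<open>The gradient and the cross product of the fields are proportional, both being orthogonal
  to the two fields; pairing with \<open>v\<close> gives Euler's relation on one side and the
  determinant on the other.\<close>

lemma determinant_multiple: "D v $ i * det3 v (\<theta> v) (\<eta> v) = 6 * (q1 v * q2 v * q3 v) * cross (\<theta> v) (\<eta> v) $ i"
proof -
  note c = cross_orthogonal[OF syzygy[of v], of i]
  have "D v $ i * det3 v (\<theta> v) (\<eta> v) = cross (\<theta> v) (\<eta> v) $ i * dot (D v) v"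
    unfolding det3_cross dot_def using c[of 1] c[of 2] c[of 3] by algebra
  then show ?thesis unfolding euler by (simp add: mult.commute)
qed

lemma common_component:
  assumes "D v \<noteq> 0"
  shows "\<exists>i. D v $ i \<noteq> 0 \<and> cross (\<theta> v) (\<eta> v) $ i \<noteq> 0"
proof -
  obtain i j where "D v $ i \<noteq> 0" "cross (\<theta> v) (\<eta> v) $ j \<noteq> 0"
    using assms independent[OF assms] by (auto simp: vec_eq_iff)
  then show ?thesis using cross_orthogonal[OF syzygy[of v], of i j] by (metis mult_eq_0_iff)
qed

lemma det3_nonzero:
  assumes "q1 v \<noteq> 0" "q2 v \<noteq> 0" "q3 v \<noteq> 0"
  shows "det3 v (\<theta> v) (\<eta> v) \<noteq> 0"
proof -
  have "D v \<noteq> 0" using euler[of v] assms by (auto simp: dot_def)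
  from common_component[OF this] show ?thesis using determinant_multiple[of v] assms by force
qed

text \<open>On a line avoiding the zeros of the gradient, each point has an index at which gradient
  and cross product are both nonzero. There \<open>determinant_multiple\<close> says that the
  product of the three forms and the determinant vanish to the same order, so the degrees 6 and
  \<open>m + n + 1\<close> agree.\<close>

lemma degree_sum: "m + n = 5"
proof -
  obtain u w where w: "q1 w * q2 w * q3 w \<noteq> 0" and u: "\<And>s. D (u + s *s w) \<noteq> 0" using generic_line by blast
  have "form 6 (\<lambda>v. q1 v * q2 v * q3 v)" using form_mult[OF form_mult[OF forms(1,2)] forms(3)] by simp
  from form_line_degree[OF this w, of u] obtain p where p: "degree p = 6" "p \<noteq> 0"
    "\<And>s. q1 (u + s *s w) * q2 (u + s *s w) * q3 (u + s *s w) = poly p s" by blast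
  have "det3 w (\<theta> w) (\<eta> w) \<noteq> 0" using det3_nonzero w by simp
  from form_line_degree[OF form_det3_fields[OF vform] this, of u] obtain r where r: "degree r = Suc (m + n)" "r \<noteq> 0"
    "\<And>s. det3 (u + s *s w) (\<theta> (u + s *s w)) (\<eta> (u + s *s w)) = poly r s" by blast
  have "order s p = order s r" for s
  proof -
    obtain i where i: "D (u + s *s w) $ i \<noteq> 0" "cross (\<theta> (u + s *s w)) (\<eta> (u + s *s w)) $ i \<noteq> 0"
      using common_component[OF u] by blast
    obtain a where a: "\<And>s. D (u + s *s w) $ i = poly a s"
      using form_line_poly[OF vform_gradient[unfolded vform_def, rule_format, of i]] by metis
    obtain b where b: "\<And>s. cross (\<theta> (u + s *s w)) (\<eta> (u + s *s w)) $ i = poly b s"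
      using form_line_poly[OF vform_cross[OF vform, unfolded vform_def, rule_format, of i]] by metis
    have "poly (a * r) x = poly (smult 6 p * b) x" for x
      using determinant_multiple[of "u + x *s w" i] by (simp add: a b p(3) r(3))
    then have e: "a * r = smult 6 p * b" by (simp add: poly_eq_poly_eq_iff[symmetric] fun_eq_iff)
    have nz: "a \<noteq> 0" "b \<noteq> 0" and o: "order s a = 0" "order s b = 0"
      using i by (auto simp: a b order_0I)
    have "order s (a * r) = order s r" using nz r(2) o by (subst order_mult) auto
    moreover have "order s (smult 6 p * b) = order s p" using nz p(2) o by (subst order_mult) (auto simp: order_smult)
    ultimately show ?thesis using e by simp
  qed
  then have "degree p = degree r" using degree_eq_of_order_eq p(2) r(2) by blast
  then show ?thesis using p(1) r(1) by simp
qed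

end

text \<open>On the zero set of one form only the term with its own differential survives, multiplied
  by the other two forms; irreducibility of the conic cancels these.\<close>

lemma (in three_conics) syzygy_tangent:
  assumes v: "vform m \<theta>" and s: "\<And>v. dot (D v) (\<theta> v) = 0"
  shows "tangent q1 \<theta>" "tangent q2 \<theta>" "tangent q3 \<theta>"
proof -
  have main: "tangent q \<theta>"
    if q: "smoothq q" "smoothq p" "smoothq r" "indepq q p" "indepq q r"
      and z: "\<And>v. q v = 0 \<Longrightarrow> polar q v (\<theta> v) * (p v * r v) = 0" for q p r
  proof -
    note f = q(1-3)[THEN smoothq_form]
    have "\<not> (\<forall>v. q v = 0 \<longrightarrow> p v * r v = 0)"
    proof
      assume "\<forall>v. q v = 0 \<longrightarrow> p v * r v = 0"
      then have "(\<forall>v. q v = 0 \<longrightarrow> p v = 0) \<or> (\<forall>v. q v = 0 \<longrightarrow> r v = 0)"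
        using smoothq_prime[OF q(1) f(2) f(3)] by blast
      then show False using indepq_not_vanish[OF q(1,2,4)] indepq_not_vanish[OF q(1,3,5)] by blast
    qed
    then show ?thesis
      using smoothq_prime[OF q(1) form_polar[OF f(1) v] form_mult[OF f(2,3)] z] by (auto simp: tangent_def)
  qed
  note ind = indep indepq_commute[OF smooth(1,2) indep(1)] indepq_commute[OF smooth(1,3) indep(2)]
    indepq_commute[OF smooth(2,3) indep(3)]
  note z = s[unfolded dot_gradient]
  show "tangent q1 \<theta>" by (rule main[OF smooth(1,2,3) ind(1,2)]) (use z in \<open>metis add_0_right mult_zero_left mult_zero_right\<close>)
  show "tangent q2 \<theta>" by (rule main[OF smooth(2,1,3) ind(4,3)]) (use z in \<open>metis add_0_right add_0 mult_zero_left mult_zero_right\<close>)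
  show "tangent q3 \<theta>" by (rule main[OF smooth(3,1,2) ind(5,6)]) (use z in \<open>metis add_0_right add_0 mult_zero_left mult_zero_right\<close>)
qed

section \<open>Excluding tangent fields of degrees 0 and 1\<close>

definition two_points :: "(complex ^ 3 \<Rightarrow> complex) \<Rightarrow> (complex ^ 3 \<Rightarrow> complex) \<Rightarrow> bool" where
  "two_points q1 q2 \<longleftrightarrow> (\<exists>a b. a \<noteq> 0 \<and> (\<forall>c. b \<noteq> c *s a) \<and> q1 a = 0 \<and> q2 a = 0 \<and> q1 b = 0 \<and> q2 b = 0)"

lemma two_points_or_single:
  assumes "smoothq q1" "smoothq q2" "\<not> two_points q1 q2"
  shows "\<exists>a. a \<noteq> 0 \<and> common q1 q2 = {pt a}"
proof -
  obtain P where "P \<in> common q1 q2" using common_empty[OF assms(1,2)] by blast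
  then obtain a where a: "a \<noteq> 0" "q1 a = 0" "q2 a = 0" "P = pt a" by (auto simp: common_def)
  have "pt b = pt a" if b: "b \<noteq> 0" "q1 b = 0" "q2 b = 0" for b
  proof (rule ccontr)
    assume "pt b \<noteq> pt a"
    then have "\<forall>c. b \<noteq> c *s a" using pt_neq[OF a(1) b(1)] by metis
    then show False using assms(3) a b by (auto simp: two_points_def)
  qed
  then have "common q1 q2 \<subseteq> {pt a}" unfolding common_def by blast
  moreover have "pt a \<in> common q1 q2" unfolding common_def using a by blast
  ultimately have "common q1 q2 = {pt a}" by blast
  then show ?thesis using a(1) by blast
qed

lemma smoothq_not_square:
  assumes "smoothq q" "\<And>v. q v = \<alpha> * std v + \<beta> * v $ i ^ 2" "i = 2 \<or> i = 3"
  shows "\<alpha> \<noteq> 0"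
proof
  assume a: "\<alpha> = 0"
  have "polar q (vec3 1 0 0) w = 0" for w using assms(3) by (auto simp: polar_def assms(2) a)
  then have "vec3 1 0 0 = (0 :: complex ^ 3)" using assms(1) unfolding smoothq_def by blast
  then show False by (simp add: vec3_eq_iff)
qed

text \<open>In coordinates given by the two contact points the pair is
  \<open>\<alpha> std + \<beta> Y^2\<close> and \<open>\<gamma> std + \<delta> Z^2\<close>.
  Eliminating \<open>std\<close> leaves two opposite nonzero values of Y / Z, and each is attained
  at a common point.\<close>

lemma hyperosculating_pairs:
  assumes q: "smoothq q1" "smoothq q2" "smoothq q3" "indepq q1 q2" "indepq q1 q3"
    and a: "ct4 q1 q2 a" and b: "ct4 q1 q3 b" and ab: "pt a \<noteq> pt b"
  shows "two_points q2 q3"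
proof -
  have z: "a \<noteq> 0" "q1 a = 0" "b \<noteq> 0" "q1 b = 0" using a b by (auto simp: ct4_def)
  have "b \<noteq> c *s a" for c using pt_neq[OF z(1,3) ab] .
  from conic_coordinates[OF q(1) z(2,4,1) this] obtain T c l where T: "invertible T" "c \<noteq> 0" "l \<noteq> 0"
    "\<And>v. q1 (T *v v) = c * std v" "T *v vec3 0 0 1 = a" "T *v vec3 0 1 0 = l *s b" by blast
  have P: "polar q1 (T *v u) (T *v v) = c * polar std u v" for u v
    using polar_subst[of q1 T u v] polar_cmult[of c std u v] unfolding T(4) by simp
  have pa: "polar q1 a (T *v v) = - c * v $ 2" for v
    unfolding T(5)[symmetric] P by (simp add: polar_std)
  have "polar q1 (l *s b) (T *v v) = - c * v $ 3" for v
    unfolding T(6)[symmetric] P by (simp add: polar_std)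
  then have pb: "polar q1 b (T *v v) = - c / l * v $ 3" for v
    using T(3) polar_scale_left[OF smoothq_form[OF q(1)], of l b "T *v v"] by (simp add: field_simps)
  obtain \<mu> k where "\<forall>w. q2 w = \<mu> * q1 w + k * (polar q1 a w) ^ 2" using a by (auto simp: ct4_def)
  then have q2: "q2 (T *v v) = (\<mu> * c) * std v + (k * c ^ 2) * v $ 2 ^ 2" for v
    by (simp add: T(4) pa power_mult_distrib)
  obtain \<mu>' k' where "\<forall>w. q3 w = \<mu>' * q1 w + k' * (polar q1 b w) ^ 2" using b by (auto simp: ct4_def)
  then have q3: "q3 (T *v v) = (\<mu>' * c) * std v + (k' * (c / l) ^ 2) * v $ 3 ^ 2" for v
    by (simp add: T(4) pb power_mult_distrib power_divide)
  define \<alpha> \<beta> \<gamma> \<delta> where "\<alpha> = \<mu> * c" and "\<beta> = k * c ^ 2" and "\<gamma> = \<mu>' * c" and "\<delta> = k' * (c / l) ^ 2"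
  note E = q2[folded \<alpha>_def \<beta>_def] q3[folded \<gamma>_def \<delta>_def]
  have nz: "\<alpha> \<noteq> 0" "\<gamma> \<noteq> 0"
    using smoothq_not_square[OF smoothq_subst[OF q(2) T(1), of 1], of \<alpha> \<beta> 2]
      smoothq_not_square[OF smoothq_subst[OF q(3) T(1), of 1], of \<gamma> \<delta> 3] by (simp_all add: E)
  obtain T' where T': "\<And>v. T *v (T' *v v) = v" using invertible_obtain_inverse[OF T(1)] by metis
  have "\<beta> \<noteq> 0"
  proof
    assume 0: "\<beta> = 0"
    have "q2 v = \<mu> * q1 v" for v
      using E(1)[of "T' *v v"] T(4)[of "T' *v v"] unfolding T' by (simp add: 0 \<alpha>_def)
    then show False using q(4) by (auto simp: indepq_def)
  qed
  have "\<delta> \<noteq> 0"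
  proof
    assume 0: "\<delta> = 0"
    have "q3 v = \<mu>' * q1 v" for v
      using E(2)[of "T' *v v"] T(4)[of "T' *v v"] unfolding T' by (simp add: 0 \<gamma>_def)
    then show False using q(5) by (auto simp: indepq_def)
  qed
  obtain t where t: "t ^ 2 = \<alpha> * \<delta> / (\<beta> * \<gamma>)" using csquare_root by blast
  obtain x where x: "x ^ 2 = t - \<delta> / \<gamma>" using csquare_root by blast
  obtain y where y: "y ^ 2 = - t - \<delta> / \<gamma>" using csquare_root by blast
  have t0: "t \<noteq> 0" using t nz \<open>\<beta> \<noteq> 0\<close> \<open>\<delta> \<noteq> 0\<close> by auto
  have zero: "q2 (T *v vec3 x t 1) = 0 \<and> q3 (T *v vec3 x t 1) = 0" if "t ^ 2 = \<alpha> * \<delta> / (\<beta> * \<gamma>)" "x ^ 2 = t - \<delta> / \<gamma>" for x t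
    unfolding E using nz \<open>\<beta> \<noteq> 0\<close> by (simp add: std_def that field_simps)
  show ?thesis
    unfolding two_points_def
  proof (rule exI[of _ "T *v vec3 x t 1"], rule exI[of _ "T *v vec3 y (- t) 1"], intro conjI allI)
    show "T *v vec3 x t 1 \<noteq> 0" using invertible_mult_eq_0[OF T(1)] by (simp add: vec3_eq_iff)
    show "T *v vec3 y (- t) 1 \<noteq> c *s (T *v vec3 x t 1)" for c
      unfolding vector_scalar_commute[symmetric] invertible_inj[OF T(1)] using t0 by (auto simp: vec3_eq_iff)
    show "q2 (T *v vec3 x t 1) = 0" "q3 (T *v vec3 x t 1) = 0" using zero[OF t x] by blast+
    have "(- t) ^ 2 = \<alpha> * \<delta> / (\<beta> * \<gamma>)" using t by simp
    from zero[OF this y] show "q2 (T *v vec3 y (- t) 1) = 0" "q3 (T *v vec3 y (- t) 1) = 0" by blast+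
  qed
qed

text \<open>The intersection of the tangents of \<open>q2\<close> at the two common points is an
  eigenvector of the field and lies on neither \<open>q2\<close> nor \<open>q3\<close>. It remains
  to see that \<open>q1\<close> misses it too.\<close>

lemma linear_field_fixes_point:
  assumes q: "smoothq q1" "smoothq q2" "smoothq q3" "indepq q2 q3"
    and A: "tangent q1 (\<lambda>v. A *v v)" "tangent q2 (\<lambda>v. A *v v)" "tangent q3 (\<lambda>v. A *v v)"
      "\<exists>v. \<forall>c. A *v v \<noteq> c *s v"
    and two: "two_points q2 q3"
  shows "\<exists>v c. q1 v \<noteq> 0 \<and> q2 v \<noteq> 0 \<and> q3 v \<noteq> 0 \<and> A *v v = c *s v"
proof -
  obtain p r where p: "p \<noteq> 0" "\<And>c. r \<noteq> c *s p" "q2 p = 0" "q3 p = 0" "q2 r = 0" "q3 r = 0"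
    using two unfolding two_points_def by blast
  obtain T c a f \<delta> h where T: "invertible T" "c \<noteq> 0" "\<And>v. q2 (T *v v) = c * std v"
    "\<And>v. q3 (T *v v) = a * v $ 1 ^ 2 + f * v $ 2 * v $ 3"
    "\<And>v. A *v (T *v v) = T *v (vec3 (\<delta> * v $ 1) ((\<delta> + h) * v $ 2) ((\<delta> - h) * v $ 3))"
    by (rule linear_field_diagonal[OF q(2-4) A(2-4) p]) (rule that)
  have s: "smoothq (\<lambda>v. q (T *v v))" if "smoothq q" for q using smoothq_subst[OF that T(1), of 1] by simp
  have a: "a \<noteq> 0" using smoothq_diag(1)[OF s[OF q(3)] T(4)] .
  have h: "h \<noteq> 0"
  proof
    assume h: "h = 0"
    obtain v where v: "\<forall>c. A *v v \<noteq> c *s v" using A(4) by blast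
    obtain T' where T': "\<And>v. T *v (T' *v v) = v" using invertible_obtain_inverse[OF T(1)] by metis
    have "vec3 (\<delta> * x $ 1) ((\<delta> + h) * x $ 2) ((\<delta> - h) * x $ 3) = \<delta> *s x" for x
      by (simp add: vec3_eq_iff h)
    then have "A *v v = \<delta> *s v" using T(5)[of "T' *v v"] by (simp add: T' vector_scalar_commute)
    then show False using v by blast
  qed
  have "q1 (T *v vec3 1 0 0) \<noteq> 0"
  proof
    assume 0: "q1 (T *v vec3 1 0 0) = 0"
    define g where "g v = q1 (T *v v)" for v
    have sg: "smoothq g" using s[OF q(1)] by (simp add: g_def[abs_def])
    obtain a1 a2 a3 a4 a5 a6 where E: "\<And>v. g v = a1 * v $ 1 ^ 2 + a2 * v $ 2 ^ 2 + a3 * v $ 3 ^ 2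
       + a4 * v $ 1 * v $ 2 + a5 * v $ 1 * v $ 3 + a6 * v $ 2 * v $ 3" using form2E[OF smoothq_form[OF sg]] by blast
    obtain G where G: "form (1 - 1) G" "\<forall>v. polar q1 v (A *v v) = q1 v * G v"
      using tangent_divides[OF q(1) A(1) vform1_matrix] by blast
    then obtain k where k: "\<And>v. G v = k" by (auto simp: form.simps)
    \<comment> \<open>The monomials of \<open>g\<close> are weight vectors of the diagonal field,
      with weights 0, \<open>h\<close>, \<open>- h\<close>, \<open>2 * h\<close>,
      \<open>- 2 * h\<close>, and tangency forces all monomials present to have the same weight
      \<open>\<kappa>\<close>. Without X^2, every such form is degenerate.\<close>
    define \<kappa> where "\<kappa> = k - 2 * \<delta>"
    have "polar g v (vec3 (\<delta> * v $ 1) ((\<delta> + h) * v $ 2) ((\<delta> - h) * v $ 3)) = k * g v" for v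
      using G(2)[rule_format, of "T *v v"] unfolding T(5) k g_def[abs_def] polar_subst by (simp add: mult.commute)
    then have eq: "(\<kappa> * a1) * v $ 1 ^ 2 + ((\<kappa> - 2 * h) * a2) * v $ 2 ^ 2 + ((\<kappa> + 2 * h) * a3) * v $ 3 ^ 2
       + ((\<kappa> - h) * a4) * v $ 1 * v $ 2 + ((\<kappa> + h) * a5) * v $ 1 * v $ 3 + (\<kappa> * a6) * v $ 2 * v $ 3 = 0" for v :: "complex ^ 3"
      unfolding polar_form2[of g, OF E] E by (simp add: \<kappa>_def power2_eq_square algebra_simps)
    note w = form2_zero[OF eq]
    have a1: "a1 = 0" using 0 E[of "vec3 1 0 0"] by (simp add: g_def)
    have no: "\<not> (\<forall>w. polar g v w = 0)" if "v \<noteq> 0" for v using sg that by (auto simp: smoothq_def)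
    note P = polar_form2[of g, OF E]
    have e: "vec3 1 0 0 \<noteq> (0 :: complex ^ 3)" "vec3 0 1 0 \<noteq> (0 :: complex ^ 3)" "vec3 0 0 1 \<noteq> (0 :: complex ^ 3)"
      by (simp_all add: vec3_eq_iff)
    consider "a4 = 0" "a5 = 0" | "\<kappa> = h" | "\<kappa> = - h" using w(4,5) by (auto simp: eq_neg_iff_add_eq_0)
    then show False
    proof cases
      case 1
      then show False using no[OF e(1)] by (simp add: P a1)
    next
      case 2
      then have "a2 = 0" "a3 = 0" "a5 = 0" "a6 = 0" using w h by auto
      then show False using no[OF e(3)] by (simp add: P)
    next
      case 3
      then have "a2 = 0" "a3 = 0" "a4 = 0" "a6 = 0" using w h by auto
      then show False using no[OF e(2)] by (simp add: P)
    qed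
  qed
  moreover have "A *v (T *v vec3 1 0 0) = \<delta> *s (T *v vec3 1 0 0)"
  proof -
    have "vec3 (\<delta> * vec3 1 0 0 $ 1) ((\<delta> + h) * vec3 1 0 0 $ 2) ((\<delta> - h) * vec3 1 0 0 $ 3) = \<delta> *s vec3 1 0 0"
      by (simp add: vec3_eq_iff)
    then show ?thesis unfolding T(5) by (simp add: vector_scalar_commute)
  qed
  ultimately show ?thesis using T(2,3,4) a
    by (intro exI[of _ "T *v vec3 1 0 0"] exI[of _ \<delta>]) (simp add: std_def)
qed

lemma vform1E:
  assumes "vform 1 \<theta>"
  obtains A where "\<And>v. \<theta> v = A *v v"
proof -
  have "\<exists>w :: complex ^ 3. \<forall>v. \<theta> v $ i = w $ 1 * v $ 1 + w $ 2 * v $ 2 + w $ 3 * v $ 3" for i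
  proof -
    have "form 1 (\<lambda>v. \<theta> v $ i)" using assms by (simp add: vform_def)
    then obtain a b c where "\<And>v. \<theta> v $ i = a * v $ 1 + b * v $ 2 + c * v $ 3" by (rule form1E) blast
    then show ?thesis by (intro exI[of _ "vec3 a b c"]) simp
  qed
  then obtain w :: "3 \<Rightarrow> complex ^ 3" where
    "\<And>i v. \<theta> v $ i = w i $ 1 * v $ 1 + w i $ 2 * v $ 2 + w i $ 3 * v $ 3" by metis
  then show thesis using that[of "\<chi> i. w i"] by (simp add: vec_eq_iff matrix_vector_mult_3)
qed

text \<open>A constant field tangent to a conic is orthogonal to all points of it, hence to all
  vectors, hence zero.\<close>

lemma (in three_conics) not_degree_0:
  assumes v: "vform 0 \<theta>" and t: "tangent q1 \<theta>" and nz: "\<exists>v. \<theta> v \<noteq> 0"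
  shows False
proof -
  have "\<exists>c. \<forall>v. \<theta> v $ i = c" for i using v by (simp add: vform_def form.simps)
  then obtain c where c: "\<And>i v. \<theta> v $ i = c i" by metis
  define d where "d = (\<chi> i. c i)"
  have d: "\<theta> v = d" for v by (simp add: vec_eq_iff c d_def)
  have "polar q1 v d = 0" for v
    using form_vanish_linear[OF smooth(1) form_polar_const[OF forms(1), of d]] t by (simp add: tangent_def d)
  then have "d = 0" using smooth(1) by (simp add: smoothq_def polar_commute[of q1 d])
  then show False using nz d by simp
qed

text \<open>If two of the conics share two points, the field has an eigenvector off the curve,
  against the determinant condition. Otherwise every pair has contact 4 at its single point: if this
  point is the same for the pairs containing \<open>q1\<close>, the configuration is
  \<open>bad\<close>; if not, \<open>q2\<close> and \<open>q3\<close> share two points after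
  all.\<close>

lemma (in three_conics) not_degree_1:
  assumes nb: "\<not> bad q1 q2 q3" and v: "vform 1 \<theta>"
    and t: "tangent q1 \<theta>" "tangent q2 \<theta>" "tangent q3 \<theta>"
    and nz: "\<And>v. q1 v \<noteq> 0 \<Longrightarrow> q2 v \<noteq> 0 \<Longrightarrow> q3 v \<noteq> 0 \<Longrightarrow> det3 v (\<theta> v) (\<eta> v) \<noteq> 0"
  shows False
proof -
  obtain A where A: "\<And>v. \<theta> v = A *v v" using vform1E[OF v] by blast
  have t': "tangent q1 (\<lambda>v. A *v v)" "tangent q2 (\<lambda>v. A *v v)" "tangent q3 (\<lambda>v. A *v v)"
    using t by (simp_all add: tangent_def A)
  have no: "A *v v \<noteq> c *s v" if "q1 v \<noteq> 0" "q2 v \<noteq> 0" "q3 v \<noteq> 0" for v c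
    using nz[OF that] by (auto simp: A det3_parallel)
  have s: "\<exists>v. \<forall>c. A *v v \<noteq> c *s v" using smoothq_exists_nonzero[OF smooth] no by blast
  have "two_points q1 q2 \<or> two_points q1 q3 \<or> two_points q2 q3"
  proof (rule ccontr)
    assume n: "\<not> ?thesis"
    obtain a where a: "a \<noteq> 0" "common q1 q2 = {pt a}" using two_points_or_single[OF smooth(1,2)] n by blast
    obtain b where b: "b \<noteq> 0" "common q1 q3 = {pt b}" using two_points_or_single[OF smooth(1,3)] n by blast
    have ca: "ct4 q1 q2 a" using pair_single[OF smooth(1,2) a] .
    show False
    proof (cases "pt a = pt b")
      case True
      then have cb: "ct4 q1 q3 a" using pair_single[OF smooth(1,3) a(1)] b(2) by simp
      obtain l \<mu> where "form 1 l" "\<forall>w. q3 w = \<mu> * q1 w + polar q1 a w * l w"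
        using ct4_tangent[OF cb forms(1)] by blast
      then show False using ct4_bad[OF ca forms(1)] nb by blast
    next
      case False
      then show False using hyperosculating_pairs[OF smooth indep(1,2) ca _ False] pair_single[OF smooth(1,3) b] n by blast
    qed
  qed
  then show False
    using linear_field_fixes_point[OF smooth(3,1,2) indep(1) t'(3,1,2) s]
      linear_field_fixes_point[OF smooth(2,1,3) indep(2) t'(2,1,3) s]
      linear_field_fixes_point[OF smooth indep(3) t' s] no by blast
qed

lemma (in tangent_basis) degrees_2_3:
  assumes nb: "\<not> bad q1 q2 q3"
  shows "fields q1 q2 q3"
proof -
  have d: "det3 v (\<eta> v) (\<theta> v) = - det3 v (\<theta> v) (\<eta> v)" for v by (simp add: det3_def algebra_simps)
  note t = syzygy_tangent[OF vform(1) syzygy(1)] syzygy_tangent[OF vform(2) syzygy(2)]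
  obtain v where "q1 v \<noteq> 0" "q2 v \<noteq> 0" "q3 v \<noteq> 0" using smoothq_exists_nonzero[OF smooth] by blast
  from det3_nonzero[OF this] have nz: "\<theta> v \<noteq> 0" "\<eta> v \<noteq> 0" by (auto simp: det3_def)
  have "m \<noteq> 0" using not_degree_0[OF _ t(1)] vform(1) nz(1) by metis
  moreover have "n \<noteq> 0" using not_degree_0[OF _ t(4)] vform(2) nz(2) by metis
  moreover have "m \<noteq> 1" using not_degree_1[OF nb _ t(1-3)] vform(1) det3_nonzero by metis
  moreover have "n \<noteq> 1"
  proof
    assume "n = 1"
    then have "vform 1 \<eta>" using vform(2) by simp
    then show False by (rule not_degree_1[OF nb _ t(4-6), of \<theta>]) (simp add: d det3_nonzero)
  qed
  ultimately consider "m = 2" "n = 3" | "m = 3" "n = 2" using degree_sum by linarith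
  then show ?thesis
  proof cases
    case 1
    then show ?thesis unfolding fields_def using vform t det3_nonzero by - (rule exI[of _ \<theta>], rule exI[of _ \<eta>], auto)
  next
    case 2
    then show ?thesis unfolding fields_def using vform t det3_nonzero d by - (rule exI[of _ \<eta>], rule exI[of _ \<theta>], auto)
  qed
qed

section \<open>Evaluation of polynomials\<close>

lemma eval_simps [simp]:
  "eval (F + G) v = eval F v + eval G v" "eval (F - G) v = eval F v - eval G v"
  "eval (F * G) v = eval F v * eval G v" "eval (- F) v = - eval F v"
  "eval (F ^ n) v = eval F v ^ n" "eval 0 v = 0" "eval 1 v = 1" "eval (numeral k) v = numeral k"
  "eval X v = v $ 1" "eval Y v = v $ 2" "eval Z v = v $ 3" "eval (const c) v = c"
  by (simp_all add: eval_def X_def Y_def Z_def const_def poly_power)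

lemma eval_sum:
  "eval F v = (\<Sum>k\<le>degree F. \<Sum>j\<le>degree (coeff F k). \<Sum>i\<le>degree (coeff (coeff F k) j).
     coeff (coeff (coeff F k) j) i * (v $ 1 ^ i * v $ 2 ^ j * v $ 3 ^ k))"
proof -
  have 1: "poly (poly G [:y:]) x = (\<Sum>j\<le>degree G. \<Sum>i\<le>degree (coeff G j). coeff (coeff G j) i * x ^ i * y ^ j)"
    for G :: "complex poly poly" and x y
  proof -
    have "poly (poly G [:y:]) x = (\<Sum>j\<le>degree G. poly (coeff G j) x * y ^ j)"
      by (subst poly_altdef) (simp add: poly_sum poly_power)
    then show ?thesis by (simp add: poly_altdef[of _ x] sum_distrib_right)
  qed
  have "eval F v = (\<Sum>k\<le>degree F. poly (poly (coeff F k) [:v $ 2:]) (v $ 1) * v $ 3 ^ k)"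
    unfolding eval_def by (subst poly_altdef) (simp add: poly_sum poly_power)
  then show ?thesis by (simp add: 1 sum_distrib_right mult.assoc)
qed

lemma homogeneous_form:
  assumes "homogeneous n F"
  shows "form n (eval F)"
proof -
  have m: "form (i + j + k) (\<lambda>v. v $ 1 ^ i * v $ 2 ^ j * v $ 3 ^ k)" for i j k
    by (intro form_mult form_power form_coord)
  have "form n (\<lambda>v. coeff (coeff (coeff F k) j) i * (v $ 1 ^ i * v $ 2 ^ j * v $ 3 ^ k))" for i j k
    using m[of i j k] assms form_0 by (cases "coeff (coeff (coeff F k) j) i = 0") (auto simp: homogeneous_def intro: form_cmult)
  then have "form n (\<lambda>v. eval F v)" unfolding eval_sum by (intro form_sum)
  then show ?thesis by simp
qed

text \<open>Links formal partial derivatives with functions: uniqueness of derivatives along lines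
  identifies them with the polar form of a conic and, for the product of three, with
  \<open>gradient\<close>.\<close>

lemma eval_line_derivative:
  "((\<lambda>s. eval F (v + s *s w)) has_field_derivative
     eval (dX F) v * w $ 1 + eval (dY F) v * w $ 2 + eval (dZ F) v * w $ 3) (at 0)"
proof -
  have line: "((\<lambda>s. c + s * d) has_field_derivative d) (at 0)" for c d :: complex
    by (auto intro!: derivative_eq_intros)
  have 1: "((\<lambda>s. poly p (x + s * a)) has_field_derivative poly (pderiv p) x * a) (at 0)" for p :: "complex poly" and x a
    using DERIV_chain2[OF poly_DERIV line[of x a], of p] by simp
  have 2: "((\<lambda>s. poly (poly G [:y + s * b:]) (x + s * a)) has_field_derivative
      poly (poly (map_poly pderiv G) [:y:]) x * a + poly (poly (pderiv G) [:y:]) x * b) (at 0)"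
    for G :: "complex poly poly" and x y a b
  proof (induction G)
    case (pCons p G)
    have "((\<lambda>s. poly p (x + s * a) + (y + s * b) * poly (poly G [:y + s * b:]) (x + s * a)) has_field_derivative
        poly (pderiv p) x * a + (b * poly (poly G [:y + 0 * b:]) (x + 0 * a)
          + (poly (poly (map_poly pderiv G) [:y:]) x * a + poly (poly (pderiv G) [:y:]) x * b) * (y + 0 * b))) (at 0)"
      by (intro DERIV_add 1 DERIV_mult line pCons.IH)
    then show ?case by (simp add: map_poly_pCons pderiv_pCons algebra_simps)
  qed simp
  have 3: "((\<lambda>s. poly (poly (poly F [:[:z + s * c:]:]) [:y + s * b:]) (x + s * a)) has_field_derivative
      poly (poly (poly (dX F) [:[:z:]:]) [:y:]) x * a + poly (poly (poly (dY F) [:[:z:]:]) [:y:]) x * b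
      + poly (poly (poly (dZ F) [:[:z:]:]) [:y:]) x * c) (at 0)" for x y z a b c
    unfolding dX_def dY_def dZ_def
  proof (induction F)
    case (pCons G F)
    have "((\<lambda>s. poly (poly G [:y + s * b:]) (x + s * a) + (z + s * c) * poly (poly (poly F [:[:z + s * c:]:]) [:y + s * b:]) (x + s * a)) has_field_derivative
        (poly (poly (map_poly pderiv G) [:y:]) x * a + poly (poly (pderiv G) [:y:]) x * b)
        + (c * poly (poly (poly F [:[:z + 0 * c:]:]) [:y + 0 * b:]) (x + 0 * a)
          + (poly (poly (poly (map_poly (map_poly pderiv) F) [:[:z:]:]) [:y:]) x * a + poly (poly (poly (map_poly pderiv F) [:[:z:]:]) [:y:]) x * b
      + poly (poly (poly (pderiv F) [:[:z:]:]) [:y:]) x * c) * (z + 0 * c))) (at 0)"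
      by (intro DERIV_add 2 DERIV_mult line pCons.IH)
    then show ?case by (simp add: map_poly_pCons pderiv_pCons algebra_simps)
  qed simp
  show ?thesis using 3 by (simp add: eval_def)
qed

lemma quadratic_line_derivative:
  assumes "form 2 q"
  shows "((\<lambda>s. q (v + s *s w)) has_field_derivative polar q v w) (at 0)"
proof -
  have "q (v + s *s w) = q v + s * polar q v w + s ^ 2 * q w" for s
    by (simp add: quad_add[OF assms] polar_scale_right[OF assms] quad_scale[OF assms])
  moreover have "((\<lambda>s. q v + s * polar q v w + s ^ 2 * q w) has_field_derivative polar q v w) (at 0)"
    by (auto intro!: derivative_eq_intros)
  ultimately show ?thesis by simp
qed

definition grad :: "S \<Rightarrow> complex ^ 3 \<Rightarrow> complex ^ 3" where
  "grad F v = vec3 (eval (dX F) v) (eval (dY F) v) (eval (dZ F) v)"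

lemma polar_eval:
  assumes "homogeneous 2 Q"
  shows "polar (eval Q) v w = dot (grad Q v) w"
  using DERIV_unique[OF quadratic_line_derivative[OF homogeneous_form[OF assms]] eval_line_derivative]
  by (simp add: dot_def grad_def)

lemma dot_eqI:
  assumes "\<And>w. dot u w = dot v w"
  shows "u = v"
  using assms[of "vec3 1 0 0"] assms[of "vec3 0 1 0"] assms[of "vec3 0 0 1"] by (simp add: dot_def vec3_eq_iff)

lemma smooth_conic_smoothq:
  assumes "smooth_conic Q"
  shows "smoothq (eval Q)"
proof -
  have h: "homogeneous 2 Q" and s: "singular_points Q = {}" using assms by (auto simp: smooth_conic_def)
  note f = homogeneous_form[OF h]
  have "v = 0" if z: "\<forall>w. polar (eval Q) v w = 0" for v
  proof (rule ccontr)
    assume "v \<noteq> 0"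
    have "grad Q v = 0" by (rule dot_eqI) (use z polar_eval[OF h] in \<open>simp add: dot_def\<close>)
    moreover have "eval Q v = 0" using z polar_self[OF f, of v] by simp
    ultimately have "v \<in> singular_points Q"
      using \<open>v \<noteq> 0\<close> by (simp add: singular_points_def curve_def grad_def vec3_eq_iff)
    then show False using s by blast
  qed
  then show ?thesis using f by (simp add: smoothq_def)
qed

lemma distinct_curves_indepq:
  assumes "smooth_conic Q1" "smooth_conic Q2" "curve Q1 \<noteq> curve Q2"
  shows "indepq (eval Q1) (eval Q2)"
  unfolding indepq_def
proof
  assume "\<exists>c. \<forall>v. eval Q2 v = c * eval Q1 v"
  then obtain c where c: "\<And>v. eval Q2 v = c * eval Q1 v" by blast
  have "c \<noteq> 0" using smoothq_nonzero[OF smooth_conic_smoothq[OF assms(2)]] by (auto simp: c)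
  then have "curve Q1 = curve Q2" by (simp add: curve_def c)
  then show False using assms(3) by blast
qed

lemma grad_product:
  assumes h: "homogeneous 2 Q1" "homogeneous 2 Q2" "homogeneous 2 Q3"
    and t: "three_conics (eval Q1) (eval Q2) (eval Q3)"
  shows "grad (Q1 * Q2 * Q3) v = gradient (eval Q1) (eval Q2) (eval Q3) v"
proof (rule dot_eqI)
  fix w
  note d = h[THEN homogeneous_form, THEN quadratic_line_derivative[of _ v w]]
  have "((\<lambda>s. eval (Q1 * Q2 * Q3) (v + s *s w)) has_field_derivative
    (polar (eval Q1) v w * eval Q2 (v + 0 *s w) + polar (eval Q2) v w * eval Q1 (v + 0 *s w)) * eval Q3 (v + 0 *s w)
      + polar (eval Q3) v w * (eval Q1 (v + 0 *s w) * eval Q2 (v + 0 *s w))) (at 0)"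
    unfolding eval_simps by (intro DERIV_mult d)
  from DERIV_unique[OF eval_line_derivative this]
  show "dot (grad (Q1 * Q2 * Q3) v) w = dot (gradient (eval Q1) (eval Q2) (eval Q3) v) w"
    by (simp add: three_conics.dot_gradient[OF t] dot_def[of "grad (Q1 * Q2 * Q3) v" w]) (simp add: grad_def algebra_simps)
qed

section \<open>From a basis of the syzygy module to tangent fields\<close>

definition eval3 :: "S \<times> S \<times> S \<Rightarrow> complex ^ 3 \<Rightarrow> complex ^ 3" where
  "eval3 r v = (case r of (a, b, c) \<Rightarrow> vec3 (eval a v) (eval b v) (eval c v))"

lemma homogeneous3_vform: "homogeneous3 n r \<Longrightarrow> vform n (eval3 r)"
proof (cases r)
  case (fields a b c)
  moreover assume "homogeneous3 n r"
  ultimately have f: "form n (eval a)" "form n (eval b)" "form n (eval c)" by (simp_all add: homogeneous_form)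
  have "form n (\<lambda>v. eval3 r v $ i)" for i
    using exhaust_3[of i] f by (auto simp: eval3_def fields)
  then show ?thesis by (simp add: vform_def)
qed

lemma syzygies_dot: "r \<in> syzygies f \<Longrightarrow> dot (grad f v) (eval3 r v) = 0"
proof (cases r)
  case (fields a b c)
  assume "r \<in> syzygies f"
  then have "a * dX f + b * dY f + c * dZ f = 0" by (simp add: syzygies_def fields)
  then have "eval (a * dX f + b * dY f + c * dZ f) v = 0" by simp
  then show ?thesis by (simp add: dot_def grad_def eval3_def fields mult.commute)
qed

text \<open>The Koszul syzygies are combinations of a basis of the module of syzygies and span the plane
  orthogonal to a nonzero gradient.\<close>

lemma basis_independent:
  assumes span: "syzygies f \<subseteq> range (\<lambda>(p, q). smult3 p r1 + smult3 q r2)" and nz: "grad f v \<noteq> 0"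
  shows "cross (eval3 r1 v) (eval3 r2 v) \<noteq> 0"
proof
  assume z: "cross (eval3 r1 v) (eval3 r2 v) = 0"
  have lin: "\<exists>p q. eval3 s v = p *s eval3 r1 v + q *s eval3 r2 v" if s_in: "s \<in> syzygies f" for s
  proof -
    obtain p q where s: "s = smult3 p r1 + smult3 q r2" using span s_in by fastforce
    show ?thesis
      by (cases r1, cases r2, rule exI[of _ "eval p v"], rule exI[of _ "eval q v"])
        (simp add: s eval3_def vec3_eq_iff)
  qed
  have par: "cross (eval3 s v) (eval3 t v) = 0" if st: "s \<in> syzygies f" "t \<in> syzygies f" for s t
  proof -
    obtain p q where s: "eval3 s v = p *s eval3 r1 v + q *s eval3 r2 v" using lin[OF st(1)] by blast
    obtain p' q' where t: "eval3 t v = p' *s eval3 r1 v + q' *s eval3 r2 v" using lin[OF st(2)] by blast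
    have "cross (eval3 s v) (eval3 t v) = (p * q' - q * p') *s cross (eval3 r1 v) (eval3 r2 v)"
      unfolding s t by (simp add: cross_def vec3_eq_iff algebra_simps)
    then show ?thesis using z by simp
  qed
  have k: "(0, dZ f, - dY f) \<in> syzygies f" "(- dZ f, 0, dX f) \<in> syzygies f" "(dY f, - dX f, 0) \<in> syzygies f"
    by (simp_all add: syzygies_def mult.commute)
  \<comment> \<open>The cross product of two Koszul syzygies is, up to sign, a component of the
    gradient times the gradient.\<close>
  have "grad f v = 0"
    using par[OF k(1,2)] par[OF k(2,3)] par[OF k(1,3)]
    by (simp add: grad_def cross_def eval3_def vec3_eq_iff)
  then show False using nz by simp
qed

lemma free_curve_tangent_basis:
  assumes h: "homogeneous 2 Q1" "homogeneous 2 Q2" "homogeneous 2 Q3"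
    and t: "three_conics (eval Q1) (eval Q2) (eval Q3)" and free: "free_curve (Q1 * Q2 * Q3)"
  shows "\<exists>\<theta> \<eta> m n. tangent_basis (eval Q1) (eval Q2) (eval Q3) \<theta> \<eta> m n"
proof -
  obtain m n r1 r2 where r: "homogeneous3 m r1" "homogeneous3 n r2"
    "bij_betw (\<lambda>(p, q). smult3 p r1 + smult3 q r2) UNIV (syzygies (Q1 * Q2 * Q3))"
    using free unfolding free_curve_def by blast
  have span: "range (\<lambda>(p, q). smult3 p r1 + smult3 q r2) = syzygies (Q1 * Q2 * Q3)"
    using r(3) by (simp add: bij_betw_def)
  have "r1 = smult3 1 r1 + smult3 0 r2" "r2 = smult3 0 r1 + smult3 1 r2"
    by (cases r1, cases r2, simp add: zero_prod_def)+
  then have "r1 \<in> syzygies (Q1 * Q2 * Q3)" "r2 \<in> syzygies (Q1 * Q2 * Q3)"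
    unfolding span[symmetric] by (auto intro: range_eqI[of _ _ "(1, 0)"] range_eqI[of _ _ "(0, 1)"])
  then have "tangent_basis (eval Q1) (eval Q2) (eval Q3) (eval3 r1) (eval3 r2) m n"
    using syzygies_dot[of _ "Q1 * Q2 * Q3"] basis_independent[of "Q1 * Q2 * Q3" r1 r2] span
      homogeneous3_vform[OF r(1)] homogeneous3_vform[OF r(2)]
    by (intro tangent_basis.intro t tangent_basis_axioms.intro) (simp_all add: grad_product[OF h t, symmetric])
  then show ?thesis by blast
qed

lemma bad_not_simple:
  assumes f: "form 2 q1" and b: "bad q1 q2 q3" and F: "\<And>w. eval F w = q1 w * q2 w * q3 w"
  shows "\<exists>v. v \<noteq> 0 \<and> q1 v = 0 \<and> q2 v = 0 \<and> q3 v = 0 \<and> \<not> is_ADE F v \<and> \<not> is_J20 F v"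
proof -
  obtain v \<mu> l \<mu>' l' where v: "v \<noteq> 0" "q1 v = 0" "form 1 l" "l v = 0" "\<forall>w. q2 w = \<mu> * q1 w + polar q1 v w * l w"
    "form 1 l'" "\<forall>w. q3 w = \<mu>' * q1 w + polar q1 v w * l' w"
    using b unfolding bad_def by blast
  interpret B: bad_point q1 q2 q3 v \<mu> \<mu>' l l'
    by unfold_locales (use f v in auto)
  have e: "eval F = B.f" by (rule ext) (simp add: F B.f_def)
  have "\<not> is_ADE F v" "\<not> is_J20 F v"
    unfolding is_ADE_def is_J20_def has_singularity_type_def e
    using B.not_sing_A B.not_sing_D B.not_sing_E6 B.not_sing_E7 B.not_sing_E8 B.not_sing_J20 by blast+
  moreover have "q2 v = 0" "q3 v = 0" using v B.polar_vv by simp_all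
  ultimately show ?thesis using v(1,2) by blast
qed

lemma free_arrangement:
  assumes smooth: "smooth_conic Q1" "smooth_conic Q2" "smooth_conic Q3"
    and distinct: "curve Q1 \<noteq> curve Q2" "curve Q1 \<noteq> curve Q3" "curve Q2 \<noteq> curve Q3"
    and free: "free_curve (Q1 * Q2 * Q3)"
    and sing: "\<forall>v \<in> singular_points (Q1 * Q2 * Q3).
                 is_ADE (Q1 * Q2 * Q3) v \<or> is_J20 (Q1 * Q2 * Q3) v"
  shows "arrangement (eval Q1) (eval Q2) (eval Q3)"
proof -
  note s = smooth[THEN smooth_conic_smoothq]
  note f = s[THEN smoothq_form]
  have h: "homogeneous 2 Q1" "homogeneous 2 Q2" "homogeneous 2 Q3" using smooth by (auto simp: smooth_conic_def)
  note ind = distinct_curves_indepq[OF smooth(1,2) distinct(1)] distinct_curves_indepq[OF smooth(1,3) distinct(2)]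
    distinct_curves_indepq[OF smooth(2,3) distinct(3)]
  have t: "three_conics (eval Q1) (eval Q2) (eval Q3)" by (intro three_conics.intro s ind)
  \<comment> \<open>Describing the order of the conics by a multiset treats all six instances of
    \<open>bad\<close> at once.\<close>
  have nb: "\<not> bad q r p" if fq: "form 2 q" and perm: "{#q, r, p#} = {#eval Q1, eval Q2, eval Q3#}" for q r p
  proof
    assume b: "bad q r p"
    have E: "eval (Q1 * Q2 * Q3) w = q w * r w * p w" for w
      using arg_cong[OF perm, of "\<lambda>M. prod_mset (image_mset (\<lambda>q. q w) M)"] by (simp add: mult.assoc)
    obtain v where v: "v \<noteq> 0" "q v = 0" "r v = 0" "p v = 0" "\<not> is_ADE (Q1 * Q2 * Q3) v" "\<not> is_J20 (Q1 * Q2 * Q3) v"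
      using bad_not_simple[OF fq b E] by blast
    have "set_mset {#q, r, p#} = {eval Q1, eval Q2, eval Q3}" unfolding perm by simp
    then have "\<forall>g\<in>{eval Q1, eval Q2, eval Q3}. g v = 0" using v by (metis empty_iff insert_iff set_mset_add_mset_insert set_mset_empty)
    then have "grad (Q1 * Q2 * Q3) v = 0" "eval (Q1 * Q2 * Q3) v = 0"
      by (simp_all add: grad_product[OF h t] gradient_def vec_eq_iff)
    then have "v \<in> singular_points (Q1 * Q2 * Q3)"
      using v(1) by (simp add: singular_points_def curve_def grad_def vec3_eq_iff)
    then show False using sing v by blast
  qed
  have n: "\<not> bad (eval Q1) (eval Q2) (eval Q3)" "\<not> bad (eval Q1) (eval Q3) (eval Q2)"
    "\<not> bad (eval Q2) (eval Q1) (eval Q3)" "\<not> bad (eval Q2) (eval Q3) (eval Q1)"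
    "\<not> bad (eval Q3) (eval Q1) (eval Q2)" "\<not> bad (eval Q3) (eval Q2) (eval Q1)"
    by (rule nb; use f in \<open>simp add: add_mset_commute\<close>)+
  obtain \<theta> \<eta> m k where "tangent_basis (eval Q1) (eval Q2) (eval Q3) \<theta> \<eta> m k"
    using free_curve_tangent_basis[OF h t free] by blast
  then have "fields (eval Q1) (eval Q2) (eval Q3)" using n(1) by (rule tangent_basis.degrees_2_3)
  then show ?thesis using s ind n by (simp add: arrangement_def)
qed

lemma model_equivalent_equivalent:
  assumes c: "(\<lambda>C. (*v) T ` C) ` {zset (eval Q1), zset (eval Q2), zset (eval Q3)} = {zset m1, zset m2, zset m3}"
    and T: "invertible T" and e: "\<And>v. m1 v = eval P1 v" "\<And>v. m2 v = eval P2 v" "\<And>v. m3 v = eval P3 v"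
  shows "projectively_equivalent {Q1, Q2, Q3} {P1, P2, P3}"
proof -
  have "zset (eval Q) = curve Q" for Q by (simp add: zset_def curve_def)
  moreover have "m1 = eval P1" "m2 = eval P2" "m3 = eval P3" using e by auto
  ultimately show ?thesis using c T unfolding projectively_equivalent_def by auto
qed

theorem theorem2:
  fixes Q1 Q2 Q3 :: S
  defines "w \<equiv> \<i> * complex_of_real (sqrt 3)"
  assumes smooth: "smooth_conic Q1" "smooth_conic Q2" "smooth_conic Q3"
    and distinct: "curve Q1 \<noteq> curve Q2" "curve Q1 \<noteq> curve Q3" "curve Q2 \<noteq> curve Q3"
    and free: "free_curve (Q1 * Q2 * Q3)"
    and sing: "\<forall>v \<in> singular_points (Q1 * Q2 * Q3).
                 is_ADE (Q1 * Q2 * Q3) v \<or> is_J20 (Q1 * Q2 * Q3) v"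
  shows "\<exists>A \<in> {
     {X^2 - Y*Z,
      X^2 - 2*X*Y - Y*Z,
      X^2 + 2*X*Z - Y*Z},
     {X^2 - Y*Z,
      3*X^2 + Y^2 + 3*X*Y - 3*Y*Z,
      X^2 + 27*Z^2 + 9*X*Z - Y*Z},
     {X^2 - Y*Z,
      X^2 + const w * Z^2 - Y*Z,
      8*X^2 - const (3*(w + 1)) * Y^2 + const (8*w) * X*Y - 8*Y*Z},
     {X^2 - Y*Z,
      X^2 - 2*Z^2 - Y*Z,
      2*X^2 - Y^2 - 2*Y*Z},
     {X^2 - Y*Z,
      X^2 + const (18*(w + 3)) * Y^2 - 18*X*Y - Y*Z,
      12*X^2 + const (w + 3) * X*Z - 12*Y*Z},
     {X^2 - Y*Z,
      X^2 - 3*Z^2 - Y*Z,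
      2*X^2 + 3*X*Y - 2*Y*Z}}.
     projectively_equivalent {Q1, Q2, Q3} A"
proof -
  have "w ^ 2 = - 3" by (simp add: w_def power_mult_distrib flip: of_real_power)
  then have "model_equivalent w (eval Q1) (eval Q2) (eval Q3)"
    using free_arrangement[OF smooth distinct free sing] by (rule arrangement_classified)
  then obtain m1 m2 m3 and T :: "complex ^ 3 ^ 3" where m: "(m1, m2, m3) \<in> models w" and T: "invertible T"
    and c: "(\<lambda>C. (*v) T ` C) ` {zset (eval Q1), zset (eval Q2), zset (eval Q3)} = {zset m1, zset m2, zset m3}"
    unfolding model_equivalent_def by (elim exE conjE) (rule that)
  note E = model_equivalent_equivalent[OF c T]
  show ?thesis
    using m unfolding models_def insert_iff prod.inject empty_iff
  proof (elim disjE conjE, goal_cases)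
    case 1
    have "projectively_equivalent {Q1, Q2, Q3} {X^2 - Y*Z, X^2 - 2*X*Y - Y*Z, X^2 + 2*X*Z - Y*Z}"
      by (rule E) (simp_all only: 1 std_def eval_simps, simp_all add: algebra_simps)
    then show ?thesis by (rule bexI) (simp only: insert_iff simp_thms)
  next
    case 2
    have "projectively_equivalent {Q1, Q2, Q3} {X^2 - Y*Z, 3*X^2 + Y^2 + 3*X*Y - 3*Y*Z, X^2 + 27*Z^2 + 9*X*Z - Y*Z}"
      by (rule E) (simp_all only: 2 std_def eval_simps, simp_all add: algebra_simps)
    then show ?thesis by (rule bexI) (simp only: insert_iff simp_thms)
  next
    case 3
    have "projectively_equivalent {Q1, Q2, Q3} {X^2 - Y*Z, X^2 + const w * Z^2 - Y*Z,
        8*X^2 - const (3*(w + 1)) * Y^2 + const (8*w) * X*Y - 8*Y*Z}"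
      by (rule E) (simp_all only: 3 std_def eval_simps, simp_all add: algebra_simps)
    then show ?thesis by (rule bexI) (simp only: insert_iff simp_thms)
  next
    case 4
    have "projectively_equivalent {Q1, Q2, Q3} {X^2 - Y*Z, X^2 - 2*Z^2 - Y*Z, 2*X^2 - Y^2 - 2*Y*Z}"
      by (rule E) (simp_all only: 4 std_def eval_simps, simp_all add: algebra_simps)
    then show ?thesis by (rule bexI) (simp only: insert_iff simp_thms)
  next
    case 5
    have "projectively_equivalent {Q1, Q2, Q3} {X^2 - Y*Z, X^2 + const (18*(w + 3)) * Y^2 - 18*X*Y - Y*Z,
        12*X^2 + const (w + 3) * X*Z - 12*Y*Z}"
      by (rule E) (simp_all only: 5 std_def eval_simps, simp_all add: algebra_simps)
    then show ?thesis by (rule bexI) (simp only: insert_iff simp_thms)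
  next
    case 6
    have "projectively_equivalent {Q1, Q2, Q3} {X^2 - Y*Z, X^2 - 3*Z^2 - Y*Z, 2*X^2 + 3*X*Y - 2*Y*Z}"
      by (rule E) (simp_all only: 6 std_def eval_simps, simp_all add: algebra_simps)
    then show ?thesis by (rule bexI) (simp only: insert_iff simp_thms)
  qed simp
qed

end
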